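(* Let $G$ be a finite connected non-planar ribbon graph without loops or multiple edges. Then there exists a vertex $v$ of $G$ such that the Bernardi torsor $b_v$ and the rotor-routing torsor $r_v$ do not agree, i.e. $b_v$ and $r_v$ are different actions of $\mathrm{Pic}^0(G)$ on the set $S(G)$ of spanning trees of $G$.
   Context: A ribbon graph is a finite connected graph together with, at each vertex, a cyclic ordering of the edges (edge-ends) incident to that vertex; "the next edge after $e$ at $u$" means the successor of $e$ in this cyclic order. $G$ is planar if it can be drawn in the plane without crossings so that the counterclockwise order of edges around every vertex agrees with the given cyclic ordering; otherwise it is non-planar. A divisor is a formal integer combination $\sum_v a_v(v)$ of vertices; $\mathrm{Div}^0(G)$ is the group of divisors of degree $\sum a_v=0$. For an oriented edge $\overrightarrow{uv}$ write $\partial\overrightarrow{uv}=(v)-(u)$. $\mathrm{Prin}(G)$ is the subgroup of $\mathrm{Div}^0(G)$ generated by the divisors $\sum_{\overrightarrow{uv}\text{ an edge oriented into } v}\partial\overrightarrow{uv}$, $v\in V(G)$; $D\sim D'$ means $D-D'\in\mathrm{Prin}(G)$, and $\mathrm{Pic}^0(G)=\mathrm{Div}^0(G)/\mathrm{Prin}(G)$. $S(G)$ is the set of spanning trees. Rotor-routing torsor $r_y$: given a sink vertex $y$, a spanning tree $T$ and a vertex $x$, orient the edges of $T$ towards $y$ (so each vertex $u\neq y$ has a rotor, the edge of $T$ at $u$ pointing toward $y$) and put a chip at $x$. While the chip is at a vertex $u\neq y$: replace the rotor at $u$ by the next edge at $u$ in the cyclic order, and move the chip along this new rotor to its other endpoint.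 The chip reaches $y$ in finitely many steps and the rotors then form a spanning tree, denoted $((x)-(y))_y(T)$. Extending to the free generators $(x)-(y)$ of $\mathrm{Div}^0(G)$, this descends to a simply transitive action $r_y$ of $\mathrm{Pic}^0(G)$ on $S(G)$ (Holroyd et al.). Bernardi torsor $b_v$: for a vertex $v$, an edge $e$ incident to $v$ and a spanning tree $T$, the Bernardi process is a tour starting at the pair $(v,e)$: at a current pair $(u,f)$, if $f\in T$ the tour traverses $f$ to its other endpoint $w$ and the new pair is $(w,\text{next edge after } f \text{ at } w)$; if $f\notin T$ the tour "cuts" $f$ at $u$, and if this is the first time $f$ is cut a chip is placed at $u$, and the new pair is $(u,\text{next edge after } f\text{ at }u)$. The tour ends when it returns to $(v,e)$ after having traversed every tree edge in both directions and cut every non-tree edge at both ends. The resulting divisor (of degree $|E|-|V|+1$) is $\beta_{(v,e)}(T)$; $\beta_{(v,e)}$ is a bijection from $S(G)$ to the set of break divisors. The action $b_v$ of $\mathrm{Pic}^0(G)$ on $S(G)$ is defined by $[D]\cdot T=T'$ iff $\beta_{(v,e)}(T)+D\sim\beta_{(v,e)}(T')$; by Baker–Wang this is a simply transitive action independent of the choice of $e$. *)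

theory Defs
  imports
    "HOL-Analysis.Analysis"
    "HOL-Algebra.Free_Abelian_Groups"
    "HOL-Algebra.Generated_Groups"
    "HOL-Algebra.Group_Action"
    "HOL-Combinatorics.Orbits"
    "HOL-Library.While_Combinator"
    "Graph_Theory.Graph_Theory"
begin

section \<open>Ribbon graphs\<close>

text \<open>
  An undirected edge is a pair of arcs \<open>{a, opp a}\<close>. The edge-ends at a vertex \<open>v\<close> are the arcs
  with tail \<open>v\<close> (so a loop contributes two of them), and \<open>nxt\<close> maps every arc to its successor in
  the cyclic order at its tail. The values of \<open>nxt\<close> outside \<open>arcs G\<close> play no role.
\<close>

locale ribbon_graph = fin_digraph G + bidirected_digraph G opp
  for G :: "('a, 'b) pre_digraph" and opp :: "'b \<Rightarrow> 'b" +
  fixes nxt :: "'b \<Rightarrow> 'b"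
  assumes connected: "Digraph_Component.connected G"
    and nxt_cyclic:
      "\<And>v. \<lbrakk>v \<in> verts G; out_arcs G v \<noteq> {}\<rbrakk> \<Longrightarrow> cyclic_on nxt (out_arcs G v)"


section \<open>Planarity\<close>

definition first_hit :: "(real \<Rightarrow> complex) \<Rightarrow> real \<Rightarrow> complex" where
  "first_hit \<gamma> r = \<gamma> (Inf {t \<in> {0..1}. dist (pathstart \<gamma>) (\<gamma> t) = r})"

text \<open>
  The edges are drawn as arbitrary continuous curves, which need not have a tangent at a vertex.
  The counterclockwise order of the edges around a vertex \<open>v\<close> is therefore read off on all
  sufficiently small circles around \<open>v\<close>, from the points where the curves leaving \<open>v\<close> first meet
  the circle: seen from the point of \<open>a\<close>, the point of \<open>nxt a\<close> is the first one that is met when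
  going counterclockwise.
\<close>

definition ccw_around ::
    "('a, 'b) pre_digraph \<Rightarrow> ('b \<Rightarrow> 'b) \<Rightarrow> ('a \<Rightarrow> complex) \<Rightarrow> ('b \<Rightarrow> real \<Rightarrow> complex) \<Rightarrow> 'a \<Rightarrow> bool" where
  "ccw_around G nxt pos \<gamma> v \<longleftrightarrow>
     (\<forall>\<^sub>F r in at_right 0. \<forall>a\<in>out_arcs G v. \<forall>b\<in>out_arcs G v - {a}.
        Arg2pi ((first_hit (\<gamma> (nxt a)) r - pos v) / (first_hit (\<gamma> a) r - pos v))
          \<le> Arg2pi ((first_hit (\<gamma> b) r - pos v) / (first_hit (\<gamma> a) r - pos v)))"

definition planar_drawing ::
    "('a, 'b) pre_digraph \<Rightarrow> ('b \<Rightarrow> 'b) \<Rightarrow> ('a \<Rightarrow> complex) \<Rightarrow> ('b \<Rightarrow> real \<Rightarrow> complex) \<Rightarrow> bool" where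
  "planar_drawing G opp pos \<gamma> \<longleftrightarrow>
     inj_on pos (verts G) \<and>
     (\<forall>a\<in>arcs G. simple_path (\<gamma> a) \<and> pathstart (\<gamma> a) = pos (tail G a) \<and>
        pathfinish (\<gamma> a) = pos (head G a) \<and> \<gamma> (opp a) = reversepath (\<gamma> a) \<and>
        \<gamma> a ` {0<..<1} \<inter> pos ` verts G = {}) \<and>
     (\<forall>a\<in>arcs G. \<forall>b\<in>arcs G - {a, opp a}. \<gamma> a ` {0<..<1} \<inter> \<gamma> b ` {0<..<1} = {})"

definition planar_ribbon ::
    "('a, 'b) pre_digraph \<Rightarrow> ('b \<Rightarrow> 'b) \<Rightarrow> ('b \<Rightarrow> 'b) \<Rightarrow> bool" where
  "planar_ribbon G opp nxt \<longleftrightarrow>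
     (\<exists>pos \<gamma>. planar_drawing G opp pos \<gamma> \<and> (\<forall>v\<in>verts G. ccw_around G nxt pos \<gamma> v))"


section \<open>Divisors\<close>

definition div_degree :: "('a \<Rightarrow>\<^sub>0 int) \<Rightarrow> int" where
  "div_degree D = (\<Sum>v\<in>Poly_Mapping.keys D. Poly_Mapping.lookup D v)"

definition Div0 :: "('a, 'b) pre_digraph \<Rightarrow> ('a \<Rightarrow>\<^sub>0 int) monoid" where
  "Div0 G = free_Abelian_group (verts G)
     \<lparr>carrier := {D \<in> carrier (free_Abelian_group (verts G)). div_degree D = 0}\<rparr>"

definition boundary :: "('a, 'b) pre_digraph \<Rightarrow> 'b \<Rightarrow> ('a \<Rightarrow>\<^sub>0 int)" where
  "boundary G a = frag_of (head G a) - frag_of (tail G a)"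

definition Prin :: "('a, 'b) pre_digraph \<Rightarrow> ('a \<Rightarrow>\<^sub>0 int) set" where
  "Prin G = generate (Div0 G) ((\<lambda>v. \<Sum>a\<in>in_arcs G v. boundary G a) ` verts G)"

definition lin_equiv :: "('a, 'b) pre_digraph \<Rightarrow> ('a \<Rightarrow>\<^sub>0 int) \<Rightarrow> ('a \<Rightarrow>\<^sub>0 int) \<Rightarrow> bool" where
  "lin_equiv G D D' \<longleftrightarrow> D - D' \<in> Prin G"

definition Pic0 :: "('a, 'b) pre_digraph \<Rightarrow> ('a \<Rightarrow>\<^sub>0 int) set monoid" where
  "Pic0 G = Div0 G Mod Prin G"


section \<open>Spanning trees\<close>

text \<open>
  A spanning tree is represented by its symmetric set of arcs. The notion \<open>tree\<close> of the digraph
  library is not suitable: it forbids only directed cycles, and it counts going forth and back along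
  one edge as a cycle. The latter is the only kind of cycle that is admitted here.
\<close>

definition spanning_trees :: "('a, 'b) pre_digraph \<Rightarrow> ('b \<Rightarrow> 'b) \<Rightarrow> 'b set set" where
  "spanning_trees G opp =
     {T. T \<subseteq> arcs G \<and> opp ` T = T \<and> Digraph_Component.connected (G\<lparr>arcs := T\<rparr>) \<and>
         (\<forall>p. pre_digraph.cycle (G\<lparr>arcs := T\<rparr>) p \<longrightarrow> (\<exists>a. p = [a, opp a]))}"


section \<open>The rotor-routing torsor\<close>

text \<open>The rotor at \<open>u \<noteq> y\<close> is the first arc of the path from \<open>u\<close> to \<open>y\<close> in the tree \<open>T\<close>.\<close>

definition tree_rotors :: "('a, 'b) pre_digraph \<Rightarrow> 'b set \<Rightarrow> 'a \<Rightarrow> 'a \<Rightarrow> 'b" where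
  "tree_rotors G T y u = (THE a. \<exists>p. pre_digraph.apath (G\<lparr>arcs := T\<rparr>) u (a # p) y)"

definition rotor_step ::
    "('a, 'b) pre_digraph \<Rightarrow> ('b \<Rightarrow> 'b) \<Rightarrow> ('a \<Rightarrow> 'b) \<times> 'a \<Rightarrow> ('a \<Rightarrow> 'b) \<times> 'a" where
  "rotor_step G nxt = (\<lambda>(R, u). (R(u := nxt (R u)), head G (nxt (R u))))"

text \<open>\<open>rotor_route G opp nxt y x T\<close> is the tree \<open>((x) - (y))\<^sub>y(T)\<close>.\<close>

definition rotor_route ::
    "('a, 'b) pre_digraph \<Rightarrow> ('b \<Rightarrow> 'b) \<Rightarrow> ('b \<Rightarrow> 'b) \<Rightarrow> 'a \<Rightarrow> 'a \<Rightarrow> 'b set \<Rightarrow> 'b set" where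
  "rotor_route G opp nxt y x T =
     (let R = fst (while (\<lambda>(R, u). u \<noteq> y) (rotor_step G nxt) (tree_rotors G T y, x))
      in \<Union>u\<in>verts G - {y}. {R u, opp (R u)})"

text \<open>
  The action of \<open>Pic0 G\<close> induced by the action of the free generators \<open>(x) - (y)\<close> of \<open>Div0 G\<close>.
  It exists by the theorem of Holroyd et al.; it is unique because these classes generate \<open>Pic0 G\<close>.
\<close>

definition rotor_torsor ::
    "('a, 'b) pre_digraph \<Rightarrow> ('b \<Rightarrow> 'b) \<Rightarrow> ('b \<Rightarrow> 'b) \<Rightarrow> 'a \<Rightarrow> ('a \<Rightarrow>\<^sub>0 int) set \<Rightarrow> 'b set \<Rightarrow> 'b set" where
  "rotor_torsor G opp nxt y =
     (THE \<phi>. \<phi> \<in> extensional (carrier (Pic0 G)) \<and>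
        group_action (Pic0 G) (spanning_trees G opp) \<phi> \<and>
        (\<forall>x\<in>verts G - {y}. \<forall>T\<in>spanning_trees G opp.
           \<phi> (Prin G #>\<^bsub>Div0 G\<^esub> (frag_of x - frag_of y)) T = rotor_route G opp nxt y x T))"


section \<open>The Bernardi torsor\<close>

text \<open>
  The pair of a vertex \<open>u\<close> and an edge at \<open>u\<close> is the arc of that edge with tail \<open>u\<close>. Processing it
  traverses the edge (away from \<open>u\<close>) if it belongs to \<open>T\<close>, and cuts it at \<open>u\<close> otherwise.
\<close>

definition bernardi_tour ::
    "('b \<Rightarrow> 'b) \<Rightarrow> ('b \<Rightarrow> 'b) \<Rightarrow> 'b \<Rightarrow> 'b set \<Rightarrow> nat \<Rightarrow> 'b" where
  "bernardi_tour opp nxt e T n = ((\<lambda>a. if a \<in> T then nxt (opp a) else nxt a) ^^ n) e"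

definition bernardi_length ::
    "('a, 'b) pre_digraph \<Rightarrow> ('b \<Rightarrow> 'b) \<Rightarrow> ('b \<Rightarrow> 'b) \<Rightarrow> 'b \<Rightarrow> 'b set \<Rightarrow> nat" where
  "bernardi_length G opp nxt e T =
     (LEAST N. 0 < N \<and> bernardi_tour opp nxt e T N = e \<and>
        arcs G \<subseteq> bernardi_tour opp nxt e T ` {..<N})"

definition bernardi_divisor ::
    "('a, 'b) pre_digraph \<Rightarrow> ('b \<Rightarrow> 'b) \<Rightarrow> ('b \<Rightarrow> 'b) \<Rightarrow> 'b \<Rightarrow> 'b set \<Rightarrow> ('a \<Rightarrow>\<^sub>0 int)" where
  "bernardi_divisor G opp nxt e T =
     (let t = bernardi_tour opp nxt e T
      in \<Sum>n | n < bernardi_length G opp nxt e T \<and> t n \<notin> T \<and>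
            (\<forall>m<n. t m \<noteq> t n \<and> t m \<noteq> opp (t n)). frag_of (tail G (t n)))"

definition bernardi_torsor_at ::
    "('a, 'b) pre_digraph \<Rightarrow> ('b \<Rightarrow> 'b) \<Rightarrow> ('b \<Rightarrow> 'b) \<Rightarrow> 'b \<Rightarrow> ('a \<Rightarrow>\<^sub>0 int) set \<Rightarrow> 'b set \<Rightarrow> 'b set" where
  "bernardi_torsor_at G opp nxt e =
     (\<lambda>c\<in>carrier (Pic0 G). \<lambda>T\<in>spanning_trees G opp.
        (THE T'. T' \<in> spanning_trees G opp \<and>
           (\<exists>D\<in>c. lin_equiv G (bernardi_divisor G opp nxt e T + D) (bernardi_divisor G opp nxt e T'))))"

text \<open>By the theorem of Baker and Wang, the choice of the edge \<open>e\<close> at \<open>v\<close> is immaterial.\<close>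

definition bernardi_torsor ::
    "('a, 'b) pre_digraph \<Rightarrow> ('b \<Rightarrow> 'b) \<Rightarrow> ('b \<Rightarrow> 'b) \<Rightarrow> 'a \<Rightarrow> ('a \<Rightarrow>\<^sub>0 int) set \<Rightarrow> 'b set \<Rightarrow> 'b set" where
  "bernardi_torsor G opp nxt v = bernardi_torsor_at G opp nxt (SOME e. e \<in> out_arcs G v)"

end

theory Submission
  imports Defs
begin

text \<open>
  The tour of a spanning tree \<open>T\<close> is a cyclic list of all arcs, and the arcs at each vertex occur in it
  in their cyclic order. If the two ends of any two chords of \<open>T\<close> do not alternate in the tour, then
  the tour can be straightened to a line along which the graph is drawn with semicircles, so \<open>G\<close> is
  planar. Otherwise two chords are linked. Exchanging tree edges moves the linked pair to a common
  vertex \<open>x\<close>, and then makes the components of \<open>T - x\<close> those of \<open>G - x\<close>. For a neighbour \<open>y\<close>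
  of \<open>x\<close> in a branch \<open>W\<close>, routing a chip from \<open>x\<close> to \<open>y\<close> turns the rotor at \<open>x\<close> through
  other branches until it meets \<open>W\<close> again. If the torsors agree at \<open>x\<close> and at \<open>y\<close>, the comparison
  of the Bernardi divisors before and after yields a principal divisor, supported on \<open>x\<close> and its
  neighbours, which the linked pair excludes by a maximum principle.
\<close>

section \<open>Cyclic lists\<close>

text \<open>The turn of the rotor at \<open>x\<close> from \<open>e\<close> to the next arc
  \<open>k\<close> into \<open>W\<close> is measured twice. With sink \<open>y\<close>, the routing
  compares \<open>T\<close> with the tree met when the chip re-enters \<open>W\<close>. With sink
  \<open>x\<close>, each detour through another branch is a routing of its own and contributes the
  boundary of the arc by which it leaves \<open>x\<close>. The explicit tours produce the same
  boundaries once more, since moving the start of the tour past these arcs costs their boundaries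
  too. Hence the coefficient 2 in the final principal divisor, and hence the role of simplicity in
  the maximum principle. Both torsors are given by definite descriptions, so it must first be shown
  that they are actions at all. One scheme serves for both: a map that sends different trees to
  inequivalent divisors. For rotor routing the translates of a tree come from the routing itself and
  injectivity from a flow argument; for Bernardi divisors only injectivity is proved, and counting
  against the rotor case supplies the rest.\<close>

definition cyc :: "('b \<Rightarrow> 'b) \<Rightarrow> 'b list \<Rightarrow> bool" where
  "cyc f L \<longleftrightarrow> L \<noteq> [] \<and> distinct L \<and> map f L = rotate1 L"

lemma cyc_Cons: "cyc f (x # xs) \<longleftrightarrow> distinct (x # xs) \<and> map f (x # xs) = xs @ [x]"
  by (simp add: cyc_def)

lemma cyc_distinct: "cyc f L \<Longrightarrow> distinct L"
  by (simp add: cyc_def)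

lemma cyc_rotate:
  assumes "cyc f (xs @ ys)"
  shows "cyc f (ys @ xs)"
proof (cases xs)
  case (Cons x xs')
  note xs = this
  show ?thesis
  proof (cases ys)
    case (Cons y ys')
    from assms have "map f xs @ map f ys = (xs' @ [y]) @ (ys' @ [x])"
      by (simp add: cyc_def xs Cons)
    moreover have "length (map f xs) = length (xs' @ [y])"
      by (simp add: xs)
    ultimately have "map f xs = xs' @ [y]" "map f ys = ys' @ [x]"
      by (metis append_eq_append_conv)+
    with assms show ?thesis
      by (auto simp: cyc_def xs Cons)
  qed (use assms in simp)
qed (use assms in simp)

lemma cyc_step: "cyc f (xs @ a # b # ys) \<Longrightarrow> f a = b"
  using cyc_rotate[of f xs "a # b # ys"] by (simp add: cyc_Cons)

lemma cyc_last_step: "cyc f (a # xs @ [b]) \<Longrightarrow> f b = a"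
  using cyc_rotate[of f "a # xs" "[b]"] by (simp add: cyc_Cons)

lemma cyc_cong: "(\<And>a. a \<in> set L \<Longrightarrow> f a = g a) \<Longrightarrow> cyc f L \<longleftrightarrow> cyc g L"
  by (simp add: cyc_def cong: map_cong)

text \<open>Exchanging the values of a permutation at two points on different cycles joins the
  cycles. Adding an edge to a forest has this effect: its two arcs swap their successors.\<close>

lemma cyc_merge:
  assumes "cyc f (x # xs)" "cyc f (y # ys)" "set (x # xs) \<inter> set (y # ys) = {}"
    and "g x = f y" "g y = f x" "\<And>z. z \<in> set xs \<union> set ys \<Longrightarrow> g z = f z"
  shows "cyc g (x # ys @ y # xs)"
proof -
  have mg: "map g xs = map f xs" "map g ys = map f ys"
    using assms(6) by auto
  have fx: "f x # map f xs = xs @ [x]" "f y # map f ys = ys @ [y]"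
    using assms(1,2) by (auto simp: cyc_Cons)
  have "map g (x # ys @ y # xs) = (f y # map f ys) @ (f x # map f xs)"
    unfolding list.map map_append append_Cons append_assoc mg assms(4,5) ..
  also have "\<dots> = (ys @ y # xs) @ [x]"
    unfolding fx by simp
  finally have "map g (x # ys @ y # xs) = (ys @ y # xs) @ [x]" .
  then show ?thesis
    using assms(1-3) by (auto simp: cyc_Cons)
qed

text \<open>The same exchange at two points of one cycle: removing a tree edge cuts its tour into
  two.\<close>

lemma cyc_split:
  assumes "cyc g (x # ys @ y # xs)"
    and "f x = g y" "f y = g x" "\<And>z. z \<in> set xs \<union> set ys \<Longrightarrow> f z = g z"
  shows "cyc f (x # xs)" "cyc f (y # ys)"
proof -
  have fg: "map f xs = map g xs" "map f ys = map g ys"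
    using assms(4) by auto
  have "(g x # map g ys) @ (g y # map g xs) = (ys @ [y]) @ (xs @ [x])"
    using assms(1) by (simp add: cyc_Cons)
  then have "g x # map g ys = ys @ [y]" "g y # map g xs = xs @ [x]"
    by (subst (asm) append_eq_append_conv; simp)+
  then have "map f (x # xs) = xs @ [x]" "map f (y # ys) = ys @ [y]"
    unfolding list.map fg assms(2,3) by blast+
  then show "cyc f (x # xs)" "cyc f (y # ys)"
    using assms(1) by (simp_all only: cyc_Cons distinct.simps distinct_append) auto
qed

lemma cyc_rotate_to:
  assumes "cyc f L" "a \<in> set L"
  obtains L' where "cyc f (a # L')" "set (a # L') = set L"
proof -
  obtain xs ys where "L = xs @ a # ys"
    using assms(2) by (meson split_list)
  then show thesis
    using cyc_rotate[of f xs "a # ys"] assms(1) that[of "ys @ xs"] by auto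
qed

lemma cyc_nth:
  assumes "cyc f L" "i < length L"
  shows "L ! i = (f ^^ i) (hd L)"
  using assms(2)
proof (induction i)
  case 0
  then show ?case using assms(1) by (simp add: cyc_def hd_conv_nth)
next
  case (Suc i)
  then have "f (L ! i) = rotate1 L ! i"
    using assms(1) by (metis Suc_lessD cyc_def nth_map)
  also have "\<dots> = L ! Suc i"
    using Suc.prems by (cases L) (auto simp: nth_append)
  finally show ?case using Suc by simp
qed

lemma cyc_funpow_length:
  assumes "cyc f L"
  shows "(f ^^ length L) (hd L) = hd L"
proof -
  obtain n where n: "length L = Suc n"
    using assms by (metis cyc_def length_greater_0_conv gr0_conv_Suc)
  have "f (L ! n) = rotate1 L ! n"
    using assms n by (metis cyc_def lessI nth_map)
  also have "\<dots> = hd L"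
    using n by (cases L) (auto simp: nth_append)
  finally show ?thesis
    using cyc_nth[OF assms, of n] n by simp
qed

lemma cyc_unique:
  assumes "cyc f L" "cyc f M" "hd L = hd M"
  shows "L = M"
proof -
  \<comment> \<open>If \<open>M\<close> were longer, its entry number \<open>length L\<close> would
    be its head again, against distinctness.\<close>
  have le: "length M \<le> length L" if "cyc f L" "cyc f M" "hd L = hd M" for L M
  proof (rule ccontr)
    assume *: "\<not> length M \<le> length L"
    have "M ! length L = M ! 0"
      using cyc_nth[OF that(2), of "length L"] cyc_nth[OF that(2), of 0]
        cyc_funpow_length[OF that(1)] * that(3) by fastforce
    then show False
      using that * by (auto simp: cyc_def nth_eq_iff_index_eq)
  qed
  have "length L = length M"
    using le[OF assms] le[OF assms(2,1)] assms(3) by simp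
  then show ?thesis
    using cyc_nth[OF assms(1)] cyc_nth[OF assms(2)] assms(3) by (auto intro: nth_equalityI)
qed

lemma cyclic_on_imp_cyc:
  assumes "cyclic_on f S" "finite S" "s \<in> S"
  obtains xs where "cyc f (s # xs)" "set (s # xs) = S"
proof -
  have S: "S = orbit f s" and s: "s \<in> orbit f s"
    using assms(1,3) by (simp_all add: cyclic_on_alldef)
  define n where "n = funpow_dist1 f s s"
  define L where "L = map (\<lambda>i. (f ^^ i) s) [0..<n]"
  have n: "n > 0" "(f ^^ n) s = s"
    using s unfolding n_def by (simp, metis funpow_dist1_prop)
  have inj: "inj_on (\<lambda>i. (f ^^ i) s) {0..<n}"
    unfolding n_def using s by (intro inj_on_funpow_dist1) auto
  have "set L = S"
    unfolding S L_def n_def orbit_conv_funpow_dist1[OF s] by (simp only: set_map set_upt)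
  moreover have "cyc f L"
  proof -
    obtain m where m: "n = Suc m"
      using n(1) gr0_conv_Suc by auto
    have "map f L = map (\<lambda>i. (f ^^ Suc i) s) [0..<n]"
      unfolding L_def by simp
    also have "\<dots> = map (\<lambda>i. (f ^^ i) s) [Suc 0..<Suc n]"
      unfolding map_Suc_upt[symmetric] map_map by (simp add: comp_def)
    also have "\<dots> = rotate1 L"
      using n(2) unfolding L_def m
      by (simp add: upt_conv_Cons[of 0 "Suc m"] upt_Suc_append[of "Suc 0" "Suc m"] del: upt_Suc)
    finally show ?thesis
      using inj n(1) by (auto simp: cyc_def L_def distinct_map)
  qed
  moreover have "hd L = s"
    unfolding L_def using n(1) by (simp add: upt_conv_Cons)
  ultimately show thesis
    using that[of "tl L"] by (cases L) (auto simp: cyc_def)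
qed

section \<open>Forests and their tours\<close>

locale loopless_ribbon_graph = ribbon_graph G opp nxt + loopfree_digraph G
  for G :: "('a, 'b) pre_digraph" and opp nxt :: "'b \<Rightarrow> 'b"
begin

definition adj :: "'b set \<Rightarrow> ('a \<times> 'a) set" where
  "adj F = {(tail G a, head G a) |a. a \<in> F}"

abbreviation conn :: "'b set \<Rightarrow> ('a \<times> 'a) set" where
  "conn F \<equiv> (adj F)\<^sup>*"

definition edge :: "'b \<Rightarrow> 'b set" where
  "edge a = {a, opp a}"

definition oppclosed :: "'b set \<Rightarrow> bool" where
  "oppclosed F \<longleftrightarrow> F \<subseteq> arcs G \<and> (\<forall>a\<in>F. opp a \<in> F)"

text \<open>Acyclicity in the form that every edge is a bridge. It passes to subforests and reduces
  exchanges of edges to reachability, without any walk being followed.\<close>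

definition bforest :: "'b set \<Rightarrow> bool" where
  "bforest F \<longleftrightarrow> oppclosed F \<and> (\<forall>a\<in>F. (tail G a, head G a) \<notin> conn (F - edge a))"

definition stree :: "'b set \<Rightarrow> bool" where
  "stree T \<longleftrightarrow> bforest T \<and> (\<forall>u\<in>verts G. \<forall>v\<in>verts G. (u, v) \<in> conn T)"

text \<open>One step of the Bernardi process, for an arbitrary arc set. For a forest each orbit is
  the tour around one component; for the empty forest it is the cyclic order at a vertex.\<close>

definition tau :: "'b set \<Rightarrow> 'b \<Rightarrow> 'b" where
  "tau F a = (if a \<in> F then nxt (opp a) else nxt a)"

lemma edge_opp [simp]: "edge (opp a) = edge a"
  by (auto simp: edge_def)

lemma mem_edge [simp]: "b \<in> edge a \<longleftrightarrow> b = a \<or> b = opp a"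
  by (auto simp: edge_def)

lemma opp_eq_iff [simp]: "opp a = opp b \<longleftrightarrow> a = b"
  by (rule arev_eq_iff)

lemma opp_neq [simp]: "a \<in> arcs G \<Longrightarrow> opp a \<noteq> a" "a \<in> arcs G \<Longrightarrow> a \<noteq> opp a"
  using arev_neq by metis+

lemma opp_in_arcs_iff [simp]: "opp a \<in> arcs G \<longleftrightarrow> a \<in> arcs G"
  by (metis arev_arev arev_in_arcs)

lemma oppclosed_opp_iff: "oppclosed F \<Longrightarrow> opp a \<in> F \<longleftrightarrow> a \<in> F"
  unfolding oppclosed_def by (metis arev_arev)

lemma oppclosed_arcs: "oppclosed F \<Longrightarrow> a \<in> F \<Longrightarrow> a \<in> arcs G"
  unfolding oppclosed_def by auto

lemma oppclosed_diff_edge: "oppclosed F \<Longrightarrow> oppclosed (F - edge e)"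
  unfolding oppclosed_def by (auto simp: arev_eq_iff)

lemma oppclosed_un_edge: "oppclosed F \<Longrightarrow> e \<in> arcs G \<Longrightarrow> oppclosed (F \<union> edge e)"
  unfolding oppclosed_def edge_def by auto

lemma adj_mono: "F \<subseteq> F' \<Longrightarrow> adj F \<subseteq> adj F'"
  unfolding adj_def by auto

lemma conn_mono: "F \<subseteq> F' \<Longrightarrow> p \<in> conn F \<Longrightarrow> p \<in> conn F'"
  using rtrancl_mono[OF adj_mono] by blast

lemma conn_arc: "a \<in> F \<Longrightarrow> (tail G a, head G a) \<in> conn F"
  unfolding adj_def by auto

lemma adj_sym: "oppclosed F \<Longrightarrow> sym (adj F)"
proof (rule symI)
  fix u v assume F: "oppclosed F" and "(u, v) \<in> adj F"
  then obtain a where "a \<in> F" "u = tail G a" "v = head G a"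
    by (auto simp: adj_def)
  then show "(v, u) \<in> adj F"
    using F unfolding adj_def oppclosed_def by (auto intro!: exI[of _ "opp a"])
qed

lemma conn_sym: "oppclosed F \<Longrightarrow> (u, v) \<in> conn F \<Longrightarrow> (v, u) \<in> conn F"
  by (meson adj_sym sym_rtrancl symE)

lemma conn_trans: "(u, v) \<in> conn F \<Longrightarrow> (v, w) \<in> conn F \<Longrightarrow> (u, w) \<in> conn F"
  by (rule rtrancl_trans)

lemma conn_insert:
  assumes F: "oppclosed F" and e: "e \<in> arcs G"
  shows "(u, v) \<in> conn (F \<union> edge e) \<longleftrightarrow> (u, v) \<in> conn F \<or>
    (u, tail G e) \<in> conn F \<and> (head G e, v) \<in> conn F \<or>
    (u, head G e) \<in> conn F \<and> (tail G e, v) \<in> conn F" (is "?L \<longleftrightarrow> ?R v")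
proof
  assume ?L
  then show "?R v"
  proof (induction rule: rtrancl_induct)
    case (step v w)
    then obtain a where a: "a \<in> F \<union> edge e" "v = tail G a" "w = head G a"
      by (auto simp: adj_def)
    show ?case
    proof (cases "a \<in> F")
      case True
      then have "(v, w) \<in> conn F" using a conn_arc by auto
      then show ?thesis using step.IH conn_trans by blast
    next
      case False
      then consider "v = tail G e" "w = head G e" | "v = head G e" "w = tail G e"
        using a e by auto
      then show ?thesis
        using step.IH by cases (use conn_sym[OF F] conn_trans in blast)+
    qed
  qed simp
next
  assume "?R v"
  moreover have "(x, y) \<in> conn (F \<union> edge e)" if "(x, y) \<in> conn F" for x y
    using conn_mono[OF _ that, of "F \<union> edge e"] by blast
  moreover have "(tail G e, head G e) \<in> conn (F \<union> edge e)"
    using conn_arc[of e "F \<union> edge e"] by auto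
  moreover have "(head G e, tail G e) \<in> conn (F \<union> edge e)"
    using conn_arc[of "opp e" "F \<union> edge e"] e by auto
  ultimately show ?L
    using conn_trans by blast
qed

lemma bforest_oppclosed: "bforest F \<Longrightarrow> oppclosed F"
  by (simp add: bforest_def)

lemma bforest_arcs: "bforest F \<Longrightarrow> F \<subseteq> arcs G"
  by (simp add: bforest_def oppclosed_def)

lemma bforest_subset: "bforest F \<Longrightarrow> oppclosed F' \<Longrightarrow> F' \<subseteq> F \<Longrightarrow> bforest F'"
  unfolding bforest_def using conn_mono[of "F' - edge _" "F - edge _"] by blast

lemma bforest_diff_edge: "bforest F \<Longrightarrow> bforest (F - edge e)"
  using bforest_subset oppclosed_diff_edge bforest_oppclosed by blast

lemma un_diff_edge: "oppclosed F \<Longrightarrow> e \<in> F \<Longrightarrow> F - edge e \<union> edge e = F"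
  unfolding oppclosed_def by auto

lemma bforest_bridge: "bforest F \<Longrightarrow> a \<in> F \<Longrightarrow> (tail G a, head G a) \<notin> conn (F - edge a)"
  by (simp add: bforest_def)

lemma bforest_bridge': "bforest F \<Longrightarrow> a \<in> F \<Longrightarrow> (head G a, tail G a) \<notin> conn (F - edge a)"
  using bforest_bridge conn_sym oppclosed_diff_edge bforest_oppclosed by blast

text \<open>If the ends of an old edge \<open>a\<close> were still connected after deleting
  \<open>a\<close>, the connection would run through \<open>e\<close>, and then \<open>a\<close>
  would help to connect the ends of \<open>e\<close> within \<open>F\<close>.\<close>

lemma bforest_un_edge:
  assumes F: "bforest F" and e: "e \<in> arcs G" "(tail G e, head G e) \<notin> conn F"
  shows "bforest (F \<union> edge e)"
  unfolding bforest_def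
proof (intro conjI ballI)
  have sF: "oppclosed F" using F by (rule bforest_oppclosed)
  show "oppclosed (F \<union> edge e)"
    using sF e(1) by (rule oppclosed_un_edge)
  fix a assume a: "a \<in> F \<union> edge e"
  show "(tail G a, head G a) \<notin> conn (F \<union> edge e - edge a)"
  proof (cases "a \<in> F")
    case False
    then have "a \<in> edge e" using a by auto
    then have "edge a = edge e" and *: "(tail G a, head G a) = (tail G e, head G e) \<or>
        (tail G a, head G a) = (head G e, tail G e)"
      using e by auto
    then have "conn (F \<union> edge e - edge a) \<subseteq> conn F"
      by (intro rtrancl_mono adj_mono) auto
    then show ?thesis
      using * e(2) conn_sym[OF sF] by auto
  next
    case True
    define F' where "F' = F - edge a"
    have sF': "oppclosed F'"
      unfolding F'_def using sF by (rule oppclosed_diff_edge)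
    have ta: "(tail G a, head G a) \<in> conn F"
      using True by (rule conn_arc)
    have br: "(tail G a, head G a) \<notin> conn F'"
      using F True by (simp add: bforest_def F'_def)
    have sub: "p \<in> conn F" if "p \<in> conn F'" for p
      using conn_mono[OF _ that] unfolding F'_def by blast
    have "(tail G a, head G a) \<notin> conn (F' \<union> edge e)"
      unfolding conn_insert[OF sF' e(1)]
      using br e(2) ta sub conn_sym[OF sF] conn_trans by meson
    moreover have "F \<union> edge e - edge a \<subseteq> F' \<union> edge e"
      unfolding F'_def by auto
    ultimately show ?thesis
      using conn_mono by blast
  qed
qed

lemma bforest_empty: "bforest {}"
  by (simp add: bforest_def oppclosed_def)

lemma finite_bforest: "bforest F \<Longrightarrow> finite F"
  using bforest_arcs finite_arcs finite_subset by blast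

lemma bforest_induct [consumes 1, case_names empty insert]:
  assumes F: "bforest F"
    and empty: "P {}"
    and insert: "\<And>F e. bforest F \<Longrightarrow> e \<in> arcs G \<Longrightarrow> e \<notin> F \<Longrightarrow> (tail G e, head G e) \<notin> conn F \<Longrightarrow> P F
      \<Longrightarrow> P (F \<union> edge e)"
  shows "P F"
  using F
proof (induction "card F" arbitrary: F rule: less_induct)
  case less
  show ?case
  proof (cases "F = {}")
    case False
    then obtain e where e: "e \<in> F" by auto
    have "card (F - edge e) < card F"
      using e finite_bforest[OF less.prems] by (intro psubset_card_mono) auto
    then have "P (F - edge e)"
      using less bforest_diff_edge by blast
    then have "P (F - edge e \<union> edge e)"
      using e less.prems bforest_arcs[OF less.prems]
      by (intro insert) (auto simp: bforest_diff_edge bforest_bridge)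
    then show ?thesis
      using e un_diff_edge bforest_oppclosed less.prems by simp
  qed (use empty in simp)
qed

definition arcs_at :: "'a \<Rightarrow> 'b list \<Rightarrow> 'b list" where
  "arcs_at v L = filter (\<lambda>a. tail G a = v) L"

lemma arcs_at_append [simp]: "arcs_at v (xs @ ys) = arcs_at v xs @ arcs_at v ys"
  by (simp add: arcs_at_def)

lemma arcs_at_simps [simp]:
  "arcs_at v [] = []"
  "arcs_at v (a # xs) = (if tail G a = v then a # arcs_at v xs else arcs_at v xs)"
  by (simp_all add: arcs_at_def)

lemma set_arcs_at [simp]: "set (arcs_at v L) = {a \<in> set L. tail G a = v}"
  by (auto simp: arcs_at_def)

text \<open>
  The merging of two tours by a tree edge yields both the extent of a tour and the fact that a tour
  meets the arcs at each vertex in their cyclic order.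
\<close>

lemma bforest_tour:
  assumes "bforest F" "a \<in> arcs G"
  shows "\<exists>L. cyc (tau F) L \<and> set L = {b \<in> arcs G. (tail G a, tail G b) \<in> conn F} \<and>
    (\<forall>v. arcs_at v L = [] \<or> cyc nxt (arcs_at v L))"
  using assms
proof (induction arbitrary: a rule: bforest_induct)
  case empty
  have "tail G a \<in> verts G" "out_arcs G (tail G a) \<noteq> {}"
    using empty by auto
  then have "cyclic_on nxt (out_arcs G (tail G a))"
    by (rule nxt_cyclic)
  moreover have "finite (out_arcs G (tail G a))" by auto
  ultimately obtain xs where xs: "cyc nxt (a # xs)" "set (a # xs) = out_arcs G (tail G a)"
    by (rule cyclic_on_imp_cyc[of nxt _ a]) (use empty in auto)
  have at: "arcs_at v (a # xs) = (if v = tail G a then a # xs else [])" for v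
    using xs(2) unfolding arcs_at_def by (auto simp: filter_id_conv filter_empty_conv)
  show ?case
  proof (intro exI[of _ "a # xs"] conjI allI)
    show "cyc (tau {}) (a # xs)"
      using xs(1) cyc_cong[of "a # xs" nxt "tau {}"] by (simp add: tau_def)
    show "set (a # xs) = {b \<in> arcs G. (tail G a, tail G b) \<in> conn {}}"
      unfolding xs(2) by (auto simp: adj_def)
    show "arcs_at v (a # xs) = [] \<or> cyc nxt (arcs_at v (a # xs))" for v
      unfolding at using xs(1) by auto
  qed
next
  case (insert F e)
  let ?F = "F \<union> edge e"
  have sF: "oppclosed F" using insert.hyps(1) by (rule bforest_oppclosed)
  have oe: "opp e \<in> arcs G" "opp e \<notin> F" "opp e \<noteq> e"
    using insert.hyps oppclosed_opp_iff[OF sF] by auto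
  note ci = conn_insert[OF sF insert.hyps(2)]
  show ?case
  proof (cases "(tail G a, tail G e) \<in> conn F \<or> (tail G a, head G e) \<in> conn F")
    \<comment> \<open>The edge \<open>e\<close> does not touch the component of \<open>a\<close>, so
      the tour there and its extent stay as they are.\<close>
    case False
    obtain L where L: "cyc (tau F) L" "set L = {b \<in> arcs G. (tail G a, tail G b) \<in> conn F}"
      "\<forall>v. arcs_at v L = [] \<or> cyc nxt (arcs_at v L)"
      using insert.IH[OF insert.prems] by blast
    have "e \<notin> set L" "opp e \<notin> set L"
      using L(2) False insert.hyps by auto
    then have "cyc (tau ?F) L"
      using L(1) by (subst cyc_cong[where g = "tau F"]) (auto simp: tau_def)
    moreover have "set L = {b \<in> arcs G. (tail G a, tail G b) \<in> conn ?F}"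
      unfolding L(2) ci using False by auto
    ultimately show ?thesis
      using L(3) by blast
  next
    case True
    obtain L where L: "cyc (tau F) L" "set L = {b \<in> arcs G. (tail G e, tail G b) \<in> conn F}"
      "\<forall>v. arcs_at v L = [] \<or> cyc nxt (arcs_at v L)"
      using insert.IH[OF insert.hyps(2)] by blast
    obtain M where M: "cyc (tau F) M" "set M = {b \<in> arcs G. (head G e, tail G b) \<in> conn F}"
      "\<forall>v. arcs_at v M = [] \<or> cyc nxt (arcs_at v M)"
      using insert.IH[OF oe(1)] insert.hyps(2) by auto
    have "e \<in> set L" "opp e \<in> set M"
      using L(2) M(2) insert.hyps(2) by auto
    then obtain L1 L2 M1 M2 where LM: "L = L1 @ e # L2" "M = M1 @ opp e # M2"
      by (meson split_list)
    define N where "N = e # (M2 @ M1) @ opp e # (L2 @ L1)"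
    have disj: "(tail G e, v) \<notin> conn F \<or> (head G e, v) \<notin> conn F" for v
      using insert.hyps(4) conn_sym[OF sF] conn_trans by blast
    have dis: "set L \<inter> set M = {}"
      unfolding L(2) M(2) using disj by blast
    have L': "cyc (tau F) (e # L2 @ L1)" and M': "cyc (tau F) (opp e # M2 @ M1)"
      using L(1) M(1) cyc_rotate unfolding LM by fastforce+
    have "cyc (tau ?F) N"
      unfolding N_def
    proof (rule cyc_merge[OF L' M'])
      show "set (e # L2 @ L1) \<inter> set (opp e # M2 @ M1) = {}"
        using dis unfolding LM by auto
      have e: "e \<notin> set (L2 @ L1) \<union> set (M2 @ M1)" "opp e \<notin> set (L2 @ L1) \<union> set (M2 @ M1)"
        using L' M' dis unfolding LM by (auto simp: cyc_Cons)
      show "tau ?F e = tau F (opp e)" "tau ?F (opp e) = tau F e"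
        using insert.hyps oe by (auto simp: tau_def)
      show "tau ?F z = tau F z" if "z \<in> set (L2 @ L1) \<union> set (M2 @ M1)" for z
        using that e by (auto simp: tau_def)
    qed
    moreover have "set N = {b \<in> arcs G. (tail G a, tail G b) \<in> conn ?F}"
    proof -
      have "set N = set L \<union> set M"
        unfolding N_def LM by auto
      also have "\<dots> = {b \<in> arcs G. (tail G a, tail G b) \<in> conn ?F}"
        unfolding L(2) M(2) ci using True conn_sym[OF sF] conn_trans by blast
      finally show ?thesis .
    qed
    \<comment> \<open>The vertex \<open>v\<close> lies in at most one of the two merged components,
      so its arcs come from a single one of the old tours, possibly read from another starting
      point.\<close>
    moreover have "arcs_at v N = [] \<or> cyc nxt (arcs_at v N)" for v
    proof -
      have rot: "arcs_at v (xs @ ys) = [] \<or> cyc nxt (arcs_at v (xs @ ys)) \<Longrightarrow>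
          arcs_at v (ys @ xs) = [] \<or> cyc nxt (arcs_at v (ys @ xs))" for xs ys
        unfolding arcs_at_append using cyc_rotate by blast
      have emp: "arcs_at v xs = []" if "\<forall>b\<in>set xs. tail G b \<noteq> v" for xs
        using that unfolding arcs_at_def by (auto simp: filter_empty_conv)

      from disj[of v] show ?thesis
      proof
        assume *: "(tail G e, v) \<notin> conn F"
        have "arcs_at v L1 = []" "arcs_at v L2 = []"
          using * L(2) unfolding LM by (intro emp; force)+
        moreover have "tail G e \<noteq> v"
          using * by auto
        ultimately have "arcs_at v N = arcs_at v ((M2 @ M1) @ [opp e])"
          unfolding N_def by simp
        moreover have "arcs_at v (M2 @ M1 @ [opp e]) = [] \<or> cyc nxt (arcs_at v (M2 @ M1 @ [opp e]))"
          using rot[of "M1 @ [opp e]" M2] M(3) unfolding LM by simp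
        ultimately show ?thesis by simp
      next
        assume *: "(head G e, v) \<notin> conn F"
        have "arcs_at v M1 = []" "arcs_at v M2 = []"
          using * M(2) unfolding LM by (intro emp; force)+
        moreover have "tail G (opp e) \<noteq> v"
          using * insert.hyps(2) by auto
        ultimately have "arcs_at v N = arcs_at v (e # L2 @ L1)"
          unfolding N_def by simp
        moreover have "arcs_at v (e # L2 @ L1) = [] \<or> cyc nxt (arcs_at v (e # L2 @ L1))"
          using rot[of L1 "e # L2"] L(3) unfolding LM by simp
        ultimately show ?thesis by simp
      qed
    qed
    ultimately show ?thesis
      by blast
  qed
qed

end

section \<open>Cutting, joining and exchanging edges in the tours of spanning trees\<close>

context loopless_ribbon_graph
begin

text \<open>The tour through \<open>a\<close> is unique as a cyclic list, so what
  \<open>bforest_tour\<close> provides for some list holds for every list started at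
  \<open>a\<close>.\<close>

lemma tour_set:
  assumes F: "bforest F" and a: "a \<in> arcs G" and L: "cyc (tau F) (a # L)"
  shows "set (a # L) = {b \<in> arcs G. (tail G a, tail G b) \<in> conn F}"
    and "arcs_at v (a # L) = [] \<or> cyc nxt (arcs_at v (a # L))"
proof -
  obtain M where M: "cyc (tau F) M" "set M = {b \<in> arcs G. (tail G a, tail G b) \<in> conn F}"
      "\<forall>v. arcs_at v M = [] \<or> cyc nxt (arcs_at v M)"
    using bforest_tour[OF F a] by blast
  have "a \<in> set M" using a M(2) by auto
  then obtain M1 M2 where M12: "M = M1 @ a # M2" by (meson split_list)
  have "cyc (tau F) (a # M2 @ M1)"
    using M(1) cyc_rotate unfolding M12 by fastforce
  then have L': "a # L = a # M2 @ M1"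
    using cyc_unique[OF L, of "a # M2 @ M1"] by simp
  show "set (a # L) = {b \<in> arcs G. (tail G a, tail G b) \<in> conn F}"
    unfolding L' M(2)[symmetric] M12 by auto
  have "arcs_at v (M1 @ a # M2) = [] \<or> cyc nxt (arcs_at v (M1 @ a # M2))"
    using M(3) unfolding M12 by blast
  then show "arcs_at v (a # L) = [] \<or> cyc nxt (arcs_at v (a # L))"
    unfolding L' using cyc_rotate[of nxt "arcs_at v M1" "arcs_at v (a # M2)"]
    by (auto split: if_splits)
qed

lemma tour_exists:
  assumes "bforest F" "a \<in> arcs G"
  obtains L where "cyc (tau F) (a # L)"
proof -
  obtain M where M: "cyc (tau F) M" "set M = {b \<in> arcs G. (tail G a, tail G b) \<in> conn F}"
    using bforest_tour[OF assms] by blast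
  moreover have "a \<in> set M" using assms(2) M(2) by auto
  ultimately show thesis
    using cyc_rotate_to that by metis
qed

lemma stree_bforest: "stree T \<Longrightarrow> bforest T"
  by (simp add: stree_def)

lemma stree_oppclosed: "stree T \<Longrightarrow> oppclosed T"
  by (simp add: stree_def bforest_def)

lemma stree_arcs: "stree T \<Longrightarrow> a \<in> T \<Longrightarrow> a \<in> arcs G"
  using stree_oppclosed oppclosed_arcs by blast

lemma stree_opp_iff: "stree T \<Longrightarrow> opp a \<in> T \<longleftrightarrow> a \<in> T"
  using stree_oppclosed oppclosed_opp_iff by blast

lemma stree_conn: "stree T \<Longrightarrow> u \<in> verts G \<Longrightarrow> v \<in> verts G \<Longrightarrow> (u, v) \<in> conn T"
  by (simp add: stree_def)

lemma stree_tour_set: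
  assumes "stree T" "a \<in> arcs G" "cyc (tau T) (a # L)"
  shows "set (a # L) = arcs G"
  using tour_set(1)[OF stree_bforest[OF assms(1)] assms(2,3)] stree_conn[OF assms(1)] assms(2)
  by auto

text \<open>Between \<open>e\<close> and \<open>opp e\<close> the tour stays on the head side of
  \<open>e\<close>, afterwards on the tail side. Each part closes up to the tour of its component
  once \<open>e\<close> is removed.\<close>

lemma tour_cut:
  assumes T: "stree T" and e: "e \<in> T" and L: "cyc (tau T) (e # Ys @ opp e # Xs)"
  shows "cyc (tau (T - edge e)) (e # Xs)" "cyc (tau (T - edge e)) (opp e # Ys)"
proof -
  have ea: "e \<in> arcs G" "opp e \<in> T"
    using T e stree_arcs stree_opp_iff by auto
  have "e \<notin> set Xs \<union> set Ys" "opp e \<notin> set Xs \<union> set Ys"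
    using L by (auto simp: cyc_Cons)
  moreover note e ea
  ultimately show "cyc (tau (T - edge e)) (e # Xs)" "cyc (tau (T - edge e)) (opp e # Ys)"
    by (intro cyc_split[OF L]; auto simp: tau_def)+
qed

lemma tour_join:
  assumes F: "bforest F" and e: "e \<in> arcs G" "(tail G e, head G e) \<notin> conn F"
    and X: "cyc (tau F) (e # Xs)" and Y: "cyc (tau F) (opp e # Ys)"
  shows "cyc (tau (F \<union> edge e)) (e # Ys @ opp e # Xs)"
proof -
  have sF: "oppclosed F" using F by (rule bforest_oppclosed)
  have eF: "e \<notin> F" "opp e \<notin> F"
    using e conn_arc oppclosed_opp_iff[OF sF] by auto
  have X': "set (e # Xs) = {b \<in> arcs G. (tail G e, tail G b) \<in> conn F}"
    by (rule tour_set(1)[OF F e(1) X])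
  have Y': "set (opp e # Ys) = {b \<in> arcs G. (head G e, tail G b) \<in> conn F}"
    using tour_set(1)[OF F _ Y] e(1) by simp
  have dis: "set (e # Xs) \<inter> set (opp e # Ys) = {}"
  proof (rule equals0I)
    fix b assume "b \<in> set (e # Xs) \<inter> set (opp e # Ys)"
    then have "(tail G e, tail G b) \<in> conn F" "(head G e, tail G b) \<in> conn F"
      unfolding X' Y' by auto
    then show False using e(2) conn_sym[OF sF] conn_trans by blast
  qed
  then have "e \<notin> set Xs \<union> set Ys" "opp e \<notin> set Xs \<union> set Ys"
    using X Y by (auto simp: cyc_Cons)
  then show ?thesis
    using e eF by (intro cyc_merge[OF X Y dis]) (auto simp: tau_def)
qed

lemma stree_sides:
  assumes T: "stree T" and e: "e \<in> T" and v: "v \<in> verts G"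
  shows "(tail G e, v) \<in> conn (T - edge e) \<or> (head G e, v) \<in> conn (T - edge e)"
proof -
  have sT: "oppclosed (T - edge e)"
    using T stree_oppclosed oppclosed_diff_edge by blast
  have ea: "e \<in> arcs G" using T e stree_arcs by auto
  have "(tail G e, v) \<in> conn (T - edge e \<union> edge e)"
    using un_diff_edge[OF stree_oppclosed[OF T] e] stree_conn[OF T _ v] ea by simp
  then show ?thesis
    unfolding conn_insert[OF sT ea] by auto
qed

lemma stree_sides_disj:
  assumes T: "stree T" and e: "e \<in> T"
  shows "(tail G e, v) \<notin> conn (T - edge e) \<or> (head G e, v) \<notin> conn (T - edge e)"
  using bforest_bridge[OF stree_bforest[OF T] e] conn_trans
    conn_sym[OF oppclosed_diff_edge[OF stree_oppclosed[OF T]]] by blast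

lemma stree_exchange:
  assumes T: "stree T" and e: "e \<in> T" and k: "k \<in> arcs G"
    and "(tail G e, tail G k) \<in> conn (T - edge e)" "(head G e, head G k) \<in> conn (T - edge e)"
  shows "stree (T - edge e \<union> edge k)"
proof -
  let ?F = "T - edge e"
  have F: "bforest ?F" using T stree_bforest bforest_diff_edge by blast
  have sF: "oppclosed ?F" using F by (rule bforest_oppclosed)
  have "(tail G k, head G k) \<notin> conn ?F"
    using assms(4,5) stree_sides_disj[OF T e] conn_trans by blast
  then have "bforest (?F \<union> edge k)"
    using F k by (rule_tac bforest_un_edge)
  moreover have "(u, v) \<in> conn (?F \<union> edge k)" if "u \<in> verts G" "v \<in> verts G" for u v
    unfolding conn_insert[OF sF k]
    using stree_sides[OF T e that(1)] stree_sides[OF T e that(2)] assms(4,5)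
      conn_trans conn_sym[OF sF] by meson
  ultimately show ?thesis
    by (simp add: stree_def)
qed

text \<open>Cut at \<open>e\<close>, then join at \<open>k\<close>. The four blocks between the ends
  of \<open>e\<close> and \<open>k\<close> survive as they are; only their order around the circle
  changes.\<close>

lemma tour_exchange:
  assumes T: "stree T" and e: "e \<in> T" and k: "k \<in> arcs G"
    and X: "cyc (tau (T - edge e)) (e # S1 @ k # S2)"
    and Y: "cyc (tau (T - edge e)) (opp e # B @ opp k # A)"
  shows "stree (T - edge e \<union> edge k)"
    and "cyc (tau (T - edge e \<union> edge k)) (k # (A @ opp e # B) @ opp k # (S2 @ e # S1))"
proof -
  let ?F = "T - edge e"
  have F: "bforest ?F" using T stree_bforest bforest_diff_edge by blast
  have ea: "e \<in> arcs G" using T e stree_arcs by auto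
  have "k \<in> set (e # S1 @ k # S2)" "opp k \<in> set (opp e # B @ opp k # A)" by auto
  then have *: "(tail G e, tail G k) \<in> conn ?F" "(head G e, head G k) \<in> conn ?F"
    unfolding tour_set(1)[OF F ea X] tour_set(1)[OF F arev_in_arcs[OF ea] Y] using ea k by auto
  show "stree (?F \<union> edge k)"
    by (rule stree_exchange[OF T e k *])
  have "(tail G k, head G k) \<notin> conn ?F"
    using * stree_sides_disj[OF T e] conn_trans by blast
  moreover have "cyc (tau ?F) (k # (S2 @ e # S1))"
    using cyc_rotate[of "tau ?F" "e # S1" "k # S2"] X by simp
  moreover have "cyc (tau ?F) (opp k # (A @ opp e # B))"
    using cyc_rotate[of "tau ?F" "opp e # B" "opp k # A"] Y by simp
  ultimately show "cyc (tau (?F \<union> edge k)) (k # (A @ opp e # B) @ opp k # (S2 @ e # S1))"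
    by (intro tour_join[OF F k])
qed

lemma tour_split_at:
  assumes T: "stree T" and e: "e \<in> T"
  obtains Xs Ys where "cyc (tau T) (e # Ys @ opp e # Xs)"
proof -
  have ea: "e \<in> arcs G" using T e stree_arcs by auto
  obtain L where L: "cyc (tau T) (e # L)"
    using tour_exists[OF stree_bforest[OF T] ea] .
  have "opp e \<in> set (e # L)"
    unfolding stree_tour_set[OF T ea L] using ea by simp
  then have "opp e \<in> set L"
    using ea by auto
  then show thesis
    using L that by (metis split_list)
qed

lemma tour_sides:
  assumes T: "stree T" and e: "e \<in> T" and L: "cyc (tau T) (e # Ys @ opp e # Xs)"
  shows "set (e # Xs) = {b \<in> arcs G. (tail G e, tail G b) \<in> conn (T - edge e)}"
    and "set (opp e # Ys) = {b \<in> arcs G. (head G e, tail G b) \<in> conn (T - edge e)}"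
proof -
  have ea: "e \<in> arcs G" using T e stree_arcs by auto
  have F: "bforest (T - edge e)" using T stree_bforest bforest_diff_edge by blast
  show "set (e # Xs) = {b \<in> arcs G. (tail G e, tail G b) \<in> conn (T - edge e)}"
    by (rule tour_set(1)[OF F ea tour_cut(1)[OF T e L]])
  show "set (opp e # Ys) = {b \<in> arcs G. (head G e, tail G b) \<in> conn (T - edge e)}"
    using tour_set(1)[OF F arev_in_arcs[OF ea] tour_cut(2)[OF T e L]] ea by simp
qed

lemma conn_arcs: "u \<in> verts G \<Longrightarrow> v \<in> verts G \<Longrightarrow> (u, v) \<in> conn (arcs G)"
proof -
  assume uv: "u \<in> verts G" "v \<in> verts G"
  have "strongly_connected G"
    using symmetric_connected_imp_strongly_connected[OF _ connected] sym_arcs by blast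
  then have "u \<rightarrow>\<^sup>*\<^bsub>G\<^esub> v" using uv by auto
  then have "(u, v) \<in> (arcs_ends G)\<^sup>*" by (rule reachable_rtranclI)
  moreover have "arcs_ends G = adj (arcs G)"
    unfolding arcs_ends_conv adj_def by auto
  ultimately show ?thesis by simp
qed

text \<open>A maximal forest connects the ends of every arc, since otherwise this arc could be added
  to it.\<close>

lemma stree_exists: obtains T where "stree T"
proof -
  have "finite {F. bforest F}"
    by (rule finite_subset[of _ "Pow (arcs G)"]) (auto dest: bforest_arcs)
  moreover have "{} \<in> {F. bforest F}" using bforest_empty by simp
  ultimately obtain F where F: "bforest F" "\<And>F'. bforest F' \<Longrightarrow> F \<subseteq> F' \<Longrightarrow> F' = F"
    using finite_has_maximal[of "{F. bforest F}"] by blast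
  have arc: "(tail G a, head G a) \<in> conn F" if "a \<in> arcs G" for a
  proof (rule ccontr)
    assume *: "(tail G a, head G a) \<notin> conn F"
    have "F \<union> edge a = F"
      by (rule F(2)[OF bforest_un_edge[OF F(1) that *]]) auto
    then have "edge a \<subseteq> F" by blast
    then show False using * conn_arc[of a F] by auto
  qed
  have "(u, v) \<in> conn F" if "(u, v) \<in> conn (arcs G)" for u v
    using that
  proof (induction rule: rtrancl_induct)
    case (step v w)
    then obtain a where "a \<in> arcs G" "v = tail G a" "w = head G a"
      by (auto simp: adj_def)
    then show ?case using arc step.IH conn_trans by blast
  qed simp
  then have "stree F"
    using F(1) conn_arcs by (simp add: stree_def)
  then show thesis using that by blast
qed

section \<open>Spanning trees and their rotors\<close>

lemma wf_restrict: "F \<subseteq> arcs G \<Longrightarrow> wf_digraph (G\<lparr>arcs := F\<rparr>)"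
  by unfold_locales auto

lemma cas_restrict [simp]: "pre_digraph.cas (G\<lparr>arcs := F\<rparr>) u p v = cas u p v"
  by (induction p arbitrary: u) (simp_all add: pre_digraph.cas.simps)

lemma awalk_verts_restrict [simp]: "pre_digraph.awalk_verts (G\<lparr>arcs := F\<rparr>) u p = awalk_verts u p"
  by (induction p arbitrary: u) (simp_all add: pre_digraph.awalk_verts.simps)

lemma awalk_restrict:
  "pre_digraph.awalk (G\<lparr>arcs := F\<rparr>) u p v \<longleftrightarrow> u \<in> verts G \<and> set p \<subseteq> F \<and> cas u p v"
  by (simp add: pre_digraph.awalk_def)

lemma apath_restrict:
  "pre_digraph.apath (G\<lparr>arcs := F\<rparr>) u p v \<longleftrightarrow>
    u \<in> verts G \<and> set p \<subseteq> F \<and> cas u p v \<and> distinct (awalk_verts u p)"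
  by (simp add: pre_digraph.apath_def awalk_restrict)

lemma cas_conn: "cas u p v \<Longrightarrow> set p \<subseteq> F \<Longrightarrow> (u, v) \<in> conn F"
proof (induction p arbitrary: u)
  case (Cons a p)
  then show ?case
    using conn_arc[of a F] conn_trans by auto
qed simp

lemma cas_verts: "cas u p v \<Longrightarrow> a \<in> set p \<Longrightarrow>
    tail G a \<in> set (awalk_verts u p) \<and> head G a \<in> set (awalk_verts u p)"
proof (induction p arbitrary: u)
  case (Cons b p)
  have "head G b \<in> set (awalk_verts (head G b) p)" by (cases p) (use Cons.prems in auto)
  then show ?case using Cons by auto
qed simp

lemma conn_apath:
  assumes "(u, v) \<in> conn F" "u \<in> verts G" "F \<subseteq> arcs G"
  obtains p where "pre_digraph.apath (G\<lparr>arcs := F\<rparr>) u p v"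
proof -
  interpret H: wf_digraph "G\<lparr>arcs := F\<rparr>" using assms(3) by (rule wf_restrict)
  have "arcs_ends (G\<lparr>arcs := F\<rparr>) = adj F"
    unfolding arcs_ends_conv adj_def by auto
  then have "u \<rightarrow>\<^sup>*\<^bsub>G\<lparr>arcs := F\<rparr>\<^esub> v"
    using assms(1,2) by (simp add: H.reachable_conv')
  then show thesis
    using that by (auto simp: H.reachable_awalk dest: H.apath_awalk_to_apath)
qed

text \<open>Links the cycles of the definition with bridges. An edge that is not a bridge closes a
  path to a cycle of another form than \<open>[a, opp a]\<close>. Conversely a cycle that begins
  with a bridge \<open>a\<close> has to come back over it, and since it repeats no inner vertex it
  consists of \<open>a\<close> and \<open>opp a\<close> only.\<close>

lemma mem_spanning_trees_iff: "T \<in> spanning_trees G opp \<longleftrightarrow> stree T"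
proof (cases "oppclosed T")
  case False
  moreover have "opp ` T = T \<Longrightarrow> T \<subseteq> arcs G \<Longrightarrow> oppclosed T"
    unfolding oppclosed_def by auto
  ultimately show ?thesis
    by (auto simp: spanning_trees_def stree_def bforest_def)
next
  case sT: True
  let ?H = "G\<lparr>arcs := T\<rparr>"
  have TG: "T \<subseteq> arcs G" using sT by (simp add: oppclosed_def)
  interpret H: wf_digraph ?H using TG by (rule wf_restrict)
  have oT: "opp ` T = T"
    using sT unfolding oppclosed_def by (auto simp: image_iff) (metis arev_arev)
  have ends: "arcs_ends ?H = adj T"
    unfolding arcs_ends_conv adj_def by auto
  have ne: "verts G \<noteq> {}"
    using connected by (auto simp: connected_conv)
  have "symmetric ?H"
    using adj_sym[OF sT] by (simp add: symmetric_def ends)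
  then have "Digraph_Component.connected ?H \<longleftrightarrow> strongly_connected ?H"
    by (simp add: Digraph_Component.connected_def strongly_connected_def H.reachable_mk_symmetric_eq)
  also have "\<dots> \<longleftrightarrow> (\<forall>u\<in>verts G. \<forall>v\<in>verts G. (u, v) \<in> conn T)"
    using ne by (auto simp: strongly_connected_def H.reachable_conv' ends)
  finally have con: "Digraph_Component.connected ?H \<longleftrightarrow>
    (\<forall>u\<in>verts G. \<forall>v\<in>verts G. (u, v) \<in> conn T)" .
  have "(\<forall>p. pre_digraph.cycle ?H p \<longrightarrow> (\<exists>a. p = [a, opp a])) \<longleftrightarrow> bforest T"
  proof
    assume cyc: "\<forall>p. pre_digraph.cycle ?H p \<longrightarrow> (\<exists>a. p = [a, opp a])"
    show "bforest T"
      unfolding bforest_def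
    proof (intro conjI ballI sT notI)
      fix a assume a: "a \<in> T" and c: "(tail G a, head G a) \<in> conn (T - edge a)"
      have aG: "a \<in> arcs G" using a TG by auto
      have "(head G a, tail G a) \<in> conn (T - edge a)"
        using c conn_sym[OF oppclosed_diff_edge[OF sT]] by blast
      then obtain p where p: "pre_digraph.apath (G\<lparr>arcs := T - edge a\<rparr>) (head G a) p (tail G a)"
        by (rule conn_apath) (use aG TG in auto)
      then have "pre_digraph.cycle ?H (a # p)"
        using a aG unfolding apath_restrict pre_digraph.cycle_def awalk_restrict
        by (auto simp: awalk_restrict)
      then have "p = [opp a]" using cyc by auto
      then show False using p unfolding apath_restrict by auto
    qed
  next
    assume T: "bforest T"
    show "\<forall>p. pre_digraph.cycle ?H p \<longrightarrow> (\<exists>a. p = [a, opp a])"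
    proof (intro allI impI)
      fix p assume "pre_digraph.cycle ?H p"
      then obtain u where u: "u \<in> verts G" "set p \<subseteq> T" "cas u p u" "distinct (tl (awalk_verts u p))" "p \<noteq> []"
        unfolding pre_digraph.cycle_def by (auto simp: awalk_restrict)
      then obtain a q where p: "p = a # q" by (cases p) auto
      have q: "cas (head G a) q u" "tail G a = u" "distinct (awalk_verts (head G a) q)" "a \<in> T" "set q \<subseteq> T"
        using u p by auto
      have aG: "a \<in> arcs G" using q TG by auto
      have last: "last (awalk_verts x r) = y" if "cas x r y" for x r y
        using that by (induction r arbitrary: x) auto
      \<comment> \<open>The rest of the cycle leads from the head of the bridge \<open>a\<close>
        back to its tail, so it uses this edge again. Distinctness of the vertices then excludes
        \<open>a\<close> itself and anything before or after \<open>opp a\<close>.\<close>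
      have "\<not> set q \<subseteq> T - edge a"
        using bforest_bridge'[OF T q(4)] cas_conn[OF q(1)] q(2) by auto
      then have "\<exists>b\<in>set q. b = a \<or> b = opp a" using q(5) by auto
      then obtain b where b: "b \<in> set q" "b = a \<or> b = opp a" by blast
      then obtain q1 q2 where q12: "q = q1 @ b # q2" by (meson split_list)
      have verts: "awalk_verts (head G a) q = map (tail G) q1 @ tail G b # awalk_verts (head G b) q2"
        unfolding q12 by (simp add: awalk_verts_conv)
      have "cas (head G b) q2 u"
        using q(1) unfolding q12 by (induction q1 arbitrary: a) auto
      then have l2: "u \<in> set (awalk_verts (head G b) q2)" "last (awalk_verts (head G b) q2) = u"
        using last last_in_set awalk_verts_non_Nil by metis+
      then have "tail G b \<noteq> u" using q(3) unfolding verts by auto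
      then have b: "b = opp a" using b q(2) by auto
      have "q1 = []"
      proof (rule ccontr)
        assume "q1 \<noteq> []"
        then have "head G a = tail G (hd q1)"
          using q(1) unfolding q12 by (cases q1) auto
        then show False
          using q(3) \<open>q1 \<noteq> []\<close> aG unfolding verts b by auto
      qed
      moreover have "q2 = []"
      proof (rule ccontr)
        assume "q2 \<noteq> []"
        then obtain c q2' where q2: "q2 = c # q2'" by (cases q2) auto
        have "tail G c = u"
          using \<open>cas (head G b) q2 u\<close> q(2) aG unfolding q2 b by auto
        moreover have "last (awalk_verts (head G c) q2') = u"
          using l2(2) unfolding q2 by auto
        ultimately show False
          using q(3) last_in_set[OF awalk_verts_non_Nil, of "head G c" q2'] unfolding verts q2 by auto
      qed
      ultimately show "\<exists>a. p = [a, opp a]" using p q12 b by auto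
    qed
  qed
  then show ?thesis
    using TG oT con by (auto simp: spanning_trees_def stree_def)
qed

text \<open>Replaces the first arc of a tree path by a condition on a cut, which can be compared
  between trees and between roots.\<close>

definition towards :: "'b set \<Rightarrow> 'a \<Rightarrow> 'b \<Rightarrow> bool" where
  "towards T y a \<longleftrightarrow> a \<in> T \<and> (head G a, y) \<in> conn (T - edge a)"

text \<open>Two different such arcs at one vertex would lead to \<open>y\<close> along two routes,
  against the edges of a tree being bridges.\<close>

lemma towards_unique:
  assumes T: "stree T" and a: "towards T y a" and b: "towards T y b" and ab: "tail G a = tail G b"
  shows "a = b"
proof (rule ccontr)
  assume neq: "a \<noteq> b"
  have aT: "a \<in> T" "b \<in> T" using a b by (auto simp: towards_def)
  have aG: "a \<in> arcs G" "b \<in> arcs G" using aT T stree_arcs by auto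
  have ba: "b \<noteq> opp a" "a \<noteq> opp b" using aG ab no_loops by force+
  let ?F = "T - edge a - edge b"
  have sT: "oppclosed T" using T by (rule stree_oppclosed)
  have sF: "oppclosed ?F" "oppclosed (T - edge a)" "oppclosed (T - edge b)"
    using sT oppclosed_diff_edge by blast+
  have "?F \<union> edge b = T - edge a" "?F \<union> edge a = T - edge b"
    using neq ba aT stree_opp_iff[OF T, of a] stree_opp_iff[OF T, of b] by auto
  note ins = conn_insert[OF sF(1) aG(1), unfolded this] conn_insert[OF sF(1) aG(2), unfolded this]
  have na: "(tail G a, head G a) \<notin> conn (T - edge a)" "(tail G b, head G b) \<notin> conn (T - edge b)"
    using bforest_bridge[OF stree_bforest[OF T]] aT by auto
  have y: "(head G a, y) \<in> conn (T - edge a)" "(head G b, y) \<in> conn (T - edge b)"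
    using a b by (auto simp: towards_def)
  have "b \<in> T - edge a" using neq ba aT by auto
  then have bu: "(tail G a, head G b) \<in> conn (T - edge a)"
    using conn_arc[of b "T - edge a"] ab by simp
  have sub: "p \<in> conn ?F \<Longrightarrow> p \<in> conn (T - edge a)" "p \<in> conn ?F \<Longrightarrow> p \<in> conn (T - edge b)" for p
    by (erule conn_mono[rotated], auto)+
  have nu: "(tail G a, y) \<notin> conn (T - edge a)"
    using na(1) y(1) conn_sym[OF sF(2)] conn_trans by blast
  from y(2)[unfolded ins(1)] show False
    using nu bu sub na ab conn_sym[OF sF(1)] conn_sym[OF sF(2)] conn_trans by (metis (no_types))
qed

lemma stree_rotor:
  assumes T: "stree T" and uy: "u \<in> verts G" "y \<in> verts G" "u \<noteq> y"
  shows "towards T y (tree_rotors G T y u)" "tail G (tree_rotors G T y u) = u"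
    and "towards T y a \<Longrightarrow> tail G a = u \<Longrightarrow> tree_rotors G T y u = a"
    and "\<exists>n. ((\<lambda>v. head G (tree_rotors G T y v)) ^^ n) u = y"
proof -
  let ?H = "G\<lparr>arcs := T\<rparr>"
  have TG: "T \<subseteq> arcs G" using T stree_arcs by auto
  have tw: "towards T y a \<and> tail G a = u" if "pre_digraph.apath ?H u (a # p) y" for u a p
  proof -
    have *: "tail G a = u" "cas (head G a) p y" "set p \<subseteq> T" "a \<in> T"
      "u \<notin> set (awalk_verts (head G a) p)"
      using that by (auto simp: apath_restrict)
    have "set p \<subseteq> T - edge a"
    proof
      fix b assume b: "b \<in> set p"
      have "b \<noteq> a" "b \<noteq> opp a"
        using cas_verts[OF *(2) b] * TG by auto
      then show "b \<in> T - edge a" using b * by auto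
    qed
    then show ?thesis
      using * cas_conn[OF *(2)] by (auto simp: towards_def)
  qed
  have rot: "tree_rotors G T y u = a" if "pre_digraph.apath ?H u (a # p) y" for u a p
    unfolding tree_rotors_def
    by (rule the_equality) (use that tw towards_unique[OF T] in blast)+
  obtain p where p: "pre_digraph.apath ?H u p y"
    using conn_apath[OF stree_conn[OF T uy(1,2)] uy(1) TG] .
  then obtain a q where "p = a # q"
    using uy(3) by (cases p) (auto simp: apath_restrict)
  with p have ap: "pre_digraph.apath ?H u (a # q) y" by simp
  show t: "towards T y (tree_rotors G T y u)" "tail G (tree_rotors G T y u) = u"
    using tw[OF ap] rot[OF ap] by auto
  show "tree_rotors G T y u = a" if "towards T y a" "tail G a = u" for a
    using towards_unique[OF T t(1) that(1)] t(2) that(2) by simp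
  show "\<exists>n. ((\<lambda>v. head G (tree_rotors G T y v)) ^^ n) u = y"
    using p
  proof (induction p arbitrary: u)
    case Nil
    then show ?case by (intro exI[of _ 0]) (auto simp: apath_restrict)
  next
    case (Cons a p)
    have r: "tree_rotors G T y u = a" using Cons.prems by (rule rot)
    have "pre_digraph.apath ?H (head G a) p y"
      using Cons.prems TG by (auto simp: apath_restrict)
    then obtain n where "((\<lambda>v. head G (tree_rotors G T y v)) ^^ n) (head G a) = y"
      using Cons.IH by blast
    then show ?case
      using r by (intro exI[of _ "Suc n"]) (simp add: funpow_Suc_right del: funpow.simps)
  qed
qed

end

section \<open>Divisors and actions of the Picard group\<close>

context loopless_ribbon_graph
begin

abbreviation lk :: "('a \<Rightarrow>\<^sub>0 int) \<Rightarrow> 'a \<Rightarrow> int" where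
  "lk \<equiv> Poly_Mapping.lookup"

text \<open>The graph Laplacian; every arc at \<open>u\<close> contributes one difference.\<close>

definition lap :: "('a \<Rightarrow> int) \<Rightarrow> 'a \<Rightarrow> int" where
  "lap \<phi> u = (\<Sum>a\<in>out_arcs G u. \<phi> u - \<phi> (head G a))"

definition fire :: "'a \<Rightarrow> ('a \<Rightarrow>\<^sub>0 int)" where
  "fire v = (\<Sum>a\<in>in_arcs G v. boundary G a)"

lemma lap_0 [simp]: "lap (\<lambda>_. 0) u = 0"
  by (simp add: lap_def)

lemma lap_add: "lap (\<lambda>v. \<phi> v + \<psi> v) u = lap \<phi> u + lap \<psi> u"
  unfolding lap_def sum.distrib[symmetric] by (simp add: algebra_simps)

lemma lap_uminus: "lap (\<lambda>v. - \<phi> v) u = - lap \<phi> u"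
  unfolding lap_def sum_negf[symmetric] by (simp add: algebra_simps)

lemma lap_sum: "finite A \<Longrightarrow> lap (\<lambda>v. \<Sum>i\<in>A. \<phi> i v) u = (\<Sum>i\<in>A. lap (\<phi> i) u)"
  by (induction A rule: finite_induct) (simp_all add: lap_add)

lemma lap_mult: "lap (\<lambda>v. c * \<phi> v) u = c * lap \<phi> u"
  unfolding lap_def sum_distrib_left by (simp add: algebra_simps)

lemma sum_in_arcs: "(\<Sum>a\<in>in_arcs G v. f a) = (\<Sum>a\<in>out_arcs G v. f (opp a))"
  unfolding in_arcs_eq by (subst sum.reindex) auto

text \<open>Symmetry of the Laplacian: \<open>opp\<close> matches the arcs from \<open>v\<close> to
  \<open>u\<close> with those from \<open>u\<close> to \<open>v\<close>.\<close>

lemma lookup_fire: "lk (fire v) u = lap (\<lambda>w. if w = v then 1 else 0) u"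
proof -
  have "lk (fire v) u = (\<Sum>a\<in>out_arcs G v. (if v = u then 1 else 0) - (if head G a = u then 1 else 0))"
    unfolding fire_def sum_in_arcs lookup_sum boundary_def
    by (intro sum.cong) (auto simp: lookup_minus)
  also have "\<dots> = lap (\<lambda>w. if w = v then 1 else 0) u"
  proof (cases "u = v")
    case False
    have "(\<Sum>a\<in>out_arcs G v. if head G a = u then 1 else 0) =
        (\<Sum>a\<in>{a\<in>arcs G. tail G a = v \<and> head G a = u}. 1::int)"
      by (intro sum.mono_neutral_cong_right) auto
    also have "\<dots> = (\<Sum>a\<in>{a\<in>arcs G. tail G a = u \<and> head G a = v}. 1)"
      by (rule sum.reindex_bij_witness[of _ opp opp]) auto
    also have "\<dots> = (\<Sum>a\<in>out_arcs G u. if head G a = v then 1 else 0)"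
      by (intro sum.mono_neutral_cong_left) auto
    finally show ?thesis
      using False unfolding lap_def sum_subtractf by simp
  qed (simp add: lap_def)
  finally show ?thesis .
qed

lemma keys_fire: "v \<in> verts G \<Longrightarrow> Poly_Mapping.keys (fire v) \<subseteq> verts G"
proof
  fix u assume v: "v \<in> verts G" and "u \<in> Poly_Mapping.keys (fire v)"
  then obtain a where "a \<in> out_arcs G v" "lk (boundary G (opp a)) u \<noteq> 0"
    unfolding fire_def sum_in_arcs by (auto simp: in_keys_iff lookup_sum elim: sum.not_neutral_contains_not_neutral)
  then show "u \<in> verts G"
    by (auto simp: boundary_def lookup_minus split: if_splits)
qed

lemma keys_sub: "Poly_Mapping.keys (a - b :: 'a \<Rightarrow>\<^sub>0 int) \<subseteq> Poly_Mapping.keys a \<union> Poly_Mapping.keys b"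
  by (auto simp: in_keys_iff lookup_minus)

lemma div_degree_eq: "Poly_Mapping.keys D \<subseteq> verts G \<Longrightarrow> div_degree D = (\<Sum>v\<in>verts G. lk D v)"
  unfolding div_degree_def by (intro sum.mono_neutral_left) (auto simp: in_keys_iff)

lemma mem_Div0: "D \<in> carrier (Div0 G) \<longleftrightarrow>
    Poly_Mapping.keys D \<subseteq> verts G \<and> (\<Sum>v\<in>verts G. lk D v) = 0"
  by (auto simp: Div0_def div_degree_eq)

lemma Div0_simps [simp]: "\<one>\<^bsub>Div0 G\<^esub> = 0" "x \<otimes>\<^bsub>Div0 G\<^esub> y = x + y"
  by (simp_all add: Div0_def free_Abelian_group_def)

lemma Div0_zero: "0 \<in> carrier (Div0 G)"
  by (simp add: mem_Div0)

lemma Div0_add: "a \<in> carrier (Div0 G) \<Longrightarrow> b \<in> carrier (Div0 G) \<Longrightarrow> a + b \<in> carrier (Div0 G)"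
  using keys_add[of a b] by (auto simp: mem_Div0 lookup_add sum.distrib)

lemma Div0_diff: "a \<in> carrier (Div0 G) \<Longrightarrow> b \<in> carrier (Div0 G) \<Longrightarrow> a - b \<in> carrier (Div0 G)"
  using keys_sub[of a b] by (auto simp: mem_Div0 lookup_minus sum_subtractf)

lemma Div0_uminus: "a \<in> carrier (Div0 G) \<Longrightarrow> - a \<in> carrier (Div0 G)"
  using Div0_diff[of 0 a] Div0_zero by simp

lemma Div0_frag_diff: "x \<in> verts G \<Longrightarrow> y \<in> verts G \<Longrightarrow> frag_of x - frag_of y \<in> carrier (Div0 G)"
  using keys_sub[of "frag_of x" "frag_of y"]
  by (auto simp: mem_Div0 lookup_minus sum_subtractf)

lemma comm_group_Div0: "comm_group (Div0 G)"
  by (rule comm_groupI) (auto simp: Div0_zero Div0_add intro: bexI[of _ "- _"] Div0_uminus)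

lemma group_Div0: "group (Div0 G)"
  using comm_group_Div0 by (rule comm_group.axioms(2))

lemma inv_Div0: "a \<in> carrier (Div0 G) \<Longrightarrow> inv\<^bsub>Div0 G\<^esub> a = - a"
  by (rule group.inv_equality[OF group_Div0]) (auto simp: Div0_uminus)

lemma fire_Div0: "v \<in> verts G \<Longrightarrow> fire v \<in> carrier (Div0 G)"
proof -
  assume v: "v \<in> verts G"
  have "(\<Sum>u\<in>verts G. lk (fire v) u) = (\<Sum>a\<in>in_arcs G v. \<Sum>u\<in>verts G. lk (boundary G a) u)"
    unfolding fire_def lookup_sum by (rule sum.swap)
  also have "\<dots> = 0"
    using Div0_frag_diff by (intro sum.neutral) (auto simp: boundary_def mem_Div0)
  finally show ?thesis
    using v by (simp add: mem_Div0 keys_fire)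
qed

lemma Prin_eq: "Prin G = generate (Div0 G) (fire ` verts G)"
  unfolding Prin_def fire_def ..

lemma subgroup_Prin: "subgroup (Prin G) (Div0 G)"
  unfolding Prin_eq using fire_Div0 by (intro group.generate_is_subgroup[OF group_Div0]) auto

lemma Prin_Div0: "D \<in> Prin G \<Longrightarrow> D \<in> carrier (Div0 G)"
  using subgroup.subset[OF subgroup_Prin] by auto

lemma Prin_zero [simp]: "0 \<in> Prin G"
  using subgroup.one_closed[OF subgroup_Prin] by simp

lemma Prin_add: "a \<in> Prin G \<Longrightarrow> b \<in> Prin G \<Longrightarrow> a + b \<in> Prin G"
  using subgroup.m_closed[OF subgroup_Prin] by simp

lemma Prin_uminus: "a \<in> Prin G \<Longrightarrow> - a \<in> Prin G"
  using subgroup.m_inv_closed[OF subgroup_Prin] inv_Div0 Prin_Div0 by metis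

lemma Prin_diff: "a \<in> Prin G \<Longrightarrow> b \<in> Prin G \<Longrightarrow> a - b \<in> Prin G"
  using Prin_add Prin_uminus by fastforce

lemma Prin_sum: "(\<And>i. i \<in> A \<Longrightarrow> f i \<in> Prin G) \<Longrightarrow> (\<Sum>i\<in>A. f i) \<in> Prin G"
  by (induction A rule: infinite_finite_induct) (auto intro: Prin_add)

lemma Prin_cmul: "a \<in> Prin G \<Longrightarrow> frag_cmul n a \<in> Prin G"
proof (induction n rule: int_induct[of _ 0])
  case (step1 i)
  then show ?case using Prin_add by (simp add: frag_cmul_distrib)
next
  case (step2 i)
  then show ?case using Prin_diff by (simp add: frag_cmul_diff_distrib)
qed simp

lemma fire_Prin: "v \<in> verts G \<Longrightarrow> fire v \<in> Prin G"
  unfolding Prin_eq by (intro generate.incl) auto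

text \<open>The generators are the Laplacians of indicator functions, so their integer combinations
  are the Laplacians of integer functions. The potentials obtained in this way are what the maximum
  principles below apply to.\<close>

lemma Prin_iff:
  "D \<in> Prin G \<longleftrightarrow> Poly_Mapping.keys D \<subseteq> verts G \<and> (\<exists>\<phi>. \<forall>u\<in>verts G. lk D u = lap \<phi> u)"
proof
  assume D: "D \<in> Prin G"
  have "\<exists>\<phi>. \<forall>u\<in>verts G. lk D u = lap \<phi> u"
    using D unfolding Prin_eq
  proof (induction rule: generate.induct)
    case one
    then show ?case by (intro exI[of _ "\<lambda>_. 0"]) simp
  next
    case (incl h)
    then show ?case using lookup_fire by auto
  next
    case (inv h)
    then obtain v where v: "v \<in> verts G" "h = fire v" by auto
    have "inv\<^bsub>Div0 G\<^esub> h = - h"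
      unfolding v(2) by (rule inv_Div0[OF fire_Div0[OF v(1)]])
    then have "lk (inv\<^bsub>Div0 G\<^esub> h) u = lap (\<lambda>w. - (if w = v then 1 else 0)) u" for u
      unfolding lap_uminus v(2) by (simp add: lookup_fire)
    then show ?case by blast
  next
    case (eng h1 h2)
    then obtain \<phi> \<psi> where "\<forall>u\<in>verts G. lk h1 u = lap \<phi> u" "\<forall>u\<in>verts G. lk h2 u = lap \<psi> u"
      by blast
    then show ?case
      by (intro exI[of _ "\<lambda>v. \<phi> v + \<psi> v"]) (simp add: lookup_add lap_add)
  qed
  then show "Poly_Mapping.keys D \<subseteq> verts G \<and> (\<exists>\<phi>. \<forall>u\<in>verts G. lk D u = lap \<phi> u)"
    using Prin_Div0[OF D] by (simp add: mem_Div0)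
next
  assume "Poly_Mapping.keys D \<subseteq> verts G \<and> (\<exists>\<phi>. \<forall>u\<in>verts G. lk D u = lap \<phi> u)"
  then obtain \<phi> where D: "Poly_Mapping.keys D \<subseteq> verts G" "\<And>u. u \<in> verts G \<Longrightarrow> lk D u = lap \<phi> u"
    by blast
  define E where "E = (\<Sum>v\<in>verts G. frag_cmul (\<phi> v) (fire v))"
  have "E \<in> Prin G"
    unfolding E_def by (intro Prin_sum Prin_cmul fire_Prin)
  moreover have "D = E"
  proof (rule poly_mapping_eqI)
    fix u show "lk D u = lk E u"
    proof (cases "u \<in> verts G")
      case False
      then have "lk D u = 0" using D(1) by (auto simp: in_keys_iff)
      moreover have "lk (fire v) u = 0" if "v \<in> verts G" for v
        using keys_fire[OF that] False by (auto simp: in_keys_iff)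
      ultimately show ?thesis by (simp add: E_def lookup_sum)
    next
      case True
      have "lk E u = (\<Sum>v\<in>verts G. lap (\<lambda>w. \<phi> v * (if w = v then 1 else 0)) u)"
        unfolding E_def lookup_sum lap_mult by (simp add: lookup_fire)
      also have "\<dots> = lap (\<lambda>w. \<Sum>v\<in>verts G. \<phi> v * (if w = v then 1 else 0)) u"
        by (simp add: lap_sum)
      also have "\<dots> = lap \<phi> u"
        unfolding lap_def using True by (intro sum.cong) (auto simp: if_distrib cong: if_cong)
      finally show ?thesis using D(2)[OF True] by simp
    qed
  qed
  ultimately show "D \<in> Prin G" by simp
qed

section \<open>Actions of the Picard group induced by divisors attached to trees\<close>

lemma normal_Prin: "Prin G \<lhd> Div0 G"
  using comm_group.subgroup_imp_normal[OF comm_group_Div0 subgroup_Prin] .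

lemma group_Pic0: "group (Pic0 G)"
  unfolding Pic0_def using normal.factorgroup_is_group[OF normal_Prin] .

lemma coset_eq: "Prin G #>\<^bsub>Div0 G\<^esub> D = {h + D |h. h \<in> Prin G}"
  by (auto simp: r_coset_def)

lemma carrier_Pic0: "carrier (Pic0 G) = {Prin G #>\<^bsub>Div0 G\<^esub> D |D. D \<in> carrier (Div0 G)}"
  by (auto simp: Pic0_def FactGroup_def RCOSETS_def)

lemma coset_in_Pic0: "D \<in> carrier (Div0 G) \<Longrightarrow> Prin G #>\<^bsub>Div0 G\<^esub> D \<in> carrier (Pic0 G)"
  by (auto simp: carrier_Pic0)

lemma mult_Pic0: "D \<in> carrier (Div0 G) \<Longrightarrow> E \<in> carrier (Div0 G) \<Longrightarrow>
    (Prin G #>\<^bsub>Div0 G\<^esub> D) \<otimes>\<^bsub>Pic0 G\<^esub> (Prin G #>\<^bsub>Div0 G\<^esub> E) = Prin G #>\<^bsub>Div0 G\<^esub> (D + E)"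
  using normal.rcos_sum[OF normal_Prin, of D E] by (simp add: Pic0_def FactGroup_def)

text \<open>The common form of both torsors. For the Bernardi divisors it is
  \<open>bernardi_torsor_at\<close> literally; for the rotor divisors it is shown to satisfy the
  description of the rotor-routing torsor.\<close>

definition act :: "('b set \<Rightarrow> ('a \<Rightarrow>\<^sub>0 int)) \<Rightarrow> ('a \<Rightarrow>\<^sub>0 int) set \<Rightarrow> 'b set \<Rightarrow> 'b set" where
  "act J = (\<lambda>c\<in>carrier (Pic0 G). \<lambda>T\<in>spanning_trees G opp.
    (THE T'. T' \<in> spanning_trees G opp \<and> (\<exists>D\<in>c. lin_equiv G (J T + D) (J T'))))"

text \<open>A map \<open>J\<close> from the spanning trees to the divisors that induces a bijection onto one class of
  divisors modulo degree zero translation, so that translations by \<open>Pic0 G\<close> pull back to the trees.\<close>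

definition torsorial :: "('b set \<Rightarrow> ('a \<Rightarrow>\<^sub>0 int)) \<Rightarrow> bool" where
  "torsorial J \<longleftrightarrow> (\<forall>T D. stree T \<longrightarrow> D \<in> carrier (Div0 G) \<longrightarrow>
    (\<exists>!T'. stree T' \<and> J T' - J T - D \<in> Prin G))"

lemma coset_lin_equiv: "(\<exists>E\<in>Prin G #>\<^bsub>Div0 G\<^esub> D. lin_equiv G (A + E) B) \<longleftrightarrow> B - A - D \<in> Prin G"
proof
  assume "\<exists>E\<in>Prin G #>\<^bsub>Div0 G\<^esub> D. lin_equiv G (A + E) B"
  then obtain h where "h \<in> Prin G" "A + (h + D) - B \<in> Prin G"
    by (auto simp: coset_eq lin_equiv_def)
  then have "h - (A + (h + D) - B) \<in> Prin G" by (rule Prin_diff)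
  then show "B - A - D \<in> Prin G" by (simp add: algebra_simps)
next
  assume "B - A - D \<in> Prin G"
  then show "\<exists>E\<in>Prin G #>\<^bsub>Div0 G\<^esub> D. lin_equiv G (A + E) B"
    by (intro bexI[of _ "B - A"]) (auto simp: coset_eq lin_equiv_def intro!: exI[of _ "B - A - D"])
qed

lemma act_coset_iff:
  assumes J: "torsorial J" and D: "D \<in> carrier (Div0 G)" and T: "stree T"
  shows "stree (act J (Prin G #>\<^bsub>Div0 G\<^esub> D) T)"
    and "act J (Prin G #>\<^bsub>Div0 G\<^esub> D) T = T' \<longleftrightarrow> stree T' \<and> J T' - J T - D \<in> Prin G"
proof -
  have ex: "\<exists>!T'. stree T' \<and> J T' - J T - D \<in> Prin G"
    using J T D by (simp add: torsorial_def)
  have "act J (Prin G #>\<^bsub>Div0 G\<^esub> D) T = (THE T'. stree T' \<and> J T' - J T - D \<in> Prin G)"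
    unfolding act_def using T coset_in_Pic0[OF D]
    by (simp add: mem_spanning_trees_iff coset_lin_equiv)
  then show "stree (act J (Prin G #>\<^bsub>Div0 G\<^esub> D) T)"
    "act J (Prin G #>\<^bsub>Div0 G\<^esub> D) T = T' \<longleftrightarrow> stree T' \<and> J T' - J T - D \<in> Prin G"
    using theI'[OF ex] ex by auto
qed

lemma act_group_action:
  assumes J: "torsorial J"
  shows "group_action (Pic0 G) (spanning_trees G opp) (act J)"
proof -
  let ?S = "spanning_trees G opp"
  have S: "T \<in> ?S \<longleftrightarrow> stree T" for T by (rule mem_spanning_trees_iff)
  note iff = act_coset_iff[OF J]
  have Bij: "act J (Prin G #>\<^bsub>Div0 G\<^esub> D) \<in> Bij ?S" if D: "D \<in> carrier (Div0 G)" for D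
  proof -
    have "act J (Prin G #>\<^bsub>Div0 G\<^esub> D) \<in> extensional ?S"
      unfolding act_def using coset_in_Pic0[OF D] by simp
    moreover have "bij_betw (act J (Prin G #>\<^bsub>Div0 G\<^esub> D)) ?S ?S"
    proof (rule bij_betw_byWitness[where f' = "act J (Prin G #>\<^bsub>Div0 G\<^esub> (- D))"])
      show "\<forall>T\<in>?S. act J (Prin G #>\<^bsub>Div0 G\<^esub> - D) (act J (Prin G #>\<^bsub>Div0 G\<^esub> D) T) = T"
      proof
        fix T assume T: "T \<in> ?S"
        have "J (act J (Prin G #>\<^bsub>Div0 G\<^esub> D) T) - J T - D \<in> Prin G"
          using iff(2)[OF D, of T] T S by blast
        then have "- (J (act J (Prin G #>\<^bsub>Div0 G\<^esub> D) T) - J T - D) \<in> Prin G"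
          by (rule Prin_uminus)
        then show "act J (Prin G #>\<^bsub>Div0 G\<^esub> - D) (act J (Prin G #>\<^bsub>Div0 G\<^esub> D) T) = T"
          using T S iff(1)[OF D] by (subst iff(2)[OF Div0_uminus[OF D]]) (auto simp: algebra_simps)
      qed
      show "\<forall>T\<in>?S. act J (Prin G #>\<^bsub>Div0 G\<^esub> D) (act J (Prin G #>\<^bsub>Div0 G\<^esub> - D) T) = T"
      proof
        fix T assume T: "T \<in> ?S"
        have "J (act J (Prin G #>\<^bsub>Div0 G\<^esub> - D) T) - J T - - D \<in> Prin G"
          using iff(2)[OF Div0_uminus[OF D], of T] T S by blast
        then have "- (J (act J (Prin G #>\<^bsub>Div0 G\<^esub> - D) T) - J T - - D) \<in> Prin G"
          by (rule Prin_uminus)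
        then show "act J (Prin G #>\<^bsub>Div0 G\<^esub> D) (act J (Prin G #>\<^bsub>Div0 G\<^esub> - D) T) = T"
          using T S iff(1)[OF Div0_uminus[OF D]] by (subst iff(2)[OF D]) (auto simp: algebra_simps)
      qed
    qed (use iff(1) D Div0_uminus S in auto)
    ultimately show ?thesis by (simp add: Bij_def)
  qed
  have "act J \<in> hom (Pic0 G) (BijGroup ?S)"
  proof (rule homI)
    fix c assume "c \<in> carrier (Pic0 G)"
    then show "act J c \<in> carrier (BijGroup ?S)"
      using Bij by (auto simp: carrier_Pic0 BijGroup_def)
  next
    fix c d assume "c \<in> carrier (Pic0 G)" "d \<in> carrier (Pic0 G)"
    then obtain D E where D: "D \<in> carrier (Div0 G)" "c = Prin G #>\<^bsub>Div0 G\<^esub> D"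
      and E: "E \<in> carrier (Div0 G)" "d = Prin G #>\<^bsub>Div0 G\<^esub> E"
      by (auto simp: carrier_Pic0)
    have "act J (Prin G #>\<^bsub>Div0 G\<^esub> (D + E)) T =
        compose ?S (act J (Prin G #>\<^bsub>Div0 G\<^esub> D)) (act J (Prin G #>\<^bsub>Div0 G\<^esub> E)) T" for T
    proof (cases "T \<in> ?S")
      case False
      then show ?thesis
        unfolding act_def compose_def using coset_in_Pic0[OF Div0_add[OF D(1) E(1)]] by simp
    next
      case True
      then have T: "stree T" using S by simp
      define T1 where "T1 = act J (Prin G #>\<^bsub>Div0 G\<^esub> E) T"
      define T2 where "T2 = act J (Prin G #>\<^bsub>Div0 G\<^esub> D) T1"
      have T1: "stree T1" "J T1 - J T - E \<in> Prin G"
        using iff(2)[OF E(1) T] unfolding T1_def by blast+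
      have T2: "stree T2" "J T2 - J T1 - D \<in> Prin G"
        using iff(2)[OF D(1) T1(1)] unfolding T2_def by blast+
      have "J T2 - J T - (D + E) \<in> Prin G"
        using Prin_add[OF T1(2) T2(2)] by (simp add: algebra_simps)
      then have "act J (Prin G #>\<^bsub>Div0 G\<^esub> (D + E)) T = T2"
        using iff(2)[OF Div0_add[OF D(1) E(1)] T] T2(1) by blast
      then show ?thesis
        using True by (simp add: compose_def T1_def T2_def)
    qed
    then show "act J (c \<otimes>\<^bsub>Pic0 G\<^esub> d) = act J c \<otimes>\<^bsub>BijGroup ?S\<^esub> act J d"
      using Bij[OF D(1)] Bij[OF E(1)] D E by (auto simp: mult_Pic0 BijGroup_def)
  qed
  then show ?thesis
    unfolding group_action_def group_hom_def group_hom_axioms_def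
    using group_Pic0 group_BijGroup by blast
qed

lemma Div0_induct [consumes 2, case_names zero gen diff]:
  assumes y: "y \<in> verts G" and D: "D \<in> carrier (Div0 G)"
    and zero: "P 0" and gen: "\<And>x. x \<in> verts G - {y} \<Longrightarrow> P (frag_of x - frag_of y)"
    and diff: "\<And>D E. D \<in> carrier (Div0 G) \<Longrightarrow> E \<in> carrier (Div0 G) \<Longrightarrow> P D \<Longrightarrow> P E \<Longrightarrow> P (D - E)"
  shows "P D"
proof -
  define dg where "dg E = (\<Sum>v\<in>verts G. lk E v)" for E
  \<comment> \<open>Subtracting the degree at \<open>y\<close> projects all divisors onto those of
    degree zero and sends the free generators to the differences, so that induction over the free
    group applies.\<close>
  let ?pr = "\<lambda>E. E - frag_cmul (dg E) (frag_of y)"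
  have "Poly_Mapping.keys D \<subseteq> verts G" using D by (simp add: mem_Div0)
  then have "?pr D \<in> carrier (Div0 G) \<and> P (?pr D)"
  proof (induction rule: frag_induction)
    case zero
    then show ?case using assms(3) Div0_zero by (simp add: dg_def)
  next
    case (one x)
    then have "dg (frag_of x) = 1"
      unfolding dg_def by (simp add: sum.delta)
    then show ?case
      using gen one zero Div0_frag_diff[OF one y] by (cases "x = y") auto
  next
    case (diff A B)
    have "dg (A - B) = dg A - dg B"
      unfolding dg_def by (simp add: lookup_minus sum_subtractf)
    then have "frag_cmul (dg (A - B)) (frag_of y) =
        frag_cmul (dg A) (frag_of y) - frag_cmul (dg B) (frag_of y)"
      by (simp only: frag_cmul_diff_distrib)
    then have "?pr (A - B) = ?pr A - ?pr B"
      by simp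
    then show ?case
      using diff assms(5) Div0_diff by metis
  qed
  moreover have "dg D = 0" using D by (simp add: mem_Div0 dg_def)
  ultimately show ?thesis by simp
qed

lemma finite_strees: "finite {T. stree T}"
  by (rule finite_subset[of _ "Pow (arcs G)"]) (auto dest: stree_arcs)

text \<open>Translates by the generators suffice. For a difference \<open>D - E\<close> the
  translation by \<open>E\<close> has to be inverted; this is possible because it is an injective
  map of the finite set of trees into itself.\<close>

lemma torsorialI:
  assumes y: "y \<in> verts G"
    and inj: "\<And>T T'. stree T \<Longrightarrow> stree T' \<Longrightarrow> J T' - J T \<in> Prin G \<Longrightarrow> T' = T"
    and gen: "\<And>x T. x \<in> verts G - {y} \<Longrightarrow> stree T \<Longrightarrow>
      \<exists>T'. stree T' \<and> J T' - J T - (frag_of x - frag_of y) \<in> Prin G"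
  shows "torsorial J"
proof -
  have ex: "\<forall>T. stree T \<longrightarrow> (\<exists>T'. stree T' \<and> J T' - J T - D \<in> Prin G)"
    if "D \<in> carrier (Div0 G)" for D
    using y that
  proof (induction D rule: Div0_induct)
    case zero
    then show ?case using Prin_zero by auto
  next
    case (gen x)
    then show ?case using assms(3) by blast
  next
    case (diff D E)
    show ?case
    proof (intro allI impI)
      fix T assume T: "stree T"
      obtain m where m: "\<And>T. stree T \<Longrightarrow> stree (m T) \<and> J (m T) - J T - E \<in> Prin G"
        using diff(4) by metis
      have "inj_on m {T. stree T}"
      proof (rule inj_onI)
        fix A B assume AB: "A \<in> {T. stree T}" "B \<in> {T. stree T}" "m A = m B"
        then have "(J (m A) - J B - E) - (J (m A) - J A - E) \<in> Prin G"
          using m[of A] m[of B] by (rule_tac Prin_diff) auto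
        then show "A = B" using inj[of B A] AB by simp
      qed
      then have "m ` {T. stree T} = {T. stree T}"
        using finite_strees m by (intro endo_inj_surj) auto
      then obtain A where A: "stree A" "T = m A" using T by blast
      obtain T' where T': "stree T'" "J T' - J A - D \<in> Prin G"
        using diff(3) A(1) by blast
      have "(J T' - J A - D) - (J (m A) - J A - E) \<in> Prin G"
        using T'(2) m[OF A(1)] Prin_diff by blast
      then show "\<exists>T'. stree T' \<and> J T' - J T - (D - E) \<in> Prin G"
        using T'(1) A(2) by (auto simp: algebra_simps)
    qed
  qed
  show ?thesis
    unfolding torsorial_def
  proof (intro allI impI ex_ex1I)
    fix T D assume T: "stree T" and D: "D \<in> carrier (Div0 G)"
    show "\<exists>T'. stree T' \<and> J T' - J T - D \<in> Prin G" using ex T D by blast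
    fix A B assume "stree A \<and> J A - J T - D \<in> Prin G" "stree B \<and> J B - J T - D \<in> Prin G"
    then have "stree A" "stree B" "(J A - J T - D) - (J B - J T - D) \<in> Prin G"
      by (blast intro: Prin_diff)+
    then show "A = B" using inj[of B A] by simp
  qed
qed

text \<open>A counting argument. The map \<open>m\<close> sends a tree to the one with the same
  displacement under \<open>J0\<close>. It is injective because \<open>J\<close> separates trees
  modulo \<open>Prin G\<close>, hence onto by finiteness, so every displacement from
  \<open>T\<close> also occurs under \<open>J\<close>.\<close>

lemma torsorial_transfer:
  assumes J0: "torsorial J0"
    and inj: "\<And>T T'. stree T \<Longrightarrow> stree T' \<Longrightarrow> J T' - J T \<in> Prin G \<Longrightarrow> T' = T"
    and deg: "\<And>T T'. stree T \<Longrightarrow> stree T' \<Longrightarrow> J T' - J T \<in> carrier (Div0 G)"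
  shows "torsorial J"
  unfolding torsorial_def
proof (intro allI impI ex_ex1I)
  fix T D assume T: "stree T" and D: "D \<in> carrier (Div0 G)"
  have "\<exists>T2. stree T2 \<and> J0 T2 - J0 T - (J T1 - J T) \<in> Prin G" if "stree T1" for T1
    using J0 T deg[OF T that] unfolding torsorial_def by blast
  then obtain m where m: "\<And>T1. stree T1 \<Longrightarrow> stree (m T1) \<and> J0 (m T1) - J0 T - (J T1 - J T) \<in> Prin G"
    by metis
  have "inj_on m {T. stree T}"
  proof (rule inj_onI)
    fix A B assume AB: "A \<in> {T. stree T}" "B \<in> {T. stree T}" "m A = m B"
    then have "(J0 (m A) - J0 T - (J B - J T)) - (J0 (m A) - J0 T - (J A - J T)) \<in> Prin G"
      using m[of A] m[of B] by (rule_tac Prin_diff) auto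
    then show "A = B" using inj[of B A] AB by simp
  qed
  then have "m ` {T. stree T} = {T. stree T}"
    using finite_strees m by (intro endo_inj_surj) auto
  moreover obtain T2 where T2: "stree T2" "J0 T2 - J0 T - D \<in> Prin G"
    using J0 T D unfolding torsorial_def by blast
  ultimately obtain T1 where T1: "stree T1" "T2 = m T1" by blast
  have "(J0 T2 - J0 T - D) - (J0 (m T1) - J0 T - (J T1 - J T)) \<in> Prin G"
    using T2(2) m[OF T1(1)] Prin_diff by blast
  then show "\<exists>T'. stree T' \<and> J T' - J T - D \<in> Prin G"
    using T1 by (auto simp: algebra_simps)
  fix A B assume "stree A \<and> J A - J T - D \<in> Prin G" "stree B \<and> J B - J T - D \<in> Prin G"
  then have "stree A" "stree B" "(J A - J T - D) - (J B - J T - D) \<in> Prin G"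
    by (blast intro: Prin_diff)+
  then show "A = B" using inj[of B A] by simp
qed

text \<open>An action is determined by the generators, since elements act bijectively and
  differences can be taken. This is the uniqueness demanded by the description of the rotor-routing
  torsor.\<close>

lemma group_action_eq_act:
  assumes J: "torsorial J" and y: "y \<in> verts G"
    and ga: "group_action (Pic0 G) (spanning_trees G opp) \<phi>" and ext: "\<phi> \<in> extensional (carrier (Pic0 G))"
    and gen: "\<And>x T. x \<in> verts G - {y} \<Longrightarrow> stree T \<Longrightarrow>
      J (\<phi> (Prin G #>\<^bsub>Div0 G\<^esub> (frag_of x - frag_of y)) T) - J T - (frag_of x - frag_of y) \<in> Prin G"
  shows "\<phi> = act J"
proof -
  interpret group_action "Pic0 G" "spanning_trees G opp" \<phi> by (rule ga)
  let ?c = "\<lambda>D. Prin G #>\<^bsub>Div0 G\<^esub> D"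
  let ?S = "spanning_trees G opp"
  have S: "T \<in> ?S \<longleftrightarrow> stree T" for T by (rule mem_spanning_trees_iff)
  have cl: "stree (\<phi> (?c D) T)" if "D \<in> carrier (Div0 G)" "stree T" for D T
    using element_image[OF coset_in_Pic0[OF that(1)]] that(2) S by blast
  have key: "\<forall>T. stree T \<longrightarrow> J (\<phi> (?c D) T) - J T - D \<in> Prin G" if "D \<in> carrier (Div0 G)" for D
    using y that
  proof (induction D rule: Div0_induct)
    case zero
    have "?c 0 = \<one>\<^bsub>Pic0 G\<^esub>"
      by (simp add: Pic0_def FactGroup_def coset_eq)
    then have "\<phi> (?c 0) T = T" if "stree T" for T
      using id_eq_one that S by (metis restrict_apply')
    then show ?case using Prin_zero by simp
  next
    case (gen x)
    then show ?case using assms(5) by blast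
  next
    case (diff D E)
    show ?case
    proof (intro allI impI)
      fix T assume T: "stree T"
      then obtain A where A: "stree A" "\<phi> (?c E) A = T"
        using surj_prop[OF coset_in_Pic0[OF diff(2)]] S by (metis imageE)
      have "\<phi> (?c (D - E)) T = \<phi> (?c (D - E) \<otimes>\<^bsub>Pic0 G\<^esub> ?c E) A"
        using composition_rule[OF _ coset_in_Pic0 coset_in_Pic0] A S Div0_diff diff(1,2) by metis
      also have "\<dots> = \<phi> (?c D) A"
        using mult_Pic0[OF Div0_diff[OF diff(1,2)] diff(2)] by simp
      finally have *: "\<phi> (?c (D - E)) T = \<phi> (?c D) A" .
      have "(J (\<phi> (?c D) A) - J A - D) - (J (\<phi> (?c E) A) - J A - E) \<in> Prin G"
        using diff(3,4) A(1) Prin_diff by blast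
      then show "J (\<phi> (?c (D - E)) T) - J T - (D - E) \<in> Prin G"
        unfolding * using A(2) by (simp add: algebra_simps)
    qed
  qed
  show ?thesis
  proof (rule extensionalityI[OF ext])
    show "act J \<in> extensional (carrier (Pic0 G))" by (simp add: act_def)
    fix c assume "c \<in> carrier (Pic0 G)"
    then obtain D where D: "D \<in> carrier (Div0 G)" "c = ?c D" by (auto simp: carrier_Pic0)
    show "\<phi> c = act J c"
    proof (rule extensionalityI)
      show "\<phi> c \<in> extensional ?S"
        using bij_prop0[OF coset_in_Pic0[OF D(1)]] D(2) by (simp add: Bij_def)
      show "act J c \<in> extensional ?S"
        using coset_in_Pic0[OF D(1)] D(2) by (simp add: act_def)
      fix T assume "T \<in> ?S"
      then have "stree T" using S by simp
      then show "\<phi> c T = act J c T"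
        using act_coset_iff(2)[OF J D(1), of T] key[OF D(1)] cl[OF D(1)] D(2) by metis
    qed
  qed
qed

lemma rotor_torsor_eq_act:
  assumes y: "y \<in> verts G" and J: "torsorial J"
    and gen: "\<And>x T. x \<in> verts G - {y} \<Longrightarrow> stree T \<Longrightarrow> stree (rotor_route G opp nxt y x T) \<and>
      J (rotor_route G opp nxt y x T) - J T - (frag_of x - frag_of y) \<in> Prin G"
  shows "rotor_torsor G opp nxt y = act J"
  unfolding rotor_torsor_def
proof (rule the_equality)
  let ?P = "\<lambda>\<phi>. \<phi> \<in> extensional (carrier (Pic0 G)) \<and>
    group_action (Pic0 G) (spanning_trees G opp) \<phi> \<and>
    (\<forall>x\<in>verts G - {y}. \<forall>T\<in>spanning_trees G opp.
      \<phi> (Prin G #>\<^bsub>Div0 G\<^esub> (frag_of x - frag_of y)) T = rotor_route G opp nxt y x T)"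
  have "act J (Prin G #>\<^bsub>Div0 G\<^esub> (frag_of x - frag_of y)) T = rotor_route G opp nxt y x T"
    if "x \<in> verts G - {y}" "stree T" for x T
    using act_coset_iff(2)[OF J Div0_frag_diff that(2)] gen[OF that] that(1) y by auto
  then show "?P (act J)"
    using act_group_action[OF J] by (auto simp: act_def mem_spanning_trees_iff)
  fix \<phi> assume "?P \<phi>"
  then show "\<phi> = act J"
    using gen by (intro group_action_eq_act[OF J y]) (auto simp: mem_spanning_trees_iff)
qed

end

section \<open>The rotor-routing torsor\<close>

context loopless_ribbon_graph
begin

text \<open>Deleting a tree edge leaves \<open>y\<close> on one side, and the arc of the edge that
  points to this side is the rotor at its tail.\<close>

lemma tree_eq_rotors:
  assumes T: "stree T" and y: "y \<in> verts G"
  shows "T = (\<Union>u\<in>verts G - {y}. {tree_rotors G T y u, opp (tree_rotors G T y u)})"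
proof (intro equalityI subsetI)
  fix a assume a: "a \<in> T"
  have aG: "a \<in> arcs G" using T a stree_arcs by auto
  have sF: "oppclosed (T - edge a)"
    using stree_oppclosed[OF T] oppclosed_diff_edge by blast
  have rot: "tree_rotors G T y (tail G b) = b \<and> tail G b \<noteq> y \<and> tail G b \<in> verts G"
    if "towards T y b" for b
  proof -
    have b: "b \<in> T" "(head G b, y) \<in> conn (T - edge b)" using that by (auto simp: towards_def)
    then have "tail G b \<noteq> y"
      using bforest_bridge'[OF stree_bforest[OF T]] by auto
    then show ?thesis
      using stree_rotor(3)[OF T _ y _ that] b T stree_arcs by auto
  qed
  have "towards T y a \<or> towards T y (opp a)"
    using stree_sides[OF T a y] a aG stree_opp_iff[OF T, of a] by (auto simp: towards_def)
  then show "a \<in> (\<Union>u\<in>verts G - {y}. {tree_rotors G T y u, opp (tree_rotors G T y u)})"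
  proof
    assume "towards T y a"
    then show ?thesis using rot[of a] by (intro UN_I[of "tail G a"]) auto
  next
    assume "towards T y (opp a)"
    then show ?thesis using rot[of "opp a"] aG by (intro UN_I[of "head G a"]) auto
  qed
next
  fix a assume "a \<in> (\<Union>u\<in>verts G - {y}. {tree_rotors G T y u, opp (tree_rotors G T y u)})"
  then show "a \<in> T"
    using stree_rotor(1)[OF T _ y] stree_opp_iff[OF T] by (auto simp: towards_def)
qed

text \<open>The converse passage from rotors to trees. Since all rotor walks end at
  \<open>y\<close>, each rotor is the only edge between the vertices that pass through its tail and
  the others, hence a bridge.\<close>

lemma rotors_stree:
  assumes y: "y \<in> verts G" and R: "\<And>v. v \<in> verts G - {y} \<Longrightarrow> R v \<in> out_arcs G v"
    and reach: "\<And>v. v \<in> verts G \<Longrightarrow> \<exists>n. ((\<lambda>v. head G (R v)) ^^ n) v = y"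
  defines "T \<equiv> \<Union>u\<in>verts G - {y}. {R u, opp (R u)}"
  shows "stree T" and "\<And>u. u \<in> verts G - {y} \<Longrightarrow> tree_rotors G T y u = R u"
proof -
  \<comment> \<open>The walk is stopped at the sink, where \<open>R\<close> may have any
    value.\<close>
  define f where "f v = (if v = y then y else head G (R v))" for v
  have fy: "f y = y" by (simp add: f_def)
  have R': "R v \<in> arcs G" "tail G (R v) = v" if "v \<in> verts G - {y}" for v
    using R[OF that] by auto
  have fV: "f v \<in> verts G" if "v \<in> verts G" for v
    using that y R' by (auto simp: f_def)
  have reach': "\<exists>n. (f ^^ n) v = y" if v: "v \<in> verts G" for v
  proof -
    obtain n where "((\<lambda>v. head G (R v)) ^^ n) v = y" using reach[OF v] by blast
    then show ?thesis
    proof (induction n arbitrary: v)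
      case 0 then show ?case by (intro exI[of _ 0]) simp
    next
      case (Suc n)
      show ?case
      proof (cases "v = y")
        case True then show ?thesis by (intro exI[of _ 0]) simp
      next
        case False
        have "((\<lambda>v. head G (R v)) ^^ n) (f v) = y"
          using Suc.prems False by (simp add: f_def funpow_Suc_right del: funpow.simps)
        then obtain m where "(f ^^ m) (f v) = y" using Suc.IH by blast
        then show ?thesis
          by (intro exI[of _ "Suc m"]) (simp add: funpow_Suc_right del: funpow.simps)
      qed
    qed
  qed
  have sT: "oppclosed T"
    unfolding oppclosed_def
  proof (intro conjI subsetI ballI)
    fix a assume "a \<in> T"
    then obtain u where u: "u \<in> verts G - {y}" "a = R u \<or> a = opp (R u)" by (auto simp: T_def)
    then show "a \<in> arcs G" using R'(1)[OF u(1)] by auto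
    show "opp a \<in> T" unfolding T_def using u by (intro UN_I[OF u(1)]) auto
  qed
  \<comment> \<open>The descendants of \<open>u\<close>: the vertices whose walk to the sink passes
    through \<open>u\<close>.\<close>
  define D where "D u = {v. \<exists>n. (f ^^ n) v = u}" for u
  have step: "f v \<in> D u \<longleftrightarrow> v \<in> D u" if "v \<noteq> u" for u v
  proof
    assume "f v \<in> D u"
    then obtain n where "(f ^^ n) (f v) = u" by (auto simp: D_def)
    then show "v \<in> D u"
      unfolding D_def by (intro CollectI exI[of _ "Suc n"]) (simp add: funpow_Suc_right del: funpow.simps)
  next
    assume "v \<in> D u"
    then obtain n where n: "(f ^^ n) v = u" by (auto simp: D_def)
    with that obtain m where "n = Suc m" by (cases n) auto
    with n show "f v \<in> D u"
      unfolding D_def by (intro CollectI exI[of _ m]) (simp add: funpow_Suc_right del: funpow.simps)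
  qed
  have closed: "v \<in> D u \<longleftrightarrow> w \<in> D u" if u: "u \<in> verts G - {y}" and "(v, w) \<in> conn (T - edge (R u))" for u v w
    using that(2)
  proof (induction rule: rtrancl_induct)
    case (step v w)
    then obtain a where a: "a \<in> T - edge (R u)" "v = tail G a" "w = head G a"
      by (auto simp: adj_def)
    then obtain z where z: "z \<in> verts G - {y}" "a = R z \<or> a = opp (R z)" by (auto simp: T_def)
    have "z \<noteq> u" using a(1) z(2) by auto
    have "{v, w} = {z, f z}"
      using a(2,3) z R'[OF z(1)] by (auto simp: f_def)
    then show ?case
      using step.IH \<open>\<And>v u. v \<noteq> u \<Longrightarrow> f v \<in> D u \<longleftrightarrow> v \<in> D u\<close>[OF \<open>z \<noteq> u\<close>] by (auto simp: doubleton_eq_iff)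
  qed simp
  \<comment> \<open>A return to \<open>u\<close> would make the walk from \<open>u\<close> periodic,
    whereas it reaches \<open>y\<close> and stays there.\<close>
  have nin: "f u \<notin> D u" if u: "u \<in> verts G - {y}" for u
  proof
    assume "f u \<in> D u"
    then obtain n where "(f ^^ n) (f u) = u" by (auto simp: D_def)
    then have per: "(f ^^ Suc n) u = u" by (simp add: funpow_Suc_right del: funpow.simps)
    obtain k where k: "(f ^^ k) u = y" using reach'[of u] u by blast
    have fixy: "(f ^^ j) y = y" for j by (induction j) (auto simp: fy)
    have fixp: "(g ^^ k) u = u" if "g u = u" for g k
      using that by (induction k) simp_all
    have "((f ^^ Suc n) ^^ k) u = u"
      using per by (intro fixp[of "f ^^ Suc n"])
    then have "(f ^^ (Suc n * k)) u = u"
      by (simp only: funpow_mult)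
    moreover have "(f ^^ (Suc n * k)) u = (f ^^ (n * k)) ((f ^^ k) u)"
      by (simp only: mult_Suc add.commute[of k] funpow_add o_apply)
    ultimately show False using k fixy u by simp
  qed
  have bridge: "(u, f u) \<notin> conn (T - edge (R u))" if u: "u \<in> verts G - {y}" for u
  proof
    have "u \<in> D u" unfolding D_def by (intro CollectI exI[of _ 0]) simp
    moreover assume "(u, f u) \<in> conn (T - edge (R u))"
    ultimately show False using closed[OF u] nin[OF u] by blast
  qed
  have fT: "bforest T"
    unfolding bforest_def
  proof (intro conjI ballI sT)
    fix a assume "a \<in> T"
    then obtain u where u: "u \<in> verts G - {y}" "a = R u \<or> a = opp (R u)" by (auto simp: T_def)
    have "(f u, u) \<notin> conn (T - edge (R u))"
      using bridge[OF u(1)] conn_sym[OF oppclosed_diff_edge[OF sT]] by blast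
    then show "(tail G a, head G a) \<notin> conn (T - edge a)"
      using u bridge[OF u(1)] R'[OF u(1)] by (auto simp: f_def)
  qed
  have RT: "R u \<in> T" if "u \<in> verts G - {y}" for u using that by (auto simp: T_def)
  have toy: "(u, y) \<in> conn (T - edge (R w))"
    if u: "u \<in> verts G" "w \<in> verts G - {y}" "u \<notin> D w" for u w
  proof -
    obtain n where "(f ^^ n) u = y" using reach'[OF u(1)] by blast
    then show ?thesis using u
    proof (induction n arbitrary: u)
      case (Suc n)
      show ?case
      proof (cases "u = y")
        case False
        have "w \<in> D w" unfolding D_def by (intro CollectI exI[of _ 0]) simp
        then have uw: "u \<noteq> w" using Suc.prems by auto
        then have "f u \<notin> D w" using step[of u w] Suc.prems by simp
        moreover have "(f ^^ n) (f u) = y"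
          using Suc.prems by (simp add: funpow_Suc_right del: funpow.simps)
        ultimately have "(f u, y) \<in> conn (T - edge (R w))"
          using Suc.IH fV Suc.prems by blast
        moreover have "R u \<in> T - edge (R w)"
          using RT[of u] False uw Suc.prems(2,3) R'[of u] R'[of w] bridge[of w]
        proof -
          have u: "u \<in> verts G - {y}" using False Suc.prems by auto
          have "R u \<noteq> opp (R w)"
          proof
            assume *: "R u = opp (R w)"
            then have "u = f w" using R'[OF u] R'[OF Suc.prems(3)] Suc.prems(3) by (auto simp: f_def)
            moreover have "f u = w"
              using * False R'[OF Suc.prems(3)] by (auto simp: f_def)
            ultimately show False
              using \<open>f u \<notin> D w\<close> \<open>w \<in> D w\<close> by simp
          qed
          moreover have "R u \<noteq> R w" using uw R'[OF u] R'[OF Suc.prems(3)] by metis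
          ultimately show ?thesis using RT[OF u] by auto
        qed
        then have "(u, f u) \<in> conn (T - edge (R w))"
          using conn_arc[of "R u" "T - edge (R w)"] R'[of u] False Suc.prems(2) by (auto simp: f_def)
        ultimately show ?thesis using conn_trans by blast
      qed simp
    qed simp
  qed
  have conny: "(u, y) \<in> conn T" if u: "u \<in> verts G" for u
  proof -
    obtain n where "(f ^^ n) u = y" using reach'[OF u] by blast
    then show ?thesis using u
    proof (induction n arbitrary: u)
      case (Suc n)
      show ?case
      proof (cases "u = y")
        case False
        have "(f ^^ n) (f u) = y"
          using Suc.prems by (simp add: funpow_Suc_right del: funpow.simps)
        then have "(f u, y) \<in> conn T" using Suc fV by blast
        moreover have "(u, f u) \<in> conn T"
          using conn_arc[OF RT[of u]] R'[of u] False Suc.prems by (auto simp: f_def)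
        ultimately show ?thesis using conn_trans by blast
      qed simp
    qed simp
  qed
  have "(u, v) \<in> conn T" if "u \<in> verts G" "v \<in> verts G" for u v
    using conn_trans[OF conny[OF that(1)] conn_sym[OF sT conny[OF that(2)]]] .
  then show "stree T"
    using fT unfolding stree_def by blast
  then show "tree_rotors G T y u = R u" if "u \<in> verts G - {y}" for u
    using that y R'[OF that] RT[OF that] toy[OF fV that nin[OF that]]
    by (intro stree_rotor(3)) (auto simp: towards_def f_def)
qed

section \<open>Rotor configurations and termination of the routing\<close>

abbreviation step :: "('a \<Rightarrow> 'b) \<times> 'a \<Rightarrow> ('a \<Rightarrow> 'b) \<times> 'a" where
  "step \<equiv> rotor_step G nxt"

lemma step_simp [simp]: "step (R, u) = (R(u := nxt (R u)), head G (nxt (R u)))"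
  by (simp add: rotor_step_def)

text \<open>The invariant of routing: the rotors lead from everywhere to the sink or to the chip.
  When the chip has arrived at the sink, this says that the rotors form a tree.\<close>

definition rotor_config :: "'a \<Rightarrow> ('a \<Rightarrow> 'b) \<Rightarrow> 'a \<Rightarrow> bool" where
  "rotor_config y R u \<longleftrightarrow> u \<in> verts G \<and> (\<forall>v\<in>verts G - {y}. R v \<in> out_arcs G v) \<and>
    (\<forall>v\<in>verts G. \<exists>n. ((\<lambda>v. head G (R v)) ^^ n) v \<in> {y, u})"

lemma nxt_out_arcs: "a \<in> out_arcs G v \<Longrightarrow> nxt a \<in> out_arcs G v"
proof -
  assume a: "a \<in> out_arcs G v"
  then have "cyclic_on nxt (out_arcs G v)" by (intro nxt_cyclic) auto
  then show ?thesis using a by (metis cyclic_on_inI)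
qed

text \<open>A rotor walk that used to meet the chip at \<open>u\<close> now continues from
  \<open>u\<close> along the turned rotor to the new position of the chip.\<close>

lemma rotor_config_step:
  assumes "rotor_config y R u" "u \<noteq> y" "step (R, u) = (R', w)"
  shows "rotor_config y R' w"
proof -
  have R': "R' = R(u := nxt (R u))" "w = head G (nxt (R u))" using assms(3) by auto
  have u: "u \<in> verts G" "R u \<in> out_arcs G u" using assms(1,2) by (auto simp: rotor_config_def)
  note n = nxt_out_arcs[OF u(2)]
  have key: "\<exists>m. ((\<lambda>v. head G (R' v)) ^^ m) v \<in> {y, w}" if "((\<lambda>v. head G (R v)) ^^ n) v \<in> {y, u}" for n v
    using that
  proof (induction n arbitrary: v)
    case 0
    then show ?case
    proof (cases "v = u")
      case True
      then show ?thesis by (intro exI[of _ 1]) (simp add: R')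
    qed (intro exI[of _ 0], simp)
  next
    case (Suc n)
    show ?case
    proof (cases "v = u")
      case True
      then show ?thesis by (intro exI[of _ 1]) (simp add: R')
    next
      case False
      have "((\<lambda>v. head G (R v)) ^^ n) (head G (R v)) \<in> {y, u}"
        using Suc.prems by (simp add: funpow_Suc_right del: funpow.simps)
      then obtain m where "((\<lambda>v. head G (R' v)) ^^ m) (head G (R v)) \<in> {y, w}"
        using Suc.IH by blast
      then show ?thesis
        using False by (intro exI[of _ "Suc m"]) (simp add: R' funpow_Suc_right del: funpow.simps)
    qed
  qed
  show ?thesis
    unfolding rotor_config_def
  proof (intro conjI ballI)
    show "w \<in> verts G" "\<And>v. v \<in> verts G - {y} \<Longrightarrow> R' v \<in> out_arcs G v"
      using assms(1) u n unfolding rotor_config_def by (auto simp: R')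
    show "\<exists>m. ((\<lambda>v. head G (R' v)) ^^ m) v \<in> {y, w}" if "v \<in> verts G" for v
      using assms(1) that key unfolding rotor_config_def by blast
  qed
qed

lemma rotor_config_funpow:
  assumes "rotor_config y R u" "\<And>j. j < n \<Longrightarrow> snd ((step ^^ j) (R, u)) \<noteq> y"
  shows "rotor_config y (fst ((step ^^ n) (R, u))) (snd ((step ^^ n) (R, u)))"
  using assms
proof (induction n)
  case (Suc n)
  show ?case
    by (rule rotor_config_step[of y "fst ((step ^^ n) (R, u))" "snd ((step ^^ n) (R, u))"])
      (use Suc in auto)
qed simp

lemma rotor_config_tree:
  assumes "stree T" "y \<in> verts G" "x \<in> verts G"
  shows "rotor_config y (tree_rotors G T y) x"
  unfolding rotor_config_def
proof (intro conjI ballI)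
  fix v assume "v \<in> verts G - {y}"
  then show "tree_rotors G T y v \<in> out_arcs G v"
    using stree_rotor(1,2)[OF assms(1) _ assms(2), of v] stree_arcs[OF assms(1)]
    by (auto simp: towards_def)
next
  fix v assume v: "v \<in> verts G"
  show "\<exists>n. ((\<lambda>v. head G (tree_rotors G T y v)) ^^ n) v \<in> {y, x}"
  proof (cases "v = y")
    case True
    then show ?thesis by (intro exI[of _ 0]) simp
  next
    case False
    then show ?thesis using stree_rotor(4)[OF assms(1) v assms(2)] by auto
  qed
qed (use assms in auto)

text \<open>Otherwise some vertex is visited infinitely often. Its rotor then runs through all its
  arcs infinitely often, so all neighbours are visited infinitely often as well, and by
  connectedness so is the sink.\<close>

lemma rotor_terminates:
  assumes y: "y \<in> verts G" and cfg: "rotor_config y R x"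
  shows "\<exists>k. snd ((step ^^ k) (R, x)) = y"
proof (rule ccontr)
  assume "\<not> ?thesis"
  then have ny: "snd ((step ^^ k) (R, x)) \<noteq> y" for k by blast
  define u where "u n = snd ((step ^^ n) (R, x))" for n
  define \<rho> where "\<rho> n = fst ((step ^^ n) (R, x))" for n
  have cf: "rotor_config y (\<rho> n) (u n)" for n
    unfolding \<rho>_def u_def using rotor_config_funpow[OF cfg] ny by blast
  have S: "\<rho> (Suc n) = (\<rho> n)(u n := nxt (\<rho> n (u n)))" "u (Suc n) = head G (nxt (\<rho> n (u n)))" for n
    unfolding \<rho>_def u_def by (simp_all add: rotor_step_def split: prod.split)
  have uV: "u n \<in> verts G" for n using cf[of n] by (simp add: rotor_config_def)
  have \<rho>V: "\<rho> n (u n) \<in> out_arcs G (u n)" for n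
    using cf[of n] ny[of n] by (auto simp: rotor_config_def u_def)
  define used where "used n a \<longleftrightarrow> u n = tail G a \<and> nxt (\<rho> n (u n)) = a" for n a
  define often where "often P \<longleftrightarrow> infinite {n. P n}" for P :: "nat \<Rightarrow> bool"
  have often: "often P \<longleftrightarrow> (\<forall>N. \<exists>n\<ge>N. P n)" for P
    unfolding often_def infinite_nat_iff_unbounded_le by auto
  have "\<exists>v\<in>verts G. often (\<lambda>n. u n = v)"
    using pigeonhole_infinite[of "UNIV :: nat set" u] finite_subset[OF _ finite_verts, of "range u"] uV
    unfolding often_def by auto
  then obtain v where v: "v \<in> verts G" "often (\<lambda>n. u n = v)" by blast
  have used_head: "often (\<lambda>n. u n = head G a)" if a: "often (\<lambda>n. used n a)" for a
    unfolding often
  proof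
    fix N
    obtain n where "n \<ge> N" "used n a" using a[unfolded often] by blast
    then show "\<exists>n\<ge>N. u n = head G a"
      using S(2)[of n] by (intro exI[of _ "Suc n"]) (auto simp: used_def)
  qed
  \<comment> \<open>After a use of \<open>a\<close> its rotor stays at \<open>a\<close> until the
    next visit to the tail, which exists because \<open>a\<close> is used again; that visit turns
    the rotor to \<open>nxt a\<close>.\<close>
  have used_nxt: "often (\<lambda>n. used n (nxt a))" if a: "a \<in> arcs G" "often (\<lambda>n. used n a)" for a
    unfolding often
  proof
    fix N
    obtain n where n: "n \<ge> N" "used n a" using a(2) unfolding often by blast
    obtain n' where n': "n' \<ge> Suc n" "used n' a" using a(2) unfolding often by blast
    define m where "m = (LEAST m. m > n \<and> u m = tail G a)"
    have ex: "n' > n \<and> u n' = tail G a" using n' by (auto simp: used_def)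
    have m: "m > n" "u m = tail G a"
      using LeastI[of "\<lambda>m. m > n \<and> u m = tail G a", OF ex] by (auto simp: m_def)
    have least: "u j \<noteq> tail G a" if "n < j" "j < m" for j
      using not_less_Least[of j "\<lambda>m. m > n \<and> u m = tail G a"] that by (auto simp: m_def)
    have "\<rho> j (tail G a) = a" if "n < j" "j \<le> m" for j
      using that
    proof (induction j)
      case (Suc j)
      show ?case
      proof (cases "j = n")
        case True
        then show ?thesis using n(2) S(1)[of n] by (auto simp: used_def)
      next
        case False
        then show ?thesis using Suc S(1)[of j] least[of j] by auto
      qed
    qed simp
    then have "\<rho> m (u m) = a" using m by simp
    moreover have "tail G (nxt a) = tail G a" using nxt_out_arcs[of a "tail G a"] a(1) by simp
    ultimately have "used m (nxt a)" using m(2) by (simp add: used_def)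
    then show "\<exists>n\<ge>N. used n (nxt a)" using m(1) n(1) by (intro exI[of _ m]) auto
  qed
  have used_all: "often (\<lambda>n. used n a)" if w: "often (\<lambda>n. u n = w)" and a: "a \<in> out_arcs G w" for w a
  proof -
    have "\<exists>b\<in>out_arcs G w. infinite {n \<in> {n. u n = w}. nxt (\<rho> n w) = b}"
    proof (rule pigeonhole_infinite_rel)
      show "infinite {n. u n = w}" using w by (simp add: often_def)
      show "\<forall>n\<in>{n. u n = w}. \<exists>b\<in>out_arcs G w. nxt (\<rho> n w) = b"
        using \<rho>V nxt_out_arcs by blast
    qed auto
    then obtain b where b: "b \<in> out_arcs G w" "infinite {n \<in> {n. u n = w}. nxt (\<rho> n w) = b}"
      by blast
    moreover have "{n \<in> {n. u n = w}. nxt (\<rho> n w) = b} = {n. used n b}"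
      using b(1) by (auto simp: used_def)
    ultimately have b: "b \<in> out_arcs G w" "often (\<lambda>n. used n b)"
      by (simp_all add: often_def)
    have "cyclic_on nxt (out_arcs G w)" using a by (intro nxt_cyclic) auto
    then have "a \<in> orbit nxt b" using a b(1) by (auto simp: cyclic_on_alldef)
    then show ?thesis
    proof (induction rule: orbit.induct)
      case base
      then show ?case using b used_nxt by auto
    next
      case (step c)
      have "c \<in> out_arcs G w"
        using step.hyps b(1) \<open>cyclic_on nxt (out_arcs G w)\<close> by (auto simp: cyclic_on_alldef)
      then show ?case using step used_nxt by auto
    qed
  qed
  have "often (\<lambda>n. u n = w)" if "(v, w) \<in> conn (arcs G)" for w
    using that
  proof (induction rule: rtrancl_induct)
    case base then show ?case by (rule v(2))
  next
    case (step w z)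
    then obtain a where "a \<in> arcs G" "w = tail G a" "z = head G a" by (auto simp: adj_def)
    then show ?case using used_head used_all[OF step.IH, of a] by auto
  qed
  then have "often (\<lambda>n. u n = y)" using conn_arcs v(1) y by blast
  then show False using ny unfolding often u_def by blast
qed

abbreviation rotor_run :: "'a \<Rightarrow> ('a \<Rightarrow> 'b) \<times> 'a \<Rightarrow> ('a \<Rightarrow> 'b) \<times> 'a" where
  "rotor_run y \<equiv> while (\<lambda>(R, u). u \<noteq> y) (rotor_step G nxt)"

lemma rotor_run_eq:
  assumes "snd ((step ^^ k) s) = y" "\<And>j. j < k \<Longrightarrow> snd ((step ^^ j) s) \<noteq> y"
  shows "rotor_run y s = (step ^^ k) s"
  using assms
proof (induction k arbitrary: s)
  case 0
  then show ?case by (subst while_unfold) (auto split: prod.splits)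
next
  case (Suc k)
  have "rotor_run y s = rotor_run y (step s)"
    using Suc.prems(2)[of 0] by (subst while_unfold) (auto split: prod.splits)
  also have "\<dots> = (step ^^ k) (step s)"
  proof (rule Suc.IH)
    show "snd ((step ^^ k) (step s)) = y"
      using Suc.prems(1) by (simp add: funpow_Suc_right del: funpow.simps)
    fix j assume "j < k"
    then show "snd ((step ^^ j) (step s)) \<noteq> y"
      using Suc.prems(2)[of "Suc j"] by (simp add: funpow_Suc_right del: funpow.simps)
  qed
  finally show ?case by (simp add: funpow_Suc_right del: funpow.simps)
qed

lemma rotor_run_skip:
  assumes "\<And>j. j < k \<Longrightarrow> snd ((step ^^ j) s) \<noteq> y"
  shows "rotor_run y s = rotor_run y ((step ^^ k) s)"
  using assms
proof (induction k)
  case (Suc k)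
  have "rotor_run y ((step ^^ k) s) = rotor_run y (step ((step ^^ k) s))"
    using Suc.prems[of k] by (subst while_unfold) (auto split: prod.splits)
  then show ?case using Suc by simp
qed simp

lemma rotor_runE:
  assumes "y \<in> verts G" "rotor_config y R x"
  obtains k where "snd ((step ^^ k) (R, x)) = y" "\<And>j. j < k \<Longrightarrow> snd ((step ^^ j) (R, x)) \<noteq> y"
    "rotor_run y (R, x) = (step ^^ k) (R, x)"
proof -
  define k where "k = (LEAST k. snd ((step ^^ k) (R, x)) = y)"
  obtain k0 where "snd ((step ^^ k0) (R, x)) = y" using rotor_terminates[OF assms] by blast
  then have 1: "snd ((step ^^ k) (R, x)) = y" unfolding k_def by (rule LeastI)
  have 2: "snd ((step ^^ j) (R, x)) \<noteq> y" if "j < k" for j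
    using not_less_Least that unfolding k_def by blast
  show thesis using that 1 2 rotor_run_eq by blast
qed

text \<open>While the chip stays in \<open>H\<close>, only rotors in \<open>H\<close> are read or
  changed. This allows part of a routing to be computed in another configuration with another
  sink.\<close>

lemma rotor_sync:
  assumes "\<And>v. v \<in> H \<Longrightarrow> R v = R' v" "\<And>j. j < n \<Longrightarrow> snd ((step ^^ j) (R, u)) \<in> H"
  shows "snd ((step ^^ n) (R', u)) = snd ((step ^^ n) (R, u)) \<and>
    (\<forall>v\<in>H. fst ((step ^^ n) (R', u)) v = fst ((step ^^ n) (R, u)) v) \<and>
    (\<forall>v. v \<notin> H \<longrightarrow> fst ((step ^^ n) (R', u)) v = R' v \<and> fst ((step ^^ n) (R, u)) v = R v)"
  using assms(2)
proof (induction n)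
  case (Suc n)
  obtain A p where A: "(step ^^ n) (R, u) = (A, p)" by fastforce
  obtain A' p' where A': "(step ^^ n) (R', u) = (A', p')" by fastforce
  have "p' = p" "\<forall>v\<in>H. A' v = A v" "\<forall>v. v \<notin> H \<longrightarrow> A' v = R' v \<and> A v = R v"
    using Suc A A' by auto
  moreover have "p \<in> H" using Suc.prems[of n] A by auto
  ultimately show ?case using A A' by auto
qed (use assms(1) in auto)

definition tree_of :: "'a \<Rightarrow> ('a \<Rightarrow> 'b) \<Rightarrow> 'b set" where
  "tree_of y R = (\<Union>u\<in>verts G - {y}. {R u, opp (R u)})"

lemma rotor_route_eq: "rotor_route G opp nxt y x T = tree_of y (fst (rotor_run y (tree_rotors G T y, x)))"
  by (simp add: rotor_route_def tree_of_def Let_def)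

text \<open>Routing with sink \<open>y\<close> never reads the rotor at \<open>y\<close>.\<close>

lemma rotor_run_cong:
  assumes "y \<in> verts G" "rotor_config y R x" "\<And>v. v \<in> verts G - {y} \<Longrightarrow> R v = R' v"
  shows "tree_of y (fst (rotor_run y (R', x))) = tree_of y (fst (rotor_run y (R, x)))"
proof -
  obtain k where k: "snd ((step ^^ k) (R, x)) = y" "\<And>j. j < k \<Longrightarrow> snd ((step ^^ j) (R, x)) \<noteq> y"
    "rotor_run y (R, x) = (step ^^ k) (R, x)"
    using rotor_runE[OF assms(1,2)] by blast
  have V: "snd ((step ^^ j) (R, x)) \<in> verts G - {y}" if "j < k" for j
    using rotor_config_funpow[OF assms(2), of j] k(2) that by (auto simp: rotor_config_def)
  have sync: "snd ((step ^^ n) (R', x)) = snd ((step ^^ n) (R, x)) \<and>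
    (\<forall>v\<in>verts G - {y}. fst ((step ^^ n) (R', x)) v = fst ((step ^^ n) (R, x)) v)" if "n \<le> k" for n
    using rotor_sync[of "verts G - {y}" R R' n x] assms(3) V that by auto
  have "rotor_run y (R', x) = (step ^^ k) (R', x)"
    using k(1,2) sync by (intro rotor_run_eq) auto
  then show ?thesis
    using sync[of k] k(3) by (simp add: tree_of_def)
qed

text \<open>\<open>slot\<close> numbers the arcs at each vertex in their cyclic order. Turning the rotor at \<open>v\<close> up to \<open>a\<close>
  has sent one chip along each arc of smaller slot, which is \<open>turned a\<close> up to a full turn.\<close>

lemma slot_exists:
  "\<exists>p :: 'b \<Rightarrow> nat. \<forall>v\<in>verts G. inj_on p (out_arcs G v) \<and> (\<forall>a\<in>out_arcs G v.
    p (nxt a) = Suc (p a) \<or> p (nxt a) = 0 \<and> (\<forall>b\<in>out_arcs G v. p b \<le> p a))"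
proof -
  have "\<exists>p :: 'b \<Rightarrow> nat. inj_on p (out_arcs G v) \<and> (\<forall>a\<in>out_arcs G v.
    p (nxt a) = Suc (p a) \<or> p (nxt a) = 0 \<and> (\<forall>b\<in>out_arcs G v. p b \<le> p a))" if v: "v \<in> verts G" for v
  proof (cases "out_arcs G v = {}")
    case False
    then obtain s where s: "s \<in> out_arcs G v" by blast
    obtain xs where xs: "cyc nxt (s # xs)" "set (s # xs) = out_arcs G v"
      by (rule cyclic_on_imp_cyc[OF nxt_cyclic[OF v False] _ s]) auto
    define L where "L = s # xs"
    have L: "distinct L" "set L = out_arcs G v" "L \<noteq> []" "map nxt L = rotate1 L"
      using xs by (auto simp: L_def cyc_def)
    define p where "p a = (THE i. i < length L \<and> L ! i = a)" for a
    have p: "p (L ! i) = i" if "i < length L" for i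
      unfolding p_def using that L(1) by (intro the_equality) (auto simp: nth_eq_iff_index_eq)
    have ex: "\<exists>i<length L. a = L ! i" if "a \<in> out_arcs G v" for a
      using that L(2) by (metis in_set_conv_nth)
    have "inj_on p (out_arcs G v)"
      using ex p by (intro inj_onI) metis
    moreover have "p (nxt a) = Suc (p a) \<or> p (nxt a) = 0 \<and> (\<forall>b\<in>out_arcs G v. p b \<le> p a)"
      if a: "a \<in> out_arcs G v" for a
    proof -
      obtain i where i: "i < length L" "a = L ! i" using ex a by blast
      have "nxt a = rotate1 L ! i" using i L(4) by (metis nth_map)
      also have "\<dots> = L ! (Suc i mod length L)"
        using i(1) by (rule nth_rotate1)
      finally have n: "nxt a = L ! (Suc i mod length L)" .
      show ?thesis
      proof (cases "Suc i < length L")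
        case True
        then show ?thesis using n p i by simp
      next
        case False
        then have "Suc i = length L" using i(1) by simp
        moreover have "p b \<le> i" if "b \<in> out_arcs G v" for b
          using ex[OF that] p calculation by fastforce
        ultimately show ?thesis using n p[of 0] p[OF i(1)] i L(3) by simp
      qed
    qed
    ultimately show ?thesis by blast
  qed auto
  then obtain P :: "'a \<Rightarrow> 'b \<Rightarrow> nat" where P: "\<And>v. v \<in> verts G \<Longrightarrow> inj_on (P v) (out_arcs G v) \<and> (\<forall>a\<in>out_arcs G v.
    P v (nxt a) = Suc (P v a) \<or> P v (nxt a) = 0 \<and> (\<forall>b\<in>out_arcs G v. P v b \<le> P v a))"
    by metis
  show ?thesis
  proof (intro exI[of _ "\<lambda>a. P (tail G a) a"] ballI)
    fix v assume v: "v \<in> verts G"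
    have "tail G (nxt a) = v" if "a \<in> out_arcs G v" for a using nxt_out_arcs[OF that] by simp
    then show "inj_on (\<lambda>a. P (tail G a) a) (out_arcs G v) \<and> (\<forall>a\<in>out_arcs G v.
        P (tail G (nxt a)) (nxt a) = Suc (P (tail G a) a) \<or> P (tail G (nxt a)) (nxt a) = 0 \<and>
          (\<forall>b\<in>out_arcs G v. P (tail G b) b \<le> P (tail G a) a))"
      using P[OF v] by (auto simp: inj_on_def)
  qed
qed

definition slot :: "'b \<Rightarrow> nat" where
  "slot = (SOME p. \<forall>v\<in>verts G. inj_on p (out_arcs G v) \<and> (\<forall>a\<in>out_arcs G v.
    p (nxt a) = Suc (p a) \<or> p (nxt a) = 0 \<and> (\<forall>b\<in>out_arcs G v. p b \<le> p a)))"

lemma slot: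
  assumes "a \<in> out_arcs G v"
  shows "b \<in> out_arcs G v \<Longrightarrow> slot a = slot b \<longleftrightarrow> a = b"
    and "slot (nxt a) = Suc (slot a) \<or> slot (nxt a) = 0 \<and> (\<forall>b\<in>out_arcs G v. slot b \<le> slot a)"
proof -
  have v: "v \<in> verts G" using assms by auto
  show "b \<in> out_arcs G v \<Longrightarrow> slot a = slot b \<longleftrightarrow> a = b"
    "slot (nxt a) = Suc (slot a) \<or> slot (nxt a) = 0 \<and> (\<forall>b\<in>out_arcs G v. slot b \<le> slot a)"
    using someI_ex[OF slot_exists, folded slot_def] v assms by (auto simp: inj_on_def)
qed

definition turned :: "'b \<Rightarrow> ('a \<Rightarrow>\<^sub>0 int)" where
  "turned a = - (\<Sum>b\<in>{b \<in> out_arcs G (tail G a). slot a < slot b}. boundary G b)"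

definition rotor_div :: "'a \<Rightarrow> ('a \<Rightarrow> 'b) \<Rightarrow> ('a \<Rightarrow>\<^sub>0 int)" where
  "rotor_div y R = (\<Sum>u\<in>verts G - {y}. turned (R u))"

lemma boundary_opp: "a \<in> arcs G \<Longrightarrow> boundary G (opp a) = - boundary G a"
  by (simp add: boundary_def)

lemma fire_eq: "fire v = - (\<Sum>b\<in>out_arcs G v. boundary G b)"
  unfolding fire_def sum_in_arcs sum_negf[symmetric] by (intro sum.cong) (auto simp: boundary_opp)

text \<open>A turn without wrap-around removes exactly the new arc from the sum. With wrap-around
  one full turn is completed, that is, the vertex has fired.\<close>

lemma turned_nxt:
  assumes a: "a \<in> arcs G"
  shows "turned (nxt a) - turned a - boundary G (nxt a) \<in> Prin G"
proof -
  define v where "v = tail G a"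
  have av: "a \<in> out_arcs G v" "nxt a \<in> out_arcs G v" "tail G (nxt a) = v"
    using a nxt_out_arcs[of a v] by (auto simp: v_def)
  show ?thesis
  proof (cases "slot (nxt a) = Suc (slot a)")
    case True
    have "{b \<in> out_arcs G v. slot a < slot b} = insert (nxt a) {b \<in> out_arcs G v. slot (nxt a) < slot b}"
      using True av(2) slot(1)[OF av(2)] by (auto simp: nat_less_le)
    then have "(\<Sum>b\<in>{b \<in> out_arcs G v. slot a < slot b}. boundary G b) =
        boundary G (nxt a) + (\<Sum>b\<in>{b \<in> out_arcs G v. slot (nxt a) < slot b}. boundary G b)"
      by simp
    then show ?thesis by (simp add: turned_def av v_def[symmetric])
  next
    case False
    then have *: "slot (nxt a) = 0" "\<forall>b\<in>out_arcs G v. slot b \<le> slot a"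
      using slot(2)[OF av(1)] by auto
    then have e: "{b \<in> out_arcs G v. slot a < slot b} = {}"
      using not_le by blast
    have "out_arcs G v = insert (nxt a) {b \<in> out_arcs G v. slot (nxt a) < slot b}"
    proof -
      have "b = nxt a \<or> slot (nxt a) < slot b" if "b \<in> out_arcs G v" for b
        using slot(1)[OF av(2) that] *(1) by auto
      then show ?thesis using av(2) by blast
    qed
    then have "(\<Sum>b\<in>out_arcs G v. boundary G b) =
        boundary G (nxt a) + (\<Sum>b\<in>{b \<in> out_arcs G v. slot (nxt a) < slot b}. boundary G b)"
      by (subst (1) \<open>out_arcs G v = _\<close>) simp
    then have "turned (nxt a) - turned a - boundary G (nxt a) = fire v"
      unfolding turned_def av v_def[symmetric] e by (simp add: fire_eq)
    then show ?thesis using fire_Prin a by (simp add: v_def)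
  qed
qed

text \<open>The chip minus the turning of the rotors is invariant modulo \<open>Prin G\<close>. This
  conservation law is why rotor routing respects linear equivalence.\<close>

lemma rotor_div_step:
  assumes "rotor_config y R u" "u \<noteq> y" "step (R, u) = (R', w)"
  shows "(frag_of w - rotor_div y R') - (frag_of u - rotor_div y R) \<in> Prin G"
proof -
  have R': "R' = R(u := nxt (R u))" "w = head G (nxt (R u))" using assms(3) by auto
  have u: "u \<in> verts G - {y}" "R u \<in> out_arcs G u" using assms(1,2) by (auto simp: rotor_config_def)
  have n: "tail G (nxt (R u)) = u" using nxt_out_arcs[OF u(2)] by simp
  have "rotor_div y R' = turned (nxt (R u)) + (\<Sum>v\<in>verts G - {y} - {u}. turned (R v))"
    unfolding rotor_div_def by (subst sum.remove[OF _ u(1)]) (auto simp: R' intro!: sum.cong)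
  moreover have "rotor_div y R = turned (R u) + (\<Sum>v\<in>verts G - {y} - {u}. turned (R v))"
    unfolding rotor_div_def by (subst sum.remove[OF _ u(1)]) auto
  ultimately have "(frag_of w - rotor_div y R') - (frag_of u - rotor_div y R) =
      - (turned (nxt (R u)) - turned (R u) - boundary G (nxt (R u)))"
    by (simp add: boundary_def n R'(2))
  then show ?thesis using Prin_uminus[OF turned_nxt[of "R u"]] u(2) by simp
qed

lemma rotor_div_funpow:
  assumes "rotor_config y R u" "\<And>j. j < n \<Longrightarrow> snd ((step ^^ j) (R, u)) \<noteq> y"
  shows "(frag_of (snd ((step ^^ n) (R, u))) - rotor_div y (fst ((step ^^ n) (R, u)))) -
    (frag_of u - rotor_div y R) \<in> Prin G"
  using assms(2)
proof (induction n)
  case (Suc n)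
  let ?s = "(step ^^ n) (R, u)"
  have "(frag_of (snd (step ?s)) - rotor_div y (fst (step ?s))) - (frag_of (snd ?s) - rotor_div y (fst ?s)) \<in> Prin G"
    using Suc.prems by (intro rotor_div_step[of y "fst ?s" "snd ?s"] rotor_config_funpow[OF assms(1)]) auto
  from Prin_add[OF this Suc.IH] Suc.prems show ?case
    by (simp add: algebra_simps del: step_simp)
qed simp

lemma rotor_run_result:
  assumes y: "y \<in> verts G" and cfg: "rotor_config y R x"
  defines "R' \<equiv> fst (rotor_run y (R, x))"
  shows "stree (tree_of y R')" "\<And>u. u \<in> verts G - {y} \<Longrightarrow> tree_rotors G (tree_of y R') y u = R' u"
    and "rotor_div y R - rotor_div y R' - (frag_of x - frag_of y) \<in> Prin G"
proof -
  obtain k where k: "snd ((step ^^ k) (R, x)) = y" "\<And>j. j < k \<Longrightarrow> snd ((step ^^ j) (R, x)) \<noteq> y"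
    "rotor_run y (R, x) = (step ^^ k) (R, x)"
    using rotor_runE[OF y cfg] by blast
  have c: "rotor_config y R' y"
    using rotor_config_funpow[OF cfg k(2), of k] k(1,3) by (simp add: R'_def)
  have 1: "\<And>v. v \<in> verts G - {y} \<Longrightarrow> R' v \<in> out_arcs G v"
    "\<And>v. v \<in> verts G \<Longrightarrow> \<exists>n. ((\<lambda>v. head G (R' v)) ^^ n) v = y"
    using c by (auto simp: rotor_config_def)
  show "stree (tree_of y R')" "\<And>u. u \<in> verts G - {y} \<Longrightarrow> tree_rotors G (tree_of y R') y u = R' u"
    unfolding tree_of_def using rotors_stree[OF y 1] by blast+
  have "(frag_of y - rotor_div y R') - (frag_of x - rotor_div y R) \<in> Prin G"
    using rotor_div_funpow[OF cfg k(2), of k] k(1,3) by (simp add: R'_def)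
  then show "rotor_div y R - rotor_div y R' - (frag_of x - frag_of y) \<in> Prin G"
    by (simp add: algebra_simps)
qed

text \<open>Sum the balance over \<open>X\<close>: arcs inside contribute nothing, arcs across the
  border contribute nothing positive in either direction. As the total is zero, no arc can carry a
  positive amount out of \<open>X\<close>.\<close>

lemma flow_closed:
  fixes c :: "'b \<Rightarrow> int"
  assumes bal: "\<And>v. v \<in> verts G \<Longrightarrow> (\<Sum>b\<in>arcs G. c b * lk (boundary G b) v) = 0"
    and X: "X \<subseteq> verts G"
    and pos: "\<And>b. b \<in> arcs G \<Longrightarrow> tail G b \<in> X \<Longrightarrow> 0 \<le> c b"
    and neg: "\<And>b. b \<in> arcs G \<Longrightarrow> tail G b \<notin> X \<Longrightarrow> c b \<le> 0"
    and a: "a \<in> arcs G" "tail G a \<in> X" "c a > 0"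
  shows "head G a \<in> X"
proof (rule ccontr)
  assume na: "head G a \<notin> X"
  have fX: "finite X" using X finite_verts by (rule finite_subset)
  let ?t = "\<lambda>b. c b * ((if head G b \<in> X then 1 else 0) - (if tail G b \<in> X then 1 else 0))"
  have "0 = (\<Sum>v\<in>X. \<Sum>b\<in>arcs G. c b * lk (boundary G b) v)"
    using bal X by (intro sum.neutral[symmetric]) auto
  also have "\<dots> = (\<Sum>b\<in>arcs G. \<Sum>v\<in>X. c b * lk (boundary G b) v)"
    by (rule sum.swap)
  also have "\<dots> = (\<Sum>b\<in>arcs G. ?t b)"
    using fX by (intro sum.cong) (auto simp: sum_distrib_left[symmetric] boundary_def lookup_minus sum_subtractf)
  also have "\<dots> < (\<Sum>b\<in>arcs G. 0)"
  proof (rule sum_strict_mono_ex1)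
    show "\<forall>b\<in>arcs G. ?t b \<le> 0"
      using pos neg by auto
    show "\<exists>b\<in>arcs G. ?t b < 0"
      using a na by (intro bexI[of _ a]) auto
  qed simp
  finally show False by simp
qed

lemma rotor_div_arcs:
  assumes "\<And>u. u \<in> verts G - {y} \<Longrightarrow> R u \<in> out_arcs G u"
  shows "rotor_div y R = - (\<Sum>b\<in>{b \<in> arcs G. tail G b \<noteq> y \<and> slot (R (tail G b)) < slot b}. boundary G b)"
proof -
  have "(\<Sum>b\<in>{b \<in> arcs G. tail G b \<noteq> y \<and> slot (R (tail G b)) < slot b}. boundary G b) =
    (\<Sum>b\<in>(\<Union>u\<in>verts G - {y}. {b \<in> out_arcs G u. slot (R u) < slot b}). boundary G b)"
    by (rule sum.cong) auto
  also have "\<dots> = (\<Sum>u\<in>verts G - {y}. \<Sum>b\<in>{b \<in> out_arcs G u. slot (R u) < slot b}. boundary G b)"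
    by (rule sum.UNION_disjoint) auto
  also have "\<dots> = - rotor_div y R"
    unfolding rotor_div_def turned_def sum_negf[symmetric] using assms by (intro sum.cong) auto
  finally show ?thesis by simp
qed

text \<open>If two trees have equivalent rotor divisors, then some numbers of rotor turns carry one
  configuration to the other without moving chips. The vertices whose rotors turn forward send their
  chips to each other only, so their final rotors never lead to the sink.\<close>

lemma rotor_div_inj:
  assumes y: "y \<in> verts G" and T: "stree T" and T': "stree T'"
    and P: "rotor_div y (tree_rotors G T' y) - rotor_div y (tree_rotors G T y) \<in> Prin G"
  shows "T' = T"
proof -
  define \<rho> where "\<rho> = tree_rotors G T y"
  define \<rho>' where "\<rho>' = tree_rotors G T' y"
  have \<rho>: "\<rho> u \<in> out_arcs G u" "\<rho>' u \<in> out_arcs G u" if "u \<in> verts G - {y}" for u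
    using rotor_config_tree[OF T y y] rotor_config_tree[OF T' y y] that
    by (auto simp: rotor_config_def \<rho>_def \<rho>'_def)
  obtain \<phi>0 where \<phi>0: "\<And>v. v \<in> verts G \<Longrightarrow> lk (rotor_div y \<rho>' - rotor_div y \<rho>) v = lap \<phi>0 v"
    using P unfolding Prin_iff \<rho>_def \<rho>'_def by blast
  \<comment> \<open>A constant does not affect the Laplacian. This choice means that the sink makes
    no turns.\<close>
  define \<phi> where "\<phi> v = \<phi>0 v - \<phi>0 y" for v
  have \<phi>: "lk (rotor_div y \<rho>' - rotor_div y \<rho>) v = lap \<phi> v" if "v \<in> verts G" for v
    using \<phi>0[OF that] by (simp add: lap_def \<phi>_def)
  have \<phi>y: "\<phi> y = 0" by (simp add: \<phi>_def)
  define gt where "gt R b = (if tail G b \<noteq> y \<and> slot (R (tail G b)) < slot b then 1 else 0 :: int)" for R b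
  \<comment> \<open>The net number of chips sent along \<open>b\<close> if every rotor passes from
    \<open>\<rho>\<close> to \<open>\<rho>'\<close> and makes \<open>\<phi>\<close> full turns
    besides. The equivalence of the rotor divisors says that this flow is balanced at every
    vertex.\<close>
  define c where "c b = gt \<rho> b - gt \<rho>' b + \<phi> (tail G b)" for b
  have dv: "lk (rotor_div y R) v = - (\<Sum>b\<in>arcs G. gt R b * lk (boundary G b) v)"
    if "\<And>u. u \<in> verts G - {y} \<Longrightarrow> R u \<in> out_arcs G u" for R v
  proof -
    have "(\<Sum>b\<in>arcs G. gt R b * lk (boundary G b) v) =
      (\<Sum>b\<in>{b \<in> arcs G. tail G b \<noteq> y \<and> slot (R (tail G b)) < slot b}. lk (boundary G b) v)"
      unfolding gt_def by (intro sum.mono_neutral_cong_right) auto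
    moreover have "rotor_div y R = - (\<Sum>b\<in>{b \<in> arcs G. tail G b \<noteq> y \<and> slot (R (tail G b)) < slot b}. boundary G b)"
      by (rule rotor_div_arcs) (rule that)
    ultimately show ?thesis by (simp add: lookup_sum)
  qed
  have bal: "(\<Sum>b\<in>arcs G. c b * lk (boundary G b) v) = 0" if v: "v \<in> verts G" for v
  proof -
    have "(\<Sum>b\<in>arcs G. \<phi> (tail G b) * lk (boundary G b) v) =
      (\<Sum>b\<in>arcs G. \<phi> (tail G b) * (if head G b = v then 1 else 0)) -
      (\<Sum>b\<in>arcs G. \<phi> (tail G b) * (if tail G b = v then 1 else 0))"
      unfolding sum_subtractf[symmetric] by (intro sum.cong) (auto simp: boundary_def lookup_minus)
    also have "(\<Sum>b\<in>arcs G. \<phi> (tail G b) * (if head G b = v then 1 else 0)) =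
      (\<Sum>b\<in>arcs G. \<phi> (head G b) * (if tail G b = v then 1 else 0))"
      by (rule sum.reindex_bij_witness[of _ opp opp]) auto
    also have "\<dots> = (\<Sum>b\<in>out_arcs G v. \<phi> (head G b))"
      by (intro sum.mono_neutral_cong_right) auto
    also have "(\<Sum>b\<in>arcs G. \<phi> (tail G b) * (if tail G b = v then 1 else 0)) = (\<Sum>b\<in>out_arcs G v. \<phi> v)"
      by (intro sum.mono_neutral_cong_right) auto
    finally have "(\<Sum>b\<in>arcs G. \<phi> (tail G b) * lk (boundary G b) v) = - lap \<phi> v"
      by (simp add: lap_def sum_subtractf)
    moreover have "(\<Sum>b\<in>arcs G. (gt \<rho> b - gt \<rho>' b) * lk (boundary G b) v) = lap \<phi> v"
      using \<phi>[OF v] dv[of \<rho> v] dv[of \<rho>' v] \<rho>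
      by (simp add: lookup_minus left_diff_distrib sum_subtractf)
    ultimately show ?thesis
      by (simp add: c_def distrib_right sum.distrib)
  qed
  define F where "F = {u \<in> verts G - {y}. \<phi> u > 0 \<or> \<phi> u = 0 \<and> slot (\<rho> u) < slot (\<rho>' u)}"
  define B where "B = {u \<in> verts G - {y}. \<phi> u < 0 \<or> \<phi> u = 0 \<and> slot (\<rho>' u) < slot (\<rho> u)}"
  have tV: "tail G b \<in> verts G - {y} \<or> tail G b = y" if "b \<in> arcs G" for b using that by auto
  have cy: "c b = 0" if "tail G b = y" for b using that by (simp add: c_def gt_def \<phi>y)
  have "F = {}"
  proof (rule equals0I)
    fix u assume u: "u \<in> F"
    \<comment> \<open>The final rotor at \<open>v\<close> is the last arc turned over, so it carries
      a positive amount, and \<open>flow_closed\<close> keeps its head in \<open>F\<close>. For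
      \<open>B\<close> the same is done with time reversed, which exchanges initial and final
      rotors.\<close>
    have step: "head G (\<rho>' v) \<in> F" if v: "v \<in> F" for v
    proof (rule flow_closed[OF bal])
      show "F \<subseteq> verts G" "\<rho>' v \<in> arcs G" "tail G (\<rho>' v) \<in> F"
        using v \<rho>(2)[of v] by (auto simp: F_def)
      show "0 \<le> c b" if "b \<in> arcs G" "tail G b \<in> F" for b
        using that by (auto simp: F_def c_def gt_def)
      show "c b \<le> 0" if "b \<in> arcs G" "tail G b \<notin> F" for b
        using tV[OF that(1)] that(2) cy by (auto simp: F_def c_def gt_def)
      show "0 < c (\<rho>' v)"
        using v \<rho>(2)[of v] by (auto simp: F_def c_def gt_def)
    qed
    obtain n where "((\<lambda>v. head G (\<rho>' v)) ^^ n) u = y"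
      using stree_rotor(4)[OF T', of u y] u y unfolding \<rho>'_def F_def by auto
    moreover have "((\<lambda>v. head G (\<rho>' v)) ^^ n) u \<in> F" for n
      by (induction n) (use u step in auto)
    ultimately have "y \<in> F" by metis
    then show False by (simp add: F_def)
  qed
  moreover have "B = {}"
  proof (rule equals0I)
    fix u assume u: "u \<in> B"
    have step: "head G (\<rho> v) \<in> B" if v: "v \<in> B" for v
    proof (rule flow_closed[of "\<lambda>b. - c b"])
      show "(\<Sum>b\<in>arcs G. - c b * lk (boundary G b) v) = 0" if "v \<in> verts G" for v
        using bal[OF that] by (simp add: sum_negf)
      show "B \<subseteq> verts G" "\<rho> v \<in> arcs G" "tail G (\<rho> v) \<in> B"
        using v \<rho>(1)[of v] by (auto simp: B_def)
      show "0 \<le> - c b" if "b \<in> arcs G" "tail G b \<in> B" for b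
        using that by (auto simp: B_def c_def gt_def)
      show "- c b \<le> 0" if "b \<in> arcs G" "tail G b \<notin> B" for b
        using tV[OF that(1)] that(2) cy by (auto simp: B_def c_def gt_def)
      show "0 < - c (\<rho> v)"
        using v \<rho>(1)[of v] by (auto simp: B_def c_def gt_def)
    qed
    obtain n where "((\<lambda>v. head G (\<rho> v)) ^^ n) u = y"
      using stree_rotor(4)[OF T, of u y] u y unfolding \<rho>_def B_def by auto
    moreover have "((\<lambda>v. head G (\<rho> v)) ^^ n) u \<in> B" for n
      by (induction n) (use u step in auto)
    ultimately have "y \<in> B" by metis
    then show False by (simp add: B_def)
  qed
  ultimately have "\<rho>' u = \<rho> u" if "u \<in> verts G - {y}" for u
  proof -
    have "\<phi> u = 0" "slot (\<rho> u) = slot (\<rho>' u)"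
      using that \<open>F = {}\<close> \<open>B = {}\<close> unfolding F_def B_def by force+
    then show ?thesis using slot(1)[OF \<rho>(2)[OF that] \<rho>(1)[OF that]] by simp
  qed
  then show ?thesis
    using tree_eq_rotors[OF T y] tree_eq_rotors[OF T' y] unfolding \<rho>_def \<rho>'_def by simp
qed

definition rotor_J :: "'a \<Rightarrow> 'b set \<Rightarrow> ('a \<Rightarrow>\<^sub>0 int)" where
  "rotor_J y T = - rotor_div y (tree_rotors G T y)"

lemma rotor_route_J:
  assumes y: "y \<in> verts G" and x: "x \<in> verts G - {y}" and T: "stree T"
  shows "stree (rotor_route G opp nxt y x T)"
    and "rotor_J y (rotor_route G opp nxt y x T) - rotor_J y T - (frag_of x - frag_of y) \<in> Prin G"
proof -
  have "rotor_config y (tree_rotors G T y) x"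
    using rotor_config_tree[OF T y] x by blast
  note res = rotor_run_result[OF y this, folded rotor_route_eq]
  show "stree (rotor_route G opp nxt y x T)" by (rule res(1))
  have "rotor_div y (tree_rotors G (rotor_route G opp nxt y x T) y) =
      rotor_div y (fst (rotor_run y (tree_rotors G T y, x)))"
    unfolding rotor_div_def using res(2) by (intro sum.cong) auto
  then show "rotor_J y (rotor_route G opp nxt y x T) - rotor_J y T - (frag_of x - frag_of y) \<in> Prin G"
    using res(3) by (simp add: rotor_J_def)
qed

lemma torsorial_rotor_J:
  assumes y: "y \<in> verts G"
  shows "torsorial (rotor_J y)"
proof (rule torsorialI[OF y])
  fix T T' assume T: "stree T" "stree T'" and "rotor_J y T' - rotor_J y T \<in> Prin G"
  then have "rotor_div y (tree_rotors G T y) - rotor_div y (tree_rotors G T' y) \<in> Prin G"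
    by (simp add: rotor_J_def)
  then show "T' = T"
    using rotor_div_inj[OF y T(2,1)] by simp
qed (use rotor_route_J[OF y] in blast)

lemma rotor_torsor_eq: "y \<in> verts G \<Longrightarrow> rotor_torsor G opp nxt y = act (rotor_J y)"
  by (rule rotor_torsor_eq_act) (use torsorial_rotor_J rotor_route_J in blast)+

lemma rotor_torsor_route:
  assumes "y \<in> verts G" "x \<in> verts G - {y}" "stree T"
  shows "rotor_torsor G opp nxt y (Prin G #>\<^bsub>Div0 G\<^esub> (frag_of x - frag_of y)) T =
    rotor_route G opp nxt y x T"
  unfolding rotor_torsor_eq[OF assms(1)]
  using act_coset_iff(2)[OF torsorial_rotor_J[OF assms(1)] Div0_frag_diff assms(3)]
    rotor_route_J[OF assms] assms by blast

end

section \<open>The Bernardi torsor\<close>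

primrec bef :: "'b list \<Rightarrow> 'b \<Rightarrow> 'b \<Rightarrow> bool" where
  "bef [] a b \<longleftrightarrow> False"
| "bef (x # L) a b \<longleftrightarrow> x = a \<and> b \<in> set L \<or> bef L a b"

lemma bef_append [simp]:
  "bef (L @ M) a b \<longleftrightarrow> bef L a b \<or> bef M a b \<or> a \<in> set L \<and> b \<in> set M"
  by (induction L) auto

lemma bef_mem: "bef L a b \<Longrightarrow> a \<in> set L \<and> b \<in> set L"
  by (induction L) auto

lemma bef_total: "a \<in> set L \<Longrightarrow> b \<in> set L \<Longrightarrow> a \<noteq> b \<Longrightarrow> bef L a b \<or> bef L b a"
  by (induction L) auto

lemma bef_asym: "distinct L \<Longrightarrow> bef L a b \<Longrightarrow> \<not> bef L b a"
  by (induction L) (auto dest: bef_mem)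

lemma bef_iff: "distinct L \<Longrightarrow> a \<in> set L \<Longrightarrow> b \<in> set L \<Longrightarrow> a \<noteq> b \<Longrightarrow> bef L b a \<longleftrightarrow> \<not> bef L a b"
  using bef_total bef_asym by metis

lemma bef_split:
  assumes "bef L a b"
  obtains P Q R where "L = P @ a # Q @ b # R"
  using assms
proof (induction L arbitrary: thesis)
  case (Cons x L)
  show ?case
  proof (cases "bef L a b")
    case True
    then obtain P Q R where "L = P @ a # Q @ b # R" using Cons.IH by blast
    then show ?thesis using Cons.prems(1)[of "x # P" Q R] by simp
  next
    case False
    then have "x = a" "b \<in> set L" using Cons.prems(2) by auto
    then show ?thesis using Cons.prems(1)[of "[]"] by (metis append_Nil split_list)
  qed
qed simp

section \<open>Bernardi divisors read off the tour\<close>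

context loopless_ribbon_graph
begin

definition tour :: "'b set \<Rightarrow> 'b \<Rightarrow> 'b list" where
  "tour T e = e # (SOME L. cyc (tau T) (e # L))"

lemma cyc_tour: "stree T \<Longrightarrow> e \<in> arcs G \<Longrightarrow> cyc (tau T) (tour T e)"
  unfolding tour_def using tour_exists[OF stree_bforest] by (metis (mono_tags) someI_ex)

lemma tour_eqI: "stree T \<Longrightarrow> e \<in> arcs G \<Longrightarrow> cyc (tau T) (e # L) \<Longrightarrow> tour T e = e # L"
  using cyc_unique[OF cyc_tour, of T e "e # L"] by (simp add: tour_def)

lemma set_tour: "stree T \<Longrightarrow> e \<in> arcs G \<Longrightarrow> set (tour T e) = arcs G"
  using stree_tour_set cyc_tour unfolding tour_def by metis

lemma distinct_tour: "stree T \<Longrightarrow> e \<in> arcs G \<Longrightarrow> distinct (tour T e)"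
  using cyc_tour cyc_distinct by blast

lemma hd_tour [simp]: "hd (tour T e) = e" "tour T e \<noteq> []"
  by (simp_all add: tour_def)

text \<open>The Bernardi divisor as a function of a list: an edge of \<open>N\<close> is charged at
  the end that occurs first, recognised by the other end still being ahead.\<close>

primrec bdl :: "'b set \<Rightarrow> 'b list \<Rightarrow> ('a \<Rightarrow>\<^sub>0 int)" where
  "bdl N [] = 0"
| "bdl N (a # L) = (if a \<in> N \<and> opp a \<in> set L then frag_of (tail G a) else 0) + bdl N L"

definition cross :: "'b set \<Rightarrow> 'b list \<Rightarrow> 'b list \<Rightarrow> ('a \<Rightarrow>\<^sub>0 int)" where
  "cross N A B = (\<Sum>a\<in>{a \<in> set A. a \<in> N \<and> opp a \<in> set B}. frag_of (tail G a))"

text \<open>The change of \<open>bdl\<close> when the block \<open>A\<close> is moved from before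
  \<open>B\<close> to behind it: chords between the two blocks move their chip to the other
  end.\<close>

definition flux :: "'b set \<Rightarrow> 'b list \<Rightarrow> 'b list \<Rightarrow> ('a \<Rightarrow>\<^sub>0 int)" where
  "flux N A B = (\<Sum>a\<in>{a \<in> set A. a \<in> N \<and> opp a \<in> set B}. boundary G a)"

lemma cross_Nil [simp]: "cross N [] B = 0" "cross N A [] = 0"
  by (simp_all add: cross_def)

lemma cross_append1:
  "set A \<inter> set B = {} \<Longrightarrow> cross N (A @ B) C = cross N A C + cross N B C"
proof -
  assume "set A \<inter> set B = {}"
  moreover have "{a \<in> set (A @ B). a \<in> N \<and> opp a \<in> set C} =
      {a \<in> set A. a \<in> N \<and> opp a \<in> set C} \<union> {a \<in> set B. a \<in> N \<and> opp a \<in> set C}" by auto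
  ultimately show ?thesis unfolding cross_def by (simp only:) (rule sum.union_disjoint, auto)
qed

lemma cross_single: "cross N [a] B = (if a \<in> N \<and> opp a \<in> set B then frag_of (tail G a) else 0)"
proof -
  have "{b \<in> set [a]. b \<in> N \<and> opp b \<in> set B} = (if a \<in> N \<and> opp a \<in> set B then {a} else {})" by auto
  then show ?thesis by (simp add: cross_def)
qed

lemma bdl_append:
  "distinct (A @ B) \<Longrightarrow> bdl N (A @ B) = bdl N A + bdl N B + cross N A B"
proof (induction A)
  case (Cons a A)
  have "cross N ([a] @ A) B = cross N [a] B + cross N A B"
    using Cons.prems by (intro cross_append1) auto
  then show ?case
    using Cons by (auto simp: cross_single)
qed simp

lemma flux_eq: "N \<subseteq> arcs G \<Longrightarrow> (\<And>a. a \<in> N \<Longrightarrow> opp a \<in> N) \<Longrightarrow> flux N A B = cross N B A - cross N A B"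
proof -
  assume N: "N \<subseteq> arcs G" "\<And>a. a \<in> N \<Longrightarrow> opp a \<in> N"
  have "cross N B A = (\<Sum>a\<in>{a \<in> set A. a \<in> N \<and> opp a \<in> set B}. frag_of (head G a))"
    unfolding cross_def using N by (intro sum.reindex_bij_witness[of _ opp opp]) auto
  then show ?thesis
    unfolding flux_def boundary_def sum_subtractf cross_def by simp
qed

lemma bdl_rotate:
  assumes "distinct (A @ B)" "N \<subseteq> arcs G" "\<And>a. a \<in> N \<Longrightarrow> opp a \<in> N"
  shows "bdl N (B @ A) - bdl N (A @ B) = flux N A B"
  using assms by (subst (1 2) bdl_append) (auto simp: flux_eq)

lemma bdl_sum:
  "bdl N M = (\<Sum>i<length M. if M ! i \<in> N \<and> opp (M ! i) \<in> set (drop (Suc i) M) then frag_of (tail G (M ! i)) else 0)"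
proof (induction M)
  case (Cons a M)
  then show ?case by (simp add: sum.lessThan_Suc_shift del: sum.lessThan_Suc cong: if_cong)
qed simp

abbreviation chords :: "'b set \<Rightarrow> 'b set" where
  "chords T \<equiv> arcs G - T"

abbreviation beta :: "'b \<Rightarrow> 'b set \<Rightarrow> ('a \<Rightarrow>\<^sub>0 int)" where
  "beta \<equiv> bernardi_divisor G opp nxt"

lemma bernardi_tour_eq: "bernardi_tour opp nxt e T n = (tau T ^^ n) e"
proof -
  have "(\<lambda>a. if a \<in> T then nxt (opp a) else nxt a) = tau T"
    by (auto simp: tau_def)
  then show ?thesis by (simp add: bernardi_tour_def)
qed

lemma beta_eq_bdl:
  assumes T: "stree T" and e: "e \<in> arcs G"
  shows "beta e T = bdl (chords T) (tour T e)"
proof -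
  let ?M = "tour T e"
  let ?n = "length ?M"
  note M = cyc_tour[OF T e] set_tour[OF T e] distinct_tour[OF T e]
  have t: "bernardi_tour opp nxt e T i = ?M ! i" if "i < ?n" for i
    using cyc_nth[OF M(1) that] by (simp add: bernardi_tour_eq)
  have img: "bernardi_tour opp nxt e T ` {..<?n} = arcs G"
    using t M(2) by (auto simp: set_conv_nth image_iff)
  have len: "bernardi_length G opp nxt e T = ?n"
    unfolding bernardi_length_def
  proof (rule Least_equality)
    show "0 < ?n \<and> bernardi_tour opp nxt e T ?n = e \<and> arcs G \<subseteq> bernardi_tour opp nxt e T ` {..<?n}"
      using img cyc_funpow_length[OF M(1)] by (simp add: bernardi_tour_eq)
    \<comment> \<open>All arcs have to be visited, so no shorter round can end the process.\<close>
    fix N assume "0 < N \<and> bernardi_tour opp nxt e T N = e \<and> arcs G \<subseteq> bernardi_tour opp nxt e T ` {..<N}"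
    then have "card (arcs G) \<le> card {..<N}"
      by (meson card_image_le card_mono finite_imageI finite_lessThan le_trans)
    then show "?n \<le> N" using M(2) distinct_card[OF M(3)] by simp
  qed
  have cond: "(\<forall>m<n. bernardi_tour opp nxt e T m \<noteq> bernardi_tour opp nxt e T n \<and>
      bernardi_tour opp nxt e T m \<noteq> opp (bernardi_tour opp nxt e T n)) \<longleftrightarrow>
      opp (?M ! n) \<in> set (drop (Suc n) ?M)" if n: "n < ?n" for n
  proof -
    have "?M = take n ?M @ ?M ! n # drop (Suc n) ?M" using n by (simp add: id_take_nth_drop)
    moreover have a: "opp (?M ! n) \<in> set ?M" "opp (?M ! n) \<noteq> ?M ! n"
      using M(2) n nth_mem by fastforce+
    moreover have "set ?M = set (take n ?M) \<union> insert (?M ! n) (set (drop (Suc n) ?M))"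
      using arg_cong[OF calculation(1), of set] by simp
    moreover have "set (take n ?M) \<inter> set (drop (Suc n) ?M) = {}"
      using M(3) by (intro set_take_disj_set_drop_if_distinct) auto
    ultimately have "opp (?M ! n) \<in> set (drop (Suc n) ?M) \<longleftrightarrow> opp (?M ! n) \<notin> set (take n ?M)"
      by auto
    also have "\<dots> \<longleftrightarrow> (\<forall>m<n. ?M ! m \<noteq> opp (?M ! n))"
      using n by (auto simp: in_set_conv_nth)
    also have "\<dots> \<longleftrightarrow> (\<forall>m<n. ?M ! m \<noteq> ?M ! n \<and> ?M ! m \<noteq> opp (?M ! n))"
      using n M(3) by (auto simp: nth_eq_iff_index_eq)
    also have "\<dots> \<longleftrightarrow> (\<forall>m<n. bernardi_tour opp nxt e T m \<noteq> bernardi_tour opp nxt e T n \<and>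
      bernardi_tour opp nxt e T m \<noteq> opp (bernardi_tour opp nxt e T n))"
      by (intro all_cong) (use t n in auto)
    finally show ?thesis by (rule sym)
  qed
  have "beta e T = (\<Sum>n\<in>{n \<in> {..<?n}. ?M ! n \<in> chords T \<and> opp (?M ! n) \<in> set (drop (Suc n) ?M)}. frag_of (tail G (?M ! n)))"
    unfolding bernardi_divisor_def Let_def len
  proof (rule sum.cong)
    show "{n. n < ?n \<and> bernardi_tour opp nxt e T n \<notin> T \<and>
        (\<forall>m<n. bernardi_tour opp nxt e T m \<noteq> bernardi_tour opp nxt e T n \<and>
          bernardi_tour opp nxt e T m \<noteq> opp (bernardi_tour opp nxt e T n))} =
      {n \<in> {..<?n}. ?M ! n \<in> chords T \<and> opp (?M ! n) \<in> set (drop (Suc n) ?M)}"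
      using cond t M(2) nth_mem by fastforce
  qed (use t in auto)
  also have "\<dots> = bdl (chords T) ?M"
    unfolding bdl_sum by (rule sum.inter_filter) simp
  finally show ?thesis .
qed

lemma chords_opp: "stree T \<Longrightarrow> a \<in> chords T \<Longrightarrow> opp a \<in> chords T"
  using stree_opp_iff by auto

text \<open>Up to sign this is the joint firing of all vertices of \<open>W\<close>; the arcs inside
  \<open>W\<close> cancel in opposite pairs.\<close>

lemma cut_Prin:
  assumes W: "W \<subseteq> verts G"
  shows "(\<Sum>a\<in>{a \<in> arcs G. tail G a \<in> W \<and> head G a \<notin> W}. boundary G a) \<in> Prin G"
proof -
  let ?I = "{a \<in> arcs G. tail G a \<in> W \<and> head G a \<in> W}"
  let ?C = "{a \<in> arcs G. tail G a \<in> W \<and> head G a \<notin> W}"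
  have fW: "finite W" using W finite_verts by (rule finite_subset)
  have "(\<Sum>a\<in>?I. boundary G a) = (\<Sum>a\<in>?I. boundary G (opp a))"
    by (rule sum.reindex_bij_witness[of _ opp opp]) auto
  also have "\<dots> = - (\<Sum>a\<in>?I. boundary G a)"
    unfolding sum_negf[symmetric] by (intro sum.cong) (auto simp: boundary_opp)
  finally have "lk (\<Sum>a\<in>?I. boundary G a) v = lk (- (\<Sum>a\<in>?I. boundary G a)) v" for v
    by (rule arg_cong)
  moreover have "x = - x \<Longrightarrow> x = 0" for x :: int
    by simp
  ultimately have "lk (\<Sum>a\<in>?I. boundary G a) v = 0" for v
    unfolding lookup_uminus by blast
  then have I: "(\<Sum>a\<in>?I. boundary G a) = 0"
    by (intro poly_mapping_eqI) simp
  have "(\<Sum>v\<in>W. fire v) = - (\<Sum>v\<in>W. \<Sum>a\<in>out_arcs G v. boundary G a)"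
    by (simp add: fire_eq sum_negf)
  also have "(\<Sum>v\<in>W. \<Sum>a\<in>out_arcs G v. boundary G a) = (\<Sum>a\<in>(\<Union>v\<in>W. out_arcs G v). boundary G a)"
    by (rule sum.UNION_disjoint[symmetric]) (use fW in auto)
  also have "(\<Union>v\<in>W. out_arcs G v) = ?I \<union> ?C" by auto
  also have "(\<Sum>a\<in>?I \<union> ?C. boundary G a) = (\<Sum>a\<in>?I. boundary G a) + (\<Sum>a\<in>?C. boundary G a)"
    by (rule sum.union_disjoint) auto
  finally have "(\<Sum>a\<in>?C. boundary G a) = - (\<Sum>v\<in>W. fire v)"
    using I by simp
  then show ?thesis
    using W fire_Prin by (auto intro!: Prin_uminus Prin_sum)
qed

text \<open>If \<open>h\<close> is a chord, only \<open>h\<close> moves to the end of the tour. If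
  \<open>h\<close> is a tree arc, the whole part from \<open>h\<close> to \<open>opp h\<close>
  moves; the chords that change their end form the cut around the side beyond \<open>h\<close>, from
  which \<open>opp h\<close> is missing, and the full cut is principal.\<close>

lemma beta_nxt:
  assumes T: "stree T" and h: "h \<in> arcs G"
  shows "beta (nxt h) T - beta h T - boundary G h \<in> Prin G"
proof -
  let ?N = "chords T"
  have N: "?N \<subseteq> arcs G" "\<And>a. a \<in> ?N \<Longrightarrow> opp a \<in> ?N"
    using chords_opp[OF T] by blast+
  have nh: "nxt h \<in> arcs G" using nxt_out_arcs[of h "tail G h"] h by simp
  show ?thesis
  proof (cases "h \<in> T")
    case False
    obtain L where L: "tour T h = h # L" by (simp add: tour_def)
    note c = cyc_tour[OF T h, unfolded L]
    have oL: "opp h \<in> set L"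
      using set_tour[OF T h] h unfolding L by (metis arev_in_arcs opp_neq(1) set_ConsD)
    then obtain b L' where L': "L = b # L'" by (cases L) auto
    have "nxt h = b" using c False by (simp add: cyc_Cons L' tau_def)
    moreover have "cyc (tau T) (L @ [h])" using cyc_rotate[of "tau T" "[h]" L] c by simp
    ultimately have "tour T (nxt h) = L @ [h]"
      using tour_eqI[OF T nh] by (simp add: L')
    then have "beta (nxt h) T - beta h T = flux ?N [h] L"
      unfolding beta_eq_bdl[OF T nh] beta_eq_bdl[OF T h] L
      using bdl_rotate[of "[h]" L ?N] N cyc_distinct[OF c] by simp
    also have "{a \<in> set [h]. a \<in> ?N \<and> opp a \<in> set L} = {h}" using oL False h by auto
    then have "flux ?N [h] L = boundary G h" by (simp add: flux_def)
    finally show ?thesis by simp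
  next
    case True
    obtain Xs Ys where L: "cyc (tau T) (h # Ys @ opp h # Xs)"
      using tour_split_at[OF T True] .
    let ?A = "h # Ys @ [opp h]"
    have c: "cyc (tau T) (Xs @ ?A)"
      using cyc_rotate[of "tau T" ?A Xs] L by simp
    have oh: "opp h \<in> T" using True stree_opp_iff[OF T] by simp
    have hd: "nxt h = hd (Xs @ ?A)"
    proof (cases Xs)
      case Nil
      then show ?thesis
        using cyc_last_step[of "tau T" h Ys "opp h"] L oh by (simp add: tau_def)
    next
      case (Cons b Xs')
      then show ?thesis
        using cyc_step[of "tau T" "h # Ys" "opp h" b Xs'] L oh by (simp add: tau_def)
    qed
    have tn: "tour T (nxt h) = Xs @ ?A"
      using tour_eqI[OF T nh, of "tl (Xs @ ?A)"] c hd by (cases Xs) auto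
    have th: "tour T h = ?A @ Xs" using tour_eqI[OF T h L] by simp
    define W where "W = {v \<in> verts G. (head G h, v) \<in> conn (T - edge h)}"
    have W: "W \<subseteq> verts G" by (auto simp: W_def)
    note sides = tour_sides[OF T True L]
    have tailW: "tail G a \<in> W \<longleftrightarrow> a \<in> set (opp h # Ys)" if "a \<in> arcs G" for a
      unfolding sides(2) using that by (auto simp: W_def)
    have dis: "distinct (?A @ Xs)" and all: "set (?A @ Xs) = arcs G"
      using distinct_tour[OF T h] set_tour[OF T h] unfolding th by auto
    have hW: "head G h \<in> W" "tail G h \<notin> W"
      using h bforest_bridge'[OF stree_bforest[OF T] True] by (auto simp: W_def)
    have headW: "head G a \<notin> W \<longleftrightarrow> opp a \<in> set (h # Xs)" if "a \<in> arcs G" for a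
    proof -
      have "opp a \<in> set (?A @ Xs)" using that all by simp
      then show ?thesis using tailW[of "opp a"] that dis by auto
    qed
    \<comment> \<open>The edge of \<open>h\<close> is the only tree edge across this cut, so all
      other arcs of the cut are chords.\<close>
    have bri: "a = h \<or> a = opp h" if a: "a \<in> T" "tail G a \<in> W" "head G a \<notin> W" for a
    proof (rule ccontr)
      assume "\<not> (a = h \<or> a = opp h)"
      then have "a \<in> T - edge h" using a by auto
      then have "(tail G a, head G a) \<in> conn (T - edge h)" by (rule conn_arc)
      moreover have "(head G h, tail G a) \<in> conn (T - edge h)" using a(2) by (simp add: W_def)
      ultimately have "(head G h, head G a) \<in> conn (T - edge h)" using conn_trans by blast
      then show False using a(3) stree_arcs[OF T a(1)] by (simp add: W_def)
    qed
    have "beta (nxt h) T - beta h T = flux ?N ?A Xs"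
      unfolding beta_eq_bdl[OF T nh] beta_eq_bdl[OF T h] tn th
      using bdl_rotate[OF dis N] by simp
    also have "\<dots> = (\<Sum>a\<in>{a \<in> arcs G. tail G a \<in> W \<and> head G a \<notin> W} - {opp h}. boundary G a)"
      unfolding flux_def
    proof (rule sum.cong)
      show "{a \<in> set ?A. a \<in> ?N \<and> opp a \<in> set Xs} = {a \<in> arcs G. tail G a \<in> W \<and> head G a \<notin> W} - {opp h}"
      proof (intro equalityI subsetI)
        fix a assume a: "a \<in> {a \<in> set ?A. a \<in> ?N \<and> opp a \<in> set Xs}"
        then have "a \<in> set (opp h # Ys)" "a \<in> arcs G" "a \<noteq> opp h" using True oh by auto
        then show "a \<in> {a \<in> arcs G. tail G a \<in> W \<and> head G a \<notin> W} - {opp h}"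
          using a tailW headW by auto
      next
        fix a assume a: "a \<in> {a \<in> arcs G. tail G a \<in> W \<and> head G a \<notin> W} - {opp h}"
        then have aA: "a \<in> set Ys" using tailW[of a] by auto
        have "opp a \<in> set Xs" using headW[of a] a by auto
        moreover have "a \<notin> T" using bri[of a] a hW by auto
        ultimately show "a \<in> {a \<in> set ?A. a \<in> ?N \<and> opp a \<in> set Xs}" using aA a by auto
      qed
    qed simp
    also have "\<dots> = (\<Sum>a\<in>{a \<in> arcs G. tail G a \<in> W \<and> head G a \<notin> W}. boundary G a) - boundary G (opp h)"
      using hW h by (subst sum.remove[of "{a \<in> arcs G. tail G a \<in> W \<and> head G a \<notin> W}" "opp h"]) auto
    finally show ?thesis
      using cut_Prin[OF W] h by (simp add: boundary_opp)
  qed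
qed

text \<open>The correction in \<open>beta_nxt\<close> does not depend on the tree, so it cancels in
  differences of Bernardi divisors. This is why the choice of the arc at \<open>v\<close> is
  immaterial.\<close>

lemma beta_same_vertex:
  assumes T: "stree T" "stree T'" and s: "s \<in> out_arcs G v" "s' \<in> out_arcs G v"
  shows "(beta s' T' - beta s' T) - (beta s T' - beta s T) \<in> Prin G"
proof -
  have "cyclic_on nxt (out_arcs G v)" using s by (intro nxt_cyclic) auto
  then have orb: "s' \<in> orbit nxt s" using s by (auto simp: cyclic_on_alldef)
  have sh: "(beta (nxt h) T' - beta (nxt h) T) - (beta h T' - beta h T) \<in> Prin G" if "h \<in> arcs G" for h
    using Prin_diff[OF beta_nxt[OF T(2) that] beta_nxt[OF T(1) that]] by (simp add: algebra_simps)
  have "s' \<in> arcs G \<and> ?thesis"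
    using orb
  proof (induction rule: orbit.induct)
    case base
    then show ?case using sh[of s] s nxt_out_arcs[OF s(1)] by auto
  next
    case (step h)
    then have h: "h \<in> arcs G" "(beta h T' - beta h T) - (beta s T' - beta s T) \<in> Prin G" by auto
    show ?case
      using Prin_add[OF sh[OF h(1)] h(2)] nxt_out_arcs[of h "tail G h"] h(1) by (simp add: algebra_simps)
  qed
  then show ?thesis by blast
qed

end

section \<open>Orientations and injectivity of the Bernardi map\<close>

context loopless_ribbon_graph
begin

text \<open>The orientation behind the Bernardi divisor: tree edges point away from the start of the tour,
  and the other edges point to the end at which they are cut first.\<close>

definition orient :: "'b set \<Rightarrow> 'b list \<Rightarrow> 'b set" where
  "orient T M = {a \<in> arcs G. if a \<in> T then bef M a (opp a) else bef M (opp a) a}"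

definition ind :: "'b set \<Rightarrow> 'b \<Rightarrow> int" where
  "ind Q a = (if a \<in> Q then 1 else 0)"

lemma orient_opp:
  assumes T: "stree T" and e: "e \<in> arcs G" and a: "a \<in> arcs G"
  shows "opp a \<in> orient T (tour T e) \<longleftrightarrow> a \<notin> orient T (tour T e)"
  using a set_tour[OF T e] bef_iff[OF distinct_tour[OF T e], of a "opp a"] stree_opp_iff[OF T, of a]
  by (auto simp: orient_def)

lemma ind_opp:
  "stree T \<Longrightarrow> e \<in> arcs G \<Longrightarrow> a \<in> arcs G \<Longrightarrow>
    ind (orient T (tour T e)) (opp a) = 1 - ind (orient T (tour T e)) a"
  using orient_opp[of T e a] by (auto simp: ind_def)

text \<open>The tour comes back over a tree edge only after finishing the side beyond it, so its
  start lies on the side from which the edge is traversed first.\<close>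

lemma forward_iff_towards:
  assumes T: "stree T" and e: "e \<in> arcs G" and a: "a \<in> T"
  shows "bef (tour T e) a (opp a) \<longleftrightarrow> towards T (tail G e) (opp a)"
proof -
  let ?M = "tour T e"
  have imp: "towards T (tail G e) (opp a)" if a: "a \<in> T" "bef ?M a (opp a)" for a
  proof -
    have aG: "a \<in> arcs G" "opp a \<in> T" using a T stree_arcs stree_opp_iff by auto
    obtain P Ys R where M: "?M = P @ a # Ys @ opp a # R"
      using bef_split[OF a(2)] .
    have "cyc (tau T) (a # Ys @ opp a # (R @ P))"
      using cyc_tour[OF T e] cyc_rotate[of "tau T" P "a # Ys @ opp a # R"] unfolding M by simp
    note s = tour_sides(1)[OF T a(1) this]
    have "e \<in> set (a # R @ P)"
      using hd_tour(1)[of T e] unfolding M by (cases P) auto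
    then have "(tail G a, tail G e) \<in> conn (T - edge a)"
      unfolding s by simp
    then show ?thesis
      using aG by (simp add: towards_def)
  qed
  have aG: "a \<in> arcs G" "opp a \<in> T" using a T stree_arcs stree_opp_iff by auto
  show ?thesis
  proof
    assume "towards T (tail G e) (opp a)"
    then have t: "(tail G a, tail G e) \<in> conn (T - edge a)"
      using aG by (simp add: towards_def)
    show "bef ?M a (opp a)"
    proof (rule ccontr)
      assume "\<not> bef ?M a (opp a)"
      then have "bef ?M (opp a) a"
        using bef_iff[OF distinct_tour[OF T e], of a "opp a"] set_tour[OF T e] aG by auto
      then have "towards T (tail G e) a" using imp[of "opp a"] aG by simp
      then show False
        using t stree_sides_disj[OF T a] by (auto simp: towards_def)
    qed
  qed (rule imp[OF a])
qed

lemma bdl_chords: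
  assumes "distinct M"
  shows "bdl N M = (\<Sum>a\<in>{a \<in> set M. a \<in> N \<and> bef M a (opp a)}. frag_of (tail G a))"
  using assms
proof (induction M)
  case (Cons b M)
  have "{a \<in> set (b # M). a \<in> N \<and> bef (b # M) a (opp a)} =
    (if b \<in> N \<and> opp b \<in> set M then {b} else {}) \<union> {a \<in> set M. a \<in> N \<and> bef M a (opp a)}"
    using Cons.prems by (auto dest: bef_mem)
  moreover have "b \<notin> {a \<in> set M. a \<in> N \<and> bef M a (opp a)}" using Cons.prems by auto
  ultimately show ?case using Cons by auto
qed simp

lemma beta_keys:
  assumes T: "stree T" and e: "e \<in> arcs G"
  shows "Poly_Mapping.keys (beta e T) \<subseteq> verts G"
proof
  fix v assume "v \<in> Poly_Mapping.keys (beta e T)"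
  then have "lk (beta e T) v \<noteq> 0" by (simp add: in_keys_iff)
  then obtain a where "a \<in> set (tour T e)" "lk (frag_of (tail G a)) v \<noteq> 0"
    unfolding beta_eq_bdl[OF T e] bdl_chords[OF distinct_tour[OF T e]] lookup_sum
    by (auto elim: sum.not_neutral_contains_not_neutral)
  then show "v \<in> verts G" using set_tour[OF T e] by (auto split: if_splits)
qed

text \<open>A chord is charged at the head of its orientation. The oriented tree has in-degree one
  at every vertex except the start, so the Bernardi divisor is the in-degree minus one away from the
  start.\<close>

lemma lookup_beta:
  assumes T: "stree T" and e: "e \<in> arcs G" and v: "v \<in> verts G"
  shows "lk (beta e T) v = (\<Sum>a\<in>in_arcs G v. ind (orient T (tour T e)) a) - (if v = tail G e then 0 else 1)"
proof -
  let ?M = "tour T e" and ?q = "tail G e"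
  have M: "distinct ?M" "set ?M = arcs G" using distinct_tour[OF T e] set_tour[OF T e] by auto
  have q: "?q \<in> verts G" using e by simp
  have "lk (beta e T) v = (\<Sum>a\<in>{a \<in> arcs G. a \<notin> T \<and> bef ?M a (opp a)}. if tail G a = v then 1 else 0)"
    unfolding beta_eq_bdl[OF T e] bdl_chords[OF M(1)] lookup_sum M(2) by (intro sum.cong) auto
  also have "\<dots> = (\<Sum>a\<in>{a \<in> out_arcs G v. a \<notin> T \<and> bef ?M a (opp a)}. 1)"
    by (intro sum.mono_neutral_cong_right) auto
  also have "\<dots> = (\<Sum>a\<in>{a \<in> in_arcs G v. a \<notin> T \<and> a \<in> orient T ?M}. 1)"
    by (rule sum.reindex_bij_witness[of _ opp opp]) (auto simp: orient_def stree_opp_iff[OF T])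
  finally have chord: "lk (beta e T) v = (\<Sum>a\<in>{a \<in> in_arcs G v. a \<notin> T \<and> a \<in> orient T ?M}. 1)" .
  have "{a \<in> in_arcs G v. a \<in> T \<and> a \<in> orient T ?M} = (if v = ?q then {} else {opp (tree_rotors G T ?q v)})"
  proof -
    have iff: "a \<in> orient T ?M \<longleftrightarrow> towards T ?q (opp a)" if "a \<in> T" for a
      using forward_iff_towards[OF T e that] that stree_arcs[OF T that] by (simp add: orient_def)
    show ?thesis
    proof (cases "v = ?q")
      case True
      have "\<not> towards T ?q (opp a)" if "a \<in> T" "head G a = ?q" for a
        using that bforest_bridge[OF stree_bforest[OF T] that(1)] stree_arcs[OF T that(1)]
        by (auto simp: towards_def)
      then show ?thesis using True iff by auto
    next
      case False
      note r = stree_rotor(1,2)[OF T v q False]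
      have rT: "tree_rotors G T ?q v \<in> T" using r(1) by (simp add: towards_def)
      have rG: "tree_rotors G T ?q v \<in> arcs G" using rT stree_arcs[OF T] by blast
      have "a = opp (tree_rotors G T ?q v)" if "a \<in> in_arcs G v" "a \<in> T" "a \<in> orient T ?M" for a
      proof -
        have "tree_rotors G T ?q v = opp a"
          using iff[OF that(2)] that by (intro stree_rotor(3)[OF T v q False]) auto
        then show ?thesis by simp
      qed
      moreover have "opp (tree_rotors G T ?q v) \<in> {a \<in> in_arcs G v. a \<in> T \<and> a \<in> orient T ?M}"
        using r rT rG iff[of "opp (tree_rotors G T ?q v)"] stree_opp_iff[OF T] by auto
      ultimately show ?thesis using False by auto
    qed
  qed
  then have tree: "(\<Sum>a\<in>{a \<in> in_arcs G v. a \<in> T \<and> a \<in> orient T ?M}. 1::int) = (if v = ?q then 0 else 1)"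
    by simp
  have "(\<Sum>a\<in>in_arcs G v. ind (orient T ?M) a) = (\<Sum>a\<in>{a \<in> in_arcs G v. a \<in> orient T ?M}. 1)"
    unfolding ind_def by (intro sum.mono_neutral_cong_right) auto
  also have "{a \<in> in_arcs G v. a \<in> orient T ?M} =
      {a \<in> in_arcs G v. a \<notin> T \<and> a \<in> orient T ?M} \<union> {a \<in> in_arcs G v. a \<in> T \<and> a \<in> orient T ?M}" by auto
  also have "(\<Sum>a\<in>{a \<in> in_arcs G v. a \<notin> T \<and> a \<in> orient T ?M} \<union> {a \<in> in_arcs G v. a \<in> T \<and> a \<in> orient T ?M}. 1::int) =
      (\<Sum>a\<in>{a \<in> in_arcs G v. a \<notin> T \<and> a \<in> orient T ?M}. 1) + (\<Sum>a\<in>{a \<in> in_arcs G v. a \<in> T \<and> a \<in> orient T ?M}. 1)"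
    by (intro sum.union_disjoint) (auto simp: in_arcs_def)
  finally show ?thesis using chord tree by simp
qed

text \<open>An edge inside \<open>W\<close> contributes one to the in-degrees whichever way it is
  oriented, so only the arcs entering \<open>W\<close> matter.\<close>

lemma orient_boundary:
  assumes T: "stree T" "stree T'" and e: "e \<in> arcs G" and W: "W \<subseteq> verts G"
  shows "(\<Sum>v\<in>W. lk (beta e T) v - lk (beta e T') v) =
    (\<Sum>a\<in>{a \<in> arcs G. head G a \<in> W \<and> tail G a \<notin> W}. ind (orient T (tour T e)) a - ind (orient T' (tour T' e)) a)"
proof -
  let ?d = "\<lambda>a. ind (orient T (tour T e)) a - ind (orient T' (tour T' e)) a"
  let ?I = "{a \<in> arcs G. head G a \<in> W \<and> tail G a \<in> W}"
  let ?C = "{a \<in> arcs G. head G a \<in> W \<and> tail G a \<notin> W}"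
  have fW: "finite W" using W finite_verts by (rule finite_subset)
  have "(\<Sum>v\<in>W. lk (beta e T) v - lk (beta e T') v) = (\<Sum>v\<in>W. \<Sum>a\<in>in_arcs G v. ?d a)"
    using lookup_beta[OF T(1) e] lookup_beta[OF T(2) e] W
    by (intro sum.cong) (auto simp: sum_subtractf)
  also have "\<dots> = (\<Sum>a\<in>(\<Union>v\<in>W. in_arcs G v). ?d a)"
    by (rule sum.UNION_disjoint[symmetric]) (use fW in auto)
  also have "(\<Union>v\<in>W. in_arcs G v) = ?I \<union> ?C" by auto
  also have "(\<Sum>a\<in>?I \<union> ?C. ?d a) = (\<Sum>a\<in>?I. ?d a) + (\<Sum>a\<in>?C. ?d a)"
    by (rule sum.union_disjoint) auto
  also have "(\<Sum>a\<in>?I. ?d a) = 0"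
  proof -
    have "(\<Sum>a\<in>?I. ?d a) = (\<Sum>a\<in>?I. ?d (opp a))"
      by (rule sum.reindex_bij_witness[of _ opp opp]) auto
    also have "\<dots> = - (\<Sum>a\<in>?I. ?d a)"
      unfolding sum_negf[symmetric] using T e by (intro sum.cong) (auto simp: ind_opp)
    finally show ?thesis by simp
  qed
  finally show ?thesis by simp
qed

text \<open>Along the tree path from the start of the tour to \<open>v\<close> all arcs are oriented
  away from the start, and somewhere this path leaves \<open>S\<close>.\<close>

lemma orient_cut:
  assumes T: "stree T" and e: "e \<in> arcs G" and v: "v \<in> verts G" "v \<notin> S" and q: "tail G e \<in> S"
  obtains a where "a \<in> orient T (tour T e)" "tail G a \<in> S" "head G a \<notin> S"
proof -
  let ?q = "tail G e"
  let ?f = "\<lambda>v. head G (tree_rotors G T ?q v)"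
  have qV: "?q \<in> verts G" using e by simp
  obtain n where n: "(?f ^^ n) v = ?q"
    using stree_rotor(4)[OF T v(1) qV] v q by auto
  have "(?f ^^ i) v \<in> verts G" if "\<And>j. j < i \<Longrightarrow> (?f ^^ j) v \<noteq> ?q" for i
    using that
  proof (induction i)
    case (Suc i)
    let ?x = "(?f ^^ i) v"
    have "?x \<in> verts G" "?x \<noteq> ?q" using Suc.IH Suc.prems by (simp_all add: less_SucI)
    then have "tree_rotors G T ?q ?x \<in> arcs G"
      using stree_rotor(1)[OF T _ qV, of ?x] stree_arcs[OF T] by (auto simp: towards_def)
    then show ?case by simp
  qed (use v in simp)
  note inV = this
  have "\<exists>w. w \<in> verts G \<and> w \<noteq> ?q \<and> w \<notin> S \<and> ?f w \<in> S"
  proof -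
    define n0 where "n0 = (LEAST n. (?f ^^ n) v \<in> S)"
    have "(?f ^^ n) v \<in> S" using n q by simp
    then have "(?f ^^ n0) v \<in> S" unfolding n0_def by (rule LeastI)
    moreover have "(?f ^^ j) v \<notin> S" if "j < n0" for j
      using not_less_Least[OF that[unfolded n0_def]] .
    ultimately have n0: "(?f ^^ n0) v \<in> S" "\<And>j. j < n0 \<Longrightarrow> (?f ^^ j) v \<notin> S" by blast+
    then obtain m where m: "n0 = Suc m" using v(2) by (cases n0) auto
    have "(?f ^^ m) v \<in> verts G" using n0(2) m q by (intro inV) (metis less_SucI)
    then show ?thesis using n0(1) n0(2)[of m] m q by (intro exI[of _ "(?f ^^ m) v"]) auto
  qed
  then obtain w where w: "w \<in> verts G" "w \<noteq> ?q" "w \<notin> S" "?f w \<in> S" by blast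
  note r = stree_rotor(1,2)[OF T w(1) qV w(2)]
  let ?b = "tree_rotors G T ?q w"
  have bT: "?b \<in> T" using r(1) by (simp add: towards_def)
  have bG: "?b \<in> arcs G" using bT stree_arcs[OF T] by blast
  have "opp ?b \<in> orient T (tour T e)"
    using forward_iff_towards[OF T e, of "opp ?b"] bT bG r(1) stree_opp_iff[OF T] by (simp add: orient_def)
  then show thesis using that[of "opp ?b"] w r bG by simp
qed

text \<open>Let \<open>U\<close> be the set where a potential of the difference is maximal. Summed
  over \<open>U\<close>, its Laplacian is at least the number of arcs entering \<open>U\<close>,
  whereas the in-degrees differ by at most this number. Equality orients all these arcs into
  \<open>U\<close> for \<open>T'\<close> and out of \<open>U\<close> for \<open>T\<close>. By
  \<open>orient_cut\<close>, applied to \<open>T'\<close> or to \<open>T\<close> according to the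
  place of the start, \<open>U\<close> must be everything and the difference vanishes.\<close>

lemma beta_class_inj:
  assumes T: "stree T" "stree T'" and e: "e \<in> arcs G" and P: "beta e T' - beta e T \<in> Prin G"
    and v: "v \<in> verts G"
  shows "lk (beta e T') v = lk (beta e T) v"
proof -
  let ?O = "orient T (tour T e)" and ?O' = "orient T' (tour T' e)"
  have q: "tail G e \<in> verts G" using e by simp
  obtain \<phi> where \<phi>: "\<And>v. v \<in> verts G \<Longrightarrow> lk (beta e T' - beta e T) v = lap \<phi> v"
    using P unfolding Prin_iff by blast
  define m where "m = Max (\<phi> ` verts G)"
  have ne: "verts G \<noteq> {}" using v by auto
  have le: "\<phi> v \<le> m" if "v \<in> verts G" for v
    unfolding m_def using that by (intro Max_ge) auto
  have "m \<in> \<phi> ` verts G" unfolding m_def using ne by (intro Max_in) auto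
  define U where "U = {v \<in> verts G. \<phi> v = m}"
  have U: "U \<subseteq> verts G" "U \<noteq> {}" using \<open>m \<in> \<phi> ` verts G\<close> by (auto simp: U_def)
  let ?C = "{a \<in> arcs G. head G a \<in> U \<and> tail G a \<notin> U}"
  have fU: "finite U" using U(1) finite_verts by (rule finite_subset)
  have "(\<Sum>v\<in>U. lap \<phi> v) = (\<Sum>v\<in>U. \<Sum>a\<in>in_arcs G v. m - \<phi> (tail G a))"
    unfolding lap_def sum_in_arcs by (intro sum.cong) (auto simp: U_def)
  also have "\<dots> = (\<Sum>a\<in>(\<Union>v\<in>U. in_arcs G v). m - \<phi> (tail G a))"
    by (rule sum.UNION_disjoint[symmetric]) (use fU in auto)
  also have "\<dots> = (\<Sum>a\<in>?C. m - \<phi> (tail G a))"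
    by (intro sum.mono_neutral_right) (auto simp: U_def)
  finally have 1: "(\<Sum>v\<in>U. lap \<phi> v) = (\<Sum>a\<in>?C. m - \<phi> (tail G a))" .
  have "(\<Sum>v\<in>U. lap \<phi> v) = (\<Sum>v\<in>U. lk (beta e T') v - lk (beta e T) v)"
    using \<phi> U(1) by (intro sum.cong) (auto simp: lookup_minus)
  also have "\<dots> = (\<Sum>a\<in>?C. ind ?O' a - ind ?O a)"
    by (rule orient_boundary[OF T(2,1) e U(1)])
  finally have 2: "(\<Sum>a\<in>?C. (m - \<phi> (tail G a)) - (ind ?O' a - ind ?O a)) = 0"
    using 1 by (simp add: sum_subtractf)
  have nonneg: "0 \<le> (m - \<phi> (tail G a)) - (ind ?O' a - ind ?O a)" if "a \<in> ?C" for a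
  proof -
    have "\<phi> (tail G a) < m" using le[of "tail G a"] that by (auto simp: U_def)
    then show ?thesis by (auto simp: ind_def)
  qed
  have C: "a \<in> ?O' \<and> a \<notin> ?O" if a: "a \<in> ?C" for a
  proof -
    have "(m - \<phi> (tail G a)) - (ind ?O' a - ind ?O a) = 0"
      using sum_nonneg_eq_0_iff[of ?C "\<lambda>a. (m - \<phi> (tail G a)) - (ind ?O' a - ind ?O a)"] nonneg 2 a by auto
    moreover have "\<phi> (tail G a) < m" using le[of "tail G a"] a by (auto simp: U_def)
    ultimately show ?thesis by (auto simp: ind_def split: if_splits)
  qed
  have "U = verts G"
  proof (rule ccontr)
    assume "U \<noteq> verts G"
    then obtain w where w: "w \<in> verts G" "w \<notin> U" using U(1) by blast
    show False
    proof (cases "tail G e \<in> U")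
      case True
      obtain a where a: "a \<in> ?O'" "tail G a \<in> U" "head G a \<notin> U"
        using orient_cut[OF T(2) e w True] .
      then have aG: "a \<in> arcs G" by (simp add: orient_def)
      have "opp a \<in> ?O'" using C[of "opp a"] a aG by auto
      then show False using orient_opp[OF T(2) e aG] a(1) by simp
    next
      case False
      obtain u where u: "u \<in> U" using U(2) by blast
      obtain a where a: "a \<in> ?O" "tail G a \<in> - U" "head G a \<notin> - U"
        using orient_cut[OF T(1) e, of u "- U"] u U(1) False by blast
      then have "a \<in> arcs G" by (simp add: orient_def)
      then show False using C[of a] a by auto
    qed
  qed
  then have "\<phi> u = m" if "u \<in> verts G" for u using that by (auto simp: U_def)
  then have "lap \<phi> v = 0" using v by (simp add: lap_def)
  then show ?thesis using \<phi>[OF v] by (simp add: lookup_minus)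
qed

text \<open>At the first edge \<open>a\<close> on which two trees with the same Bernardi divisor differ, the two
  orientations disagree. An edge that balances this at the far side of \<open>a\<close> must have been cut
  before \<open>a\<close>, so the orientations agree on it.\<close>

lemma beta_eq_imp_prefix_eq:
  assumes T: "stree T" "stree T'" and e: "e \<in> arcs G"
    and eq: "\<And>v. v \<in> verts G \<Longrightarrow> lk (beta e T') v = lk (beta e T) v"
    and M: "tour T e = P @ a # R" "tour T' e = P @ a # R'"
    and agree: "\<And>b. b \<in> set P \<Longrightarrow> b \<in> T \<longleftrightarrow> b \<in> T'"
    and a: "a \<in> T" "a \<notin> T'"
  shows False
proof -
  let ?O = "orient T (tour T e)" and ?O' = "orient T' (tour T' e)"
  have aG: "a \<in> arcs G" using T a stree_arcs by blast
  have oaP: "opp a \<notin> set P" using agree[of "opp a"] a stree_opp_iff[OF T(1)] stree_opp_iff[OF T(2)] by auto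
  have all: "set (P @ a # R) = arcs G" "set (P @ a # R') = arcs G"
    using set_tour[OF T(1) e] set_tour[OF T(2) e] M by auto
  have dis: "distinct (P @ a # R)" "distinct (P @ a # R')"
    using distinct_tour[OF T(1) e] distinct_tour[OF T(2) e] M by auto
  have oa: "opp a \<in> set (P @ a # R)" "opp a \<in> set (P @ a # R')" unfolding all using aG by auto
  have "opp a \<in> set R" "opp a \<in> set R'" using oaP aG oa by auto
  \<comment> \<open>In \<open>T\<close> the arc is traversed here away from the start; in
    \<open>T'\<close> it is a chord cut here for the first time, hence oriented the other
    way.\<close>
  then have aO: "a \<in> ?O" "a \<notin> ?O'"
    unfolding orient_def M using a aG dis oaP by (auto dest: bef_mem)
  obtain Ys Q where R: "R = Ys @ opp a # Q" using \<open>opp a \<in> set R\<close> by (meson split_list)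
  have L: "cyc (tau T) (a # Ys @ opp a # (Q @ P))"
    using cyc_tour[OF T(1) e] cyc_rotate[of "tau T" P "a # Ys @ opp a # Q"] unfolding M R by simp
  note sides = tour_sides[OF T(1) a(1) L]
  define W where "W = {v \<in> verts G. (head G a, v) \<in> conn (T - edge a)}"
  have W: "W \<subseteq> verts G" by (auto simp: W_def)
  have tailW: "tail G b \<in> W \<longleftrightarrow> b \<in> set (opp a # Ys)" if "b \<in> arcs G" for b
    unfolding sides(2) using that by (auto simp: W_def)
  have hW: "head G a \<in> W" "tail G a \<notin> W"
    using aG bforest_bridge'[OF stree_bforest[OF T(1)] a(1)] by (auto simp: W_def)
  let ?C = "{b \<in> arcs G. head G b \<in> W \<and> tail G b \<notin> W}"
  have "(\<Sum>v\<in>W. lk (beta e T) v - lk (beta e T') v) = 0"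
    using eq W by (intro sum.neutral) auto
  then have "(\<Sum>b\<in>?C. ind ?O b - ind ?O' b) = 0"
    using orient_boundary[OF T e W] by simp
  moreover have "(\<Sum>b\<in>?C. ind ?O b - ind ?O' b) > 0"
  proof (rule sum_pos2[of ?C a])
    show "finite ?C" "a \<in> ?C" using aG hW by auto
    show "0 < ind ?O a - ind ?O' a" using aO by (simp add: ind_def)
    fix b assume b: "b \<in> ?C"
    show "0 \<le> ind ?O b - ind ?O' b"
    proof (rule ccontr)
      assume "\<not> ?thesis"
      then have bO: "b \<in> ?O'" "b \<notin> ?O" by (auto simp: ind_def split: if_splits)
      then have bG: "b \<in> arcs G" by (simp add: orient_def)
      have ob: "opp b \<in> ?O" using orient_opp[OF T(1) e bG] bO by simp
      have "b \<noteq> a" using bO aO by auto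
      have obY: "opp b \<in> set Ys" using tailW[of "opp b"] b bG \<open>b \<noteq> a\<close> by auto
      have bn: "b \<notin> set (opp a # Ys)" using tailW[OF bG] b by auto
      have "b \<notin> T"
      proof
        assume "b \<in> T"
        then have "b \<in> T - edge a" using \<open>b \<noteq> a\<close> bn by auto
        then have "(head G b, tail G b) \<in> conn (T - edge a)"
          using conn_arc conn_sym[OF oppclosed_diff_edge[OF stree_oppclosed[OF T(1)]]] by blast
        moreover have "(head G a, head G b) \<in> conn (T - edge a)" using b by (simp add: W_def)
        ultimately have "(head G a, tail G b) \<in> conn (T - edge a)" using conn_trans by blast
        then show False using b bG by (simp add: W_def)
      qed
      then have bb: "bef (P @ a # Ys @ opp a # Q) b (opp b)"
        using ob stree_opp_iff[OF T(1)] unfolding orient_def M R by auto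
      have "opp b \<notin> set P" "opp b \<notin> set Q" "opp b \<noteq> opp a" "opp b \<noteq> a"
        using dis(1) obY unfolding R by auto
      then have bP: "b \<in> set P"
        using bb bn \<open>b \<noteq> a\<close> by (auto dest: bef_mem)
      have "b \<notin> T'" using agree[OF bP] \<open>b \<notin> T\<close> by simp
      moreover have "opp b \<in> set (P @ a # R')" unfolding all using bG by simp
      then have "bef (P @ a # R') b (opp b)"
        using bP \<open>opp b \<notin> set P\<close> by auto
      ultimately have "opp b \<in> ?O'"
        using bG stree_opp_iff[OF T(2)] unfolding orient_def M by auto
      then show False using orient_opp[OF T(2) e bG] bO(1) by simp
    qed
  qed
  ultimately show False by simp
qed

text \<open>A step of the tour depends only on whether the current arc belongs to the tree. So the
  two tours coincide up to the first arc on which the trees differ, and the prefix lemma applies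
  with the trees in one order or the other.\<close>

lemma beta_inj:
  assumes T: "stree T" "stree T'" and e: "e \<in> arcs G" and P: "beta e T' - beta e T \<in> Prin G"
  shows "T' = T"
proof (rule ccontr)
  assume neq: "T' \<noteq> T"
  let ?M = "tour T e" and ?M' = "tour T' e"
  have M: "cyc (tau T) ?M" "cyc (tau T') ?M'" "set ?M = arcs G" "length ?M = length ?M'"
    using cyc_tour[OF T(1) e] cyc_tour[OF T(2) e] set_tour[OF T(1) e]
      distinct_card[OF distinct_tour[OF T(1) e]] distinct_card[OF distinct_tour[OF T(2) e]] set_tour[OF T(2) e]
    by auto
  have "\<exists>a\<in>arcs G. (a \<in> T) \<noteq> (a \<in> T')"
    using neq stree_arcs[OF T(1)] stree_arcs[OF T(2)] by blast
  then have "\<exists>k. k < length ?M \<and> (?M ! k \<in> T) \<noteq> (?M ! k \<in> T')"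
    using M(3) by (metis in_set_conv_nth)
  then obtain k where k: "k < length ?M" "(?M ! k \<in> T) \<noteq> (?M ! k \<in> T')"
    and least: "\<And>j. j < k \<Longrightarrow> (?M ! j \<in> T) = (?M ! j \<in> T')"
  proof -
    assume ex: "\<exists>k. k < length ?M \<and> (?M ! k \<in> T) \<noteq> (?M ! k \<in> T')"
    define k where "k = (LEAST k. k < length ?M \<and> (?M ! k \<in> T) \<noteq> (?M ! k \<in> T'))"
    have "k < length ?M \<and> (?M ! k \<in> T) \<noteq> (?M ! k \<in> T')"
      unfolding k_def by (rule LeastI_ex[OF ex])
    moreover have "(?M ! j \<in> T) = (?M ! j \<in> T')" if "j < k" for j
      using not_less_Least[OF that[unfolded k_def]] calculation that by auto
    ultimately show thesis using that by blast
  qed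
  have same: "?M' ! j = ?M ! j" if "j \<le> k" for j
    using that
  proof (induction j)
    case 0
    then show ?case by (simp add: tour_def)
  next
    case (Suc j)
    have "?M ! Suc j = tau T (?M ! j)" "?M' ! Suc j = tau T' (?M' ! j)"
      using cyc_nth[OF M(1), of j] cyc_nth[OF M(1), of "Suc j"]
        cyc_nth[OF M(2), of j] cyc_nth[OF M(2), of "Suc j"] Suc.prems k(1) M(4) by auto
    moreover have "tau T (?M ! j) = tau T' (?M ! j)"
      using least[of j] Suc.prems by (auto simp: tau_def)
    ultimately show ?case using Suc by simp
  qed
  define P where "P = take k ?M"
  have tk: "take k ?M' = P"
    unfolding P_def using same k(1) M(4) by (intro nth_equalityI) auto
  have e1: "?M = P @ ?M ! k # drop (Suc k) ?M"
    unfolding P_def using k(1) by (rule id_take_nth_drop)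
  have e2: "?M' = P @ ?M ! k # drop (Suc k) ?M'"
    using id_take_nth_drop[of k ?M'] tk same[of k] k(1) M(4) by simp
  have ag: "b \<in> T \<longleftrightarrow> b \<in> T'" if "b \<in> set P" for b
    using that least k(1) by (auto simp: P_def in_set_conv_nth)
  have eq: "lk (beta e T') v = lk (beta e T) v" if "v \<in> verts G" for v
    by (rule beta_class_inj[OF T e P that])
  show False
  proof (cases "?M ! k \<in> T")
    case True
    then show ?thesis
      using beta_eq_imp_prefix_eq[OF T e eq e1 e2 ag] k(2) by blast
  next
    case False
    then show ?thesis
      using beta_eq_imp_prefix_eq[OF T(2,1) e eq[symmetric] e2 e1 ag[symmetric]] k(2) by blast
  qed
qed

text \<open>Injectivity and constant degree are specific to the Bernardi divisors; the existence of
  translates is inherited from the rotor divisors with sink \<open>tail G e\<close> by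
  counting.\<close>

lemma torsorial_beta:
  assumes e: "e \<in> arcs G"
  shows "torsorial (beta e)"
proof (rule torsorial_transfer[OF torsorial_rotor_J[of "tail G e"]])
  fix T T' assume T: "stree T" "stree T'"
  show "beta e T' - beta e T \<in> Prin G \<Longrightarrow> T' = T" by (rule beta_inj[OF T e])
  have "(\<Sum>v\<in>verts G. lk (beta e T') v - lk (beta e T) v) = 0"
    unfolding orient_boundary[OF T(2,1) e subset_refl] by (intro sum.neutral) auto
  then show "beta e T' - beta e T \<in> carrier (Div0 G)"
    using beta_keys[OF T(1) e] beta_keys[OF T(2) e] keys_sub[of "beta e T'" "beta e T"]
    by (auto simp: mem_Div0 lookup_minus)
qed (use e in simp)

lemma bernardi_torsor_eq: "bernardi_torsor G opp nxt v = act (beta (SOME e. e \<in> out_arcs G v))"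
  unfolding bernardi_torsor_def bernardi_torsor_at_def act_def ..

text \<open>Agreement turned into a relation between routing and Bernardi divisors. The arc chosen
  in the torsor is replaced by an arbitrary arc \<open>s\<close> at \<open>y\<close> by means of
  \<open>beta_same_vertex\<close>.\<close>

lemma agree_route:
  assumes agree: "bernardi_torsor G opp nxt y = rotor_torsor G opp nxt y"
    and s: "s \<in> out_arcs G y" and x: "x \<in> verts G - {y}" and T: "stree T"
  shows "beta s (rotor_route G opp nxt y x T) - beta s T - (frag_of x - frag_of y) \<in> Prin G"
proof -
  define e where "e = (SOME e. e \<in> out_arcs G y)"
  have e: "e \<in> out_arcs G y" unfolding e_def by (rule someI[of _ s]) (rule s)
  have y: "y \<in> verts G" using s by auto
  let ?c = "Prin G #>\<^bsub>Div0 G\<^esub> (frag_of x - frag_of y)"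
  note r = rotor_torsor_route[OF y x T] rotor_route_J(1)[OF y x T]
  have "act (beta e) ?c T = rotor_route G opp nxt y x T"
    using agree r(1) unfolding bernardi_torsor_eq e_def by simp
  then have "beta e (rotor_route G opp nxt y x T) - beta e T - (frag_of x - frag_of y) \<in> Prin G"
    using act_coset_iff(2)[OF torsorial_beta Div0_frag_diff T, of e x y] e x y by auto
  from Prin_add[OF beta_same_vertex[OF T r(2) e s] this] show ?thesis
    by (simp add: algebra_simps)
qed

end

section \<open>Turning a rotor over several branches\<close>

context loopless_ribbon_graph
begin

text \<open>The rotor at \<open>u\<close> does not belong to the edge of \<open>e\<close>, so
  deleting it does not separate the two ends of \<open>e\<close>.\<close>

lemma rotors_adjacent:
  assumes T: "stree T" and e: "e \<in> T" and u: "u \<in> verts G" "u \<noteq> tail G e" "u \<noteq> head G e"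
  shows "tree_rotors G T (tail G e) u = tree_rotors G T (head G e) u"
proof -
  have eG: "e \<in> arcs G" using T e stree_arcs by blast
  have xy: "tail G e \<in> verts G" "head G e \<in> verts G" using eG by auto
  let ?a = "tree_rotors G T (tail G e) u"
  note r = stree_rotor(1,2)[OF T u(1) xy(1) u(2)]
  have "?a \<noteq> e" "?a \<noteq> opp e" using r(2) u eG by auto
  then have "e \<noteq> ?a \<and> e \<noteq> opp ?a" by (metis arev_arev)
  then have "e \<in> T - edge ?a" using e by auto
  then have "(tail G e, head G e) \<in> conn (T - edge ?a)" by (rule conn_arc)
  then have "towards T (head G e) ?a"
    using r(1) conn_trans by (auto simp: towards_def)
  then show ?thesis
    using stree_rotor(3)[OF T u(1) xy(2) u(3) _ r(2)] by simp
qed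

lemma cyc_successively: "cyc f L \<Longrightarrow> successively (\<lambda>a b. f a = b) L"
proof (induction L rule: rev_induct)
  case (snoc b L)
  show ?case
  proof (cases L rule: rev_cases)
    case (snoc L' a)
    have "successively (\<lambda>a b. f a = b) (xs @ [a])" if "cyc f (xs @ a # ys)" for xs a ys
      using that
    proof (induction xs arbitrary: a ys rule: rev_induct)
      case (snoc c xs)
      then have "successively (\<lambda>a b. f a = b) (xs @ [c])" "f c = a"
        using cyc_step[of f xs c a ys] by auto
      then show ?case by (simp add: successively_append_iff)
    qed simp
    then show ?thesis using snoc.prems by simp
  qed simp
qed simp

text \<open>The new tour only moves \<open>e\<close> to its end, and a tree arc carries no
  chip.\<close>

lemma beta_tree_step:
  assumes T: "stree T" and e: "e \<in> T"
  shows "beta (nxt (opp e)) T = beta e T"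
proof -
  have eG: "e \<in> arcs G" "opp e \<in> T" using T e stree_arcs stree_opp_iff by auto
  obtain L where L: "tour T e = e # L" by (simp add: tour_def)
  note c = cyc_tour[OF T eG(1), unfolded L]
  have oL: "opp e \<in> set L"
    using set_tour[OF T eG(1)] eG unfolding L by (metis arev_in_arcs opp_neq(1) set_ConsD)
  then obtain b L' where L': "L = b # L'" by (cases L) auto
  have b: "nxt (opp e) = b" using c e by (simp add: cyc_Cons L' tau_def)
  have "b \<in> arcs G" using set_tour[OF T eG(1)] by (auto simp: L L')
  moreover have "cyc (tau T) (L @ [e])" using cyc_rotate[of "tau T" "[e]" L] c by simp
  ultimately have t: "tour T b = L @ [e]"
    using tour_eqI[OF T] by (simp add: L')
  have "{a \<in> set L. a \<in> chords T \<and> opp a \<in> set [e]} = {}"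
    using eG by auto
  then have "cross (chords T) L [e] = 0" by (simp only: cross_def) simp
  moreover have "distinct (L @ [e])" using cyc_distinct[OF c] by simp
  ultimately show ?thesis
    unfolding b beta_eq_bdl[OF T \<open>b \<in> arcs G\<close>] beta_eq_bdl[OF T eG(1)] t L
    using e by (subst bdl_append) auto
qed

lemma beta_chain:
  assumes T: "stree T" and "successively (\<lambda>a b. nxt a = b) (fs @ [b])" "set (fs @ [b]) \<subseteq> arcs G" "distinct fs"
  shows "beta b T - beta (hd (fs @ [b])) T - (\<Sum>f\<in>set fs. boundary G f) \<in> Prin G"
  using assms(2-)
proof (induction fs)
  case (Cons f fs)
  let ?g = "hd (fs @ [b])"
  have "beta b T - beta ?g T - (\<Sum>f\<in>set fs. boundary G f) \<in> Prin G"
    using Cons by (auto simp: successively_Cons)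
  moreover have "nxt f = ?g" using Cons.prems by (cases fs) auto
  then have "beta ?g T - beta f T - boundary G f \<in> Prin G"
    using beta_nxt[OF T, of f] Cons.prems by auto
  ultimately have "(beta b T - beta ?g T - (\<Sum>f\<in>set fs. boundary G f)) + (beta ?g T - beta f T - boundary G f) \<in> Prin G"
    by (rule Prin_add)
  moreover have "(\<Sum>f\<in>set (f # fs). boundary G f) = boundary G f + (\<Sum>f\<in>set fs. boundary G f)"
    using Cons.prems by simp
  ultimately show ?case by (simp add: algebra_simps)
qed simp

end

text \<open>The last assumption says that arcs leave the branch beyond \<open>e\<close> only towards
  \<open>x\<close>. A chip can therefore pass between \<open>W\<close> and the other branches
  \<open>K\<close> only through \<open>x\<close>.\<close>

locale branch_edge = loopless_ribbon_graph G opp nxt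
  for G :: "('a, 'b) pre_digraph" and opp nxt :: "'b \<Rightarrow> 'b" +
  fixes T :: "'b set" and e :: 'b
  assumes tree: "stree T" and eT: "e \<in> T"
    and branch: "\<And>a. a \<in> arcs G \<Longrightarrow> (head G e, tail G a) \<in> conn (T - edge e) \<Longrightarrow>
      (head G e, head G a) \<in> conn (T - edge e) \<or> head G a = tail G e"
begin

abbreviation x :: 'a where "x \<equiv> tail G e"
abbreviation y :: 'a where "y \<equiv> head G e"

definition W :: "'a set" where "W = {v \<in> verts G. (y, v) \<in> conn (T - edge e)}"
definition K :: "'a set" where "K = verts G - W - {x}"

lemma eG: "e \<in> arcs G" using tree eT stree_arcs by blast

lemma oeT: "opp e \<in> T" using tree eT stree_opp_iff by blast

lemma xyV: "x \<in> verts G" "y \<in> verts G" using eG by auto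

lemma yW: "y \<in> W" and xW: "x \<notin> W"
  using bforest_bridge'[OF stree_bforest[OF tree] eT] xyV by (auto simp: W_def)

lemma xy: "x \<noteq> y" using yW xW by auto

lemma W_step: "a \<in> arcs G \<Longrightarrow> tail G a \<in> W \<Longrightarrow> head G a \<in> W \<or> head G a = x"
  using branch[of a] by (auto simp: W_def)

lemma K_step: "a \<in> arcs G \<Longrightarrow> tail G a \<in> K \<Longrightarrow> head G a \<in> K \<or> head G a = x"
  using W_step[of "opp a"] by (auto simp: K_def)

lemma W_sub: "W \<subseteq> verts G" by (auto simp: W_def)

lemma W_tree_step: "a \<in> T - edge e \<Longrightarrow> tail G a \<in> W \<Longrightarrow> head G a \<in> W"
  using conn_trans[OF _ conn_arc[of a "T - edge e"]] stree_arcs[OF tree, of a] unfolding W_def by auto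

definition same :: "'b set \<Rightarrow> bool" where
  "same U \<longleftrightarrow> stree U \<and> (\<forall>v\<in>W. tree_rotors G U x v = tree_rotors G T x v)"

lemma same_stree: "same U \<Longrightarrow> stree U"
  by (simp add: same_def)

lemma same_T: "same T" using tree by (simp add: same_def)

text \<open>Every tree edge is the rotor of one of its ends. For an edge that meets \<open>W\<close>
  this end lies in \<open>W\<close>, as no edge joins \<open>W\<close> to \<open>K\<close> and the
  root \<open>x\<close> has no rotor.\<close>

lemma same_iff:
  assumes U: "same U" and a: "tail G a \<in> W"
  shows "a \<in> U \<longleftrightarrow> a \<in> T"
proof -
  have dir: "a \<in> U'" if U: "same U" "same U'" and aU: "a \<in> U" for U U'
  proof -
    have UU: "stree U" "stree U'" using U by (auto simp: same_def)
    obtain u where u: "u \<in> verts G - {x}" "a = tree_rotors G U x u \<or> a = opp (tree_rotors G U x u)"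
      using aU tree_eq_rotors[OF UU(1) xyV(1)] by blast
    let ?r = "tree_rotors G U x u"
    have r: "?r \<in> U" "tail G ?r = u"
      using stree_rotor(1,2)[OF UU(1) _ xyV(1), of u] u(1) by (auto simp: towards_def)
    have rG: "?r \<in> arcs G" using r(1) stree_arcs[OF UU(1)] by blast
    have "u \<in> W"
    proof (rule ccontr)
      assume "u \<notin> W"
      then have "u \<in> K" using u(1) by (auto simp: K_def)
      then have "head G ?r \<notin> W" using K_step[OF rG] r(2) xW by (auto simp: K_def)
      then show False using a u(2) r(2) rG \<open>u \<notin> W\<close> by auto
    qed
    then have "?r = tree_rotors G U' x u" using U by (simp add: same_def)
    moreover have "tree_rotors G U' x u \<in> U'"
      using stree_rotor(1)[OF UU(2) _ xyV(1), of u] u(1) by (auto simp: towards_def)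
    ultimately show ?thesis using u(2) stree_opp_iff[OF UU(2)] by auto
  qed
  show ?thesis using dir[OF U same_T] dir[OF same_T U] by blast
qed

lemma same_e: "same U \<Longrightarrow> e \<in> U"
  using same_iff[of U "opp e"] yW eG oeT stree_opp_iff[of U e] same_stree by simp

text \<open>The rotors of \<open>U\<close> lead to \<open>y\<close> through \<open>x\<close>, except that the rotor at \<open>x\<close> is arbitrary.\<close>

definition nearly :: "'b set \<Rightarrow> ('a \<Rightarrow> 'b) \<Rightarrow> bool" where
  "nearly U R \<longleftrightarrow> same U \<and> (\<forall>v\<in>K. R v = tree_rotors G U x v) \<and> (\<forall>v\<in>W - {y}. R v = tree_rotors G T y v)"

text \<open>An arc into \<open>K\<close> sends the chip on a detour that comes back to
  \<open>x\<close> before \<open>y\<close> is reached. On \<open>K\<close> the rotors are those of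
  \<open>U\<close> with root \<open>x\<close>, so the detour is the routing of
  \<open>head G f\<close> with sink \<open>x\<close>; it leaves the rotors in \<open>W\<close>
  alone.\<close>

lemma excursion:
  assumes n: "nearly U R" and f: "nxt (R x) = f" "f \<in> out_arcs G x" "head G f \<in> K"
  shows "\<exists>R' k. (step ^^ k) (R, x) = (R', x) \<and> (\<forall>j<k. snd ((step ^^ j) (R, x)) \<noteq> y) \<and>
    R' x = f \<and> nearly (rotor_route G opp nxt x (head G f) U) R'"
proof -
  let ?w = "head G f" and ?\<rho> = "tree_rotors G U x" and ?R = "R(x := f)"
  have U: "stree U" using n by (simp add: nearly_def same_def)
  have wV: "?w \<in> verts G" using f(2) by auto
  have cfg: "rotor_config x ?\<rho> ?w" by (rule rotor_config_tree[OF U xyV(1) wV])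
  obtain k where k: "snd ((step ^^ k) (?\<rho>, ?w)) = x" "\<And>j. j < k \<Longrightarrow> snd ((step ^^ j) (?\<rho>, ?w)) \<noteq> x"
    "rotor_run x (?\<rho>, ?w) = (step ^^ k) (?\<rho>, ?w)"
    using rotor_runE[OF xyV(1) cfg] by blast
  \<comment> \<open>The chip starts in \<open>K\<close>, and the only exit from \<open>K\<close> is
    \<open>x\<close>, where the run with sink \<open>x\<close> stops.\<close>
  have inK: "snd ((step ^^ j) (?\<rho>, ?w)) \<in> K" if "j < k" for j
    using that
  proof (induction j)
    case (Suc j)
    obtain A p where A: "(step ^^ j) (?\<rho>, ?w) = (A, p)" by fastforce
    have p: "p \<in> K" using Suc A by simp
    have "rotor_config x A p"
      using rotor_config_funpow[OF cfg, of j] k(2) Suc.prems A by simp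
    then have "A p \<in> out_arcs G p" using p by (auto simp: rotor_config_def K_def)
    then have "nxt (A p) \<in> out_arcs G p" by (rule nxt_out_arcs)
    then have "head G (nxt (A p)) \<in> K \<or> head G (nxt (A p)) = x" using K_step p by auto
    moreover have "head G (nxt (A p)) \<noteq> x" using k(2)[OF Suc.prems] A by simp
    ultimately show ?case using A by simp
  qed (use f(3) in simp)
  have agree: "\<And>v. v \<in> K \<Longrightarrow> ?\<rho> v = ?R v"
    using n by (auto simp: nearly_def K_def)
  have sync: "snd ((step ^^ j) (?R, ?w)) = snd ((step ^^ j) (?\<rho>, ?w)) \<and>
    (\<forall>v\<in>K. fst ((step ^^ j) (?R, ?w)) v = fst ((step ^^ j) (?\<rho>, ?w)) v) \<and>
    (\<forall>v. v \<notin> K \<longrightarrow> fst ((step ^^ j) (?R, ?w)) v = ?R v \<and> fst ((step ^^ j) (?\<rho>, ?w)) v = ?\<rho> v)"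
    if "j \<le> k" for j
    using rotor_sync[of K ?\<rho> ?R j ?w] agree inK that by auto
  define R' where "R' = fst ((step ^^ k) (?R, ?w))"
  define U' where "U' = rotor_route G opp nxt x ?w U"
  have S1: "(step ^^ Suc j) (R, x) = (step ^^ j) (?R, ?w)" for j
    using f(1) by (simp add: funpow_Suc_right del: funpow.simps)
  have "(step ^^ Suc k) (R, x) = (R', x)"
    unfolding S1 R'_def using sync[of k] k(1) by (simp add: prod_eq_iff)
  moreover have "snd ((step ^^ j) (R, x)) \<noteq> y" if "j < Suc k" for j
  proof (cases j)
    case (Suc i)
    then have "snd ((step ^^ j) (R, x)) \<in> K"
      using S1[of i] sync[of i] inK[of i] that by simp
    then show ?thesis using yW by (auto simp: K_def)
  qed (use xy in simp)
  moreover have "R' x = f" using sync[of k] by (simp add: R'_def K_def)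
  moreover have "nearly U' R'"
  proof -
    note res = rotor_run_result[OF xyV(1) cfg, folded rotor_route_eq U'_def]
    have fin: "tree_rotors G U' x u = fst ((step ^^ k) (?\<rho>, ?w)) u" if "u \<in> verts G - {x}" for u
      using res(2)[OF that] k(3) by simp
    have "tree_rotors G U' x v = tree_rotors G T x v" if "v \<in> W" for v
    proof -
      have "v \<in> verts G - {x}" "v \<notin> K" using that xW W_sub by (auto simp: K_def)
      then have "tree_rotors G U' x v = ?\<rho> v" using fin sync[of k] by simp
      then show ?thesis using n that by (simp add: nearly_def same_def)
    qed
    moreover have "R' v = tree_rotors G U' x v" if "v \<in> K" for v
      using fin[of v] sync[of k] that by (simp add: R'_def K_def)
    moreover have "R' v = tree_rotors G T y v" if "v \<in> W - {y}" for v
    proof -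
      have "v \<notin> K" "v \<noteq> x" using that xW by (auto simp: K_def)
      then have "R' v = R v" using sync[of k] by (simp add: R'_def)
      then show ?thesis using n that by (simp add: nearly_def)
    qed
    ultimately show ?thesis using res(1) by (simp add: nearly_def same_def)
  qed
  ultimately show ?thesis unfolding U'_def by blast
qed

text \<open>Repeats \<open>excursion\<close> for consecutive arcs at \<open>x\<close>. By agreement
  at \<open>x\<close> each detour shifts the Bernardi class by the boundary of its first
  arc.\<close>

lemma excursions:
  assumes "nearly U R" "successively (\<lambda>a b. nxt a = b) (R x # fs)" "distinct fs"
    and "set fs \<subseteq> {f \<in> out_arcs G x. head G f \<in> K}"
    and agree: "bernardi_torsor G opp nxt x = rotor_torsor G opp nxt x"
  shows "\<exists>U' R' k. (step ^^ k) (R, x) = (R', x) \<and> (\<forall>j<k. snd ((step ^^ j) (R, x)) \<noteq> y) \<and>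
    R' x = last (R x # fs) \<and> nearly U' R' \<and>
    (\<forall>s\<in>out_arcs G x. beta s U' - beta s U - (\<Sum>f\<in>set fs. boundary G f) \<in> Prin G)"
  using assms(1-4)
proof (induction fs arbitrary: U R)
  case Nil
  then show ?case by (intro exI[of _ U] exI[of _ R] exI[of _ 0]) simp
next
  case (Cons f fs)
  have f: "nxt (R x) = f" "f \<in> out_arcs G x" "head G f \<in> K" using Cons.prems by auto
  let ?U = "rotor_route G opp nxt x (head G f) U"
  obtain R1 k1 where 1: "(step ^^ k1) (R, x) = (R1, x)" "\<And>j. j < k1 \<Longrightarrow> snd ((step ^^ j) (R, x)) \<noteq> y"
    "R1 x = f" "nearly ?U R1"
    using excursion[OF Cons.prems(1) f] by blast
  have U: "stree U" "stree ?U" using Cons.prems(1) 1(4) by (auto simp: nearly_def same_def)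
  obtain U' R' k where 2: "(step ^^ k) (R1, x) = (R', x)" "\<And>j. j < k \<Longrightarrow> snd ((step ^^ j) (R1, x)) \<noteq> y"
    "R' x = last (R1 x # fs)" "nearly U' R'"
    "\<And>s. s \<in> out_arcs G x \<Longrightarrow> beta s U' - beta s ?U - (\<Sum>f\<in>set fs. boundary G f) \<in> Prin G"
    using Cons.IH[OF 1(4)] Cons.prems 1(3) by auto
  have "(step ^^ (k + k1)) (R, x) = (R', x)" using 1(1) 2(1) by (simp add: funpow_add)
  moreover have "snd ((step ^^ j) (R, x)) \<noteq> y" if "j < k + k1" for j
  proof (cases "j < k1")
    case False
    then have "(step ^^ j) (R, x) = (step ^^ (j - k1)) (R1, x)"
      using funpow_add[of "j - k1" k1 step] 1(1) by simp
    then show ?thesis using 2(2)[of "j - k1"] False that by simp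
  qed (use 1(2) in blast)
  moreover have "beta s U' - beta s U - (\<Sum>f\<in>set (f # fs). boundary G f) \<in> Prin G"
    if s: "s \<in> out_arcs G x" for s
  proof -
    have "head G f \<in> verts G - {x}" using f by (auto simp: K_def)
    then have U1: "beta s ?U - beta s U - (frag_of (head G f) - frag_of x) \<in> Prin G"
      using agree_route[OF agree s _ U(1)] by blast
    have "(\<Sum>f\<in>set (f # fs). boundary G f) = boundary G f + (\<Sum>f\<in>set fs. boundary G f)"
      using Cons.prems by simp
    moreover have "boundary G f = frag_of (head G f) - frag_of x"
      using f by (simp add: boundary_def)
    ultimately have eq: "beta s U' - beta s U - (\<Sum>f\<in>set (f # fs). boundary G f) =
        (beta s U' - beta s ?U - (\<Sum>f\<in>set fs. boundary G f)) +
        (beta s ?U - beta s U - (frag_of (head G f) - frag_of x))"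
      by (simp add: algebra_simps)
    show ?thesis
      unfolding eq by (rule Prin_add[OF 2(5)[OF s] U1])
  qed
  ultimately show ?case using 2(3,4) 1(3) by (intro exI[of _ U'] exI[of _ R'] exI[of _ "k + k1"]) simp
qed

lemma nearly_T: "nearly T (tree_rotors G T y)"
  unfolding nearly_def
proof (intro conjI ballI same_T refl)
  fix v assume "v \<in> K"
  then have "v \<in> verts G" "v \<noteq> x" "v \<noteq> y" using yW by (auto simp: K_def)
  then show "tree_rotors G T y v = tree_rotors G T x v"
    using rotors_adjacent[OF tree eT] by simp
qed

lemma rotor_x: "tree_rotors G T y x = e"
  using stree_rotor(3)[OF tree xyV xy] eT by (auto simp: towards_def)

text \<open>When the chip re-enters \<open>W\<close> along \<open>e'\<close>, all rotors lead to
  \<open>y\<close> already, so they come from a tree. The rest of the routing is then a routing in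
  its own right, started at \<open>head G e'\<close>.\<close>

lemma final_turn:
  assumes n: "nearly U R" and e': "e' \<in> arcs G" "tail G e' = x" "head G e' \<in> W" "e' \<noteq> e"
    and cfg: "rotor_config y (R(x := e')) (head G e')"
  defines "U' \<equiv> U - edge e \<union> edge e'"
  shows "stree U'" "\<And>u. u \<in> verts G - {y} \<Longrightarrow> tree_rotors G U' y u = (R(x := e')) u"
proof -
  let ?R = "R(x := e')"
  have U: "stree U" using n by (simp add: nearly_def same_def)
  have RW: "?R v = tree_rotors G T y v" if "v \<in> W - {y}" for v
    using n that xW by (auto simp: nearly_def)
  have RK: "?R v = tree_rotors G U x v" if "v \<in> K" for v
    using n that by (auto simp: nearly_def K_def)
  \<comment> \<open>Inside \<open>W\<close> the rotors still form the branch of \<open>T\<close>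
    directed to \<open>y\<close>, because no detour has touched them.\<close>
  have W_y: "\<exists>n. ((\<lambda>v. head G (?R v)) ^^ n) v = y" if v: "v \<in> W" for v
  proof -
    have "\<exists>n. ((\<lambda>v. head G (tree_rotors G T y v)) ^^ n) v = y"
    proof (cases "v = y")
      case True
      then show ?thesis by (intro exI[of _ 0]) simp
    next
      case False
      then show ?thesis using stree_rotor(4)[OF tree _ xyV(2), of v] v W_sub by blast
    qed
    then obtain n where n: "((\<lambda>v. head G (tree_rotors G T y v)) ^^ n) v = y" by blast
    show ?thesis using n v
    proof (induction n arbitrary: v)
      case 0
      then show ?case by (intro exI[of _ 0]) simp
    next
      case (Suc n)
      show ?case
      proof (cases "v = y")
        case True
        then show ?thesis by (intro exI[of _ 0]) simp
      next
        case False
        let ?a = "tree_rotors G T y v"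
        have r: "?a \<in> T" "tail G ?a = v"
          using stree_rotor(1,2)[OF tree _ xyV(2) False] Suc.prems(2) W_sub by (auto simp: towards_def)
        then have "?a \<in> T - edge e" using False Suc.prems(2) xW eG by auto
        then have "head G ?a \<in> W" using W_tree_step r Suc.prems by simp
        moreover have "((\<lambda>v. head G (tree_rotors G T y v)) ^^ n) (head G ?a) = y"
          using Suc.prems(1) by (simp add: funpow_Suc_right del: funpow.simps)
        ultimately obtain m where "((\<lambda>v. head G (?R v)) ^^ m) (head G ?a) = y"
          using Suc.IH by blast
        then show ?thesis
          using RW[of v] False Suc.prems(2)
          by (intro exI[of _ "Suc m"]) (simp add: funpow_Suc_right del: funpow.simps fun_upd_apply)
      qed
    qed
  qed
  have reach: "\<exists>n. ((\<lambda>v. head G (?R v)) ^^ n) v = y" if v: "v \<in> verts G" for v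
  proof -
    have "\<exists>n. ((\<lambda>v. head G (?R v)) ^^ n) v \<in> {y, head G e'}"
      using cfg[unfolded rotor_config_def] v by (elim conjE) (rule bspec)
    then obtain n where n: "((\<lambda>v. head G (?R v)) ^^ n) v \<in> {y, head G e'}" by blast
    obtain m where "((\<lambda>v. head G (?R v)) ^^ m) (head G e') = y" using W_y[OF e'(3)] by blast
    then have "((\<lambda>v. head G (?R v)) ^^ n) v = y \<or> ((\<lambda>v. head G (?R v)) ^^ (m + n)) v = y"
      using n by (auto simp: funpow_add)
    then show ?thesis by blast
  qed
  have out: "\<And>v. v \<in> verts G - {y} \<Longrightarrow> ?R v \<in> out_arcs G v"
    using cfg unfolding rotor_config_def by blast
  \<comment> \<open>With root \<open>x\<close> the tree \<open>U\<close> has the rotor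
    \<open>opp e\<close> at \<open>y\<close>; with root \<open>y\<close> the new tree has the rotor
    \<open>e'\<close> at \<open>x\<close>. All other rotors are common to both.\<close>
  have VU: "verts G - {y} = insert x (K \<union> (W - {y}))" "verts G - {x} = insert y (K \<union> (W - {y}))"
    using xyV xy yW xW W_sub by (auto simp: K_def)
  have UT: "tree_rotors G U x v = tree_rotors G T x v" if "v \<in> W" for v
    using n that by (simp add: nearly_def same_def)
  have Txy: "tree_rotors G T x v = tree_rotors G T y v" if "v \<in> W - {y}" for v
    using rotors_adjacent[OF tree eT, of v] that W_sub xW by auto
  have R: "?R v = tree_rotors G U x v" if "v \<in> K \<union> (W - {y})" for v
    using that RW[of v] RK[of v] UT[of v] Txy[of v] by (auto simp del: fun_upd_apply)
  have "tree_rotors G U x y = opp e"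
    using stree_rotor(3)[OF U xyV(2,1) xy[symmetric], of "opp e"] same_e[of U] n eG stree_opp_iff[OF U, of e]
    by (auto simp: nearly_def towards_def)
  define Z where "Z = (\<Union>u\<in>K \<union> (W - {y}). {?R u, opp (?R u)})"
  have UZ: "U = edge e \<union> Z"
    using tree_eq_rotors[OF U xyV(1)] R \<open>tree_rotors G U x y = opp e\<close> unfolding VU Z_def
    by (auto simp: edge_def)
  have "e \<notin> {?R u, opp (?R u)} \<and> opp e \<notin> {?R u, opp (?R u)}" if u: "u \<in> K \<union> (W - {y})" for u
  proof -
    have "u \<noteq> x" "u \<noteq> y" "u \<in> verts G" using u xW yW W_sub by (auto simp: K_def)
    then have "?R u \<noteq> e" "?R u \<noteq> opp e" using out[of u] eG by auto
    then show ?thesis by (metis arev_arev insertE singletonD)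
  qed
  then have "e \<notin> Z" "opp e \<notin> Z" unfolding Z_def by blast+
  then have "U - edge e = Z" unfolding UZ edge_def by auto
  then have U': "U' = (\<Union>u\<in>verts G - {y}. {?R u, opp (?R u)})"
    unfolding U'_def VU Z_def by (auto simp: edge_def)
  show "stree U'"
    unfolding U' by (rule rotors_stree(1)[OF xyV(2) out reach])
  show "tree_rotors G U' y u = ?R u" if "u \<in> verts G - {y}" for u
    unfolding U' by (rule rotors_stree(2)[OF xyV(2) out reach that])
qed

end

section \<open>Bernardi divisors before and after an exchange of edges\<close>

context loopless_ribbon_graph
begin

lemma not_bef [simp]: "a \<notin> set L \<Longrightarrow> \<not> bef L a b" "b \<notin> set L \<Longrightarrow> \<not> bef L a b"
  by (auto dest: bef_mem)

text \<open>Between the block orders \<open>B A S1 S2\<close> and \<open>B S2 S1 A\<close> the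
  inverted pairs are \<open>S1 S2\<close>, \<open>A S1\<close> and \<open>A S2\<close>.\<close>

lemma bef_block_swap:
  assumes "distinct (B @ A @ S1 @ S2)" "a \<in> set (B @ A @ S1 @ S2)" "b \<in> set (B @ A @ S1 @ S2)"
  shows "bef (B @ A @ S1 @ S2) a b \<and> \<not> bef (B @ S2 @ S1 @ A) a b \<longleftrightarrow>
    a \<in> set S1 \<and> b \<in> set S2 \<or> a \<in> set A \<and> b \<in> set S1 \<union> set S2"
  using assms bef_mem[of B a b] bef_mem[of A a b] bef_mem[of S1 a b] bef_mem[of S2 a b]
  unfolding bef_append set_append Un_iff distinct_append disjoint_iff by (elim conjE) metis

text \<open>The old tour from \<open>e\<close> and the new tour from \<open>nxt (opp e)\<close>
  consist of the same four blocks in a different order. The old chord \<open>k\<close> is charged at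
  \<open>head G k\<close>, the new chord \<open>e\<close> at \<open>tail G e\<close>, and any other
  chord changes its end exactly if its ends lie in inverted blocks.\<close>

lemma beta_exchange:
  assumes T: "stree T" and e: "e \<in> T" and k: "k \<in> arcs G"
    and X: "cyc (tau (T - edge e)) (e # S1 @ k # S2)"
    and Y: "cyc (tau (T - edge e)) (opp e # B @ opp k # A)"
  defines "C \<equiv> arcs G - T - edge k"
  shows "beta (nxt (opp e)) (T - edge e \<union> edge k) - beta e T =
    frag_of (tail G e) - frag_of (head G k) +
    (\<Sum>a\<in>{a \<in> set S1. a \<in> C \<and> opp a \<in> set S2}. boundary G a) +
    (\<Sum>a\<in>{a \<in> set A. a \<in> C \<and> opp a \<in> set S1 \<union> set S2}. boundary G a)"
proof -
  let ?T' = "T - edge e \<union> edge k"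
  let ?M = "e # (B @ opp k # A) @ opp e # (S1 @ k # S2)"
  let ?M' = "B @ opp k # (S2 @ e # S1) @ k # A @ [opp e]"
  have eG: "e \<in> arcs G" "opp e \<in> T" using T e stree_arcs stree_opp_iff by auto
  have F: "bforest (T - edge e)" using T stree_bforest bforest_diff_edge by blast
  have "cyc (tau (T - edge e \<union> edge e)) ?M"
    using tour_join[OF F eG(1) bforest_bridge[OF stree_bforest[OF T] e] X Y] by simp
  then have cM: "cyc (tau T) ?M" using un_diff_edge[OF stree_oppclosed[OF T] e] by simp
  have tM: "tour T e = ?M" using tour_eqI[OF T eG(1) cM] .
  have T': "stree ?T'" by (rule tour_exchange(1)[OF T e k X Y])
  have "cyc (tau ?T') ((k # A @ [opp e]) @ (B @ opp k # (S2 @ e # S1)))"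
    using tour_exchange(2)[OF T e k X Y] by simp
  then have cM': "cyc (tau ?T') ?M'"
    using cyc_rotate[of "tau ?T'" "k # A @ [opp e]" "B @ opp k # (S2 @ e # S1)"] by simp
  have disM: "distinct ?M" "set ?M = arcs G"
    using distinct_tour[OF T eG(1)] set_tour[OF T eG(1)] tM by auto
  have disM': "distinct ?M'" using disM(1) by auto
  have setM': "set ?M' = arcs G" unfolding disM(2)[symmetric] by auto
  have kT: "k \<notin> T" "opp k \<notin> T"
  proof -
    have "(tail G k, head G k) \<notin> conn (T - edge e)"
    proof -
      have "k \<in> set (e # S1 @ k # S2)" "opp k \<in> set (opp e # B @ opp k # A)" by auto
      then have "(tail G e, tail G k) \<in> conn (T - edge e)" "(head G e, head G k) \<in> conn (T - edge e)"
        unfolding tour_set(1)[OF F eG(1) X] tour_set(1)[OF F arev_in_arcs[OF eG(1)] Y] using eG k by auto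
      then show ?thesis using stree_sides_disj[OF T e] conn_trans by blast
    qed
    moreover have "k \<noteq> e" "k \<noteq> opp e" using disM(1) by auto
    ultimately show "k \<notin> T" using conn_arc[of k "T - edge e"] by auto
    then show "opp k \<notin> T" using stree_opp_iff[OF T] by simp
  qed
  have nxe: "nxt (opp e) = hd ?M'"
  proof (cases B)
    case Nil
    then show ?thesis using cM e by (simp add: cyc_Cons tau_def)
  next
    case (Cons b B')
    then show ?thesis using cM e by (simp add: cyc_Cons tau_def)
  qed
  have nG: "nxt (opp e) \<in> arcs G" using nxt_out_arcs[of "opp e" "head G e"] eG by simp
  have tM': "tour ?T' (nxt (opp e)) = ?M'"
    using tour_eqI[OF T' nG, of "tl ?M'"] cM' nxe by (cases B) auto
  define Q where "Q M = {a \<in> C. bef M a (opp a)}" for M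
  have CG: "C \<subseteq> arcs G" by (auto simp: C_def)
  have oC: "opp a \<in> C \<longleftrightarrow> a \<in> C" for a
    using stree_opp_iff[OF T, of a] unfolding C_def by (auto simp: arev_eq_iff)
  have fin: "finite (Q M)" for M
    using CG finite_subset[OF _ finite_arcs, of "Q M"] by (auto simp: Q_def)
  have 1: "beta e T = frag_of (head G k) + (\<Sum>a\<in>Q ?M. frag_of (tail G a))"
  proof -
    have "{a \<in> set ?M. a \<in> chords T \<and> bef ?M a (opp a)} = insert (opp k) (Q ?M)"
    proof (intro equalityI subsetI)
      fix a assume a: "a \<in> {a \<in> set ?M. a \<in> chords T \<and> bef ?M a (opp a)}"
      have "\<not> bef ?M k (opp k)" using disM(1) by auto
      moreover have aa: "a \<in> chords T" "bef ?M a (opp a)" using a by blast+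
      ultimately have "a \<noteq> k" by blast
      then have "a = opp k \<or> a \<in> C" using aa(1) unfolding C_def by auto
      then show "a \<in> insert (opp k) (Q ?M)" using aa(2) unfolding Q_def by blast
    next
      fix a assume a: "a \<in> insert (opp k) (Q ?M)"
      have b: "bef ?M (opp k) (opp (opp k))" by simp
      have "a \<in> chords T \<and> bef ?M a (opp a)"
      proof (cases "a = opp k")
        case True
        have "opp k \<in> chords T" using kT k by simp
        then show ?thesis unfolding True using b by (rule conjI)
      next
        case False
        then have "a \<in> C" "bef ?M a (opp a)" using a by (auto simp: Q_def)
        then show ?thesis unfolding C_def by blast
      qed
      then show "a \<in> {a \<in> set ?M. a \<in> chords T \<and> bef ?M a (opp a)}"
        unfolding disM(2) by blast
    qed
    moreover have "opp k \<notin> Q ?M" by (auto simp: Q_def C_def)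
    ultimately show ?thesis
      unfolding beta_eq_bdl[OF T eG(1)] tM bdl_chords[OF disM(1)] using fin k by simp
  qed
  have 2: "beta (nxt (opp e)) ?T' = frag_of (tail G e) + (\<Sum>a\<in>Q ?M'. frag_of (tail G a))"
  proof -
    have ek: "e \<noteq> k" "e \<noteq> opp k" "opp e \<noteq> k" using disM(1) by auto
    have "{a \<in> set ?M'. a \<in> chords ?T' \<and> bef ?M' a (opp a)} = insert e (Q ?M')"
    proof (intro equalityI subsetI)
      fix a assume a: "a \<in> {a \<in> set ?M'. a \<in> chords ?T' \<and> bef ?M' a (opp a)}"
      have "\<not> bef ?M' (opp e) e" using disM'(1) by auto
      moreover have aa: "a \<in> chords ?T'" "bef ?M' a (opp a)" using a by blast+
      ultimately have "a \<noteq> opp e" by (metis arev_arev)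
      then have "a = e \<or> a \<in> C" using aa(1) unfolding C_def by auto
      then show "a \<in> insert e (Q ?M')" using aa(2) unfolding Q_def by blast
    next
      fix a assume a: "a \<in> insert e (Q ?M')"
      have b: "bef ?M' e (opp e)" by simp
      have "a \<in> chords ?T' \<and> bef ?M' a (opp a)"
      proof (cases "a = e")
        case True
        then show ?thesis using b eG ek by auto
      next
        case False
        then have "a \<in> C" "bef ?M' a (opp a)" using a by (auto simp: Q_def)
        then show ?thesis unfolding C_def by blast
      qed
      then show "a \<in> {a \<in> set ?M'. a \<in> chords ?T' \<and> bef ?M' a (opp a)}"
        unfolding setM' by blast
    qed
    moreover have "e \<notin> Q ?M'" using e by (auto simp: Q_def C_def)
    ultimately show ?thesis
      unfolding beta_eq_bdl[OF T' nG] tM' bdl_chords[OF disM'] using fin by simp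
  qed
  \<comment> \<open>The common chords that are charged at the other end in the new tour. Moving the
    chip across such a chord \<open>a\<close> adds \<open>boundary G a\<close>.\<close>
  define \<Delta> where "\<Delta> = Q ?M - Q ?M'"
  have flip: "bef M (opp a) a \<longleftrightarrow> \<not> bef M a (opp a)" if "a \<in> C" "distinct M" "set M = arcs G" for a M
    using bef_iff[OF that(2), of a "opp a"] that CG by auto
  have \<Delta>': "Q ?M' - Q ?M = opp ` \<Delta>"
  proof (intro equalityI subsetI)
    fix a assume a: "a \<in> Q ?M' - Q ?M"
    then have "a \<in> C" by (simp add: Q_def)
    then have "opp a \<in> \<Delta>"
      using a oC[of a] flip[OF _ disM, of a] flip[OF _ disM' setM', of a]
      unfolding \<Delta>_def Q_def Diff_iff mem_Collect_eq arev_arev by blast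
    then show "a \<in> opp ` \<Delta>" by (metis arev_arev imageI)
  next
    fix a assume "a \<in> opp ` \<Delta>"
    then obtain b where b: "b \<in> \<Delta>" "a = opp b" by blast
    then have "b \<in> C" by (simp add: Q_def \<Delta>_def)
    then show "a \<in> Q ?M' - Q ?M"
      using b(1) oC[of b] flip[OF _ disM, of b] flip[OF _ disM' setM', of b]
      unfolding \<Delta>_def Q_def Diff_iff mem_Collect_eq b(2) arev_arev by blast
  qed
  have "(\<Sum>a\<in>Q ?M'. frag_of (tail G a)) - (\<Sum>a\<in>Q ?M. frag_of (tail G a)) =
      (\<Sum>a\<in>Q ?M' - Q ?M. frag_of (tail G a)) - (\<Sum>a\<in>Q ?M - Q ?M'. frag_of (tail G a))"
    using sum.Int_Diff[OF fin, of "\<lambda>a. frag_of (tail G a)" ?M "Q ?M'"]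
      sum.Int_Diff[OF fin, of "\<lambda>a. frag_of (tail G a)" ?M' "Q ?M"]
    by (simp add: Int_commute)
  also have "(\<Sum>a\<in>Q ?M' - Q ?M. frag_of (tail G a)) = (\<Sum>a\<in>\<Delta>. frag_of (tail G (opp a)))"
    unfolding \<Delta>' by (rule sum.reindex_cong[of opp]) auto
  also have "\<dots> - (\<Sum>a\<in>Q ?M - Q ?M'. frag_of (tail G a)) = (\<Sum>a\<in>\<Delta>. boundary G a)"
    unfolding \<Delta>_def[symmetric] sum_subtractf[symmetric]
    using CG by (intro sum.cong) (auto simp: \<Delta>_def Q_def boundary_def)
  also have "\<Delta> = {a \<in> set S1. a \<in> C \<and> opp a \<in> set S2} \<union> {a \<in> set A. a \<in> C \<and> opp a \<in> set S1 \<union> set S2}"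
  proof -
    have blocks: "a \<in> set B \<union> set A \<union> set S1 \<union> set S2" if "a \<in> C" for a
    proof -
      have "a \<in> set ?M" using that CG disM(2) by blast
      moreover have "a \<noteq> e" "a \<noteq> opp e" "a \<noteq> k" "a \<noteq> opp k" using that e eG unfolding C_def by auto
      ultimately show ?thesis by simp
    qed
    have "a \<in> \<Delta> \<longleftrightarrow> a \<in> set S1 \<and> opp a \<in> set S2 \<or> a \<in> set A \<and> opp a \<in> set S1 \<union> set S2" if a: "a \<in> C" for a
    proof -
      have ab: "a \<in> set (B @ A @ S1 @ S2)" "opp a \<in> set (B @ A @ S1 @ S2)"
        using blocks[of a] blocks[of "opp a"] oC a by auto
      have n: "a \<noteq> e" "a \<noteq> opp e" "a \<noteq> k" "a \<noteq> opp k" "opp a \<noteq> e" "opp a \<noteq> opp e" "opp a \<noteq> k" "opp a \<noteq> opp k"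
        using a e eG oC[of a] unfolding C_def by auto
      have M: "bef ?M a (opp a) \<longleftrightarrow> bef (B @ A @ S1 @ S2) a (opp a)"
        "bef ?M' a (opp a) \<longleftrightarrow> bef (B @ S2 @ S1 @ A) a (opp a)"
        using n by auto
      have "a \<in> \<Delta> \<longleftrightarrow> bef ?M a (opp a) \<and> \<not> bef ?M' a (opp a)"
        using a unfolding \<Delta>_def Q_def by blast
      also have "\<dots> \<longleftrightarrow> a \<in> set S1 \<and> opp a \<in> set S2 \<or> a \<in> set A \<and> opp a \<in> set S1 \<union> set S2"
        unfolding M by (rule bef_block_swap[OF _ ab]) (use disM(1) in auto)
      finally show ?thesis .
    qed
    moreover have "a \<in> C" if "a \<in> \<Delta>" for a using that unfolding \<Delta>_def Q_def by blast
    ultimately show ?thesis by blast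
  qed
  also have "(\<Sum>a\<in>{a \<in> set S1. a \<in> C \<and> opp a \<in> set S2} \<union> {a \<in> set A. a \<in> C \<and> opp a \<in> set S1 \<union> set S2}. boundary G a) =
    (\<Sum>a\<in>{a \<in> set S1. a \<in> C \<and> opp a \<in> set S2}. boundary G a) +
    (\<Sum>a\<in>{a \<in> set A. a \<in> C \<and> opp a \<in> set S1 \<union> set S2}. boundary G a)"
    using disM(1) by (intro sum.union_disjoint) auto
  finally show ?thesis unfolding 1 2 by (simp add: algebra_simps)
qed

end

text \<open>Agreement at \<open>y\<close> gives the class of the change from \<open>T\<close> to the
  tree met on entering \<open>W\<close> along \<open>k\<close>; agreement at \<open>x\<close> gives
  that from \<open>T\<close> to the tree \<open>U\<close> left by the detours. The change between
  these two trees is read off the tours. Comparing the three leaves the chords between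
  \<open>A\<close> and \<open>x\<close> and, twice, the arcs of the detours.\<close>

lemma (in branch_edge) turn_Prin:
  assumes simple: "\<And>a b. a \<in> out_arcs G x \<Longrightarrow> b \<in> out_arcs G x \<Longrightarrow> head G a = head G b \<Longrightarrow> a = b"
    and agree: "bernardi_torsor G opp nxt x = rotor_torsor G opp nxt x"
      "bernardi_torsor G opp nxt y = rotor_torsor G opp nxt y"
    and k: "k \<in> arcs G" "tail G k = x"
    and X: "cyc (tau (T - edge e)) (e # S1 @ k # S2)"
    and Y: "cyc (tau (T - edge e)) (opp e # B @ opp k # A)"
    and nox: "\<And>a. a \<in> set S1 \<Longrightarrow> tail G a = x \<Longrightarrow> head G a \<notin> W"
  shows "(\<Sum>a\<in>{a \<in> set A. head G a = x}. boundary G a) +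
    frag_cmul 2 (\<Sum>f\<in>{f \<in> set S1. tail G f = x}. boundary G f) \<in> Prin G"
proof -
  have F: "bforest (T - edge e)" using tree stree_bforest bforest_diff_edge by blast
  note setX = tour_set[OF F eG X]
  have setY: "set (opp e # B @ opp k # A) = {b \<in> arcs G. tail G b \<in> W}"
    using tour_set(1)[OF F arev_in_arcs[OF eG] Y] eG by (auto simp: W_def)
  have disX: "distinct (e # S1 @ k # S2)" and disY: "distinct (opp e # B @ opp k # A)"
    by (rule cyc_distinct[OF X], rule cyc_distinct[OF Y])
  define fs where "fs = arcs_at x S1"
  have at: "arcs_at x (e # S1 @ k # S2) = e # fs @ k # arcs_at x S2"
    using k by (simp add: fs_def)
  have cn: "cyc nxt (e # fs @ k # arcs_at x S2)"
    using setX(2)[of x] unfolding at by simp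
  have "successively (\<lambda>a b. nxt a = b) ((e # fs) @ k # arcs_at x S2)"
    using cyc_successively[OF cn] by simp
  then have suc: "successively (\<lambda>a b. nxt a = b) (e # fs)" "nxt (last (e # fs)) = k"
    by (simp_all only: successively_append_iff list.sel list.distinct simp_thms)
  have "successively (\<lambda>a b. nxt a = b) ((e # fs) @ [k])"
    using suc by (simp only: successively_append_iff successively.simps list.sel simp_thms)
  then have "successively (\<lambda>a b. nxt a = b) (e # (fs @ [k]))"
    by (simp only: append_Cons)
  then have "fs @ [k] = [] \<or> nxt e = hd (fs @ [k]) \<and> successively (\<lambda>a b. nxt a = b) (fs @ [k])"
    by (simp only: successively_Cons)
  then have suc': "successively (\<lambda>a b. nxt a = b) (fs @ [k])" "nxt e = hd (fs @ [k])"
    by blast+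
  have S1G: "set S1 \<subseteq> arcs G" using setX(1) by auto
  have fsK: "set fs \<subseteq> {f \<in> out_arcs G x. head G f \<in> K}"
  proof
    fix f assume "f \<in> set fs"
    then have f: "f \<in> set S1" "tail G f = x" by (auto simp: fs_def)
    then have "f \<in> arcs G" "head G f \<notin> W" "head G f \<noteq> x" using S1G nox no_loops[of f] by auto
    then show "f \<in> {f \<in> out_arcs G x. head G f \<in> K}" using f by (auto simp: K_def)
  qed
  have dfs: "distinct fs" using cyc_distinct[OF cn] by simp
  have ke: "k \<noteq> e" using disX by auto
  have hkW: "head G k \<in> W"
  proof -
    have "opp k \<in> set (opp e # B @ opp k # A)" by simp
    then show ?thesis unfolding setY using k by simp
  qed
  have hky: "head G k \<noteq> y" using simple[of k e] k eG ke by auto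
  let ?\<rho> = "tree_rotors G T y"
  obtain U R j where U: "(step ^^ j) (?\<rho>, x) = (R, x)" "\<And>i. i < j \<Longrightarrow> snd ((step ^^ i) (?\<rho>, x)) \<noteq> y"
    "R x = last (e # fs)" "nearly U R"
    "\<And>s. s \<in> out_arcs G x \<Longrightarrow> beta s U - beta s T - (\<Sum>f\<in>set fs. boundary G f) \<in> Prin G"
    using excursions[OF nearly_T _ dfs fsK agree(1)] suc(1) unfolding rotor_x by blast
  have sU: "stree U" "same U" using U(4) by (auto simp: nearly_def same_def)
  have eU: "e \<in> U" by (rule same_e[OF sU(2)])
  let ?U' = "U - edge e \<union> edge k" and ?R = "R(x := k)" and ?z = "head G k"
  have cfg0: "rotor_config y ?\<rho> x" by (rule rotor_config_tree[OF tree xyV(2,1)])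
  have sj: "(step ^^ Suc j) (?\<rho>, x) = (?R, ?z)" using U(1,3) suc(2) by simp
  have nj: "snd ((step ^^ i) (?\<rho>, x)) \<noteq> y" if "i < Suc j" for i
    using U(2)[of i] U(1) xy that by (cases "i = j") auto
  have cfg: "rotor_config y ?R ?z"
    using rotor_config_funpow[OF cfg0, of "Suc j"] nj unfolding sj by simp
  note U' = final_turn[OF U(4) k hkW ke cfg]
  \<comment> \<open>The routing from \<open>T\<close> passes through a state that is also the
    initial state of the routing from the new tree, so both end in the same tree.\<close>
  have route: "rotor_route G opp nxt y x T = rotor_route G opp nxt y ?z ?U'"
  proof -
    have "rotor_run y (?\<rho>, x) = rotor_run y (?R, ?z)"
      using rotor_run_skip[of "Suc j" "(?\<rho>, x)" y] nj unfolding sj by blast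
    then show ?thesis
      unfolding rotor_route_eq using rotor_run_cong[OF xyV(2) cfg, of "tree_rotors G ?U' y"] U'(2) by simp
  qed
  define s where "s = nxt (opp e)"
  have s: "s \<in> out_arcs G y" unfolding s_def using eG by (intro nxt_out_arcs) simp
  have zV: "?z \<in> verts G - {y}" "x \<in> verts G - {y}" using hkW W_sub hky xy xyV by auto
  \<comment> \<open>Agreement at \<open>y\<close> is applied to both routings; their common final
    tree cancels.\<close>
  have "(beta s (rotor_route G opp nxt y x T) - beta s T - (frag_of x - frag_of y)) -
      (beta s (rotor_route G opp nxt y ?z ?U') - beta s ?U' - (frag_of ?z - frag_of y)) \<in> Prin G"
    by (rule Prin_diff[OF agree_route[OF agree(2) s zV(2) tree] agree_route[OF agree(2) s zV(1) U'(1)]])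
  then have I: "beta s ?U' - beta s T - (frag_of x - frag_of ?z) \<in> Prin G"
    unfolding route by (simp add: algebra_simps)
  have sT: "beta s T = beta e T"
    unfolding s_def by (rule beta_tree_step[OF tree eT])
  have II: "beta e U - beta e T - (\<Sum>f\<in>set fs. boundary G f) \<in> Prin G"
    using U(5)[of e] eG by simp
  have FU: "bforest (U - edge e)" using sU(1) stree_bforest bforest_diff_edge by blast
  \<comment> \<open>The tour around the branch sees only arcs with tail in \<open>W\<close>, on
    which \<open>U\<close> and \<open>T\<close> coincide.\<close>
  have YU: "cyc (tau (U - edge e)) (opp e # B @ opp k # A)"
  proof -
    have "tau (T - edge e) a = tau (U - edge e) a" if "a \<in> set (opp e # B @ opp k # A)" for a
      using same_iff[OF sU(2), of a] that unfolding setY by (auto simp: tau_def)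
    then show ?thesis using Y cyc_cong by blast
  qed
  obtain L where L: "cyc (tau (U - edge e)) (e # L)" using tour_exists[OF FU eG] .
  have "k \<in> set (e # L)" unfolding tour_set(1)[OF FU eG L] using k by simp
  then obtain S1' S2' where L12: "L = S1' @ k # S2'" using ke by (auto dest: split_list)
  note XU = L[unfolded L12]
  note setXU = tour_set[OF FU eG XU]
  have disXU: "distinct (e # S1' @ k # S2')" using cyc_distinct[OF XU] .
  \<comment> \<open>The tours of \<open>T - edge e\<close> and \<open>U - edge e\<close> may differ
    outside the branch, but both meet the arcs at \<open>x\<close> in their cyclic order from
    \<open>e\<close> on, hence the same arcs before \<open>k\<close>.\<close>
  have fs': "arcs_at x S1' = fs"
  proof -
    have "cyc nxt (e # arcs_at x S1' @ k # arcs_at x S2')"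
      using setXU(2)[of x] k by simp
    then have "arcs_at x S1' @ k # arcs_at x S2' = fs @ k # arcs_at x S2"
      using cyc_unique[OF cn, of "e # arcs_at x S1' @ k # arcs_at x S2'"] by simp
    moreover have "k \<notin> set (arcs_at x S1')" "k \<notin> set (arcs_at x S2')" using disXU by auto
    ultimately show ?thesis by (simp add: append_Cons_eq_iff)
  qed
  have XYU: "set (e # S1' @ k # S2') \<inter> set (opp e # B @ opp k # A) = {}"
  proof (rule equals0I)
    fix b assume b: "b \<in> set (e # S1' @ k # S2') \<inter> set (opp e # B @ opp k # A)"
    have "b \<in> set (opp e # B @ opp k # A)" using b by blast
    then have "(y, tail G b) \<in> conn (U - edge e)"
      unfolding tour_set(1)[OF FU arev_in_arcs[OF eG] YU] using eG by simp
    moreover have "b \<in> set (e # S1' @ k # S2')" using b by blast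
    then have "(x, tail G b) \<in> conn (U - edge e)" unfolding setXU(1) by simp
    ultimately show False using stree_sides_disj[OF sU(1) eU] by blast
  qed
  define C where "C = arcs G - U - edge k"
  have III: "beta s ?U' - beta e U = frag_of x - frag_of ?z +
    (\<Sum>a\<in>{a \<in> set S1'. a \<in> C \<and> opp a \<in> set S2'}. boundary G a) +
    (\<Sum>a\<in>{a \<in> set A. a \<in> C \<and> opp a \<in> set S1' \<union> set S2'}. boundary G a)"
    unfolding s_def C_def by (rule beta_exchange[OF sU(1) eU k(1) XU YU])
  \<comment> \<open>From \<open>W\<close> one leaves only to \<open>x\<close>, and \<open>e\<close>
    is the only tree edge between \<open>W\<close> and \<open>x\<close>. So the arcs of
    \<open>A\<close> with the other end outside the branch are chords that end at
    \<open>x\<close>.\<close>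
  have setA: "{a \<in> set A. a \<in> C \<and> opp a \<in> set S1' \<union> set S2'} = {a \<in> set A. head G a = x}"
  proof (intro equalityI subsetI)
    fix a assume a: "a \<in> {a \<in> set A. a \<in> C \<and> opp a \<in> set S1' \<union> set S2'}"
    then have "a \<in> set (opp e # B @ opp k # A)" by simp
    then have aW: "a \<in> arcs G" "tail G a \<in> W" unfolding setY by auto
    have "opp a \<notin> set (opp e # B @ opp k # A)" using a XYU by auto
    then have "head G a \<notin> W" unfolding setY using aW by auto
    then show "a \<in> {a \<in> set A. head G a = x}" using W_step[OF aW] a by auto
  next
    fix a assume a: "a \<in> {a \<in> set A. head G a = x}"
    then have "a \<in> set (opp e # B @ opp k # A)" by simp
    then have aW: "a \<in> arcs G" "tail G a \<in> W" unfolding setY by auto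
    have ne: "a \<noteq> opp e" "a \<noteq> opp k" "a \<noteq> e" "a \<noteq> k" using a disY aW xW k by auto
    then have oe: "opp a \<noteq> e" "opp a \<noteq> k" by (metis arev_arev)+
    have "opp a \<in> set (e # S1' @ k # S2')" unfolding setXU(1) using aW a by simp
    then have "opp a \<in> set S1' \<union> set S2'" using oe by auto
    moreover have "a \<notin> U"
    proof
      assume "a \<in> U"
      then have "a \<in> T - edge e" using same_iff[OF sU(2) aW(2)] ne by auto
      then show False using W_tree_step[OF _ aW(2)] a xW by auto
    qed
    ultimately show "a \<in> {a \<in> set A. a \<in> C \<and> opp a \<in> set S1' \<union> set S2'}"
      using a aW ne by (auto simp: C_def)
  qed
  let ?rest = "k # S2' @ e # (B @ opp k # A) @ [opp e]"
  \<comment> \<open>Moving the start of the tour of \<open>U\<close> from \<open>nxt e\<close> to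
    \<open>k\<close> rotates the block \<open>S1'\<close> to the end. The lists give this sum as the
    change, while stepping along the cyclic order at \<open>x\<close> gives the boundaries of
    \<open>fs\<close>. This is their second copy.\<close>
  have IV: "(\<Sum>a\<in>{a \<in> set S1'. a \<in> C \<and> opp a \<in> set S2'}. boundary G a) - (\<Sum>f\<in>set fs. boundary G f) \<in> Prin G"
  proof -
    have "cyc (tau (U - edge e \<union> edge e)) (e # (B @ opp k # A) @ opp e # (S1' @ k # S2'))"
      by (rule tour_join[OF FU eG bforest_bridge[OF stree_bforest[OF sU(1)] eU] XU YU])
    then have "cyc (tau U) ((e # (B @ opp k # A) @ [opp e]) @ (S1' @ k # S2'))"
      using un_diff_edge[OF stree_oppclosed[OF sU(1)] eU] by simp
    then have c1: "cyc (tau U) (S1' @ ?rest)"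
      using cyc_rotate[of "tau U" "e # (B @ opp k # A) @ [opp e]" "S1' @ k # S2'"] by simp
    have c2: "cyc (tau U) (?rest @ S1')" using cyc_rotate[OF c1] .
    have oeU: "opp e \<in> U" using eU stree_opp_iff[OF sU(1)] by simp
    have h1: "hd (S1' @ ?rest) = nxt e"
    proof (cases S1')
      case Nil
      then show ?thesis
        using cyc_last_step[of "tau U" k "S2' @ e # (B @ opp k # A)" "opp e"] c1 oeU by (simp add: tau_def)
    next
      case (Cons b S)
      then show ?thesis
        using cyc_last_step[of "tau U" b "S @ k # S2' @ e # (B @ opp k # A)" "opp e"] c1 oeU by (simp add: tau_def)
    qed
    have nG: "nxt e \<in> arcs G" using nxt_out_arcs[of e x] eG by simp
    have t1: "tour U (nxt e) = S1' @ ?rest"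
      using tour_eqI[OF sU(1) nG, of "tl (S1' @ ?rest)"] c1 h1 by (cases S1') auto
    have t2: "tour U k = ?rest @ S1'" using tour_eqI[OF sU(1) k(1)] c2 by simp
    have "beta k U - beta (nxt e) U = flux (chords U) S1' ?rest"
      unfolding beta_eq_bdl[OF sU(1) k(1)] beta_eq_bdl[OF sU(1) nG] t1 t2
      using cyc_distinct[OF c1] chords_opp[OF sU(1)] by (intro bdl_rotate) auto
    also have "flux (chords U) S1' ?rest = (\<Sum>a\<in>{a \<in> set S1'. a \<in> C \<and> opp a \<in> set S2'}. boundary G a)"
      unfolding flux_def
    proof (rule sum.cong)
      show "{a \<in> set S1'. a \<in> chords U \<and> opp a \<in> set ?rest} = {a \<in> set S1'. a \<in> C \<and> opp a \<in> set S2'}"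
      proof (intro equalityI subsetI)
        fix a assume a: "a \<in> {a \<in> set S1'. a \<in> chords U \<and> opp a \<in> set ?rest}"
        have aS: "a \<in> set S1'" using a by blast
        have nY: "a \<notin> set (opp e # B @ opp k # A)" using XYU aS by auto
        then have ne: "a \<noteq> opp k" "a \<noteq> k" "a \<noteq> e" "a \<noteq> opp e" using aS disXU by auto
        then have oe: "opp a \<noteq> e" "opp a \<noteq> k" by (metis arev_arev)+
        have "opp a \<notin> set (opp e # B @ opp k # A)"
        proof
          assume *: "opp a \<in> set (opp e # B @ opp k # A)"
          have aG: "a \<in> arcs G" using a by auto
          have hW: "head G a \<in> W" using * unfolding setY using aG by simp
          have "tail G a \<notin> W" using nY aG unfolding setY by auto
          then have "tail G a = x" using W_step[of "opp a"] aG hW by auto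
          then have "a \<in> set fs" using a unfolding fs'[symmetric] by simp
          then show False using fsK hW by (auto simp: K_def)
        qed
        then show "a \<in> {a \<in> set S1'. a \<in> C \<and> opp a \<in> set S2'}"
          using a oe ne by (auto simp: C_def)
      qed (auto simp: C_def)
    qed simp
    finally show ?thesis
      using beta_chain[OF sU(1) suc'(1) _ dfs] fsK k(1) unfolding suc'(2) by auto
  qed
  have sfs: "set fs = {f \<in> set S1. tail G f = x}" by (auto simp: fs_def)
  define A' where "A' = (\<Sum>a\<in>{a \<in> set A. head G a = x}. boundary G a)"
  define B' where "B' = (\<Sum>a\<in>{a \<in> set S1'. a \<in> C \<and> opp a \<in> set S2'}. boundary G a)"
  define F' where "F' = (\<Sum>f\<in>set fs. boundary G f)"
  have "(beta s ?U' - beta s T - (frag_of x - frag_of ?z)) - (beta e U - beta e T - F') - (B' - F') \<in> Prin G"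
    unfolding A'_def B'_def F'_def by (rule Prin_diff[OF Prin_diff[OF I II] IV])
  moreover have "beta s ?U' = beta e U + frag_of x - frag_of ?z + B' + A'"
    using III unfolding setA A'_def B'_def by (simp add: algebra_simps)
  ultimately have "A' + (F' + F') \<in> Prin G"
    unfolding sT by (simp add: algebra_simps)
  moreover have "frag_cmul 2 F' = F' + F'"
    using frag_cmul_distrib[of 1 1 F'] by simp
  ultimately show ?thesis
    unfolding A'_def F'_def sfs by simp
qed

section \<open>Consequences of agreement\<close>

context loopless_ribbon_graph
begin

definition off :: "'a \<Rightarrow> 'b set" where
  "off x = {a \<in> arcs G. tail G a \<noteq> x \<and> head G a \<noteq> x}"

lemma oppclosed_off: "oppclosed (off x)"
  by (auto simp: oppclosed_def off_def)

lemma conn_off_neq: "(u, v) \<in> conn (off x) \<Longrightarrow> u \<noteq> x \<Longrightarrow> v \<noteq> x"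
  by (induction rule: rtrancl_induct) (auto simp: adj_def off_def)

text \<open>A maximum principle for the Laplacian on a component \<open>H\<close> of \<open>G - x\<close>. For \<open>c = 2\<close> it fails in
  the presence of parallel edges.\<close>

lemma component_potential:
  fixes \<phi> :: "'a \<Rightarrow> int"
  assumes H: "H \<subseteq> verts G" "x \<notin> H"
    and con: "\<And>u v. u \<in> H \<Longrightarrow> v \<in> H \<Longrightarrow> (u, v) \<in> conn (off x)"
    and closed: "\<And>a. a \<in> arcs G \<Longrightarrow> tail G a \<in> H \<Longrightarrow> head G a \<in> H \<or> head G a = x"
    and simple: "\<And>a b. a \<in> out_arcs G x \<Longrightarrow> b \<in> out_arcs G x \<Longrightarrow> head G a = head G b \<Longrightarrow> a = b"
    and S: "S \<subseteq> out_arcs G x" "\<And>a. a \<in> S \<Longrightarrow> head G a \<in> H"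
    and L: "\<And>v. v \<in> H \<Longrightarrow> lap \<phi> v = c * (if \<exists>a\<in>S. head G a = v then 1 else 0)"
    and c: "c = 1 \<or> c = 2"
    and ne: "S \<noteq> {}" and b: "b \<in> out_arcs G x" "head G b \<in> H"
  shows "b \<in> S"
proof -
  \<comment> \<open>The potential is grounded at \<open>x\<close>, the only vertex through which
    \<open>H\<close> is left.\<close>
  define \<psi> where "\<psi> v = \<phi> v - \<phi> x" for v
  have \<psi>x: "\<psi> x = 0" by (simp add: \<psi>_def)
  have L\<psi>: "lap \<psi> v = (\<Sum>a\<in>out_arcs G v. \<psi> v - \<psi> (head G a))" for v by (simp add: lap_def)
  have L': "lap \<psi> v = c * (if \<exists>a\<in>S. head G a = v then 1 else 0)" if "v \<in> H" for v
    using L[OF that] by (simp add: lap_def \<psi>_def)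
  have c0: "c > 0" using c by auto
  have nn: "lap \<psi> v \<ge> 0" "lap \<psi> v \<le> c" if "v \<in> H" for v using L'[OF that] c0 by auto
  have fH: "finite H" using H(1) finite_verts by (rule finite_subset)
  \<comment> \<open>By connectedness of \<open>H\<close> in \<open>G - x\<close>, a nonempty set
    that contains all its neighbours other than \<open>x\<close> is the whole of \<open>H\<close>.
    It will be applied to the sets of minima and of maxima.\<close>
  have full: "Z = H" if Z: "Z \<subseteq> H" "Z \<noteq> {}"
    "\<And>v a. v \<in> Z \<Longrightarrow> a \<in> out_arcs G v \<Longrightarrow> head G a \<noteq> x \<Longrightarrow> head G a \<in> Z" for Z
  proof
    obtain u where u: "u \<in> Z" using Z(2) by blast
    show "H \<subseteq> Z"
    proof
      fix v assume "v \<in> H"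
      then have "(u, v) \<in> conn (off x)" using con u Z(1) by blast
      then show "v \<in> Z"
      proof (induction rule: rtrancl_induct)
        case (step v w)
        then obtain a where "a \<in> off x" "v = tail G a" "w = head G a" by (auto simp: adj_def)
        then show ?case using Z(3)[OF step.IH, of a] by (auto simp: off_def)
      qed (rule u)
    qed
  qed (rule Z(1))
  have ob: "opp b \<in> out_arcs G (head G b)" "head G (opp b) = x" using b(1) by auto
  \<comment> \<open>Minimum principle: a negative minimum would spread over \<open>H\<close> to the
    neighbours of \<open>x\<close>, where the value 0 at \<open>x\<close> contradicts it.\<close>
  have nonneg: "0 \<le> \<psi> v" if "v \<in> H" for v
  proof (rule ccontr)
    assume neg: "\<not> 0 \<le> \<psi> v"
    define m where "m = Min (\<psi> ` H)"
    have le: "m \<le> \<psi> v" if "v \<in> H" for v unfolding m_def using fH that by auto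
    have "m \<in> \<psi> ` H" unfolding m_def using fH that by (intro Min_in) auto
    moreover have "m < 0" using le[OF that] neg by simp
    define Z where "Z = {v \<in> H. \<psi> v = m}"
    have tm: "\<psi> u - \<psi> (head G a) = 0" if "u \<in> Z" "a \<in> out_arcs G u" for u a
    proof -
      have t: "0 \<le> \<psi> (head G a) - \<psi> u" if "a \<in> out_arcs G u" for a
        using closed[of a] le[of "head G a"] \<psi>x \<open>m < 0\<close> \<open>u \<in> Z\<close> that by (auto simp: Z_def)
      have "(\<Sum>a\<in>out_arcs G u. \<psi> (head G a) - \<psi> u) = - lap \<psi> u"
        unfolding L\<psi> sum_negf[symmetric] by simp
      moreover have "0 \<le> (\<Sum>a\<in>out_arcs G u. \<psi> (head G a) - \<psi> u)" by (rule sum_nonneg) (rule t)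
      moreover have "lap \<psi> u \<ge> 0" using nn(1)[of u] that(1) by (simp add: Z_def)
      ultimately have "(\<Sum>a\<in>out_arcs G u. \<psi> (head G a) - \<psi> u) = 0" by simp
      then show ?thesis
        using sum_nonneg_eq_0_iff[OF finite_out_arcs[of u], of "\<lambda>a. \<psi> (head G a) - \<psi> u"] t that(2) by auto
    qed
    have "Z = H"
    proof (rule full)
      show "Z \<subseteq> H" "Z \<noteq> {}" using calculation by (auto simp: Z_def)
      fix v a assume va: "v \<in> Z" "a \<in> out_arcs G v" "head G a \<noteq> x"
      then show "head G a \<in> Z" using tm[OF va(1,2)] closed[of a] by (auto simp: Z_def)
    qed
    then have "\<psi> (head G b) - \<psi> (head G (opp b)) = 0" using tm[OF _ ob(1)] b(2) by blast
    moreover have "\<psi> (head G b) = m" using b(2) \<open>Z = H\<close> by (auto simp: Z_def)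
    ultimately show False using ob(2) \<psi>x \<open>m < 0\<close> by simp
  qed
  define M where "M = Max (\<psi> ` H)"
  have le: "\<psi> v \<le> M" if "v \<in> H" for v unfolding M_def using fH that by auto
  have "M \<in> \<psi> ` H" unfolding M_def using fH b(2) by (intro Max_in) auto
  then obtain w where w: "w \<in> H" "\<psi> w = M" by auto
  have M0: "0 \<le> M" using nonneg[OF w(1)] w(2) by simp
  have leM: "\<psi> (head G a) \<le> M" if "a \<in> out_arcs G v" "v \<in> H" for a v
    using closed[of a] le[of "head G a"] that \<psi>x M0 by auto
  have Mpos: "M \<noteq> 0"
  proof
    assume "M = 0"
    then have z: "\<psi> v = 0" if "v \<in> H" for v using le[OF that] nonneg[OF that] by simp
    obtain s where s: "s \<in> S" using ne by blast
    have "lap \<psi> (head G s) = 0"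
      unfolding L\<psi> using z \<psi>x closed S(2)[OF s] by (intro sum.neutral) fastforce
    moreover have "\<exists>a\<in>S. head G a = head G s" using s by blast
    ultimately show False using L'[OF S(2)[OF s]] c0 by simp
  qed
  define Z where "Z = {v \<in> H. \<psi> v = M}"
  have "Z = H"
  proof (rule full)
    show "Z \<subseteq> H" "Z \<noteq> {}" using w by (auto simp: Z_def)
    fix v a assume v: "v \<in> Z" and a: "a \<in> out_arcs G v" "head G a \<noteq> x"
    have vH: "v \<in> H" "\<psi> v = M" using v by (auto simp: Z_def)
    have aH: "head G a \<in> H" using closed[of a] a vH by auto
    have t: "0 \<le> \<psi> v - \<psi> (head G a)" if "a \<in> out_arcs G v" for a using leM[OF that vH(1)] vH(2) by simp
    have "\<psi> v - \<psi> (head G a) = 0"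
    proof (cases "\<exists>s\<in>S. head G s = v")
      case False
      then have "(\<Sum>a\<in>out_arcs G v. \<psi> v - \<psi> (head G a)) = 0" using L'[OF vH(1)] L\<psi>[of v] by simp
      then show ?thesis
        using sum_nonneg_eq_0_iff[OF finite_out_arcs[of v], of "\<lambda>a. \<psi> v - \<psi> (head G a)"] t a(1) by auto
    next
      case True
      then obtain s where s: "s \<in> S" "head G s = v" by blast
      have sG: "s \<in> arcs G" "tail G s = x" using S(1) s by auto
      have os: "opp s \<in> out_arcs G v" "head G (opp s) = x" using sG s by auto
      have "(\<Sum>a\<in>out_arcs G v. \<psi> v - \<psi> (head G a)) = c" using L'[OF vH(1)] L\<psi>[of v] True by auto
      \<comment> \<open>The arc back to \<open>x\<close> alone contributes \<open>M\<close> to the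
        total \<open>c\<close>, so the remaining arcs share \<open>c - M\<close>.\<close>
      then have rest: "(\<Sum>a\<in>out_arcs G v - {opp s}. \<psi> v - \<psi> (head G a)) = c - M"
        using sum.remove[OF finite_out_arcs os(1), of "\<lambda>a. \<psi> v - \<psi> (head G a)"] os(2) \<psi>x vH(2) by simp
      have ar: "a \<in> out_arcs G v - {opp s}" using a os(2) by auto
      have le1: "\<psi> v - \<psi> (head G a) \<le> c - M"
        unfolding rest[symmetric] using ar t by (intro member_le_sum) auto
      show ?thesis
      proof (rule ccontr)
        \<comment> \<open>The values are integers, so only \<open>M = 1\<close>,
          \<open>c = 2\<close> and a neighbour of value 0 are possible. At that neighbour the
          Laplacian would be negative.\<close>
        assume n0: "\<psi> v - \<psi> (head G a) \<noteq> 0"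
        then have "\<psi> v - \<psi> (head G a) \<ge> 1" using t[OF a(1)] by simp
        then have "M = 1" "c = 2" "\<psi> (head G a) = 0" using le1 c Mpos M0 vH(2) nonneg[OF aH] by auto
        moreover have "(\<Sum>d\<in>out_arcs G (head G a). \<psi> (head G a) - \<psi> (head G d)) < (\<Sum>d\<in>out_arcs G (head G a). 0)"
        proof (rule sum_strict_mono_ex1)
          show "\<forall>d\<in>out_arcs G (head G a). \<psi> (head G a) - \<psi> (head G d) \<le> 0"
          proof
            fix d assume d: "d \<in> out_arcs G (head G a)"
            then have "head G d \<in> H \<or> head G d = x" using closed[of d] aH by auto
            then show "\<psi> (head G a) - \<psi> (head G d) \<le> 0" using nonneg \<psi>x calculation(3) by auto
          qed
          show "\<exists>d\<in>out_arcs G (head G a). \<psi> (head G a) - \<psi> (head G d) < 0"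
            using a vH(2) calculation by (intro bexI[of _ "opp a"]) auto
        qed auto
        ultimately show False using nn(1)[OF aH] L\<psi>[of "head G a"] by simp
      qed
    qed
    then show "head G a \<in> Z" using aH vH by (simp add: Z_def)
  qed
  \<comment> \<open>A constant positive potential on \<open>H\<close> has positive Laplacian at
    every neighbour of \<open>x\<close>, so each of them is an end of an arc of
    \<open>S\<close>.\<close>
  then have vb: "\<psi> (head G b) = M" using b(2) by (auto simp: Z_def)
  have "\<psi> (head G b) - \<psi> (head G (opp b)) \<le> (\<Sum>a\<in>out_arcs G (head G b). \<psi> (head G b) - \<psi> (head G a))"
    using ob(1) leM[OF _ b(2)] vb by (intro member_le_sum) auto
  then have "lap \<psi> (head G b) > 0" using vb ob(2) \<psi>x M0 Mpos L\<psi>[of "head G b"] by simp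
  then obtain s where "s \<in> S" "head G s = head G b" using L'[OF b(2)] by (auto split: if_splits)
  then show ?thesis using simple[of s b] S(1) b(1) by auto
qed

text \<open>Each component of \<open>G - x\<close> is spanned by a single branch of \<open>T\<close>
  at \<open>x\<close>.\<close>

definition starred :: "'b set \<Rightarrow> 'a \<Rightarrow> bool" where
  "starred T x \<longleftrightarrow> (\<forall>a\<in>off x. (tail G a, head G a) \<in> conn (T \<inter> off x))"

lemma starred_conn:
  assumes "starred T x"
  shows "(u, v) \<in> conn (off x) \<longleftrightarrow> (u, v) \<in> conn (T \<inter> off x)"
proof
  assume "(u, v) \<in> conn (off x)"
  then show "(u, v) \<in> conn (T \<inter> off x)"
  proof (induction rule: rtrancl_induct)
    case (step v w)
    then obtain a where "a \<in> off x" "v = tail G a" "w = head G a" by (auto simp: adj_def)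
    then show ?case using assms step.IH conn_trans unfolding starred_def by blast
  qed simp
qed (rule conn_mono[of "T \<inter> off x"], auto)

text \<open>Within the branch beyond the bridge \<open>h\<close> a path never comes back to
  \<open>tail G h\<close>.\<close>

lemma branch_conn:
  assumes T: "stree T" and h: "h \<in> T"
  shows "(head G h, v) \<in> conn (T - edge h) \<longleftrightarrow> (head G h, v) \<in> conn (T \<inter> off (tail G h))"
proof
  assume "(head G h, v) \<in> conn (T - edge h)"
  then show "(head G h, v) \<in> conn (T \<inter> off (tail G h))"
  proof (induction rule: rtrancl_induct)
    case (step v w)
    then obtain a where a: "a \<in> T - edge h" "v = tail G a" "w = head G a" by (auto simp: adj_def)
    have "(head G h, w) \<in> conn (T - edge h)" using step.hyps by (rule rtrancl_into_rtrancl)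
    then have "v \<noteq> tail G h" "w \<noteq> tail G h"
      using bforest_bridge'[OF stree_bforest[OF T] h] step.hyps(1) by auto
    then have "a \<in> T \<inter> off (tail G h)" using a stree_arcs[OF T] by (auto simp: off_def)
    then show ?case using conn_arc[of a "T \<inter> off (tail G h)"] a step.IH conn_trans by blast
  qed simp
next
  have "h \<notin> off (tail G h)" "opp h \<notin> off (tail G h)" using stree_arcs[OF T h] by (auto simp: off_def)
  then show "(head G h, v) \<in> conn (T \<inter> off (tail G h)) \<Longrightarrow> (head G h, v) \<in> conn (T - edge h)"
    by (rule_tac conn_mono[of "T \<inter> off (tail G h)"]) auto
qed

end

locale agreeing_ribbon_graph = loopless_ribbon_graph G opp nxt + nomulti_digraph G
  for G :: "('a, 'b) pre_digraph" and opp nxt :: "'b \<Rightarrow> 'b" +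
  assumes agree: "\<And>v. v \<in> verts G \<Longrightarrow> bernardi_torsor G opp nxt v = rotor_torsor G opp nxt v"
begin

lemma simple_out: "a \<in> out_arcs G v \<Longrightarrow> b \<in> out_arcs G v \<Longrightarrow> head G a = head G b \<Longrightarrow> a = b"
  by (rule no_multi_arcs) (auto simp: arc_to_ends_def)

text \<open>On the branch of \<open>e\<close> the divisor of \<open>turn_Prin\<close> is minus the
  indicator of the ends of the arcs from \<open>A\<close> to \<open>x\<close>; on any other
  component of \<open>G - x\<close> it is twice the indicator of the ends of the arcs at
  \<open>x\<close> in \<open>S1\<close>. By the maximum principle each of these arc sets is empty or
  consists of all arcs between \<open>x\<close> and the component. For \<open>A\<close> only
  emptiness is possible, as \<open>opp e\<close> is not in \<open>A\<close>.\<close>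

lemma agree_turn:
  assumes T: "stree T" and e: "e \<in> T" and star: "starred T (tail G e)"
    and k: "k \<in> arcs G" "tail G k = tail G e"
    and X: "cyc (tau (T - edge e)) (e # S1 @ k # S2)"
    and Y: "cyc (tau (T - edge e)) (opp e # B @ opp k # A)"
    and nox: "\<And>a. a \<in> set S1 \<Longrightarrow> tail G a = tail G e \<Longrightarrow> (head G e, head G a) \<notin> conn (off (tail G e))"
  shows "g \<in> set A \<Longrightarrow> head G g \<noteq> tail G e"
    and "u \<in> set S1 \<Longrightarrow> tail G u = tail G e \<Longrightarrow> u' \<in> arcs G \<Longrightarrow> tail G u' = tail G e \<Longrightarrow>
      (head G u, head G u') \<in> conn (off (tail G e)) \<Longrightarrow> u' \<in> set S1"
proof -
  have eG: "e \<in> arcs G" using T e stree_arcs by blast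
  let ?x = "tail G e" and ?y = "head G e"
  have eq: "(?y, v) \<in> conn (T - edge e) \<longleftrightarrow> (?y, v) \<in> conn (off ?x)" for v
    using branch_conn[OF T e] starred_conn[OF star] by blast
  have step_off: "(w, head G a) \<in> conn (off ?x) \<or> head G a = ?x"
    if "a \<in> arcs G" "(w, tail G a) \<in> conn (off ?x)" "w \<noteq> ?x" for a w
    using conn_arc[of a "off ?x"] conn_trans[OF that(2)] conn_off_neq[OF that(2,3)] that(1)
    by (auto simp: off_def)
  interpret branch_edge G opp nxt T e
    using T e step_off[of _ ?y] eq eG no_loops[OF eG] by unfold_locales auto
  have Weq: "W = {v \<in> verts G. (y, v) \<in> conn (off x)}"
    unfolding W_def eq ..
  have F: "bforest (T - edge e)" using tree stree_bforest bforest_diff_edge by blast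
  have setX: "set (e # S1 @ k # S2) = {b \<in> arcs G. (x, tail G b) \<in> conn (T - edge e)}"
    by (rule tour_set(1)[OF F eG X])
  have setY: "set (opp e # B @ opp k # A) = {b \<in> arcs G. tail G b \<in> W}"
    using tour_set(1)[OF F arev_in_arcs[OF eG] Y] eG by (auto simp: W_def)
  have S1G: "a \<in> arcs G" if "a \<in> set S1" for a using setX that by auto
  have AY: "a \<in> arcs G \<and> tail G a \<in> W" if "a \<in> set A" for a
  proof -
    have "a \<in> set (opp e # B @ opp k # A)" using that by simp
    then show ?thesis unfolding setY by simp
  qed
  have nW: "head G a \<notin> W" if "a \<in> set S1" "tail G a = x" for a
    using nox[OF that] by (auto simp: Weq)
  let ?A = "{a \<in> set A. head G a = x}" and ?f = "{f \<in> set S1. tail G f = x}"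
  define D where "D = (\<Sum>a\<in>?A. boundary G a) + frag_cmul 2 (\<Sum>f\<in>?f. boundary G f)"
  have "D \<in> Prin G"
    unfolding D_def by (rule turn_Prin[OF simple_out agree[OF xyV(1)] agree[OF xyV(2)] k X Y nW])
  then obtain \<phi> where \<phi>: "\<And>v. v \<in> verts G \<Longrightarrow> lk D v = lap \<phi> v"
    unfolding Prin_iff by blast
  have lkA: "lk (\<Sum>a\<in>?A. boundary G a) v = - (if \<exists>a\<in>opp ` ?A. head G a = v then 1 else 0)" if "v \<noteq> x" for v
  proof -
    have "lk (\<Sum>a\<in>?A. boundary G a) v = (\<Sum>a\<in>?A. - (if tail G a = v then 1 else 0))"
      unfolding lookup_sum boundary_def using that by (intro sum.cong) (auto simp: lookup_minus)
    also have "\<dots> = - (\<Sum>a\<in>{a \<in> ?A. tail G a = v}. 1)"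
      unfolding sum_negf by (subst sum.inter_filter) (auto simp: sum.inter_filter)
    also have "(\<Sum>a\<in>{a \<in> ?A. tail G a = v}. 1::int) = (if \<exists>a\<in>opp ` ?A. head G a = v then 1 else 0)"
    proof (cases "\<exists>a\<in>opp ` ?A. head G a = v")
      case True
      then obtain a where a: "a \<in> ?A" "tail G a = v" using AY by auto
      have "b = a" if b: "b \<in> ?A" "tail G b = v" for b
        using simple_out[of "opp b" x "opp a"] a b AY by auto
      then have "{a \<in> ?A. tail G a = v} = {a}" using a by blast
      then show ?thesis using True by simp
    next
      case False
      then have "{a \<in> ?A. tail G a = v} = {}" using AY by auto
      then show ?thesis using False by simp
    qed
    finally show ?thesis .
  qed
  have lkf: "lk (\<Sum>f\<in>?f. boundary G f) v = (if \<exists>a\<in>?f. head G a = v then 1 else 0)" if "v \<noteq> x" for v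
  proof -
    have "lk (\<Sum>f\<in>?f. boundary G f) v = (\<Sum>f\<in>?f. if head G f = v then 1 else 0)"
      unfolding lookup_sum boundary_def using that by (intro sum.cong) (auto simp: lookup_minus)
    also have "\<dots> = (\<Sum>f\<in>{f \<in> ?f. head G f = v}. 1)"
      by (subst sum.inter_filter) auto
    also have "\<dots> = (if \<exists>a\<in>?f. head G a = v then 1 else 0)"
    proof (cases "\<exists>a\<in>?f. head G a = v")
      case True
      then obtain a where a: "a \<in> ?f" "head G a = v" by auto
      have "b = a" if b: "b \<in> ?f" "head G b = v" for b
        using simple_out[of b x a] a b S1G by auto
      then have "{f \<in> ?f. head G f = v} = {a}" using a by blast
      then show ?thesis using True by simp
    next
      case False
      then have "{f \<in> ?f. head G f = v} = {}" by auto
      then show ?thesis using False by simp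
    qed
    finally show ?thesis .
  qed
  have D: "lk D v = - (if \<exists>a\<in>opp ` ?A. head G a = v then 1 else 0) + 2 * (if \<exists>a\<in>?f. head G a = v then 1 else 0)"
    if "v \<noteq> x" for v
    unfolding D_def using lkA[OF that] lkf[OF that] by (simp add: lookup_add)
  show "head G g \<noteq> x" if g: "g \<in> set A"
  proof
    assume gx: "head G g = x"
    have "e \<in> opp ` ?A"
    proof (rule component_potential[of W x "opp ` ?A" "\<lambda>v. - \<phi> v" 1])
      show "(u, v) \<in> conn (off x)" if "u \<in> W" "v \<in> W" for u v
        using that conn_trans conn_sym[OF oppclosed_off] unfolding Weq by blast
      show "opp ` ?A \<subseteq> out_arcs G x" "\<And>a. a \<in> opp ` ?A \<Longrightarrow> head G a \<in> W" using AY by auto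
      show "opp ` ?A \<noteq> {}" using g gx by auto
      show "lap (\<lambda>v. - \<phi> v) v = 1 * (if \<exists>a\<in>opp ` ?A. head G a = v then 1 else 0)" if "v \<in> W" for v
      proof -
        have vx: "v \<noteq> x" using that xW by auto
        have vV: "v \<in> verts G" using that W_sub by blast
        have "\<not> (\<exists>a\<in>?f. head G a = v)" using nW that by auto
        then have "lk D v = - (if \<exists>a\<in>opp ` ?A. head G a = v then 1 else 0)"
          using D[OF vx] by (simp only: if_False mult_zero_right add_0_right)
        then show ?thesis
          unfolding lap_uminus \<phi>[OF vV, symmetric] by (simp only: minus_minus mult_1)
      qed
    qed (use W_sub xW W_step simple_out eG yW in auto)
    then have "opp e \<in> set A" by auto
    then show False using cyc_distinct[OF Y] by auto
  qed
  show "u' \<in> set S1" if u: "u \<in> set S1" "tail G u = x" and u': "u' \<in> arcs G" "tail G u' = x"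
    "(head G u, head G u') \<in> conn (off x)"
  proof -
    define H where "H = {v \<in> verts G. (head G u, v) \<in> conn (off x)}"
    have uG: "u \<in> arcs G" using S1G u by blast
    have hux: "head G u \<noteq> x" using no_loops[OF uG] u by auto
    have HW: "v \<notin> W" if "v \<in> H" for v
    proof
      assume "v \<in> W"
      then have "(y, head G u) \<in> conn (off x)"
        using that conn_sym[OF oppclosed_off] conn_trans unfolding Weq H_def by blast
      then show False using nW[OF u] uG by (auto simp: Weq)
    qed
    have "u' \<in> {f \<in> ?f. head G f \<in> H}"
    proof (rule component_potential[of H x "{f \<in> ?f. head G f \<in> H}" \<phi> 2])
      show "H \<subseteq> verts G" "x \<notin> H" using conn_off_neq[OF _ hux] by (auto simp: H_def)
      show "(v, w) \<in> conn (off x)" if "v \<in> H" "w \<in> H" for v w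
        using that conn_trans conn_sym[OF oppclosed_off] unfolding H_def by blast
      show "head G a \<in> H \<or> head G a = x" if "a \<in> arcs G" "tail G a \<in> H" for a
        using step_off[OF that(1) _ hux] that by (auto simp: H_def)
      show "{f \<in> ?f. head G f \<in> H} \<subseteq> out_arcs G x" using S1G by auto
      have "u \<in> {f \<in> ?f. head G f \<in> H}" using u uG by (simp add: H_def)
      then show "{f \<in> ?f. head G f \<in> H} \<noteq> {}" by blast
      show "lap \<phi> v = 2 * (if \<exists>a\<in>{f \<in> ?f. head G f \<in> H}. head G a = v then 1 else 0)" if v: "v \<in> H" for v
      proof -
        have vx: "v \<noteq> x" using v conn_off_neq[OF _ hux] by (auto simp: H_def)
        have vV: "v \<in> verts G" using v by (simp add: H_def)
        have "\<not> (\<exists>a\<in>opp ` ?A. head G a = v)" using AY HW[OF v] by auto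
        then have "lk D v = 2 * (if \<exists>a\<in>?f. head G a = v then 1 else 0)"
          using D[OF vx] by (simp only: if_False minus_zero add_0_left)
        moreover have "(\<exists>a\<in>{f \<in> ?f. head G f \<in> H}. head G a = v) \<longleftrightarrow> (\<exists>a\<in>?f. head G a = v)"
          using v by blast
        ultimately show ?thesis
          unfolding \<phi>[OF vV, symmetric] by simp
      qed
    qed (use simple_out u' in \<open>auto simp: H_def\<close>)
    then show ?thesis by simp
  qed
qed

end

section \<open>Linked chords\<close>

lemma bef_trans: "distinct L \<Longrightarrow> bef L a b \<Longrightarrow> bef L b c \<Longrightarrow> bef L a c"
  by (induction L) (auto dest: bef_mem)

context loopless_ribbon_graph
begin

text \<open>The ends of \<open>c\<close> and of \<open>d\<close> alternate in the list.\<close>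

definition il :: "'b list \<Rightarrow> 'b \<Rightarrow> 'b \<Rightarrow> bool" where
  "il M c d \<longleftrightarrow> (bef M c d \<noteq> bef M c (opp d)) \<noteq> (bef M (opp c) d \<noteq> bef M (opp c) (opp d))"

lemma il_opp [simp]: "il M (opp c) d = il M c d" "il M c (opp d) = il M c d"
  by (auto simp: il_def)

lemma il_sym:
  assumes "distinct M" "{c, opp c, d, opp d} \<subseteq> set M" "d \<noteq> c" "d \<noteq> opp c"
  shows "il M d c = il M c d"
proof -
  have "opp d \<noteq> c" using assms(4) by (metis arev_arev)
  then show ?thesis
    using assms bef_iff[of M c d] bef_iff[of M c "opp d"] bef_iff[of M "opp c" d] bef_iff[of M "opp c" "opp d"]
    unfolding il_def by auto
qed

text \<open>Moving a block reverses the comparison of \<open>x\<close> and \<open>z\<close> exactly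
  if one of them lies in the block. Modulo 2 this is a term in \<open>x\<close> plus a term in
  \<open>z\<close>, which cancels in the four comparisons of \<open>il\<close>.\<close>

lemma il_rotate:
  assumes "distinct (A @ B)" "{c, opp c, d, opp d} \<subseteq> set (A @ B)"
  shows "il (B @ A) c d = il (A @ B) c d"
proof -
  have dis: "set A \<inter> set B = {}" using assms(1) by auto
  have mem: "x \<in> set B \<longleftrightarrow> x \<notin> set A" if "x \<in> {c, opp c, d, opp d}" for x
    using subsetD[OF assms(2) that] dis by (simp add: disjoint_iff) blast
  have flip: "(bef B x z \<or> bef A x z \<or> x \<in> set B \<and> z \<in> set A) =
      ((bef A x z \<or> bef B x z \<or> x \<in> set A \<and> z \<in> set B) \<noteq> ((x \<in> set A) \<noteq> (z \<in> set A)))"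
    if "x \<in> {c, opp c}" "z \<in> {d, opp d}" for x z
  proof -
    have "bef A x z \<longrightarrow> x \<in> set A \<and> z \<in> set A" "bef B x z \<longrightarrow> x \<in> set B \<and> z \<in> set B"
      by (rule impI, erule bef_mem)+
    moreover have "x \<in> set B \<longleftrightarrow> x \<notin> set A" "z \<in> set B \<longleftrightarrow> z \<notin> set A"
      using mem that by blast+
    ultimately show ?thesis by argo
  qed
  note f = flip[of c d, simplified] flip[of c "opp d", simplified]
    flip[of "opp c" d, simplified] flip[of "opp c" "opp d", simplified]
  show ?thesis
    unfolding il_def bef_append f by argo
qed

definition linked :: "'b set \<Rightarrow> 'b \<Rightarrow> 'b \<Rightarrow> bool" where
  "linked T c d \<longleftrightarrow> c \<in> chords T \<and> d \<in> chords T \<and> d \<noteq> c \<and> d \<noteq> opp c \<and> il (tour T c) c d"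

lemma linked_iff:
  assumes T: "stree T" and M: "cyc (tau T) M" "set M = arcs G"
  shows "linked T c d \<longleftrightarrow> c \<in> chords T \<and> d \<in> chords T \<and> d \<noteq> c \<and> d \<noteq> opp c \<and> il M c d"
proof -
  have "il (tour T c) c d = il M c d" if cd: "c \<in> chords T" "d \<in> chords T"
  proof -
    have "c \<in> set M" using cd M(2) by auto
    then obtain A B where AB: "M = A @ c # B" by (meson split_list)
    have "cyc (tau T) (c # B @ A)" using cyc_rotate[of "tau T" A "c # B"] M(1) AB by simp
    then have t: "tour T c = (c # B) @ A" using tour_eqI[OF T] cd by simp
    show ?thesis
      unfolding t AB by (rule il_rotate) (use cd cyc_distinct[OF M(1)] M(2) in \<open>auto simp: AB\<close>)
  qed
  then show ?thesis by (auto simp: linked_def)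
qed

lemma linked_sym:
  assumes T: "stree T" and l: "linked T c d"
  shows "linked T d c"
proof -
  have cd: "c \<in> arcs G" "d \<in> arcs G" using l by (auto simp: linked_def)
  note M = cyc_tour[OF T cd(1)] set_tour[OF T cd(1)]
  have "d \<noteq> c" "d \<noteq> opp c" using l by (auto simp: linked_def)
  then have "c \<noteq> d" "c \<noteq> opp d" by (auto simp: arev_eq_iff)
  then show ?thesis
    using l il_sym[of "tour T c" c d] cd M(2) cyc_distinct[OF M(1)]
    unfolding linked_iff[OF T M] by auto
qed

lemma linked_opp:
  assumes T: "stree T" and l: "linked T c d"
  shows "linked T (opp c) d" "linked T c (opp d)"
proof -
  have cd: "c \<in> arcs G" "d \<in> arcs G" using l by (auto simp: linked_def)
  note M = cyc_tour[OF T cd(1)] set_tour[OF T cd(1)]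
  show "linked T (opp c) d" "linked T c (opp d)"
    using l chords_opp[OF T, of c] chords_opp[OF T, of d] unfolding linked_iff[OF T M] by (auto simp: arev_eq_iff)
qed

lemma chord_sides:
  assumes T: "stree T" and h: "h \<in> T" and M: "cyc (tau T) (h # Ws @ opp h # Ys)"
    and a: "a \<in> arcs G" "a \<noteq> h" "a \<noteq> opp h"
  shows "(head G h, tail G a) \<in> conn (T - edge h) \<longleftrightarrow> a \<in> set Ws"
    and "(tail G h, tail G a) \<in> conn (T - edge h) \<longleftrightarrow> a \<in> set Ys"
    and "a \<in> set Ws \<longleftrightarrow> a \<notin> set Ys"
proof -
  note s = tour_sides[OF T h M]
  have "a \<in> set (opp h # Ws) \<longleftrightarrow> (head G h, tail G a) \<in> conn (T - edge h)"
    "a \<in> set (h # Ys) \<longleftrightarrow> (tail G h, tail G a) \<in> conn (T - edge h)"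
    unfolding s using a by auto
  then show "(head G h, tail G a) \<in> conn (T - edge h) \<longleftrightarrow> a \<in> set Ws"
    "(tail G h, tail G a) \<in> conn (T - edge h) \<longleftrightarrow> a \<in> set Ys"
    using a by auto
  have "a \<in> set (h # Ws @ opp h # Ys)"
    using stree_tour_set[OF T stree_arcs[OF T h] M] a by blast
  then show "a \<in> set Ws \<longleftrightarrow> a \<notin> set Ys"
    using cyc_distinct[OF M] a by auto
qed

text \<open>The effect of an exchange on two blocks of a tour. Between ends in the same block the order is
  unchanged, which leaves a finite check.\<close>

lemma il_exchange:
  fixes W1 W2 Y1 Y2 :: "'b list" and h k c d :: 'b
  defines "M \<equiv> h # (W1 @ opp k # W2) @ opp h # (Y1 @ k # Y2)"
    and "M' \<equiv> k # (W2 @ opp h # W1) @ opp k # (Y2 @ h # Y1)"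
  assumes dis: "distinct M" and mem: "{c, opp c, d, opp d} \<subseteq> set M"
    and ne: "c \<notin> {h, opp h, k, opp k}" "opp c \<notin> {h, opp h, k, opp k}"
      "d \<notin> {h, opp h, k, opp k}" "opp d \<notin> {h, opp h, k, opp k}"
    and il: "il M c d"
  shows "il M' c d \<or> il M' c h \<or> il M' d h"
proof -
  \<comment> \<open>The number of the block that contains an arc, in the order of
    \<open>M\<close>.\<close>
  define bl :: "'b \<Rightarrow> nat" where
    "bl a = (if a \<in> set W1 then 0 else if a \<in> set W2 then 1 else if a \<in> set Y1 then 2 else 3)" for a
  define Q where "Q = {c, opp c, d, opp d}"
  have nn: "a \<noteq> h" "a \<noteq> opp h" "a \<noteq> k" "a \<noteq> opp k" if "a \<in> Q" for a
    using that ne unfolding Q_def by (elim insertE; simp)+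
  have disj: "distinct (W1 @ W2 @ Y1 @ Y2)" using dis unfolding M_def by auto
  have vals: "bl a = 0 \<or> bl a = 1 \<or> bl a = 2 \<or> bl a = 3" for a
    unfolding bl_def by simp
  have blk: "a \<in> set W1 \<longleftrightarrow> bl a = 0" "a \<in> set W2 \<longleftrightarrow> bl a = 1" "a \<in> set Y1 \<longleftrightarrow> bl a = 2"
      "a \<in> set Y2 \<longleftrightarrow> bl a = 3" if "a \<in> Q" for a
  proof -
    have "a \<in> set M" using mem that unfolding Q_def by (rule subsetD)
    then have 1: "a \<in> set W1 \<or> a \<in> set W2 \<or> a \<in> set Y1 \<or> a \<in> set Y2"
      unfolding M_def by (simp add: nn[OF that])
    have 2: "a \<in> set W1 \<longrightarrow> a \<notin> set W2 \<and> a \<notin> set Y1 \<and> a \<notin> set Y2"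
      "a \<in> set W2 \<longrightarrow> a \<notin> set Y1 \<and> a \<notin> set Y2" "a \<in> set Y1 \<longrightarrow> a \<notin> set Y2"
      using disj by auto
    show "a \<in> set W1 \<longleftrightarrow> bl a = 0" "a \<in> set W2 \<longleftrightarrow> bl a = 1" "a \<in> set Y1 \<longleftrightarrow> bl a = 2"
      "a \<in> set Y2 \<longleftrightarrow> bl a = 3"
      unfolding bl_def using 1 2 by auto
  qed
  define same where "same a b \<longleftrightarrow> bef W1 a b \<or> bef W2 a b \<or> bef Y1 a b \<or> bef Y2 a b" for a b
  have same: "same a b \<longrightarrow> bl a = bl b" if q: "a \<in> Q" "b \<in> Q" for a b
    unfolding same_def by (intro impI, elim disjE; drule bef_mem; simp add: blk[OF q(1)] blk[OF q(2)])
  have 1: "bef M a b \<longleftrightarrow> same a b \<or> bl a < bl b" if q: "a \<in> Q" "b \<in> Q" for a b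
  proof -
    have "bef M a b \<longleftrightarrow> same a b \<or> bl a = 0 \<and> (bl b = 1 \<or> bl b = 2 \<or> bl b = 3) \<or>
        bl a = 1 \<and> (bl b = 2 \<or> bl b = 3) \<or> bl a = 2 \<and> bl b = 3"
      unfolding M_def same_def
      by (simp add: nn[OF q(1)] nn[OF q(2)] nn[OF q(1), symmetric] blk[OF q(1)] blk[OF q(2)]) argo
    also have "\<dots> \<longleftrightarrow> same a b \<or> bl a < bl b"
      using vals[of a] vals[of b] by (elim disjE; simp)
    finally show ?thesis .
  qed
  \<comment> \<open>The place of each block in \<open>M'\<close>, where the order is
    \<open>W2\<close>, \<open>W1\<close>, \<open>Y2\<close>, \<open>Y1\<close>.\<close>
  define pos :: "nat \<Rightarrow> nat" where "pos i = (if i = 1 then 0 else if i = 0 then 1 else if i = 3 then 2 else 3)" for i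
  have 2: "bef M' a b \<longleftrightarrow> same a b \<or> pos (bl a) < pos (bl b)" if q: "a \<in> Q" "b \<in> Q" for a b
  proof -
    have "bef M' a b \<longleftrightarrow> same a b \<or> bl a = 1 \<and> (bl b = 0 \<or> bl b = 2 \<or> bl b = 3) \<or>
        bl a = 0 \<and> (bl b = 2 \<or> bl b = 3) \<or> bl a = 3 \<and> bl b = 2"
      unfolding M'_def same_def
      by (simp add: nn[OF q(1)] nn[OF q(2)] nn[OF q(1), symmetric] blk[OF q(1)] blk[OF q(2)]) argo
    also have "\<dots> \<longleftrightarrow> same a b \<or> pos (bl a) < pos (bl b)"
      using vals[of a] vals[of b] by (elim disjE; simp add: pos_def)
    finally show ?thesis .
  qed
  have h: "bef M' a h \<longleftrightarrow> bl a \<noteq> 2" "bef M' a (opp h) \<longleftrightarrow> bl a = 1" if q: "a \<in> Q" for a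
  proof -
    have d1: "h \<notin> set W1" "h \<notin> set W2" "h \<notin> set Y1" "h \<notin> set Y2"
      "opp h \<notin> set W1" "opp h \<notin> set W2" "opp h \<notin> set Y1" "opp h \<notin> set Y2"
      "k \<noteq> h" "k \<noteq> opp h" "opp k \<noteq> h" "opp h \<noteq> h" "h \<noteq> opp h"
      using dis unfolding M_def by auto
    have nb: "\<not> bef L u v" if "v \<notin> set L" for L u v using bef_mem[of L u v] that by blast
    have "bef M' a h \<longleftrightarrow> bl a = 3 \<or> bl a = 0 \<or> bl a = 1" "bef M' a (opp h) \<longleftrightarrow> bl a = 1"
      unfolding M'_def by (simp_all add: nn[OF q] nn[OF q, symmetric] blk[OF q] d1 d1(9)[symmetric] nb)
    then show "bef M' a h \<longleftrightarrow> bl a \<noteq> 2" "bef M' a (opp h) \<longleftrightarrow> bl a = 1"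
      using vals[of a] by linarith+
  qed
  \<comment> \<open>The two binary digits of the block number: the side of \<open>h\<close>, and the
    half within this side. The exchange reverses two ends exactly if they lie on the same side in
    different halves.\<close>
  define p q where "p a \<longleftrightarrow> 2 \<le> bl a" and "q a \<longleftrightarrow> bl a = 1 \<or> bl a = 3" for a
  define r where "r a b \<longleftrightarrow> (p a \<longleftrightarrow> p b) \<and> (q a \<noteq> q b)" for a b
  have change: "bef M' a b \<longleftrightarrow> bef M a b \<noteq> r a b" if "a \<in> Q" "b \<in> Q" for a b
    unfolding 1[OF that] 2[OF that] r_def p_def q_def
    using vals[of a] vals[of b] same[OF that] by (elim disjE; simp add: pos_def)
  have parity: "(bef M' a h \<noteq> bef M' a (opp h)) \<longleftrightarrow> (p a \<longleftrightarrow> q a)" if "a \<in> Q" for a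
    unfolding h[OF that] p_def q_def using vals[of a] by (elim disjE; simp)
  have q: "c \<in> Q" "opp c \<in> Q" "d \<in> Q" "opp d \<in> Q" by (simp_all add: Q_def)
  show ?thesis
  proof (rule ccontr)
    assume "\<not> (il M' c d \<or> il M' c h \<or> il M' d h)"
    then have n: "\<not> il M' c d" "\<not> il M' c h" "\<not> il M' d h" by blast+
    have "(p c \<longleftrightarrow> q c) \<longleftrightarrow> (p (opp c) \<longleftrightarrow> q (opp c))"
      using n(2) unfolding il_def parity[OF q(1)] parity[OF q(2)] by argo
    moreover have "(p d \<longleftrightarrow> q d) \<longleftrightarrow> (p (opp d) \<longleftrightarrow> q (opp d))"
      using n(3) unfolding il_def parity[OF q(3)] parity[OF q(4)] by argo
    \<comment> \<open>If neither chord is linked with \<open>h\<close>, both ends of each chord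
      agree on whether the two digits are equal. The four reversals then cancel, and
      \<open>c\<close> and \<open>d\<close> would have stayed linked.\<close>
    ultimately have "(r c d \<noteq> r c (opp d)) \<longleftrightarrow> (r (opp c) d \<noteq> r (opp c) (opp d))"
      unfolding r_def
      by (cases "p c"; cases "q c"; cases "p d"; cases "q d"; cases "p (opp c)"; cases "p (opp d)"; simp)
    then show False
      using il n(1) unfolding il_def change[OF q(1) q(3)] change[OF q(1) q(4)] change[OF q(2) q(3)] change[OF q(2) q(4)]
      by argo
  qed
qed

end

context loopless_ribbon_graph
begin

text \<open>For any other arc, lying between the ends of \<open>h\<close> in the new tour is the
  opposite of lying between the ends of \<open>k\<close> in the old one. Complementing this for both
  ends of \<open>d\<close> does not affect alternation.\<close>

lemma il_exchange_new:
  fixes W1 W2 Y1 Y2 :: "'b list" and h k d :: 'b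
  defines "M \<equiv> h # (W1 @ opp k # W2) @ opp h # (Y1 @ k # Y2)"
    and "M' \<equiv> k # (W2 @ opp h # W1) @ opp k # (Y2 @ h # Y1)"
  assumes dis: "distinct M" and mem: "d \<in> set M" "opp d \<in> set M"
    and ne: "d \<notin> {h, opp h, k, opp k}" "opp d \<notin> {h, opp h, k, opp k}"
    and il: "il M k d"
  shows "il M' h d"
proof -
  have nb: "\<not> bef L u v" if "u \<notin> set L" for L u v using bef_mem[of L u v] that by blast
  have *: "(bef M k a \<noteq> bef M (opp k) a) \<noteq> (bef M' h a \<noteq> bef M' (opp h) a)"
    if a: "a \<in> set M" "a \<notin> {h, opp h, k, opp k}" for a
  proof -
    have d: "h \<notin> set W1" "h \<notin> set W2" "h \<notin> set Y1" "h \<notin> set Y2"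
      "opp h \<notin> set W1" "opp h \<notin> set W2" "opp h \<notin> set Y1" "opp h \<notin> set Y2"
      "k \<notin> set W1" "k \<notin> set W2" "k \<notin> set Y1" "k \<notin> set Y2"
      "opp k \<notin> set W1" "opp k \<notin> set W2" "opp k \<notin> set Y1" "opp k \<notin> set Y2"
      "k \<noteq> h" "k \<noteq> opp h" "opp h \<noteq> k" "opp k \<noteq> h" "opp h \<noteq> h" "h \<noteq> opp h" "h \<noteq> k" "h \<noteq> opp k" "opp k \<noteq> k" "k \<noteq> opp k"
      using dis unfolding M_def by auto
    have dd: "distinct (W1 @ W2 @ Y1 @ Y2)" using dis unfolding M_def by auto
    have n: "a \<noteq> h" "a \<noteq> opp h" "a \<noteq> k" "a \<noteq> opp k" using a(2) by auto
    have 1: "a \<in> set W1 \<or> a \<in> set W2 \<or> a \<in> set Y1 \<or> a \<in> set Y2"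
      using a(1) unfolding M_def by (simp add: n)
    have 2: "a \<in> set W1 \<longrightarrow> a \<notin> set W2 \<and> a \<notin> set Y1 \<and> a \<notin> set Y2"
      "a \<in> set W2 \<longrightarrow> a \<notin> set Y1 \<and> a \<notin> set Y2" "a \<in> set Y1 \<longrightarrow> a \<notin> set Y2"
      using dd by auto
    have 3: "bef M k a \<longleftrightarrow> a \<in> set Y2" "bef M (opp k) a \<longleftrightarrow> a \<in> set W2 \<or> a \<in> set Y1 \<or> a \<in> set Y2"
      "bef M' h a \<longleftrightarrow> a \<in> set Y1" "bef M' (opp h) a \<longleftrightarrow> a \<in> set W1 \<or> a \<in> set Y2 \<or> a \<in> set Y1"
      unfolding M_def M'_def by (simp_all add: d n n[symmetric] nb)
    show ?thesis unfolding 3 using 1 2 by argo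
  qed
  show ?thesis
    using il *[OF mem(1) ne(1)] *[OF mem(2) ne(2)] unfolding il_def by argo
qed

text \<open>The removed tree edge \<open>h\<close> becomes a chord. It takes over the links of
  \<open>k\<close>, and it is linked with one chord of any pair that loses its link.\<close>

lemma linked_exchange:
  assumes T: "stree T" and h: "h \<in> T" and k: "k \<in> chords T"
    and s: "(tail G h, tail G k) \<in> conn (T - edge h)" "(head G h, head G k) \<in> conn (T - edge h)"
  shows "linked T c d \<Longrightarrow> c \<notin> edge k \<Longrightarrow> d \<notin> edge k \<Longrightarrow>
      linked (T - edge h \<union> edge k) c d \<or> linked (T - edge h \<union> edge k) c h \<or> linked (T - edge h \<union> edge k) d h"
    and "linked T k d \<Longrightarrow> linked (T - edge h \<union> edge k) h d"
proof -
  let ?F = "T - edge h" and ?T' = "T - edge h \<union> edge k"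
  have F: "bforest ?F" using T stree_bforest bforest_diff_edge by blast
  have hG: "h \<in> arcs G" "h \<noteq> opp h" using T h stree_arcs by auto
  have kG: "k \<in> arcs G" "opp k \<in> arcs G" "k \<notin> T" "opp k \<notin> T" using k stree_opp_iff[OF T] by auto
  have kh: "k \<noteq> h" "k \<noteq> opp h" "opp k \<noteq> h" "opp k \<noteq> opp h"
    using kG h stree_opp_iff[OF T, of h] by (auto simp: arev_eq_iff)
  obtain L where L: "cyc (tau T) L" "set L = arcs G" using cyc_tour[OF T hG(1)] set_tour[OF T hG(1)] by blast
  obtain Xs Ys where M0: "cyc (tau T) (h # Ys @ opp h # Xs)" using tour_split_at[OF T h] .
  note sides = tour_sides[OF T h M0] and cut = tour_cut[OF T h M0]
  have "k \<in> set (h # Xs)" "opp k \<in> set (opp h # Ys)"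
    unfolding sides using kG s by simp_all
  then have "k \<in> set Xs" "opp k \<in> set Ys" using kh by auto
  then obtain Y1 Y2 W1 W2 where XY: "Xs = Y1 @ k # Y2" "Ys = W1 @ opp k # W2" by (meson split_list)
  let ?M = "h # (W1 @ opp k # W2) @ opp h # (Y1 @ k # Y2)"
  let ?M' = "k # (W2 @ opp h # W1) @ opp k # (Y2 @ h # Y1)"
  have M: "cyc (tau T) ?M" "set ?M = arcs G"
    using M0 stree_tour_set[OF T hG(1) M0] unfolding XY by blast+
  note ex = tour_exchange[OF T h kG(1) cut[unfolded XY]]
  have M': "set ?M' = arcs G" using M(2) by auto
  note lk = linked_iff[OF T M] and lk' = linked_iff[OF ex(1) ex(2) M']
  have nin: "a \<noteq> h" "a \<noteq> opp h" if "a \<in> chords T" for a using that h stree_opp_iff[OF T, of h] by auto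
  have ch: "a \<in> chords ?T' \<and> opp a \<in> chords ?T'" if "a \<in> chords T" "a \<notin> edge k" for a
    using that stree_opp_iff[OF T, of a] by auto
  have hc: "h \<in> chords ?T'" using hG kh by auto
  show "linked ?T' c d \<or> linked ?T' c h \<or> linked ?T' d h" if l: "linked T c d" and ck: "c \<notin> edge k" "d \<notin> edge k"
  proof -
    have cd: "c \<in> chords T" "d \<in> chords T" "d \<noteq> c" "d \<noteq> opp c" "il ?M c d" using l unfolding lk by blast+
    have ocd: "opp c \<in> chords T" "opp d \<in> chords T" using cd chords_opp[OF T] by blast+
    have ock: "opp c \<notin> edge k" "opp d \<notin> edge k" using ck by auto
    have "il ?M' c d \<or> il ?M' c h \<or> il ?M' d h"
    proof (rule il_exchange)
      show "distinct ?M" using M(1) by (rule cyc_distinct)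
      show "{c, opp c, d, opp d} \<subseteq> set ?M" unfolding M(2) using cd ocd by blast
      show "c \<notin> {h, opp h, k, opp k}" using nin[OF cd(1)] ck by simp
      show "opp c \<notin> {h, opp h, k, opp k}" using nin[OF ocd(1)] ock by simp
      show "d \<notin> {h, opp h, k, opp k}" using nin[OF cd(2)] ck by simp
      show "opp d \<notin> {h, opp h, k, opp k}" using nin[OF ocd(2)] ock by simp
    qed (rule cd(5))
    then show ?thesis
      unfolding lk' using ch[OF cd(1) ck(1)] ch[OF cd(2) ck(2)] hc cd(3,4) nin[OF cd(1)] nin[OF cd(2)]
        nin[OF ocd(1)] nin[OF ocd(2)] by metis
  qed
  show "linked ?T' h d" if l: "linked T k d"
  proof -
    have cd: "d \<in> chords T" "d \<noteq> k" "d \<noteq> opp k" "il ?M k d" using l unfolding lk by blast+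
    have od: "opp d \<in> chords T" using cd chords_opp[OF T] by blast
    have dk: "d \<notin> edge k" "opp d \<notin> edge k" using cd by auto
    have "il ?M' h d"
    proof (rule il_exchange_new)
      show "distinct ?M" using M(1) by (rule cyc_distinct)
      show "d \<in> set ?M" "opp d \<in> set ?M" unfolding M(2) using cd od by blast+
      show "d \<notin> {h, opp h, k, opp k}" using nin[OF cd(1)] dk by simp
      show "opp d \<notin> {h, opp h, k, opp k}" using nin[OF od] dk by simp
    qed (rule cd(4))
    then show ?thesis
      unfolding lk' using ch[OF cd(1) dk(1)] hc nin[OF cd(1)] by blast
  qed
qed

text \<open>The tour visits the head side of \<open>h\<close> in one block, so a chord with both
  ends there cannot alternate with a chord that has both ends on the tail side.\<close>

lemma linked_sides:
  assumes T: "stree T" and h: "h \<in> T" and l: "linked T c d"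
    and c: "(tail G h, tail G c) \<in> conn (T - edge h)" "(tail G h, head G c) \<in> conn (T - edge h)"
    and d: "(head G h, tail G d) \<in> conn (T - edge h)"
  shows "(tail G h, head G d) \<in> conn (T - edge h)"
proof (rule ccontr)
  assume nd: "(tail G h, head G d) \<notin> conn (T - edge h)"
  have hG: "h \<in> arcs G" using T h stree_arcs by auto
  obtain Xs Ys where M: "cyc (tau T) (h # Ys @ opp h # Xs)" using tour_split_at[OF T h] .
  note set = stree_tour_set[OF T hG M]
  note lk = linked_iff[OF T M set]
  have cd: "c \<in> chords T" "d \<in> chords T" "il (h # Ys @ opp h # Xs) c d" using l unfolding lk by blast+
  have ocd: "opp c \<in> chords T" "opp d \<in> chords T" using cd chords_opp[OF T] by blast+
  have nin: "a \<in> arcs G" "a \<noteq> h" "a \<noteq> opp h" if "a \<in> chords T" for a using that h stree_opp_iff[OF T, of h] by auto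
  note sd = chord_sides[OF T h M nin]
  have 1: "c \<in> set Xs" "opp c \<in> set Xs" using sd(2)[OF cd(1) cd(1) cd(1)] sd(2)[OF ocd(1) ocd(1) ocd(1)] c cd by auto
  have 2: "d \<in> set Ys" "opp d \<in> set Ys"
    using sd(1)[OF cd(2) cd(2) cd(2)] sd(2,3)[OF ocd(2) ocd(2) ocd(2)] d nd cd by auto
  have dis: "distinct (h # Ys @ opp h # Xs)" using M by (rule cyc_distinct)
  have "\<not> bef (h # Ys @ opp h # Xs) u v" if "u \<in> set Xs" "v \<in> set Ys" for u v
    using bef_asym[OF dis, of v u] that by simp
  then show False using cd(3) 1 2 unfolding il_def by blast
qed

lemma relpow_mono: "(R :: ('c \<times> 'c) set) \<subseteq> S \<Longrightarrow> R ^^ n \<subseteq> S ^^ n"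
  by (induction n) (simp_all add: relcomp_mono)

text \<open>A walk that uses the edge of \<open>a\<close> passes through \<open>tail G a\<close>,
  and its remainder from there is no longer than the walk.\<close>

lemma relpow_avoid:
  assumes a: "a \<in> arcs G" and "(u, v) \<in> adj T ^^ m"
  shows "(u, v) \<in> adj (T - edge a) ^^ m \<or> (\<exists>n\<le>m. (tail G a, v) \<in> adj T ^^ n)"
  using assms(2)
proof (induction m arbitrary: u)
  case (Suc m)
  obtain w where w: "(u, w) \<in> adj T" "(w, v) \<in> adj T ^^ m" using Suc.prems by (rule relpow_Suc_E2)
  then obtain b where b: "b \<in> T" "u = tail G b" "w = head G b" by (auto simp: adj_def)
  consider "b = a" | "u = head G a" "w = tail G a" | "b \<notin> edge a"
    using b a by (cases "b = opp a") auto
  then show ?case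
  proof cases
    case 1 then show ?thesis using Suc.prems b by blast
  next
    case 2 then show ?thesis using w(2) le_Suc_eq by blast
  next
    case 3
    then have "(u, w) \<in> adj (T - edge a)" using b by (auto simp: adj_def)
    then show ?thesis using Suc.IH[OF w(2)] by (meson relpow_Suc_I2 le_SucI)
  qed
qed simp

text \<open>Induction on the distance of the tails in the tree, with \<open>a\<close> the first edge
  on the way from \<open>c\<close> to \<open>d\<close>. If \<open>c\<close> crosses the cut of
  \<open>a\<close>, then exchanging \<open>a\<close> for \<open>c\<close> makes \<open>opp a\<close>
  a chord linked with \<open>d\<close> that starts one step closer. Otherwise \<open>d\<close>
  crosses it by \<open>linked_sides\<close>, and exchanging \<open>a\<close> for \<open>d\<close>
  makes \<open>a\<close> a chord linked with \<open>c\<close> at the same vertex.\<close>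

lemma linked_at_vertex:
  assumes "stree T" "linked T c d"
  shows "\<exists>T' c' d'. stree T' \<and> linked T' c' d' \<and> tail G c' = tail G d'"
proof -
  have cd: "c \<in> arcs G" "d \<in> arcs G" using assms(2) by (auto simp: linked_def)
  then have "(tail G c, tail G d) \<in> conn T" using stree_conn[OF assms(1)] by simp
  then obtain n where "(tail G c, tail G d) \<in> adj T ^^ n" using rtrancl_imp_relpow by blast
  with assms show ?thesis
  proof (induction n arbitrary: T c d rule: less_induct)
    case (less n)
    note T = less.prems(1) and l = less.prems(2)
    have cd: "c \<in> chords T" "d \<in> chords T" using l by (auto simp: linked_def)
    show ?case
    proof (cases "\<exists>m<n. (tail G c, tail G d) \<in> adj T ^^ m")
      case True then show ?thesis using less.IH T l by blast
    next
      case short: False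
      show ?thesis
      proof (cases n)
        case 0 then show ?thesis using less.prems by auto
      next
        case (Suc m)
        obtain w where w: "(tail G c, w) \<in> adj T" "(w, tail G d) \<in> adj T ^^ m"
          using less.prems(3) unfolding Suc by (rule relpow_Suc_E2)
        then obtain a where a: "a \<in> T" "tail G c = tail G a" "w = head G a" by (auto simp: adj_def)
        have aG: "a \<in> arcs G" using T a stree_arcs by blast
        \<comment> \<open>By minimality of the distance the rest of the walk does not return to
          \<open>tail G a\<close>, so it avoids the edge of \<open>a\<close> and survives the
          exchange.\<close>
        have far: "(head G a, tail G d) \<in> adj (T - edge a) ^^ m"
          using relpow_avoid[OF aG w(2)] short a Suc by (auto simp: less_Suc_eq_le)
        then have hd: "(head G a, tail G d) \<in> conn (T - edge a)" by (rule relpow_imp_rtrancl)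
        show ?thesis
        proof (cases "(head G a, head G c) \<in> conn (T - edge a)")
          case True
          let ?T = "T - edge a \<union> edge c"
          have s: "(tail G a, tail G c) \<in> conn (T - edge a)" using a by simp
          have T': "stree ?T" by (rule stree_exchange[OF T a(1) _ s True]) (use cd in blast)
          have "linked ?T a d" by (rule linked_exchange(2)[OF T a(1) cd(1) s True l])
          then have "linked ?T (opp a) d" using linked_opp[OF T'] by blast
          moreover have "adj (T - edge a) \<subseteq> adj ?T" by (rule adj_mono) blast
          then have "adj (T - edge a) ^^ m \<subseteq> adj ?T ^^ m" by (rule relpow_mono)
          then have "(tail G (opp a), tail G d) \<in> adj ?T ^^ m" using far aG by auto
          ultimately show ?thesis using less.IH[of m ?T "opp a" d] T' Suc by blast
        next
          case False
          have "head G c \<in> verts G" using cd by simp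
          then have hc: "(tail G a, head G c) \<in> conn (T - edge a)"
            using stree_sides[OF T a(1)] False by blast
          have dd: "(tail G a, head G d) \<in> conn (T - edge a)"
            using linked_sides[OF T a(1) l _ hc hd] a by simp
          let ?T = "T - edge a \<union> edge (opp d)"
          have od: "opp d \<in> chords T" using cd chords_opp[OF T] by blast
          have s: "(tail G a, tail G (opp d)) \<in> conn (T - edge a)" "(head G a, head G (opp d)) \<in> conn (T - edge a)"
            using dd hd cd by auto
          have T': "stree ?T" by (rule stree_exchange[OF T a(1) _ s]) (use od in blast)
          have "linked T (opp d) c" using linked_opp(1)[OF T linked_sym[OF T l]] .
          then have "linked ?T a c" by (rule linked_exchange(2)[OF T a(1) od s])
          then show ?thesis using T' a by metis
        qed
      qed
    qed
  qed
qed

text \<open>Induction on the degree of \<open>x\<close> in \<open>T\<close>. If an arc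
  \<open>a\<close> of \<open>G - x\<close> joins two branches, it replaces the tree arc
  \<open>h\<close> from \<open>x\<close> to one of them, which lowers the degree. By
  \<open>linked_exchange\<close> a linked pair remains, and if \<open>h\<close> enters it, it also
  starts at \<open>x\<close>.\<close>

lemma linked_starred:
  assumes "stree T" "linked T c d" "tail G c = x" "tail G d = x"
  shows "\<exists>T' c' d'. stree T' \<and> linked T' c' d' \<and> tail G c' = x \<and> tail G d' = x \<and> starred T' x"
  using assms
proof (induction "card {a \<in> T. tail G a = x}" arbitrary: T c d rule: less_induct)
  case less
  note T = less.prems(1) and l = less.prems(2)
  have cd: "c \<in> arcs G" "d \<in> arcs G" using l by (auto simp: linked_def)
  show ?case
  proof (cases "starred T x")
    case True then show ?thesis using less.prems by blast
  next
    case False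
    then obtain a where a: "a \<in> off x" "(tail G a, head G a) \<notin> conn (T \<inter> off x)"
      by (auto simp: starred_def)
    have aG: "a \<in> arcs G" "tail G a \<noteq> x" "head G a \<noteq> x" using a by (auto simp: off_def)
    have aT: "a \<notin> T" using a conn_arc[of a "T \<inter> off x"] by blast
    define h where "h = tree_rotors G T (tail G a) x"
    have xV: "x \<in> verts G" using cd less.prems by auto
    have h: "h \<in> T" "(head G h, tail G a) \<in> conn (T - edge h)" "tail G h = x"
      using stree_rotor(1,2)[OF T xV _ aG(2)[symmetric]] aG(1) unfolding h_def towards_def by auto
    have hG: "h \<in> arcs G" using T h stree_arcs by blast
    have sF: "oppclosed (T \<inter> off x)"
      using stree_oppclosed[OF T] oppclosed_off[of x] unfolding oppclosed_def by auto
    have "(head G h, head G a) \<notin> conn (T - edge h)"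
    proof
      assume "(head G h, head G a) \<in> conn (T - edge h)"
      then have "(head G h, head G a) \<in> conn (T \<inter> off x)" "(head G h, tail G a) \<in> conn (T \<inter> off x)"
        using h branch_conn[OF T h(1)] by auto
      then show False using a(2) conn_trans[OF conn_sym[OF sF]] by blast
    qed
    moreover have "head G a \<in> verts G" using aG by simp
    ultimately have s1: "(tail G h, head G a) \<in> conn (T - edge h)" using stree_sides[OF T h(1)] by blast
    let ?k = "opp a" and ?T = "T - edge h \<union> edge (opp a)"
    have k: "?k \<in> chords T" using aG aT stree_opp_iff[OF T] by auto
    have s: "(tail G h, tail G ?k) \<in> conn (T - edge h)" "(head G h, head G ?k) \<in> conn (T - edge h)"
      using s1 h aG by auto
    have T': "stree ?T" by (rule stree_exchange[OF T h(1) _ s]) (use k in blast)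
    have "c \<notin> edge ?k" "d \<notin> edge ?k" using less.prems aG by auto
    then have "linked ?T c d \<or> linked ?T c h \<or> linked ?T d h"
      by (rule linked_exchange(1)[OF T h(1) k s l])
    moreover have "card {b \<in> ?T. tail G b = x} < card {b \<in> T. tail G b = x}"
    proof (rule psubset_card_mono)
      have "T \<subseteq> arcs G" using stree_arcs[OF T] by blast
      then have "finite T" using finite_arcs by (rule finite_subset)
      then show "finite {b \<in> T. tail G b = x}" by simp
      have "h \<in> {b \<in> T. tail G b = x}" "h \<notin> {b \<in> ?T. tail G b = x}" using h aG by auto
      moreover have "{b \<in> ?T. tail G b = x} \<subseteq> {b \<in> T. tail G b = x}" using aG by auto
      ultimately show "{b \<in> ?T. tail G b = x} \<subset> {b \<in> T. tail G b = x}" by blast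
    qed
    ultimately show ?thesis using less.hyps[OF _ T'] less.prems(3,4) h(3) by blast
  qed
qed

end

section \<open>Agreement excludes linked chords\<close>

context loopless_ribbon_graph
begin

lemma branch_arc:
  assumes T: "stree T" and v: "v \<in> verts G" "x \<in> verts G" "v \<noteq> x"
  obtains h where "h \<in> T" "tail G h = x" "(head G h, v) \<in> conn (T - edge h)"
  using stree_rotor(1,2)[OF T v(2,1) v(3)[symmetric]] that unfolding towards_def by blast

end

context agreeing_ribbon_graph
begin

text \<open>In the tours of \<open>T - edge h\<close> any arc \<open>e\<close> from \<open>x\<close> to the branch of \<open>h\<close> can play the role of \<open>h\<close>.\<close>

lemma agree_turn_branch:
  assumes T: "stree T" and h: "h \<in> T" "tail G h = x" and star: "starred T x"
    and e: "e \<in> arcs G" "tail G e = x" "(head G h, head G e) \<in> conn (off x)"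
    and k: "k \<in> arcs G" "tail G k = x"
    and X: "cyc (tau (T - edge h)) (e # S1 @ k # S2)"
    and Y: "cyc (tau (T - edge h)) (opp e # B @ opp k # A)"
    and nox: "\<And>a. a \<in> set S1 \<Longrightarrow> tail G a = x \<Longrightarrow> (head G h, head G a) \<notin> conn (off x)"
  shows "g \<in> set A \<Longrightarrow> head G g \<noteq> x"
    and "u \<in> set S1 \<Longrightarrow> tail G u = x \<Longrightarrow> u' \<in> arcs G \<Longrightarrow> tail G u' = x \<Longrightarrow>
      (head G u, head G u') \<in> conn (off x) \<Longrightarrow> u' \<in> set S1"
proof -
  let ?T = "T - edge h \<union> edge e"
  have eq: "(head G h, v) \<in> conn (T - edge h) \<longleftrightarrow> (head G h, v) \<in> conn (off x)" for v
    using branch_conn[OF T h(1)] starred_conn[OF star] h(2) by blast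
  have s: "(tail G h, tail G e) \<in> conn (T - edge h)" "(head G h, head G e) \<in> conn (T - edge h)"
    using h e eq by auto
  have T': "stree ?T" by (rule stree_exchange[OF T h(1) e(1) s])
  have eT: "e \<notin> T - edge h"
  proof
    assume "e \<in> T - edge h"
    then have "(tail G h, head G e) \<in> conn (T - edge h)" using conn_arc[of e "T - edge h"] h e by simp
    then show False using stree_sides_disj[OF T h(1), of "head G e"] s by blast
  qed
  then have "opp e \<notin> T - edge h"
    using oppclosed_opp_iff[OF oppclosed_diff_edge[OF stree_oppclosed[OF T]]] by blast
  then have F: "?T - edge e = T - edge h" using eT by auto
  have "h \<notin> off x" "opp h \<notin> off x" "e \<notin> off x" "opp e \<notin> off x"
    using h e stree_arcs[OF T h(1)] by (auto simp: off_def)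
  then have "?T \<inter> off x = T \<inter> off x" by auto
  then have star': "starred ?T x" using star unfolding starred_def by simp
  have sym: "(head G h, v) \<in> conn (off x)" if "(head G e, v) \<in> conn (off x)" for v
    using e(3) that by (rule conn_trans)
  note turn = agree_turn[of ?T e k S1 S2 B A, unfolded F e(2), OF T' _ star' k X Y]
  show "head G g \<noteq> x" if "g \<in> set A"
    using that by (rule turn(1)[rotated 2]) (use nox sym in auto)
  show "u' \<in> set S1" if "u \<in> set S1" "tail G u = x" "u' \<in> arcs G" "tail G u' = x"
    "(head G u, head G u') \<in> conn (off x)"
    using that by (rule turn(2)[rotated 2]) (use nox sym in auto)
qed

text \<open>Let \<open>h\<close> be the tree arc from \<open>x\<close> to the branch that
  \<open>c\<close> enters. If \<open>d\<close> enters it too, the link means that the branch meets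
  both chords in the same order as \<open>x\<close> does; a closest pair of this kind makes
  \<open>opp h\<close> violate the first conclusion of \<open>agree_turn_branch\<close>. If
  \<open>d\<close> enters another branch, the arcs into the branch of \<open>c\<close> separate two
  arcs from \<open>x\<close> into that branch, against the second conclusion.\<close>

lemma unlinked_starred:
  assumes T: "stree T" and star: "starred T x" and l: "linked T c d" and x: "tail G c = x" "tail G d = x"
  shows False
proof -
  have cdG: "c \<in> arcs G" "d \<in> arcs G" "c \<notin> T" "d \<notin> T" "c \<noteq> d" using l by (auto simp: linked_def)
  have xV: "x \<in> verts G" using cdG x by auto
  have hd: "head G a \<in> verts G \<and> head G a \<noteq> x" if "a \<in> arcs G" "tail G a = x" for a
    using that no_loops[OF that(1)] by auto
  obtain h where h: "h \<in> T" "tail G h = x" "(head G h, head G c) \<in> conn (T - edge h)"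
    using branch_arc[OF T _ xV] hd[OF cdG(1) x(1)] by blast
  have hG: "h \<in> arcs G" using T h stree_arcs by blast
  have F: "bforest (T - edge h)" using T stree_bforest bforest_diff_edge by blast
  have eq: "(head G h, v) \<in> conn (T - edge h) \<longleftrightarrow> (head G h, v) \<in> conn (off x)" for v
    using branch_conn[OF T h(1)] starred_conn[OF star] h(2) by blast
  obtain Xs Ys where M: "cyc (tau T) (h # Ys @ opp h # Xs)" using tour_split_at[OF T h(1)] .
  note setM = stree_tour_set[OF T hG M]
  note lk = linked_iff[OF T M setM]
  note cut = tour_cut[OF T h(1) M]
  have dis: "distinct (h # Ys @ opp h # Xs)" using M by (rule cyc_distinct)
  have setX: "set (h # Xs) = {b \<in> arcs G. (tail G h, tail G b) \<in> conn (T - edge h)}"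
    and setY: "set (opp h # Ys) = {b \<in> arcs G. (head G h, tail G b) \<in> conn (T - edge h)}"
    by (rule tour_sides[OF T h(1) M])+
  have inX: "a \<in> set Xs" if "a \<in> arcs G" "tail G a = x" "a \<noteq> h" for a
  proof -
    have "a \<in> set (h # Xs)" unfolding setX using that h by simp
    then show ?thesis using that by simp
  qed
  have XG: "a \<in> arcs G" if "a \<in> set Xs" for a
  proof -
    have "a \<in> set (h # Xs)" using that by simp
    then show ?thesis unfolding setX by simp
  qed
  have inY: "opp a \<in> set Ys \<longleftrightarrow> (head G h, head G a) \<in> conn (off x)" if "a \<in> arcs G" "a \<noteq> h" "a \<noteq> opp h" for a
  proof -
    have "opp a \<in> set (opp h # Ys) \<longleftrightarrow> (head G h, head G a) \<in> conn (off x)"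
      unfolding setY eq using that by simp
    then show ?thesis using that by simp
  qed
  have c: "c \<in> set Xs" "opp c \<in> set Ys" "(head G h, head G c) \<in> conn (off x)" "c \<noteq> h" "c \<noteq> opp h"
  proof -
    show 1: "c \<noteq> h" "c \<noteq> opp h" using cdG h stree_opp_iff[OF T, of h] by auto
    show 2: "(head G h, head G c) \<in> conn (off x)" using h eq by blast
    show "c \<in> set Xs" "opp c \<in> set Ys" using inX inY[of c] cdG x 1 2 by auto
  qed
  have d: "d \<in> set Xs" "d \<noteq> h" "d \<noteq> opp h"
    using inX cdG x h stree_opp_iff[OF T, of h] by auto
  have befX: "bef (h # Ys @ opp h # Xs) u v = bef Xs u v" if "u \<in> set Xs" for u v
  proof -
    have "u \<notin> set Ys" "u \<noteq> h" "u \<noteq> opp h" using that dis by auto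
    moreover have "\<not> bef Ys u v" using calculation(1) bef_mem[of Ys u v] by blast
    ultimately show ?thesis by simp
  qed
  have befY: "bef (h # Ys @ opp h # Xs) u v" if "u \<in> set Ys" "v \<in> set Xs" for u v
    using that by simp
  have disX: "distinct Xs" and disY: "distinct Ys" and disXY: "set Xs \<inter> set Ys = {}" using dis by auto
  show False
  proof (cases "(head G h, head G d) \<in> conn (off x)")
    case True
    define K where "K = {g \<in> arcs G. tail G g = x \<and> (head G h, head G g) \<in> conn (off x) \<and> g \<noteq> h}"
    \<comment> \<open>Pairs in the same order at \<open>x\<close> and in the branch. For two chords
      this is what being linked amounts to.\<close>
    define P where "P u v \<longleftrightarrow> u \<in> K \<and> v \<in> K \<and> bef Xs u v \<and> bef Ys (opp u) (opp v)" for u v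
    have K: "g \<in> set Xs" "opp g \<in> set Ys" if "g \<in> K" for g
    proof -
      have "g \<noteq> opp h" using that hG h(2) no_loops[OF hG] by (auto simp: K_def)
      then show "g \<in> set Xs" "opp g \<in> set Ys" using that inX inY[of g] by (auto simp: K_def)
    qed
    have cK: "c \<in> K" "d \<in> K" using cdG x c(3,4) d True by (auto simp: K_def)
    have Y: "opp c \<in> set Ys" "opp d \<in> set Ys" using K cK by blast+
    have il: "il (h # Ys @ opp h # Xs) c d" using l unfolding lk by blast
    have "bef (h # Ys @ opp h # Xs) (opp c) (opp d) = bef Ys (opp c) (opp d)"
    proof -
      have n: "opp c \<noteq> h" "opp c \<noteq> opp h" "opp c \<notin> set Xs" "opp d \<notin> set Xs" using Y dis by auto
      then have "\<not> bef Xs (opp c) (opp d)" using bef_mem[of Xs "opp c" "opp d"] by blast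
      then show ?thesis using n d(2) by simp
    qed
    moreover have "\<not> bef Xs c (opp d)" using Y bef_mem[of Xs c "opp d"] disXY by blast
    ultimately have "bef Xs c d \<longleftrightarrow> bef Ys (opp c) (opp d)"
      using il unfolding il_def befX[OF c(1)] using befY[OF Y(1) d(1)] by argo
    moreover have "bef Xs c d \<or> bef Xs d c" using bef_total[OF c(1) d(1) cdG(5)] .
    moreover have "bef Ys (opp c) (opp d) \<or> bef Ys (opp d) (opp c)" using bef_total[OF Y] cdG(5) by simp
    moreover have "\<not> (bef Xs c d \<and> bef Xs d c)" using bef_asym[OF disX] by blast
    ultimately have "P c d \<or> P d c" unfolding P_def using cK by blast
    then have ex: "\<exists>uv. P (fst uv) (snd uv)" by auto
    define between where "between uv = {g \<in> K. bef Xs (fst uv) g \<and> bef Xs g (snd uv)}" for uv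
    obtain uv where uv: "P (fst uv) (snd uv)"
      "\<And>uv'. P (fst uv') (snd uv') \<Longrightarrow> card (between uv) \<le> card (between uv')"
      using ex_has_least_nat[of "\<lambda>uv. P (fst uv) (snd uv)" _ "\<lambda>uv. card (between uv)"] ex by blast
    obtain a b where ab: "uv = (a, b)" by (cases uv)
    have P: "P a b" using uv(1) ab by simp
    have fin: "finite (between p)" for p
      by (rule finite_subset[of _ "arcs G"]) (auto simp: between_def K_def)
    \<comment> \<open>An arc of \<open>K\<close> between \<open>a\<close> and \<open>b\<close> would
      form such a pair with \<open>a\<close> or with \<open>b\<close>, with fewer arcs of
      \<open>K\<close> in between.\<close>
    have gap: "between uv = {}"
    proof (rule equals0I)
      fix g assume "g \<in> between uv"
      then have g: "g \<in> K" "bef Xs a g" "bef Xs g b" by (auto simp: between_def ab)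
      have aK: "a \<in> K" "b \<in> K" using P by (auto simp: P_def)
      have ng: "\<not> bef Xs g g" using bef_asym[OF disX, of g g] by blast
      have "g \<noteq> a" using g ng by blast
      then have "bef Ys (opp a) (opp g) \<or> bef Ys (opp g) (opp a)"
        using bef_total[OF K(2)[OF aK(1)] K(2)[OF g(1)]] by simp
      then have "P a g \<or> P g b"
        using g aK P bef_trans[OF disY, of "opp g" "opp a" "opp b"] unfolding P_def by blast
      moreover have "between (a, g) \<subset> between uv" "between (g, b) \<subset> between uv"
        using g ng bef_trans[OF disX, of _ g b] bef_trans[OF disX, of a g] unfolding between_def ab by auto
      then have "card (between (a, g)) < card (between uv)" "card (between (g, b)) < card (between uv)"
        using psubset_card_mono[OF fin] by blast+
      ultimately show False using uv(2)[of "(a, g)"] uv(2)[of "(g, b)"] by auto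
    qed
    have P': "a \<in> K" "b \<in> K" "bef Xs a b" "bef Ys (opp a) (opp b)" using P by (auto simp: P_def)
    obtain X1 X2 X3 where X: "Xs = X1 @ a # X2 @ b # X3" using P'(3) by (rule bef_split)
    obtain Y1 Y2 Y3 where Y: "Ys = Y1 @ opp a # Y2 @ opp b # Y3" using P'(4) by (rule bef_split)
    have cX: "cyc (tau (T - edge h)) (a # X2 @ b # (X3 @ h # X1))"
      using cyc_rotate[of _ "h # X1" "a # X2 @ b # X3"] cut(1) unfolding X by simp
    have cY: "cyc (tau (T - edge h)) (opp a # Y2 @ opp b # (Y3 @ opp h # Y1))"
      using cyc_rotate[of _ "opp h # Y1" "opp a # Y2 @ opp b # Y3"] cut(2) unfolding Y by simp
    have a: "a \<in> arcs G" "tail G a = x" "(head G h, head G a) \<in> conn (off x)"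
      and b: "b \<in> arcs G" "tail G b = x" using P' by (auto simp: K_def)
    \<comment> \<open>In the tour of the branch started at \<open>opp a\<close>, the arc
      \<open>opp h\<close> comes after \<open>opp b\<close>, so it belongs to the block whose arcs
      must not lead to \<open>x\<close>.\<close>
    have "head G (opp h) \<noteq> x"
    proof (rule agree_turn_branch(1)[OF T h(1,2) star a b cX cY])
      fix g assume g: "g \<in> set X2" "tail G g = x"
      have gX: "g \<in> set Xs" "g \<noteq> h" using g(1) dis unfolding X by auto
      show "(head G h, head G g) \<notin> conn (off x)"
      proof
        assume "(head G h, head G g) \<in> conn (off x)"
        then have "g \<in> K" using g gX XG by (simp add: K_def)
        then have "g \<in> between uv" using g unfolding between_def ab X by simp
        then show False using gap by blast
      qed
    qed simp
    then show False using hG h by simp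
  next
    case False
    obtain h' where h': "h' \<in> T" "tail G h' = x" "(head G h', head G d) \<in> conn (T - edge h')"
      using branch_arc[OF T _ xV] hd[OF cdG(2) x(2)] by blast
    have h'G: "h' \<in> arcs G" using T h' stree_arcs by blast
    have h'd: "(head G h', head G d) \<in> conn (off x)"
      using h' branch_conn[OF T h'(1)] starred_conn[OF star] by blast
    have h'W: "(head G h, head G h') \<notin> conn (off x)" using False h'd conn_trans by blast
    then have h'h: "h' \<noteq> h" by auto
    have h'X: "h' \<in> set Xs" using inX h'G h' h'h by blast
    have od: "opp d \<in> set Xs"
    proof -
      have "opp d \<in> set (h # Ys @ opp h # Xs)" unfolding setM using cdG by simp
      then show ?thesis using inY[OF cdG(2) d(2,3)] False d by (auto simp: arev_eq_iff)
    qed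
    have il: "il (h # Ys @ opp h # Xs) c d" using l unfolding lk by blast
    have "bef Xs c d \<noteq> bef Xs c (opp d)"
      using il unfolding il_def befX[OF c(1)] using befY[OF c(2) d(1)] befY[OF c(2) od] by argo
    \<comment> \<open>The tour visits the whole branch of \<open>h'\<close>, and with it
      \<open>opp d\<close>, right after \<open>h'\<close> and before any further arc at
      \<open>x\<close>. So \<open>opp d\<close> and \<open>h'\<close> lie on the same side of
      \<open>c\<close>.\<close>
    moreover have "bef Xs c (opp d) \<longleftrightarrow> bef Xs c h'"
    proof -
      obtain Xs' Ys' where M': "cyc (tau T) (h' # Ys' @ opp h' # Xs')" using tour_split_at[OF T h'(1)] .
      note setM' = stree_tour_set[OF T h'G M']
      have dis': "distinct (h' # Ys' @ opp h' # Xs')" using M' by (rule cyc_distinct)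
      have nh: "a \<noteq> h'" "a \<noteq> opp h'" if "a \<in> arcs G" "tail G a = x" "a \<noteq> h'" for a
        using that h'(2) no_loops[OF h'G] h'G by auto
      have Xs': "a \<in> set Xs'" if "a \<in> arcs G" "tail G a = x" "a \<noteq> h'" for a
        using chord_sides(2)[OF T h'(1) M' that(1) nh[OF that]] that h'(2) by simp
      have cX': "c \<in> set Xs'" "h \<in> set Xs'" using Xs' cdG x h'(1) hG h h'h by auto
      have dh': "opp d \<noteq> h'" "opp d \<noteq> opp h'" using cdG h'(1) stree_opp_iff[OF T, of d] by auto
      have oY': "opp d \<in> set Ys'"
        using chord_sides(1)[OF T h'(1) M', of "opp d"] h'(3) cdG dh' by simp
      obtain U V where U: "Xs' = U @ h # V" using cX'(2) by (meson split_list)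
      have "cyc (tau T) (h # V @ h' # Ys' @ opp h' # U)"
        using cyc_rotate[of _ "h' # Ys' @ opp h' # U" "h # V"] M' unfolding U by simp
      then have eqM: "h # Ys @ opp h # Xs = h # V @ h' # Ys' @ opp h' # U"
        by (intro cyc_unique[OF M]) auto
      have "bef (h # Ys @ opp h # Xs) c (opp d) \<longleftrightarrow> bef (h # Ys @ opp h # Xs) c h'"
      proof (cases "c \<in> set V")
        case True then show ?thesis unfolding eqM using oY' by simp
      next
        case False
        then have cU: "c \<in> set U" using cX'(1) c(4) U by auto
        have disM: "distinct (h # V @ h' # Ys' @ opp h' # U)" using dis unfolding eqM .
        have "\<not> bef (h # V @ h' # Ys' @ opp h' # U) c v" if "v = h' \<or> v \<in> set Ys'" for v
        proof -
          have "bef (h # V @ h' # Ys' @ opp h' # U) v c" using that cU by auto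
          then show ?thesis by (rule bef_asym[OF disM])
        qed
        then show ?thesis unfolding eqM using oY' by blast
      qed
      then show ?thesis unfolding befX[OF c(1)] .
    qed
    ultimately have ne: "bef Xs c d \<noteq> bef Xs c h'" by blast
    have ch': "h' \<noteq> c" using h' cdG by blast
    \<comment> \<open>The arcs \<open>d\<close> and \<open>h'\<close> from \<open>x\<close> into the
      same branch lie on different sides of \<open>c\<close>; the earlier one is
      \<open>u\<close>.\<close>
    obtain u u2 where u: "bef Xs u c" "bef Xs c u2" "(u = d \<and> u2 = h') \<or> (u = h' \<and> u2 = d)"
      using ne bef_total[OF c(1) d(1) cdG(5)] bef_total[OF h'X c(1) ch'] by metis
    have uG: "u \<in> arcs G" "tail G u = x" "u2 \<in> arcs G" "tail G u2 = x" using u(3) cdG x h'G h' by auto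
    have uu: "(head G u, head G u2) \<in> conn (off x)" using u(3) h'd conn_sym[OF oppclosed_off] by blast
    have uW: "(head G h, head G u) \<notin> conn (off x)" using u(3) False h'W by blast
    define K where "K g \<longleftrightarrow> tail G g = x \<and> (head G h, head G g) \<in> conn (off x)" for g
    have KX: "g \<in> arcs G" if "g \<in> set (h # Xs)" for g using that XG hG by auto
    obtain P Q R where X: "Xs = P @ u # Q @ c # R" using u(1) by (rule bef_split)
    \<comment> \<open>The arcs \<open>e\<close> and \<open>k\<close> are the nearest arcs into the
      branch of \<open>h\<close> before and after \<open>u\<close>; they exist because of
      \<open>h\<close> and \<open>c\<close>. The turn from \<open>e\<close> to \<open>k\<close>
      passes \<open>u\<close>, and as \<open>k\<close> comes no later than \<open>c\<close>, it does
      not reach \<open>u2\<close>.\<close>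
    have "\<exists>g\<in>set (h # P). K g" using h(2) by (simp add: K_def)
    then obtain P1 e P2 where e: "h # P = P1 @ e # P2" "K e" "\<forall>g\<in>set P2. \<not> K g"
      by (rule split_list_last_propE) blast
    have "\<exists>g\<in>set (Q @ c # R). K g" using x c(3) by (simp add: K_def)
    then obtain Q1 k Q2 where k: "Q @ c # R = Q1 @ k # Q2" "K k" "\<forall>g\<in>set Q1. \<not> K g"
      by (rule split_list_first_propE) blast
    have hX: "h # Xs = P1 @ e # P2 @ u # Q1 @ k # Q2" using e(1) k(1) unfolding X by simp
    have disH: "distinct (P1 @ e # P2 @ u # Q1 @ k # Q2)" using cyc_distinct[OF cut(1)] unfolding hX .
    have cX: "cyc (tau (T - edge h)) (e # (P2 @ u # Q1) @ k # (Q2 @ P1))"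
      using cyc_rotate[of _ P1 "e # P2 @ u # Q1 @ k # Q2"] cut(1) unfolding hX by simp
    have eG: "e \<in> arcs G" "tail G e = x" "(head G h, head G e) \<in> conn (off x)"
      and kG: "k \<in> arcs G" "tail G k = x" "(head G h, head G k) \<in> conn (off x)"
      using KX[of e] KX[of k] e(2) k(2) unfolding hX by (simp_all add: K_def)
    have ek: "e \<noteq> k" using disH by auto
    obtain L where L: "cyc (tau (T - edge h)) (opp e # L)"
      using tour_exists[OF F arev_in_arcs[OF eG(1)]] .
    have "opp k \<in> set (opp e # L)"
    proof -
      have "(head G e, head G k) \<in> conn (T - edge h)"
        using eG(3) kG(3) conn_sym[OF oppclosed_diff_edge[OF stree_oppclosed[OF T]]] conn_trans
        unfolding eq[symmetric] by blast
      then show ?thesis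
        unfolding tour_set(1)[OF F arev_in_arcs[OF eG(1)] L] using eG(1) kG(1) by simp
    qed
    then have "opp k \<in> set L" using ek by simp
    then obtain B A where LBA: "L = B @ opp k # A" by (meson split_list)
    have "u2 \<in> set (P2 @ u # Q1)"
    proof (rule agree_turn_branch(2)[OF T h(1,2) star eG kG(1,2) cX L[unfolded LBA] _ _ uG(2,3,4) uu])
      fix g assume g: "g \<in> set (P2 @ u # Q1)" "tail G g = x"
      then have "\<not> K g" using e(3) k(3) uW by (auto simp: K_def)
      then show "(head G h, head G g) \<notin> conn (off x)" using g by (simp add: K_def)
    qed simp
    moreover have "u2 \<in> set R"
    proof (rule ccontr)
      assume "u2 \<notin> set R"
      moreover have "u2 \<noteq> c" using bef_asym[OF disX u(2)] u(2) by blast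
      moreover have "u2 \<in> set Xs" using bef_mem[OF u(2)] by blast
      ultimately have "bef Xs u2 c" unfolding X by auto
      then show False using bef_asym[OF disX u(2)] by blast
    qed
    moreover have "c \<notin> set Q1" using k(3) x c(3) by (auto simp: K_def)
    then have "R = Q2 \<or> (\<exists>Z. Q2 = Z @ c # R)"
      using k(1) by (auto simp: append_eq_append_conv2 Cons_eq_append_conv append_eq_Cons_conv)
    ultimately show False using disH by auto
  qed
qed

lemma unlinked:
  assumes "stree T"
  shows "\<not> linked T c d"
proof
  assume "linked T c d"
  then obtain T1 c1 d1 where 1: "stree T1" "linked T1 c1 d1" "tail G c1 = tail G d1"
    using linked_at_vertex[OF assms] by blast
  then obtain T2 c2 d2 where "stree T2" "linked T2 c2 d2" "tail G c2 = tail G d1" "tail G d2 = tail G d1"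
      "starred T2 (tail G d1)"
    using linked_starred[OF 1(1,2,3) refl] by blast
  then show False using unlinked_starred by blast
qed

end

section \<open>Semicircles\<close>

text \<open>The upper semicircle over a segment, parametrised so that the real part is linear. The square of
  the distance to an end is then linear as well.\<close>

definition semi :: "real \<Rightarrow> real \<Rightarrow> real \<Rightarrow> complex" where
  "semi a b t = Complex (a + t * (b - a)) (\<bar>b - a\<bar> * sqrt (t * (1 - t)))"

lemma semi_ends [simp]: "pathstart (semi a b) = of_real a" "pathfinish (semi a b) = of_real b"
  by (simp_all add: pathstart_def pathfinish_def semi_def complex_eq_iff)

lemma reversepath_semi: "reversepath (semi a b) = semi b a"
  by (rule ext) (simp add: reversepath_def semi_def algebra_simps abs_minus_commute)

lemma arc_semi:
  assumes "a \<noteq> b"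
  shows "arc (semi a b)"
proof -
  have "inj_on (semi a b) {0..1}"
    using assms by (intro inj_onI) (simp add: semi_def)
  moreover have "path (semi a b)"
    unfolding path_def semi_def by (intro continuous_intros)
  ultimately show ?thesis by (simp add: arc_def)
qed

lemma semi_image:
  assumes "a < b" "z \<in> path_image (semi a b)"
  shows "a \<le> Re z" "Re z \<le> b" "0 \<le> Im z" "(Im z)\<^sup>2 = (Re z - a) * (b - Re z)"
proof -
  obtain t where t: "0 \<le> t" "t \<le> 1" "z = semi a b t" using assms(2) by (auto simp: path_image_def)
  have "0 \<le> t * (b - a)" "0 \<le> (1 - t) * (b - a)" using t assms(1) by auto
  then show "a \<le> Re z" "Re z \<le> b" using t by (auto simp: semi_def algebra_simps)
  have "0 \<le> t * (1 - t)" using t by simp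
  then show "0 \<le> Im z" using t assms(1) by (simp add: semi_def)
  have "(Im z)\<^sup>2 = (b - a)\<^sup>2 * (t * (1 - t))"
    using t \<open>0 \<le> t * (1 - t)\<close> by (simp add: semi_def power_mult_distrib)
  also have "\<dots> = (Re z - a) * (b - Re z)"
    using t by (simp add: semi_def algebra_simps power2_eq_square)
  finally show "(Im z)\<^sup>2 = (Re z - a) * (b - Re z)" .
qed

lemma semi_real:
  assumes "a < b" "z \<in> path_image (semi a b)" "Im z = 0"
  shows "z = of_real a \<or> z = of_real b"
  using semi_image(4)[OF assms(1,2)] assms(3) by (auto simp: complex_eq_iff)

text \<open>The squared height is the product of the distances of the real part to the two ends,
  which grows with the interval. For nested intervals equal heights off the axis thus force equal
  intervals; disjoint intervals meet at an end at most.\<close>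

lemma semi_meet:
  assumes ab: "a < b" and cd: "c < d" and z: "z \<in> path_image (semi a b)" "z \<in> path_image (semi c d)"
    and sep: "b \<le> c \<or> d \<le> a \<or> a \<le> c \<and> d \<le> b \<or> c \<le> a \<and> b \<le> d" and ne: "a \<noteq> c \<or> b \<noteq> d"
  shows "(z = of_real a \<or> z = of_real b) \<and> (z = of_real c \<or> z = of_real d)"
proof -
  note 1 = semi_image[OF ab z(1)] and 2 = semi_image[OF cd z(2)]
  have nested: "Im z = 0" if "a \<le> c" "d \<le> b" "(Im z)\<^sup>2 = (Re z - a) * (b - Re z)"
    "(Im z)\<^sup>2 = (Re z - c) * (d - Re z)" "c \<le> Re z" "Re z \<le> d" "a \<noteq> c \<or> b \<noteq> d" for a b c d
  proof (rule ccontr)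
    assume "Im z \<noteq> 0"
    then have "(Re z - c) * (d - Re z) > 0" using that(4) by (metis zero_less_power2)
    then have pos: "0 < Re z - c" "0 < d - Re z" using that(5,6) by (auto simp: zero_less_mult_iff)
    have "(Re z - c) * (d - Re z) \<le> (Re z - c) * (b - Re z)"
      by (rule mult_left_mono; use pos that(2) in linarith)
    moreover have "(Re z - c) * (b - Re z) \<le> (Re z - a) * (b - Re z)"
      by (rule mult_right_mono; use pos that(1,2) in linarith)
    ultimately have e: "(Re z - c) * (d - Re z) = (Re z - c) * (b - Re z)"
      "(Re z - c) * (b - Re z) = (Re z - a) * (b - Re z)" using that(3,4) by linarith+
    have "d - Re z = b - Re z" by (rule mult_left_cancel[THEN iffD1, OF _ e(1)]) (use pos in simp)
    moreover have "Re z - c = Re z - a"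
      by (rule mult_right_cancel[THEN iffD1, OF _ e(2)]) (use pos that(2) in simp)
    ultimately show False using that by simp
  qed
  have "Im z = 0"
    using sep
  proof (elim disjE conjE)
    assume "b \<le> c" then have "Re z = b" using 1 2 by linarith
    then show ?thesis using 1(4) by simp
  next
    assume "d \<le> a" then have "Re z = a" using 1 2 by linarith
    then show ?thesis using 1(4) by simp
  next
    assume "a \<le> c" "d \<le> b" then show ?thesis using nested[of a c d b] 1 2 ne by blast
  next
    assume "c \<le> a" "b \<le> d" then show ?thesis using nested[of c a b d] 1 2 ne by blast
  qed
  then show ?thesis using semi_real[OF ab z(1)] semi_real[OF cd z(2)] by blast
qed

definition lower :: "real \<Rightarrow> real \<Rightarrow> real \<Rightarrow> complex" where
  "lower a b t = cnj (semi a b t)"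

lemma lower_ends [simp]: "pathstart (lower a b) = of_real a" "pathfinish (lower a b) = of_real b"
  using semi_ends[of a b] by (simp_all add: pathstart_def pathfinish_def lower_def)

lemma arc_lower:
  assumes "a \<noteq> b"
  shows "arc (lower a b)"
proof -
  have "path (lower a b)"
    using arc_imp_path[OF arc_semi[OF assms]] unfolding path_def lower_def by (intro continuous_intros)
  then show ?thesis
    using arc_imp_inj_on[OF arc_semi[OF assms]] by (simp add: arc_def lower_def inj_on_def)
qed

lemma lower_image: "z \<in> path_image (lower a b) \<longleftrightarrow> cnj z \<in> path_image (semi a b)"
proof -
  have "z = cnj w \<longleftrightarrow> cnj z = w" for w by auto
  then show ?thesis by (simp add: path_image_def lower_def image_iff)
qed

lemma upper_lower_meet:
  assumes "a < b" "c < d" "z \<in> path_image (semi a b)" "z \<in> path_image (lower c d)"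
  shows "(z = of_real a \<or> z = of_real b) \<and> (z = of_real c \<or> z = of_real d)"
proof -
  have z: "cnj z \<in> path_image (semi c d)" using assms(4) by (simp add: lower_image)
  have i: "Im z = 0" using semi_image(3)[OF assms(1,3)] semi_image(3)[OF assms(2) z] by simp
  then have "cnj z = z" by (simp add: complex_eq_iff)
  then show ?thesis using semi_real[OF assms(1,3) i] semi_real[OF assms(2) z] i by simp
qed

text \<open>A form of \<open>first_hit\<close> without infimum, which carries over when further
  paths are joined at the end.\<close>

definition hits :: "(real \<Rightarrow> complex) \<Rightarrow> real \<Rightarrow> complex \<Rightarrow> bool" where
  "hits \<gamma> r z \<longleftrightarrow> (\<exists>t\<in>{0..1}. \<gamma> t = z \<and> dist (pathstart \<gamma>) z = r \<and> (\<forall>u. 0 \<le> u \<longrightarrow> u < t \<longrightarrow> dist (pathstart \<gamma>) (\<gamma> u) \<noteq> r))"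

lemma first_hit_eqI:
  assumes "hits \<gamma> r z"
  shows "first_hit \<gamma> r = z"
proof -
  obtain t where t: "t \<in> {0..1}" "\<gamma> t = z" "dist (pathstart \<gamma>) z = r"
    "\<And>u. 0 \<le> u \<Longrightarrow> u < t \<Longrightarrow> dist (pathstart \<gamma>) (\<gamma> u) \<noteq> r"
    using assms by (auto simp: hits_def)
  have "Inf {t \<in> {0..1}. dist (pathstart \<gamma>) (\<gamma> t) = r} = t"
  proof (rule cInf_eq_minimum)
    show "t \<in> {t \<in> {0..1}. dist (pathstart \<gamma>) (\<gamma> t) = r}" using t by simp
    show "t \<le> u" if "u \<in> {t \<in> {0..1}. dist (pathstart \<gamma>) (\<gamma> t) = r}" for u
      using t(4)[of u] that by force
  qed
  then show ?thesis by (simp add: first_hit_def t)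
qed

lemma hits_join:
  assumes "hits \<gamma> r z"
  shows "hits (\<gamma> +++ \<gamma>') r z"
proof -
  obtain t where t: "t \<in> {0..1}" "\<gamma> t = z" "dist (pathstart \<gamma>) z = r"
    "\<And>u. 0 \<le> u \<Longrightarrow> u < t \<Longrightarrow> dist (pathstart \<gamma>) (\<gamma> u) \<noteq> r"
    using assms by (auto simp: hits_def)
  have "dist (pathstart \<gamma>) ((\<gamma> +++ \<gamma>') u) \<noteq> r" if "0 \<le> u" "u < t / 2" for u
    using t(4)[of "2 * u"] t(1) that by (simp add: joinpaths_def)
  moreover have "(\<gamma> +++ \<gamma>') (t / 2) = z" using t by (simp add: joinpaths_def)
  ultimately show ?thesis
    unfolding hits_def pathstart_join using t by (intro bexI[of _ "t / 2"]) auto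
qed

text \<open>The squared distance from the start is \<open>t * (b - a)\<^sup>2\<close>, so the circle
  is met exactly once. The angle is acute or obtuse according to the sign of
  \<open>b - a\<close>.\<close>

lemma hits_semi:
  assumes r: "0 < r" "r < \<bar>b - a\<bar>"
  shows "hits (semi a b) r (of_real a + of_real r * cis (arccos (r / (b - a))))"
proof -
  define D where "D = b - a"
  have D: "0 < r" "r < \<bar>D\<bar>" "D \<noteq> 0" using r by (auto simp: D_def)
  have sq: "(cmod (semi a b t - of_real a))\<^sup>2 = t * D\<^sup>2" if "0 \<le> t" "t \<le> 1" for t
  proof -
    have "0 \<le> t * (1 - t)" using that by simp
    then show ?thesis
      by (simp add: cmod_power2 semi_def D_def power_mult_distrib) (simp add: algebra_simps power2_eq_square)
  qed
  define t where "t = r\<^sup>2 / D\<^sup>2"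
  have rD: "r\<^sup>2 < D\<^sup>2" using D by (metis abs_le_square_iff abs_of_pos not_le)
  have t: "0 \<le> t" "t < 1" using D rD by (simp_all add: t_def)
  have q: "\<bar>r / D\<bar> \<le> 1" using D by (simp add: abs_le_iff field_simps abs_if split: if_splits)
  have "t * (1 - t) = (r / D)\<^sup>2 * (1 - (r / D)\<^sup>2)" by (simp add: t_def power_divide)
  then have "\<bar>D\<bar> * sqrt (t * (1 - t)) = \<bar>D\<bar> * (\<bar>r / D\<bar> * sqrt (1 - (r / D)\<^sup>2))"
    by (simp add: real_sqrt_mult)
  also have "\<dots> = r * sqrt (1 - (r / D)\<^sup>2)" using D by simp
  also have "sqrt (1 - (r / D)\<^sup>2) = sin (arccos (r / D))" using sin_arccos_abs[OF q] by simp
  finally have im: "\<bar>D\<bar> * sqrt (t * (1 - t)) = r * sin (arccos (r / D))" .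
  have "t * D = r * (r / D)" using D by (simp add: t_def power2_eq_square)
  also have "\<dots> = r * cos (arccos (r / D))" using cos_arccos_abs[OF q] by simp
  finally have z: "semi a b t = of_real a + of_real r * cis (arccos (r / D))"
    using im by (simp add: semi_def complex_eq_iff D_def)
  have dist: "dist (of_real a) (semi a b u) = r \<longleftrightarrow> u = t" if "0 \<le> u" "u \<le> 1" for u
  proof -
    have "dist (of_real a) (semi a b u) = r \<longleftrightarrow> (cmod (semi a b u - of_real a))\<^sup>2 = r\<^sup>2"
      using D(1) by (simp add: dist_norm norm_minus_commute power2_eq_iff_nonneg)
    also have "\<dots> \<longleftrightarrow> u = t" unfolding sq[OF that] using D by (auto simp: t_def field_simps)
    finally show ?thesis .
  qed
  show ?thesis
    unfolding hits_def semi_ends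
  proof (intro bexI[of _ t] conjI allI impI)
    show "semi a b t = of_real a + of_real r * cis (arccos (r / (b - a)))" using z by (simp add: D_def)
    then show "dist (of_real a) (of_real a + of_real r * cis (arccos (r / (b - a)))) = r"
      using dist[of t] t by simp
    show "dist (of_real a) (semi a b u) \<noteq> r" if "0 \<le> u" "u < t" for u using dist[of u] that t by simp
  qed (use t in auto)
qed

section \<open>Drawing a ribbon graph with unlinked chords\<close>

lemma bef_filter: "bef (filter P L) a b \<longleftrightarrow> bef L a b \<and> P a \<and> P b"
  by (induction L) (auto dest: bef_mem)

definition idx :: "'b list \<Rightarrow> 'b \<Rightarrow> nat" where
  "idx L a = length (takeWhile (\<lambda>x. x \<noteq> a) L)"

lemma idx_append: "a \<notin> set A \<Longrightarrow> idx (A @ a # B) a = length A"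
  unfolding idx_def by (subst takeWhile_append2) auto

lemma bef_iff_idx:
  assumes "distinct L" "a \<in> set L" "b \<in> set L"
  shows "bef L a b \<longleftrightarrow> idx L a < idx L b"
proof -
  have lt: "idx L a < idx L b" if ab: "bef L a b" for a b
  proof -
    obtain P Q R where L: "L = P @ a # Q @ b # R" using ab by (rule bef_split)
    have "idx L a = length P" "idx L b = length (P @ a # Q)"
      using assms(1) idx_append[of a P] idx_append[of b "P @ a # Q" R] unfolding L by auto
    then show ?thesis by simp
  qed
  show ?thesis
    using lt[of a b] lt[of b a] bef_total[OF assms(2,3)] by (cases "a = b") (use bef_asym[OF assms(1)] in auto)
qed

locale unlinked_tree = loopless_ribbon_graph G opp nxt
  for G :: "('a, 'b) pre_digraph" and opp nxt :: "'b \<Rightarrow> 'b" +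
  fixes T :: "'b set" and s :: 'b
  assumes T: "stree T" and s: "s \<in> arcs G" and unl: "\<And>c d. \<not> linked T c d"
begin

abbreviation "L \<equiv> tour T s"
abbreviation "ix \<equiv> idx L"

lemma L: "cyc (tau T) L" "set L = arcs G" "distinct L"
  using cyc_tour[OF T s] set_tour[OF T s] distinct_tour[OF T s] .

lemma bef_ix: "a \<in> arcs G \<Longrightarrow> b \<in> arcs G \<Longrightarrow> bef L a b \<longleftrightarrow> ix a < ix b"
  using bef_iff_idx[OF L(3)] L(2) by simp

lemma ix_inj: "a \<in> arcs G \<Longrightarrow> b \<in> arcs G \<Longrightarrow> ix a = ix b \<longleftrightarrow> a = b"
  using bef_total[of a L b] bef_ix[of a b] bef_ix[of b a] L(2) by force

lemma ix_Suc:
  assumes "a \<in> arcs G" "b \<in> arcs G" "ix b = Suc (ix a)"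
  shows "tau T a = b"
proof -
  have "bef L a b" using assms bef_ix by simp
  then obtain P Q R where eq: "L = P @ a # Q @ b # R" by (rule bef_split)
  have "ix a = length P" "ix b = length (P @ a # Q)"
    using L(3) idx_append[of a P] idx_append[of b "P @ a # Q" R] unfolding eq by auto
  then have "Q = []" using assms(3) by simp
  then show ?thesis using L(1) cyc_step unfolding eq by fastforce
qed

text \<open>The tour meets the arcs at a vertex in their cyclic order. Cut open at \<open>s\<close>
  this order becomes linear, so \<open>nxt\<close> goes to the next larger index or wraps around
  from the largest to the smallest.\<close>

lemma nxt_ix:
  assumes "a \<in> arcs G"
  shows "(\<forall>b\<in>arcs G. tail G b = tail G a \<longrightarrow> ix (nxt a) \<le> ix b \<and> ix b \<le> ix a) \<or>
    ix a < ix (nxt a) \<and> (\<forall>b\<in>arcs G. tail G b = tail G a \<longrightarrow> ix b \<le> ix a \<or> ix (nxt a) \<le> ix b)"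
proof -
  let ?l = "arcs_at (tail G a) L"
  have l: "set ?l = {b \<in> arcs G. tail G b = tail G a}" by (auto simp: arcs_at_def L(2))
  obtain L' where L': "L = s # L'" by (simp add: tour_def)
  have "?l = [] \<or> cyc nxt ?l"
    using tour_set(2)[OF stree_bforest[OF T] s] L(1) unfolding L' by blast
  moreover have "a \<in> set ?l" using l assms by simp
  ultimately have c: "cyc nxt ?l" by (metis empty_iff empty_set)
  obtain P Q where PQ: "?l = P @ a # Q" using \<open>a \<in> set ?l\<close> by (meson split_list)
  have lt: "ix x < ix y" if "bef ?l x y" for x y
    using that bef_mem[OF that] bef_ix[of x y] unfolding l unfolding arcs_at_def bef_filter by blast
  have mem: "b \<in> set P \<or> b = a \<or> b \<in> set Q" if "b \<in> arcs G" "tail G b = tail G a" for b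
    using that l unfolding PQ by auto
  have ltP: "ix b < ix a" if "b \<in> set P" for b using lt[of b a] that unfolding PQ by simp
  show ?thesis
  proof (cases Q)
    case Nil
    have c': "cyc nxt (P @ [a])" using c unfolding PQ Nil .
    have "nxt a = hd (P @ [a])"
    proof (cases P)
      case Nil then show ?thesis using c' by (simp add: cyc_Cons)
    next
      case (Cons p P') then show ?thesis using c' cyc_last_step[of nxt p P' a] by simp
    qed
    moreover obtain y l' where yl: "P @ [a] = y # l'" by (cases P) auto
    ultimately have l': "?l = nxt a # l'" unfolding PQ Nil by simp
    have "ix (nxt a) \<le> ix b" if "b \<in> arcs G" "tail G b = tail G a" for b
    proof -
      have "b \<in> set ?l" using that unfolding l by simp
      then have "b = nxt a \<or> bef ?l (nxt a) b" unfolding l' by auto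
      then show ?thesis using lt by force
    qed
    moreover have "ix b \<le> ix a" if "b \<in> arcs G" "tail G b = tail G a" for b
      using mem[OF that] ltP[of b] Nil by auto
    ultimately show ?thesis by blast
  next
    case (Cons a' Q')
    have na: "nxt a = a'" using c cyc_step unfolding PQ Cons by fastforce
    have "ix a < ix a'" using lt[of a a'] unfolding PQ Cons by simp
    moreover have "ix b \<le> ix a \<or> ix a' \<le> ix b" if "b \<in> arcs G" "tail G b = tail G a" for b
    proof -
      have "b = a' \<or> ix a' < ix b" if "b \<in> set Q" using lt[of a' b] that unfolding PQ Cons by auto
      then show ?thesis using mem[OF that] ltP[of b] by force
    qed
    ultimately show ?thesis unfolding na by blast
  qed
qed

text \<open>The tour spends one interval of the circle in the branch that contains
  \<open>tail G b\<close>, and the arcs at \<open>tail G a\<close> lie outside it. Hence the arcs of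
  two vertices never alternate, which keeps the upper semicircles apart.\<close>

lemma noncrossing:
  assumes abcd: "a \<in> arcs G" "b \<in> arcs G" "c \<in> arcs G" "d \<in> arcs G"
    and tl: "tail G a = tail G c" "tail G b = tail G d" and lt: "ix a < ix b" "ix b < ix c" "ix c < ix d"
  shows "tail G a = tail G b"
proof (rule ccontr)
  assume ne: "tail G a \<noteq> tail G b"
  obtain h where h: "h \<in> T" "tail G h = tail G a" "(head G h, tail G b) \<in> conn (T - edge h)"
    using branch_arc[OF T _ _ ne[symmetric]] abcd by auto
  have hG: "h \<in> arcs G" using h T stree_arcs by blast
  obtain Xs Ys where M: "cyc (tau T) (h # Ys @ opp h # Xs)" using tour_split_at[OF T h(1)] .
  note dis = cyc_distinct[OF M]
  have X: "a \<in> set (h # Xs)" "c \<in> set (h # Xs)" and Y: "b \<in> set (Ys @ [opp h])" "d \<in> set (Ys @ [opp h])"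
    using tour_sides[OF T h(1) M] abcd h tl by auto
  have "h \<in> set L" using hG L(2) by simp
  then obtain P Q where PQ: "L = P @ h # Q" by (meson split_list)
  have "cyc (tau T) (h # Q @ P)" using cyc_rotate[of "tau T" P "h # Q"] L(1) unfolding PQ by simp
  then have "h # Q @ P = h # Ys @ opp h # Xs" using cyc_unique[OF _ M] by simp
  then have QP: "Q @ P = (Ys @ [opp h]) @ Xs" by simp
  define B where "B = Ys @ [opp h]"
  have disB: "set (h # Xs) \<inter> set B = {}" using dis unfolding B_def by auto
  have block: False
    if "distinct (U @ V @ W)" "bef (U @ V @ W) x y" "bef (U @ V @ W) y z" "x \<in> set V" "z \<in> set V" "y \<notin> set V"
    for U V W x y z
  proof -
    have "y \<in> set U \<or> y \<in> set W" using bef_mem[OF that(2)] that(6) by auto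
    then have "bef (U @ V @ W) y x \<or> bef (U @ V @ W) z y" using that(4,5) by auto
    then show False using bef_asym[OF that(1)] that(2,3) by blast
  qed
  have bef: "bef L a b" "bef L b c" "bef L c d" using lt bef_ix abcd by blast+
  \<comment> \<open>Cutting the circle at the start of \<open>L\<close> leaves either this interval
    or its complement in one piece.\<close>
  consider Z where "Q = B @ Z" "Xs = Z @ P" | Z where "B = Q @ Z" "P = Z @ Xs"
    using QP unfolding B_def[symmetric] by (auto simp: append_eq_append_conv2)
  then show False
  proof cases
    case 1
    then have eq: "L = (P @ [h]) @ B @ Z" using PQ by simp
    have "c \<notin> set B" using X disB by blast
    then show ?thesis using block[of "P @ [h]" B Z b c d] bef L(3) Y unfolding eq B_def by blast
  next
    case 2
    then have eq: "L = Z @ (Xs @ [h]) @ Q" using PQ by simp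
    have "b \<notin> set (Xs @ [h])" using Y disB unfolding B_def by auto
    then show ?thesis using block[of Z "Xs @ [h]" Q a b c] bef L(3) X unfolding eq by auto
  qed
qed

text \<open>A tree arc that is traversed forward opens the branch beyond it, and
  \<open>opp a\<close> closes it.\<close>

lemma entry:
  assumes a: "a \<in> T" "ix a < ix (opp a)" and b: "b \<in> arcs G" "tail G b = head G a"
  shows "ix a < ix b" "ix b \<le> ix (opp a)"
proof -
  have aG: "a \<in> arcs G" using a T stree_arcs by blast
  have "bef L a (opp a)" using a aG bef_ix by simp
  then obtain P Q R where eq: "L = P @ a # Q @ opp a # R" by (rule bef_split)
  have "cyc (tau T) (a # Q @ opp a # (R @ P))"
    using cyc_rotate[of "tau T" P "a # Q @ opp a # R"] L(1) unfolding eq by simp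
  note sd = tour_sides(2)[OF T a(1) this]
  have "b \<in> set (opp a # Q)" unfolding sd using b by simp
  then have "bef L a b" "b = opp a \<or> bef L b (opp a)" unfolding eq by auto
  then show "ix a < ix b" "ix b \<le> ix (opp a)"
    using bef_ix[of a b] bef_ix[of b "opp a"] aG b by auto
qed

lemma out_arcs_nonempty:
  assumes "v \<in> verts G"
  shows "out_arcs G v \<noteq> {}"
proof (cases "v = tail G s")
  case True then show ?thesis using s by auto
next
  case False
  have "(v, tail G s) \<in> conn (arcs G)" using conn_arcs assms s by simp
  then obtain w where "(v, w) \<in> adj (arcs G)" using False by (meson converse_rtranclE)
  then show ?thesis by (auto simp: adj_def)
qed

definition fst_ix :: "'a \<Rightarrow> nat" where
  "fst_ix v = Min (ix ` out_arcs G v)"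

lemma fst_ix_le: "a \<in> arcs G \<Longrightarrow> fst_ix (tail G a) \<le> ix a"
  unfolding fst_ix_def by (rule Min_le) auto

lemma fst_ix_arc:
  assumes "v \<in> verts G"
  obtains a where "a \<in> arcs G" "tail G a = v" "ix a = fst_ix v"
proof -
  have "fst_ix v \<in> ix ` out_arcs G v"
    unfolding fst_ix_def using out_arcs_nonempty[OF assms] by (intro Min_in) auto
  then show thesis using that by auto
qed

lemma fst_ix_head:
  assumes a: "a \<in> T" "ix a < ix (opp a)"
  shows "fst_ix (head G a) = Suc (ix a)"
proof -
  have aG: "a \<in> arcs G" using a T stree_arcs by blast
  have "bef L a (opp a)" using a aG bef_ix by simp
  then obtain P Q R where eq: "L = P @ a # Q @ opp a # R" by (rule bef_split)
  then obtain b Q' where b: "L = P @ a # b # Q'" by (cases Q) auto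
  have bG: "b \<in> arcs G" using L(2) unfolding b by auto
  have "b = tau T a" using L(1) cyc_step unfolding b by metis
  then have "b = nxt (opp a)" using a by (simp add: tau_def)
  moreover have "tail G (nxt (opp a)) = head G a" using nxt_out_arcs[of "opp a" "head G a"] aG by simp
  ultimately have t: "tail G b = head G a" by simp
  have "ix a = length P" "ix b = length (P @ [a])"
    using L(3) idx_append[of a P "b # Q'"] idx_append[of b "P @ [a]" Q'] unfolding b by auto
  then have "ix b = Suc (ix a)" by simp
  then have "fst_ix (head G a) \<le> Suc (ix a)" using fst_ix_le[OF bG] t by simp
  moreover obtain c where "c \<in> arcs G" "tail G c = head G a" "ix c = fst_ix (head G a)"
    using fst_ix_arc[of "head G a"] aG by auto
  ultimately show ?thesis using entry(1)[OF a, of c] by simp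
qed

text \<open>Right before its first arc a vertex is entered by a tree arc: a predecessor outside
  \<open>T\<close> would have the same tail and be an earlier arc of the vertex.\<close>

lemma fst_ix_pred:
  assumes c: "c \<in> arcs G" "fst_ix v = Suc (ix c)" and v: "v \<in> verts G"
  shows "c \<in> T" "head G c = v"
proof -
  obtain f where f: "f \<in> arcs G" "tail G f = v" "ix f = fst_ix v" using fst_ix_arc[OF v] .
  have t: "tau T c = f" using ix_Suc[OF c(1) f(1)] f(3) c(2) by simp
  show cT: "c \<in> T"
  proof (rule ccontr)
    assume "c \<notin> T"
    then have "nxt c = f" using t by (simp add: tau_def)
    then have "tail G c = v" using nxt_out_arcs[of c "tail G c"] c(1) f(2) by simp
    then show False using fst_ix_le[OF c(1)] c(2) by simp
  qed
  then have "nxt (opp c) = f" using t by (simp add: tau_def)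
  then show "head G c = v" using nxt_out_arcs[of "opp c" "head G c"] c(1) f(2) by simp
qed

lemma fst_ix_inj: "u \<in> verts G \<Longrightarrow> v \<in> verts G \<Longrightarrow> fst_ix u = fst_ix v \<longleftrightarrow> u = v"
  using fst_ix_arc ix_inj by metis

end

section \<open>The drawing along the tour and its order around the vertices\<close>

context unlinked_tree
begin

definition X :: "'a \<Rightarrow> real" where
  "X v = real (fst_ix v) - 1"

definition pos :: "'a \<Rightarrow> complex" where
  "pos v = of_real (X v)"

definition fwd :: "'b \<Rightarrow> bool" where
  "fwd a \<longleftrightarrow> ix a < ix (opp a)"

definition spoke :: "'b \<Rightarrow> real \<Rightarrow> complex" where
  "spoke a = semi (X (tail G a)) (real (ix a))"

definition hook :: "'b \<Rightarrow> real \<Rightarrow> complex" where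
  "hook a = lower (real (ix a)) (real (ix (opp a)))"

definition delta :: "'b \<Rightarrow> real \<Rightarrow> complex" where
  "delta a = (if a \<in> T then spoke a else spoke a +++ (hook a +++ reversepath (spoke (opp a))))"

text \<open>A vertex sits just before its first arc in the tour, which for \<open>v\<close> other than the root is the
  place of the tree arc by which the tour enters \<open>v\<close>. So a tree edge is a single upper semicircle, and a
  chord consists of two of them with a lower one between the places of its two ends.\<close>

definition gamma :: "'b \<Rightarrow> real \<Rightarrow> complex" where
  "gamma a = (if fwd a then delta a else reversepath (delta (opp a)))"

lemma spoke_lt: "a \<in> arcs G \<Longrightarrow> X (tail G a) + 1 \<le> real (ix a)"
  using fst_ix_le[of a] by (simp add: X_def)

lemma fwd_opp: "a \<in> arcs G \<Longrightarrow> fwd (opp a) \<longleftrightarrow> \<not> fwd a"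
  using ix_inj[of a "opp a"] by (auto simp: fwd_def)

lemma X_head: "a \<in> T \<Longrightarrow> fwd a \<Longrightarrow> X (head G a) = real (ix a)"
  using fst_ix_head[of a] by (simp add: X_def fwd_def)

lemma X_eq_ix:
  assumes "v \<in> verts G" "c \<in> arcs G" "X v = real (ix c)"
  shows "c \<in> T" "head G c = v"
proof -
  have "real (fst_ix v) = real (Suc (ix c))" using assms(3) by (simp add: X_def)
  then have "fst_ix v = Suc (ix c)" by (simp only: of_nat_eq_iff)
  then show "c \<in> T" "head G c = v" using fst_ix_pred[OF assms(2) _ assms(1)] by blast+
qed

lemma X_inj: "u \<in> verts G \<Longrightarrow> v \<in> verts G \<Longrightarrow> X u = X v \<longleftrightarrow> u = v"
  using fst_ix_inj[of u v] by (simp add: X_def)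

lemma spoke_ends [simp]: "pathstart (spoke a) = pos (tail G a)" "pathfinish (spoke a) = of_real (real (ix a))"
  by (simp_all add: spoke_def pos_def)

lemma hook_ends [simp]: "pathstart (hook a) = of_real (real (ix a))"
  "pathfinish (hook a) = of_real (real (ix (opp a)))"
  by (simp_all add: hook_def)

lemma arc_spoke: "a \<in> arcs G \<Longrightarrow> Path_Connected.arc (spoke a)"
  unfolding spoke_def using spoke_lt[of a] by (intro arc_semi) auto

lemma arc_hook: "a \<in> arcs G \<Longrightarrow> Path_Connected.arc (hook a)"
  unfolding hook_def using ix_inj[of a "opp a"] by (intro arc_lower) auto

text \<open>Otherwise the first arcs of the two vertices would alternate with \<open>a\<close> and
  \<open>b\<close>, against \<open>noncrossing\<close>.\<close>

lemma spokes_nested: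
  assumes "a \<in> arcs G" "b \<in> arcs G" "fst_ix (tail G a) < fst_ix (tail G b)"
  shows "Suc (ix a) \<le> fst_ix (tail G b) \<or> ix b \<le> ix a"
proof (rule ccontr)
  assume *: "\<not> ?thesis"
  obtain a0 where a0: "a0 \<in> arcs G" "tail G a0 = tail G a" "ix a0 = fst_ix (tail G a)"
    using fst_ix_arc[of "tail G a"] assms by auto
  obtain b0 where b0: "b0 \<in> arcs G" "tail G b0 = tail G b" "ix b0 = fst_ix (tail G b)"
    using fst_ix_arc[of "tail G b"] assms by auto
  have "tail G a \<noteq> tail G b" using assms(3) by auto
  moreover from this have "ix b0 \<noteq> ix a" using ix_inj[OF b0(1) assms(1)] b0(2) by auto
  ultimately show False
    using noncrossing[OF a0(1) b0(1) assms(1,2)] * assms(3) a0 b0 by auto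
qed

lemma spokes_meet:
  assumes a: "a \<in> arcs G" and b: "b \<in> arcs G" and ne: "a \<noteq> b"
    and z: "z \<in> path_image (spoke a)" "z \<in> path_image (spoke b)"
  shows "tail G a = tail G b \<and> z = pos (tail G a) \<or>
    z = pos (tail G b) \<and> X (tail G b) = real (ix a) \<or> z = pos (tail G a) \<and> X (tail G a) = real (ix b)"
proof -
  have V: "tail G a \<in> verts G" "tail G b \<in> verts G" using a b by auto
  have ixn: "ix a \<noteq> ix b" using ix_inj[OF a b] ne by simp
  have lt: "X (tail G a) < real (ix a)" "X (tail G b) < real (ix b)" using spoke_lt[OF a] spoke_lt[OF b] by auto
  have sep: "real (ix a) \<le> X (tail G b) \<or> real (ix b) \<le> X (tail G a) \<or>
      X (tail G a) \<le> X (tail G b) \<and> real (ix b) \<le> real (ix a) \<or>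
      X (tail G b) \<le> X (tail G a) \<and> real (ix a) \<le> real (ix b)"
  proof (cases "fst_ix (tail G a)" "fst_ix (tail G b)" rule: linorder_cases)
    case less then show ?thesis using spokes_nested[OF a b less] by (auto simp: X_def)
  next
    case equal then show ?thesis by (auto simp: X_def)
  next
    case greater then show ?thesis using spokes_nested[OF b a greater] by (auto simp: X_def)
  qed
  have "(z = of_real (X (tail G a)) \<or> z = of_real (real (ix a))) \<and>
      (z = of_real (X (tail G b)) \<or> z = of_real (real (ix b)))"
    by (rule semi_meet[OF lt z[unfolded spoke_def] sep]) (use ixn in simp)
  then show ?thesis
    using ixn X_inj[OF V] unfolding pos_def by (auto simp del: of_real_of_nat_eq)
qed

text \<open>A hook spans the interval between the two places of a chord in the tour. For unlinked
  chords these intervals are disjoint or nested and share no end.\<close>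

lemma hooks_disjoint:
  assumes c: "c \<in> chords T" "fwd c" and d: "d \<in> chords T" "fwd d" and ne: "c \<noteq> d"
    and z: "z \<in> path_image (hook c)" "z \<in> path_image (hook d)"
  shows False
proof -
  have G: "c \<in> arcs G" "opp c \<in> arcs G" "d \<in> arcs G" "opp d \<in> arcs G" using c d by auto
  have ne': "d \<noteq> opp c" using fwd_opp[OF G(1)] c d by auto
  have "\<not> il L c d" using unl[of c d] c d ne ne' unfolding linked_iff[OF T L(1,2)] by auto
  then have nil: "\<not> (((ix c < ix d) \<noteq> (ix c < ix (opp d))) \<noteq> ((ix (opp c) < ix d) \<noteq> (ix (opp c) < ix (opp d))))"
    unfolding il_def using bef_ix G by simp
  have lt: "ix c < ix (opp c)" "ix d < ix (opp d)" using c d by (simp_all add: fwd_def)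
  have "c \<noteq> opp d" "opp c \<noteq> opp d" "opp c \<noteq> d" using ne ne' by (auto simp: arev_eq_iff)
  then have dist: "ix c \<noteq> ix d" "ix c \<noteq> ix (opp d)" "ix (opp c) \<noteq> ix d" "ix (opp c) \<noteq> ix (opp d)"
    using ix_inj G ne by simp_all
  have "ix (opp c) \<le> ix d \<or> ix (opp d) \<le> ix c \<or> ix c \<le> ix d \<and> ix (opp d) \<le> ix (opp c) \<or>
      ix d \<le> ix c \<and> ix (opp c) \<le> ix (opp d)"
    using nil lt dist by linarith
  then have sep: "real (ix (opp c)) \<le> real (ix d) \<or> real (ix (opp d)) \<le> real (ix c) \<or>
      real (ix c) \<le> real (ix d) \<and> real (ix (opp d)) \<le> real (ix (opp c)) \<or>
      real (ix d) \<le> real (ix c) \<and> real (ix (opp c)) \<le> real (ix (opp d))" by simp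
  have "(cnj z = of_real (real (ix c)) \<or> cnj z = of_real (real (ix (opp c)))) \<and>
      (cnj z = of_real (real (ix d)) \<or> cnj z = of_real (real (ix (opp d))))"
    by (rule semi_meet[OF _ _ z[unfolded hook_def lower_image] sep]) (use lt dist in auto)
  then show False using dist by auto
qed

text \<open>Upper and lower semicircles meet only on the axis, at common ends. No vertex sits at the
  place of a chord end, since an arc at whose place a vertex sits belongs to
  \<open>T\<close>.\<close>

lemma spoke_hook:
  assumes a: "a \<in> arcs G" and c: "c \<in> chords T" "fwd c"
    and z: "z \<in> path_image (spoke a)" "z \<in> path_image (hook c)"
  shows "a = c \<and> z = of_real (real (ix c)) \<or> a = opp c \<and> z = of_real (real (ix (opp c)))"
proof -
  have cG: "c \<in> arcs G" "opp c \<in> arcs G" "c \<notin> T" "opp c \<notin> T" using c stree_opp_iff[OF T] by auto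
  have tV: "tail G a \<in> verts G" using a by simp
  have "(z = of_real (X (tail G a)) \<or> z = of_real (real (ix a))) \<and>
      (z = of_real (real (ix c)) \<or> z = of_real (real (ix (opp c))))"
    by (rule upper_lower_meet[OF _ _ z[unfolded spoke_def hook_def]]) (use spoke_lt[OF a] c(2) in \<open>auto simp: fwd_def\<close>)
  moreover have "X (tail G a) \<noteq> real (ix c)" "X (tail G a) \<noteq> real (ix (opp c))"
    using X_eq_ix(1)[OF tV] cG by blast+
  ultimately show ?thesis
    using ix_inj[OF a cG(1)] ix_inj[OF a cG(2)] by (auto simp del: of_real_of_nat_eq)
qed

lemma delta_image:
  "path_image (delta a) = path_image (spoke a) \<union>
    (if a \<in> T then {} else path_image (hook a) \<union> path_image (spoke (opp a)))"
  by (simp add: delta_def path_image_join Un_assoc)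

lemma chord_spokes_disjoint:
  assumes a: "a \<in> chords T"
  shows "path_image (spoke a) \<inter> path_image (spoke (opp a)) = {}"
proof (rule equals0I)
  fix z assume "z \<in> path_image (spoke a) \<inter> path_image (spoke (opp a))"
  moreover have aG: "a \<in> arcs G" "opp a \<in> arcs G" "a \<noteq> opp a" "a \<notin> T" "opp a \<notin> T" "tail G a \<noteq> tail G (opp a)"
    using a stree_opp_iff[OF T] no_loops[of a] by auto
  moreover have "X (tail G (opp a)) \<noteq> real (ix a)" "X (tail G a) \<noteq> real (ix (opp a))"
    using X_eq_ix(1) aG by (metis tail_in_verts)+
  ultimately show False using spokes_meet[OF aG(1,2,3), of z] by blast
qed

lemma delta_arc:
  assumes a: "a \<in> arcs G" "fwd a"
  shows "Path_Connected.arc (delta a)" "pathstart (delta a) = pos (tail G a)" "pathfinish (delta a) = pos (head G a)"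
proof -
  have oG: "opp a \<in> arcs G" using a by simp
  show "pathstart (delta a) = pos (tail G a)" by (simp add: delta_def)
  show "pathfinish (delta a) = pos (head G a)"
    using X_head[of a] a by (simp add: delta_def) (simp add: pos_def)
  show "Path_Connected.arc (delta a)"
  proof (cases "a \<in> T")
    case True then show ?thesis using arc_spoke[OF a(1)] by (simp add: delta_def)
  next
    case False
    then have c: "a \<in> chords T" using a by simp
    have "Path_Connected.arc (spoke a +++ (hook a +++ reversepath (spoke (opp a))))"
    proof (rule arc_join)
      show "Path_Connected.arc (hook a +++ reversepath (spoke (opp a)))"
        by (rule arc_join) (use arc_hook[OF a(1)] arc_reversepath[OF arc_spoke[OF oG]]
            spoke_hook[OF oG c a(2)] a in auto)
      show "path_image (spoke a) \<inter> path_image (hook a +++ reversepath (spoke (opp a)))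
          \<subseteq> {pathstart (hook a +++ reversepath (spoke (opp a)))}"
        using spoke_hook[OF a(1) c a(2)] chord_spokes_disjoint[OF c] a(1)
        by (auto simp: path_image_join)
    qed (use arc_spoke[OF a(1)] in auto)
    then show ?thesis using False by (simp add: delta_def)
  qed
qed

lemma spoke_vertex:
  assumes b: "b \<in> arcs G" and v: "v \<in> verts G" and z: "pos v \<in> path_image (spoke b)"
  shows "v = tail G b \<or> b \<in> T \<and> v = head G b"
proof -
  have "pos v = of_real (X (tail G b)) \<or> pos v = of_real (real (ix b))"
    by (rule semi_real[OF _ z[unfolded spoke_def]]) (use spoke_lt[OF b] in \<open>auto simp: pos_def\<close>)
  then have "X v = X (tail G b) \<or> X v = real (ix b)" by (auto simp: pos_def simp del: of_real_of_nat_eq)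
  then show ?thesis using X_inj[OF v, of "tail G b"] X_eq_ix[OF v b] b by auto
qed

lemma hook_vertex:
  assumes c: "c \<in> chords T" "fwd c" and v: "v \<in> verts G"
  shows "pos v \<notin> path_image (hook c)"
proof
  assume "pos v \<in> path_image (hook c)"
  then have z: "cnj (pos v) \<in> path_image (semi (real (ix c)) (real (ix (opp c))))"
    by (simp add: hook_def lower_image)
  have "pos v = of_real (real (ix c)) \<or> pos v = of_real (real (ix (opp c)))"
    using semi_real[OF _ z] c(2) by (auto simp: pos_def fwd_def)
  then have "X v = real (ix c) \<or> X v = real (ix (opp c))" by (auto simp: pos_def simp del: of_real_of_nat_eq)
  then show False using X_eq_ix(1)[OF v] c stree_opp_iff[OF T, of c] by auto
qed

lemma delta_vertex:
  assumes a: "a \<in> arcs G" "fwd a" and v: "v \<in> verts G" and z: "pos v \<in> path_image (delta a)"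
  shows "v = tail G a \<or> v = head G a"
  using z spoke_vertex[OF a(1) v] spoke_vertex[of "opp a", OF _ v] hook_vertex[OF _ a(2) v] a
  by (auto simp: delta_image split: if_splits)

lemma delta_meet:
  assumes a: "a \<in> arcs G" "fwd a" and b: "b \<in> arcs G" "fwd b" and ne: "a \<noteq> b"
    and z: "z \<in> path_image (delta a)" "z \<in> path_image (delta b)"
  shows "z \<in> pos ` verts G"
proof -
  have n: "opp a \<noteq> b" "a \<noteq> opp b" "opp a \<noteq> opp b" using fwd_opp[OF a(1)] fwd_opp[OF b(1)] a b ne by auto
  have sp: "z \<in> pos ` verts G" if "c \<in> arcs G" "d \<in> arcs G" "c \<noteq> d" "z \<in> path_image (spoke c)" "z \<in> path_image (spoke d)" for c d
    using spokes_meet[OF that] that(1,2) by (auto intro: imageI)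
  have sh: False if "c \<in> arcs G" "d \<in> chords T" "fwd d" "z \<in> path_image (spoke c)" "z \<in> path_image (hook d)" "c \<noteq> d" "c \<noteq> opp d" for c d
    using spoke_hook[OF that(1-5)] that(6,7) by blast
  have G: "opp a \<in> arcs G" "opp b \<in> arcs G" using a b by auto
  consider c where "c = a \<or> c = opp a" "z \<in> path_image (spoke c)" | "a \<in> chords T" "z \<in> path_image (hook a)"
    using z(1) a(1) by (auto simp: delta_image split: if_splits)
  then show ?thesis
  proof cases
    case 1
    consider d where "d = b \<or> d = opp b" "z \<in> path_image (spoke d)" | "b \<in> chords T" "z \<in> path_image (hook b)"
      using z(2) b(1) by (auto simp: delta_image split: if_splits)
    then show ?thesis
    proof cases
      case d: 1
      show ?thesis by (rule sp[OF _ _ _ 1(2) d(2)]) (use 1(1) d(1) G a b n ne in auto)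
    next
      case d: 2
      have False by (rule sh[OF _ d(1) b(2) 1(2) d(2)]) (use 1(1) G a n ne in auto)
      then show ?thesis ..
    qed
  next
    case 2
    consider d where "d = b \<or> d = opp b" "z \<in> path_image (spoke d)" | "b \<in> chords T" "z \<in> path_image (hook b)"
      using z(2) b(1) by (auto simp: delta_image split: if_splits)
    then show ?thesis
    proof cases
      case d: 1
      have False by (rule sh[OF _ 2(1) a(2) d(2) 2(2)]) (use d(1) G b n ne in auto)
      then show ?thesis ..
    next
      case d: 2
      then show ?thesis using hooks_disjoint[OF 2(1) a(2) d(1) b(2) ne 2(2) d(2)] by blast
    qed
  qed
qed

lemma planar_drawing_gamma: "planar_drawing G opp pos gamma"
proof -
  \<comment> \<open>Each edge is drawn from the end that the tour meets first.\<close>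
  define rep where "rep a = (if fwd a then a else opp a)" for a
  have rep: "rep a \<in> arcs G" "fwd (rep a)" "rep a = a \<or> rep a = opp a" if "a \<in> arcs G" for a
    using that fwd_opp[OF that] by (auto simp: rep_def)
  have image: "path_image (gamma a) = path_image (delta (rep a))" for a
    by (simp add: gamma_def rep_def)
  have g: "Path_Connected.arc (gamma a)" "pathstart (gamma a) = pos (tail G a)" "pathfinish (gamma a) = pos (head G a)"
    if "a \<in> arcs G" for a
    using delta_arc[OF rep(1,2)[OF that]] that by (auto simp: gamma_def rep_def arc_reversepath)
  have inner: "gamma a ` {0<..<1} = path_image (delta (rep a)) - {pos (tail G a), pos (head G a)}"
    if "a \<in> arcs G" for a
    using simple_path_endless[OF arc_imp_simple_path[OF g(1)[OF that]]] g(2,3)[OF that] image by simp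
  have ends: "v = tail G a \<or> v = head G a" if "a \<in> arcs G" "v \<in> verts G" "pos v \<in> path_image (delta (rep a))" for a v
    using delta_vertex[OF rep(1,2)[OF that(1)] that(2,3)] rep(3)[OF that(1)] that(1) by auto
  show ?thesis
    unfolding planar_drawing_def
  proof (intro conjI ballI)
    show "inj_on pos (verts G)" using X_inj by (auto simp: inj_on_def pos_def)
  next
    fix a assume a: "a \<in> arcs G"
    show "simple_path (gamma a)" using arc_imp_simple_path g(1)[OF a] by blast
    show "pathstart (gamma a) = pos (tail G a)" "pathfinish (gamma a) = pos (head G a)" using g a by auto
    show "gamma (opp a) = reversepath (gamma a)" using fwd_opp[OF a] by (simp add: gamma_def)
    show "gamma a ` {0<..<1} \<inter> pos ` verts G = {}"
      unfolding inner[OF a] using ends[OF a] by auto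
  next
    fix a b assume a: "a \<in> arcs G" and b: "b \<in> arcs G - {a, opp a}"
    have bG: "b \<in> arcs G" using b by simp
    have ne: "rep a \<noteq> rep b" using rep(3)[OF a] rep(3)[OF bG] b by (auto simp: arev_eq_iff)
    show "gamma a ` {0<..<1} \<inter> gamma b ` {0<..<1} = {}"
      unfolding inner[OF a] inner[OF bG]
      using delta_meet[OF rep(1,2)[OF a] rep(1,2)[OF bG] ne] ends[OF a] by blast
  qed
qed

text \<open>The signed width of the semicircle by which \<open>gamma a\<close> leaves
  \<open>tail G a\<close>. It is negative exactly for the tree arc back along which the vertex was
  entered.\<close>

definition reach :: "'b \<Rightarrow> real" where
  "reach a = (if a \<in> T \<and> \<not> fwd a then X (head G a) else real (ix a)) - X (tail G a)"

lemma reach_bounds: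
  assumes "a \<in> arcs G"
  shows "if a \<in> T \<and> \<not> fwd a then reach a \<le> - 1 else 1 \<le> reach a"
proof -
  have "reach a \<le> - 1" if "a \<in> T" "\<not> fwd a"
    using X_head[of "opp a"] spoke_lt[of "opp a"] that assms fwd_opp[OF assms] stree_opp_iff[OF T, of a]
    by (simp add: reach_def)
  then show ?thesis using spoke_lt[OF assms] by (auto simp: reach_def)
qed

text \<open>Later arcs leave at larger angles: widths grow with the index, and the arc back towards
  the root, the only one that goes to the left, is the last arc of its vertex.\<close>

lemma reach_mono:
  assumes a: "a \<in> arcs G" and b: "b \<in> arcs G" and t: "tail G a = tail G b" and lt: "ix a < ix b"
    and r: "0 < r" "r < 1"
  shows "r / reach b < r / reach a"
proof -
  have "fwd a" if "a \<in> T"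
  proof (rule ccontr)
    assume "\<not> fwd a"
    then have "opp a \<in> T" "ix (opp a) < ix (opp (opp a))"
      using that fwd_opp[OF a] stree_opp_iff[OF T, of a] by (auto simp: fwd_def)
    then have "ix b \<le> ix (opp (opp a))" by (rule entry(2)) (use a b t in auto)
    then show False using lt by simp
  qed
  then have e: "(a \<in> T \<and> \<not> fwd a) = False" by blast
  then have A: "1 \<le> reach a" "reach a = real (ix a) - X (tail G a)"
    using reach_bounds[OF a] unfolding reach_def e by simp_all
  show ?thesis
  proof (cases "b \<in> T \<and> \<not> fwd b")
    case True
    then have "reach b < 0" using reach_bounds[OF b] by simp
    then have "r / reach b < 0" using r by (simp add: divide_pos_neg)
    also have "0 < r / reach a" using A r by simp
    finally show ?thesis .
  next
    case False
    then have "reach b = real (ix b) - X (tail G b)" by (auto simp: reach_def)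
    then have "reach a < reach b" using A t lt by simp
    then show ?thesis using A r by (intro divide_strict_left_mono) auto
  qed
qed

text \<open>All widths have absolute value at least 1, so a circle of radius below 1 is met on the
  first semicircle already.\<close>

lemma gamma_hits:
  assumes a: "a \<in> arcs G" and r: "0 < r" "r < 1"
  shows "hits (gamma a) r (pos (tail G a) + of_real r * cis (arccos (r / reach a)))"
proof -
  have R: "r < \<bar>reach a\<bar>" using reach_bounds[OF a] r by (auto split: if_splits)
  have oG: "opp a \<in> arcs G" using a by simp
  show ?thesis
  proof (cases "a \<in> T \<and> \<not> fwd a")
    case True
    then have o: "opp a \<in> T" "fwd (opp a)" using fwd_opp[OF a] stree_opp_iff[OF T] by auto
    have "X (tail G a) = real (ix (opp a))" using X_head[OF o] a by simp
    then have "gamma a = semi (X (tail G a)) (X (head G a))"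
      using True o a by (simp add: gamma_def delta_def spoke_def reversepath_semi)
    moreover have "reach a = X (head G a) - X (tail G a)" using True by (simp add: reach_def)
    ultimately show ?thesis using hits_semi[OF r(1)] R by (simp add: pos_def)
  next
    case False
    have "reach a = real (ix a) - X (tail G a)" using False by (auto simp: reach_def)
    then have h: "hits (spoke a) r (pos (tail G a) + of_real r * cis (arccos (r / reach a)))"
      using hits_semi[OF r(1), of "real (ix a)" "X (tail G a)"] R by (simp add: pos_def spoke_def)
    show ?thesis
    proof (cases "fwd a")
      case True
      then show ?thesis using h hits_join[OF h] by (simp add: gamma_def delta_def)
    next
      case nf: False
      then have "opp a \<notin> T" using False stree_opp_iff[OF T] by blast
      then have "gamma a = (spoke a +++ reversepath (hook (opp a))) +++ reversepath (spoke (opp a))"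
        using nf a by (simp add: gamma_def delta_def reversepath_joinpaths)
      then show ?thesis using hits_join[OF hits_join[OF h]] by simp
    qed
  qed
qed

text \<open>Seen from \<open>v\<close>, the first points on a small circle lie in the closed upper
  half plane, at angles that increase with the index. By \<open>nxt_ix\<close> the cyclic order is
  therefore counterclockwise, with one wrap-around.\<close>

lemma ccw_gamma: "ccw_around G nxt pos gamma v"
  unfolding ccw_around_def
proof (rule eventually_at_rightI[of 0 1], intro ballI)
  fix r :: real and a b
  assume r: "r \<in> {0<..<1}" and a: "a \<in> out_arcs G v" and b: "b \<in> out_arcs G v - {a}"
  let ?x = "nxt a"
  have x: "?x \<in> out_arcs G v" using nxt_out_arcs[OF a] .
  define \<theta> where "\<theta> c = arccos (r / reach c)" for c
  have q: "\<bar>r / reach c\<bar> \<le> 1" if "c \<in> out_arcs G v" for c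
    using reach_bounds[of c] that r by (auto simp: abs_le_iff field_simps abs_if split: if_splits)
  have \<theta>: "0 \<le> \<theta> c" "\<theta> c \<le> pi" if "c \<in> out_arcs G v" for c
  proof -
    have "- 1 \<le> r / reach c" "r / reach c \<le> 1" using abs_le_D1[OF q[OF that]] abs_le_D2[OF q[OF that]] by linarith+
    then show "0 \<le> \<theta> c" "\<theta> c \<le> pi" unfolding \<theta>_def by (rule arccos_lbound, rule arccos_ubound)
  qed
  have mono: "\<theta> c < \<theta> d" if "c \<in> out_arcs G v" "d \<in> out_arcs G v" "ix c < ix d" for c d
  proof -
    have "- 1 \<le> r / reach d" "r / reach c \<le> 1"
      using abs_le_D1[OF q[OF that(1)]] abs_le_D2[OF q[OF that(2)]] by linarith+
    moreover have "r / reach d < r / reach c" by (rule reach_mono) (use that r in auto)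
    ultimately show ?thesis unfolding \<theta>_def by (intro arccos_less_arccos)
  qed
  have mono': "\<theta> c \<le> \<theta> d" if "c \<in> out_arcs G v" "d \<in> out_arcs G v" "ix c \<le> ix d" for c d
  proof (cases "ix c = ix d")
    case True then show ?thesis using ix_inj[of c d] that by auto
  next
    case False then show ?thesis using mono[OF that(1,2)] that(3) by simp
  qed
  have hit: "first_hit (gamma c) r - pos v = of_real r * cis (\<theta> c)" if "c \<in> out_arcs G v" for c
    using first_hit_eqI[OF gamma_hits[of c r]] that r unfolding \<theta>_def by auto
  have quot: "(first_hit (gamma c) r - pos v) / (first_hit (gamma a) r - pos v) = cis (\<theta> c - \<theta> a)"
    if "c \<in> out_arcs G v" for c
    unfolding hit[OF that] hit[OF a] using r by (simp add: cis_divide)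
  have arg: "Arg2pi (cis t) = t" if "0 \<le> t" "t < 2 * pi" for t
    using Arg2pi_exp[of "\<i> * of_real t"] that by (simp add: cis_conv_exp)
  \<comment> \<open>\<open>Arg2pi\<close> takes its values between 0 and a full turn, so a negative
    difference of angles is counted with a full turn added.\<close>
  have arg': "Arg2pi (cis t) = t + 2 * pi" if "t < 0" "- (2 * pi) \<le> t" for t
  proof -
    have "cis t = cis (t + 2 * pi)" by (simp add: complex_eq_iff)
    then show ?thesis using arg[of "t + 2 * pi"] that by simp
  qed
  have bG: "b \<in> out_arcs G v" "ix b \<noteq> ix a" using a b ix_inj[of a b] by auto
  have lim: "- (2 * pi) \<le> \<theta> c - \<theta> d" "\<theta> c - \<theta> d < 2 * pi" "- pi \<le> \<theta> c - \<theta> d" "\<theta> c - \<theta> d \<le> pi"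
    if "c \<in> out_arcs G v" "d \<in> out_arcs G v" for c d
    using \<theta>[OF that(1)] \<theta>[OF that(2)] pi_gt_zero by linarith+
  have aG: "a \<in> arcs G" using a by simp
  have "Arg2pi (cis (\<theta> ?x - \<theta> a)) \<le> Arg2pi (cis (\<theta> b - \<theta> a))"
    using nxt_ix[OF aG]
  proof (elim disjE conjE)
    \<comment> \<open>Here \<open>a\<close> has the largest index at \<open>v\<close> and
      \<open>nxt a\<close> the smallest, so both differences are negative and can be compared
      directly.\<close>
    assume *: "\<forall>c\<in>arcs G. tail G c = tail G a \<longrightarrow> ix ?x \<le> ix c \<and> ix c \<le> ix a"
    then have l: "ix ?x \<le> ix b" "ix b < ix a" using bG a by force+
    have "\<theta> ?x \<le> \<theta> b" "\<theta> b < \<theta> a" using mono'[OF x bG(1) l(1)] mono[OF bG(1) a l(2)] .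
    then show ?thesis using arg'[of "\<theta> ?x - \<theta> a"] arg'[of "\<theta> b - \<theta> a"] lim[OF x a] lim[OF bG(1) a] by simp
  next
    assume 1: "ix a < ix ?x" and *: "\<forall>c\<in>arcs G. tail G c = tail G a \<longrightarrow> ix c \<le> ix a \<or> ix ?x \<le> ix c"
    have ax: "\<theta> a < \<theta> ?x" by (rule mono[OF a x 1])
    have "ix b < ix a \<or> ix ?x \<le> ix b" using * bG a by force
    then show ?thesis
    proof
      assume "ix b < ix a"
      then have "\<theta> b < \<theta> a" by (rule mono[OF bG(1) a])
      then show ?thesis using arg[of "\<theta> ?x - \<theta> a"] arg'[of "\<theta> b - \<theta> a"] ax lim[OF x a] lim[OF bG(1) a] by simp
    next
      assume "ix ?x \<le> ix b"
      then have "\<theta> ?x \<le> \<theta> b" by (rule mono'[OF x bG(1)])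
      then show ?thesis using arg[of "\<theta> ?x - \<theta> a"] arg[of "\<theta> b - \<theta> a"] ax lim[OF x a] lim[OF bG(1) a] by simp
    qed
  qed
  then show "Arg2pi ((first_hit (gamma ?x) r - pos v) / (first_hit (gamma a) r - pos v))
      \<le> Arg2pi ((first_hit (gamma b) r - pos v) / (first_hit (gamma a) r - pos v))"
    unfolding quot[OF x] quot[OF bG(1)] .
qed simp

lemma planar: "planar_ribbon G opp nxt"
  unfolding planar_ribbon_def using planar_drawing_gamma ccw_gamma by blast

end

text \<open>By connectedness there is a single vertex then. The case is separate because a tour has
  to start at an arc.\<close>

lemma (in loopless_ribbon_graph) planar_no_arcs:
  assumes "arcs G = {}"
  shows "planar_ribbon G opp nxt"
proof -
  have "u = v" if "u \<in> verts G" "v \<in> verts G" for u v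
    using conn_arcs[OF that] unfolding assms by (simp add: adj_def)
  then have "planar_drawing G opp (\<lambda>_. 0) (\<lambda>_ _. 0)" using assms by (auto simp: planar_drawing_def inj_on_def)
  moreover have "ccw_around G nxt (\<lambda>_. 0) (\<lambda>_ _. 0) v" for v
    using assms by (simp add: ccw_around_def out_arcs_def)
  ultimately show ?thesis unfolding planar_ribbon_def by blast
qed

theorem theorem1p2:
  fixes G :: "('a, 'b) pre_digraph" and opp nxt :: "'b \<Rightarrow> 'b"
  assumes "ribbon_graph G opp nxt"
    and "loopfree_digraph G"
    and "nomulti_digraph G"
    and "\<not> planar_ribbon G opp nxt"
  shows "\<exists>v\<in>verts G. bernardi_torsor G opp nxt v \<noteq> rotor_torsor G opp nxt v"
proof (rule ccontr)
  assume "\<not> ?thesis"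
  then have "\<And>v. v \<in> verts G \<Longrightarrow> bernardi_torsor G opp nxt v = rotor_torsor G opp nxt v" by blast
  with assms(1-3) interpret agreeing_ribbon_graph G opp nxt
    by (intro agreeing_ribbon_graph.intro loopless_ribbon_graph.intro agreeing_ribbon_graph_axioms.intro)
  obtain T where T: "stree T" by (rule stree_exists)
  obtain s where "s \<in> arcs G" using planar_no_arcs assms(4) by blast
  then interpret unlinked_tree G opp nxt T s
    using T unlinked[OF T] by unfold_locales
  show False using planar assms(4) by blast
qed

end
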